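(* Let $\mathcal{O}$ be a complete discrete valuation ring with field of fractions $K$ of characteristic zero. Let $A$, $B$ be symmetric $\mathcal{O}$-algebras such that $K\otimes_{\mathcal{O}}A$ and $K\otimes_{\mathcal{O}}B$ are semisimple, and choose arbitrary symmetrising forms $s$ of $A$ and $t$ of $B$. Let $M$ be an $A$-$B$-bimodule which is finitely generated projective as a left $A$-module and as a right $B$-module, and let $M^\vee=\mathrm{Hom}_{\mathcal{O}}(M,\mathcal{O})$. Let $n$ be an integer, and let $U$, $V$ be finitely generated $\mathcal{O}$-free $A$-modules. Then for any $\alpha\in\widehat{\mathrm{Ext}}^n_A(U,V)$ and any $\beta\in\widehat{\mathrm{Ext}}^{-n}_B(M^\vee\otimes_A V,\,M^\vee\otimes_A U)$ we have $$\langle \alpha,\mathrm{tr}_M(\beta)\rangle_A=\langle \mathrm{Id}_{M^\vee}\otimes\alpha,\ \beta\rangle_B,$$ $$\langle \mathrm{tr}_M(\beta),\alpha\rangle_A=\langle \beta,\ \mathrm{Id}_{M^\vee}\otimes\alpha\rangle_B$$ in $K/\mathcal{O}$, where $\langle-,-\rangle_A$, $\langle -,-\rangle_B$ are the Tate duality pairings and $\mathrm{tr}_M:\widehat{\mathrm{Ext}}^{-n}_B(M^\vee\otimes_A V,M^\vee\otimes_A U)\to\widehat{\mathrm{Ext}}^{-n}_A(V,U)$ is the transfer map (all defined using the chosen forms $s$, $t$).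
   Context: Modules are left modules unless stated otherwise. Symmetric algebras. An algebra $A$ over a commutative ring $R$ is symmetric if it is finitely generated projective as an $R$-module and $A\cong A^\vee=\mathrm{Hom}_R(A,R)$ as $A$-$A$-bimodules; the image $s\in A^\vee$ of $1_A$ under such an isomorphism is called a symmetrising form. If $A$ is $R$-free with $R$-basis $X$, and $\{x^\vee\}_{x\in X}$ is the dual basis, i.e. $s(xx^\vee)=1$ and $s(xy^\vee)=0$ for $x\ne y$ in $X$, then the relative projective element with respect to $s$ is $z_A=\sum_{x\in X}xx^\vee\in Z(A)$; it does not depend on $X$. If $R=\mathcal{O}$ and $K\otimes_{\mathcal O}A$ is semisimple with $\mathrm{char}(K)=0$, then $z_A$ is invertible in $Z(K\otimes_{\mathcal O}A)$. Stable category and Tate-Ext. For finitely generated $\mathcal{O}$-free $A$-modules $U,V$, set $\underline{\mathrm{Hom}}_A(U,V)=\mathrm{Hom}_A(U,V)/\mathrm{Hom}_A^{\mathrm{pr}}(U,V)$, where $\mathrm{Hom}_A^{\mathrm{pr}}(U,V)$ consists of the homomorphisms factoring through a finitely generated projective $A$-module. On the resulting stable category, the shift $\Sigma=\Sigma_A$ sends $U$ to the cokernel of a relatively $\mathcal{O}$-injective envelope $U\to I$ (an $\mathcal{O}$-split embedding into a finitely generated projective $A$-module); it is an equivalence, with inverse $\Sigma^{-1}$ sending $U$ to the kernel of a projective cover (not necessarily minimal) $P\to U$. One takes $\Sigma^n(U)$ to be $\mathcal{O}$-free and identifies canonically $\Sigma^n\Sigma^m=\Sigma^{n+m}$. Set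 $\widehat{\mathrm{Ext}}^n_A(U,V)=\underline{\mathrm{Hom}}_A(U,\Sigma^n(V))$ for every integer $n$. Tate duality. The pairing $\langle-,-\rangle_A:\widehat{\mathrm{Ext}}^n_A(U,V)\times\widehat{\mathrm{Ext}}^{-n}_A(V,U)\to K/\mathcal{O}$ sends the classes of $\alpha\in\mathrm{Hom}_A(U,\Sigma^n(V))$ and $\gamma\in\mathrm{Hom}_A(V,\Sigma^{-n}(U))$ to the image in $K/\mathcal{O}$ of the trace on $K\otimes_{\mathcal O}U$ of the endomorphism $z_A^{-1}\cdot(\Sigma^n(\gamma)\circ\alpha)$, where $\Sigma^n(\gamma):\Sigma^n(V)\to U$ is any homomorphism representing the shifted morphism. This is well defined (and non-degenerate). The pairing $\langle-,-\rangle_B$ is defined analogously using $t$. Adjunction maps. $M^\vee$ is a $B$-$A$-bimodule, finitely generated projective on either side. The maps $\mathrm{Hom}_A(M,A)\to M^\vee$, $\alpha\mapsto s\circ\alpha$, and $\mathrm{Hom}_{B^{\mathrm{op}}}(M,B)\to M^\vee$, $\beta\mapsto t\circ\beta$, are bimodule isomorphisms. Define bimodule homomorphisms $$\eta_M:M\otimes_B M^\vee\to A,\quad m\otimes(s\circ\alpha)\mapsto\alpha(m)\quad(\alpha\in \mathrm{Hom}_A(M,A)),$$ $$\epsilon_{M^\vee}:A\to M\otimes_B M^\vee,\quad 1_A\mapsto\sum_{j\in J}m_j\otimes(t\circ\beta_j),$$ where $J$ is finite, $\beta_j\in\mathrm{Hom}_{B^{\mathrm{op}}}(M,B)$, $m_j\in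 M$ satisfy $\sum_j m_j\beta_j(m')=m'$ for all $m'\in M$. Transfer. The functors $M\otimes_B-$ and $M^\vee\otimes_A-$ are exact and preserve projectives, hence commute canonically with shifts in the stable categories. For finitely generated $\mathcal O$-free $A$-modules $U',V'$ and an integer $m$, an element of $\widehat{\mathrm{Ext}}_B^m(M^\vee\otimes_AU',M^\vee\otimes_AV')$ is represented by a $B$-homomorphism $\beta:M^\vee\otimes_AU'\to M^\vee\otimes_A\Sigma^m(V')$, and $\mathrm{tr}_M(\beta)\in\widehat{\mathrm{Ext}}_A^m(U',V')$ is the class of $$(\eta_M\otimes\mathrm{Id}_{\Sigma^m(V')})\circ(\mathrm{Id}_M\otimes\beta)\circ(\epsilon_{M^\vee}\otimes\mathrm{Id}_{U'}):U'\to\Sigma^m(V').$$ For $\alpha\in\widehat{\mathrm{Ext}}^n_A(U,V)$, $\mathrm{Id}_{M^\vee}\otimes\alpha$ denotes the induced element of $\widehat{\mathrm{Ext}}^n_B(M^\vee\otimes_AU,M^\vee\otimes_AV)$, using the canonical identification $M^\vee\otimes_A\Sigma^n(V)\cong\Sigma^n(M^\vee\otimes_AV)$ in the stable category. *)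

theory Defs
  imports
    "HOL-Algebra.Module" "HOL-Algebra.Subrings" "HOL-Algebra.Ring_Divisibility"
    "HOL-Algebra.Ideal_Product" "HOL-Algebra.Free_Abelian_Groups"
begin

text \<open>
  Conventions.  Rings are unital, not necessarily commutative.  A field \<open>K\<close> contains its
  discrete valuation ring \<open>\<O>\<close> as a subring, so \<open>K/\<O>\<close> is the set of additive cosets of \<open>\<O>\<close> in \<open>K\<close>.
  Module homomorphisms are extensional functions, so that a homomorphism is determined by its values
  on the carrier.  The fields \<open>mult\<close> and \<open>one\<close> of a module record carry no meaning unless the
  record is an algebra.  Maps out of quotients and quantities defined by means of a choice
  (bases, representatives) are rendered as \<open>the_elem\<close> of the set of all values that the choices
  produce.
\<close>

section \<open>Complete discrete valuation rings and their fields of fractions\<close>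

primrec ideal_pow :: "('r, 'z) ring_scheme \<Rightarrow> 'r set \<Rightarrow> nat \<Rightarrow> 'r set" where
  "ideal_pow R I 0 = carrier R"
| "ideal_pow R I (Suc n) = ideal_prod R (ideal_pow R I n) I"

definition discrete_valuation_ring :: "('r, 'z) ring_scheme \<Rightarrow> bool" where
  "discrete_valuation_ring R \<longleftrightarrow>
     principal_domain R \<and> \<not> field R \<and> (\<exists>!\<mm>. maximalideal \<mm> R)"

text \<open>Completeness: the canonical map from \<open>R\<close> to the inverse limit of the \<open>R/\<mm>\<^sup>n\<close> is bijective.\<close>

definition complete_dvr :: "('r, 'z) ring_scheme \<Rightarrow> bool" where
  "complete_dvr R \<longleftrightarrow> discrete_valuation_ring R \<and>
     (\<forall>\<mm>. maximalideal \<mm> R \<longrightarrow>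
       (\<forall>x. (\<forall>n. x n \<in> carrier R \<and> x (Suc n) \<ominus>\<^bsub>R\<^esub> x n \<in> ideal_pow R \<mm> n) \<longrightarrow>
            (\<exists>!y. y \<in> carrier R \<and> (\<forall>n::nat. y \<ominus>\<^bsub>R\<^esub> x n \<in> ideal_pow R \<mm> n))))"

definition field_of_fractions :: "'k ring \<Rightarrow> 'k ring \<Rightarrow> bool" where
  "field_of_fractions \<O> K \<longleftrightarrow>
     field K \<and> subring (carrier \<O>) K \<and> \<O> = K\<lparr>carrier := carrier \<O>\<rparr> \<and>
     (\<forall>x\<in>carrier K. \<exists>a\<in>carrier \<O>. \<exists>b\<in>carrier \<O>. b \<noteq> \<zero>\<^bsub>K\<^esub> \<and> x = a \<otimes>\<^bsub>K\<^esub> inv\<^bsub>K\<^esub> b)"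

definition char_zero :: "('r, 'z) ring_scheme \<Rightarrow> bool" where
  "char_zero R \<longleftrightarrow> (\<forall>n::nat. 0 < n \<longrightarrow> add_pow R n \<one>\<^bsub>R\<^esub> \<noteq> \<zero>\<^bsub>R\<^esub>)"

section \<open>Modules, bimodules and homomorphisms over noncommutative rings\<close>

text \<open>The library locale \<open>module\<close> is restricted to commutative rings of scalars.\<close>

locale left_module = R?: ring R + M?: abelian_group M
  for R :: "('r, 'y) ring_scheme" (structure)
  and M :: "('r, 'm, 'z) module_scheme" (structure) +
  assumes lm_closed: "\<lbrakk>a \<in> carrier R; x \<in> carrier M\<rbrakk> \<Longrightarrow> a \<odot>\<^bsub>M\<^esub> x \<in> carrier M"
    and lm_l_distr: "\<lbrakk>a \<in> carrier R; b \<in> carrier R; x \<in> carrier M\<rbrakk> \<Longrightarrow>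
      (a \<oplus> b) \<odot>\<^bsub>M\<^esub> x = a \<odot>\<^bsub>M\<^esub> x \<oplus>\<^bsub>M\<^esub> b \<odot>\<^bsub>M\<^esub> x"
    and lm_r_distr: "\<lbrakk>a \<in> carrier R; x \<in> carrier M; y \<in> carrier M\<rbrakk> \<Longrightarrow>
      a \<odot>\<^bsub>M\<^esub> (x \<oplus>\<^bsub>M\<^esub> y) = a \<odot>\<^bsub>M\<^esub> x \<oplus>\<^bsub>M\<^esub> a \<odot>\<^bsub>M\<^esub> y"
    and lm_assoc: "\<lbrakk>a \<in> carrier R; b \<in> carrier R; x \<in> carrier M\<rbrakk> \<Longrightarrow>
      (a \<otimes> b) \<odot>\<^bsub>M\<^esub> x = a \<odot>\<^bsub>M\<^esub> (b \<odot>\<^bsub>M\<^esub> x)"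
    and lm_one: "x \<in> carrier M \<Longrightarrow> \<one> \<odot>\<^bsub>M\<^esub> x = x"

definition mk_module :: "'m set \<Rightarrow> 'm \<Rightarrow> ('m \<Rightarrow> 'm \<Rightarrow> 'm) \<Rightarrow> ('r \<Rightarrow> 'm \<Rightarrow> 'm) \<Rightarrow> ('r, 'm) module" where
  "mk_module C z pls act =
     \<lparr>carrier = C,
       monoid.mult = undefined, one = undefined, ring.zero = z, add = pls, smult = act\<rparr>"

definition opp :: "('r, 'z) ring_scheme \<Rightarrow> 'r ring" where
  "opp R = \<lparr>carrier = carrier R, monoid.mult = (\<lambda>x y. y \<otimes>\<^bsub>R\<^esub> x), one = \<one>\<^bsub>R\<^esub>,
     ring.zero = \<zero>\<^bsub>R\<^esub>, add = add R\<rparr>"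

definition regular :: "('r, 'z) ring_scheme \<Rightarrow> ('r, 'r) module" where
  "regular R = mk_module (carrier R) \<zero>\<^bsub>R\<^esub> (add R) (monoid.mult R)"

definition free_module :: "('r, 'z) ring_scheme \<Rightarrow> nat \<Rightarrow> ('r, nat \<Rightarrow> 'r) module" where
  "free_module R n = mk_module ({..<n} \<rightarrow>\<^sub>E carrier R) (\<lambda>i\<in>{..<n}. \<zero>\<^bsub>R\<^esub>)
     (\<lambda>x y. \<lambda>i\<in>{..<n}. x i \<oplus>\<^bsub>R\<^esub> y i) (\<lambda>a x. \<lambda>i\<in>{..<n}. a \<otimes>\<^bsub>R\<^esub> x i)"

definition lin_hom ::
  "('r, 'y) ring_scheme \<Rightarrow> ('r, 'm, 'z) module_scheme \<Rightarrow> ('r, 'n, 'w) module_scheme \<Rightarrow> ('m \<Rightarrow> 'n) set" where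
  "lin_hom R M N = {f \<in> carrier M \<rightarrow>\<^sub>E carrier N.
     (\<forall>x\<in>carrier M. \<forall>y\<in>carrier M. f (x \<oplus>\<^bsub>M\<^esub> y) = f x \<oplus>\<^bsub>N\<^esub> f y) \<and>
     (\<forall>a\<in>carrier R. \<forall>x\<in>carrier M. f (a \<odot>\<^bsub>M\<^esub> x) = a \<odot>\<^bsub>N\<^esub> f x)}"

definition finite_basis :: "('r, 'y) ring_scheme \<Rightarrow> ('r, 'm, 'z) module_scheme \<Rightarrow> 'm set \<Rightarrow> bool" where
  "finite_basis R M X \<longleftrightarrow> finite X \<and> X \<subseteq> carrier M \<and>
     (\<forall>m\<in>carrier M. \<exists>!c. c \<in> X \<rightarrow>\<^sub>E carrier R \<and> m = (\<Oplus>\<^bsub>M\<^esub>x\<in>X. c x \<odot>\<^bsub>M\<^esub> x))"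

definition fg_free :: "('r, 'y) ring_scheme \<Rightarrow> ('r, 'm, 'z) module_scheme \<Rightarrow> bool" where
  "fg_free R M \<longleftrightarrow> (\<exists>X. finite_basis R M X)"

definition fg_projective :: "('r, 'y) ring_scheme \<Rightarrow> ('r, 'm, 'z) module_scheme \<Rightarrow> bool" where
  "fg_projective R P \<longleftrightarrow>
     (\<exists>n. \<exists>i\<in>lin_hom R P (free_module R n). \<exists>p\<in>lin_hom R (free_module R n) P.
        \<forall>x\<in>carrier P. p (i x) = x)"

definition semisimple_module :: "('r, 'y) ring_scheme \<Rightarrow> ('r, 'm, 'z) module_scheme \<Rightarrow> bool" where
  "semisimple_module R M \<longleftrightarrow> left_module R M \<and>
     (\<forall>N. submodule N R M \<longrightarrow>
        (\<exists>N'. submodule N' R M \<and> N \<inter> N' = {\<zero>\<^bsub>M\<^esub>} \<and> N <+>\<^bsub>M\<^esub> N' = carrier M))"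

definition semisimple_ring :: "('r, 'z) ring_scheme \<Rightarrow> bool" where
  "semisimple_ring R \<longleftrightarrow> ring R \<and> semisimple_module R (regular R)"

text \<open>
  For a finitely generated free module \<open>W\<close>, an endomorphism \<open>f\<close> of \<open>W\<close>, and a basis \<open>X\<close>,
  \<open>c x y\<close> below is the \<open>y\<close>-coordinate of \<open>f x\<close>.
\<close>

definition trace_on :: "('r, 'y) ring_scheme \<Rightarrow> ('r, 'm, 'z) module_scheme \<Rightarrow> ('m \<Rightarrow> 'm) \<Rightarrow> 'r" where
  "trace_on R W f = the_elem {(\<Oplus>\<^bsub>R\<^esub>x\<in>X. c x x) | X c. finite_basis R W X \<and>
     (\<forall>x\<in>X. c x \<in> X \<rightarrow> carrier R \<and> f x = (\<Oplus>\<^bsub>W\<^esub>y\<in>X. c x y \<odot>\<^bsub>W\<^esub> y))}"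

record ('a, 'b, 'm) bimodule = "('a, 'm) module" +
  rsmult :: "'m \<Rightarrow> 'b \<Rightarrow> 'm"

definition mk_bimodule ::
  "('a, 'm) module \<Rightarrow> ('m \<Rightarrow> 'b \<Rightarrow> 'm) \<Rightarrow> ('a, 'b, 'm) bimodule" where
  "mk_bimodule M ract = module.extend M \<lparr>rsmult = ract\<rparr>"

definition right_part :: "('a, 'b, 'm, 'z) bimodule_scheme \<Rightarrow> ('b, 'm) module" where
  "right_part M = mk_module (carrier M) \<zero>\<^bsub>M\<^esub> (add M) (\<lambda>b m. rsmult M m b)"

definition regular_bimodule :: "('r, 'z) ring_scheme \<Rightarrow> ('r, 'r, 'r) bimodule" where
  "regular_bimodule R = mk_bimodule (regular R) (monoid.mult R)"

section \<open>Algebras over a commutative ring\<close>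

text \<open>The library locale \<open>algebra\<close> requires the algebra to be commutative.\<close>

locale assoc_algebra = module \<O> A + ring A for \<O> (structure) and A (structure) +
  assumes smult_mult_l: "\<lbrakk>c \<in> carrier \<O>; x \<in> carrier A; y \<in> carrier A\<rbrakk> \<Longrightarrow>
      (c \<odot>\<^bsub>A\<^esub> x) \<otimes>\<^bsub>A\<^esub> y = c \<odot>\<^bsub>A\<^esub> (x \<otimes>\<^bsub>A\<^esub> y)"
    and smult_mult_r: "\<lbrakk>c \<in> carrier \<O>; x \<in> carrier A; y \<in> carrier A\<rbrakk> \<Longrightarrow>
      x \<otimes>\<^bsub>A\<^esub> (c \<odot>\<^bsub>A\<^esub> y) = c \<odot>\<^bsub>A\<^esub> (x \<otimes>\<^bsub>A\<^esub> y)"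

definition restrict_scalars :: "('o, 'a) module \<Rightarrow> ('a, 'm, 'z) module_scheme \<Rightarrow> ('o, 'm) module" where
  "restrict_scalars A M =
     mk_module (carrier M) \<zero>\<^bsub>M\<^esub> (add M) (\<lambda>c m. (c \<odot>\<^bsub>A\<^esub> \<one>\<^bsub>A\<^esub>) \<odot>\<^bsub>M\<^esub> m)"

text \<open>As usual for bimodules over \<open>\<O>\<close>-algebras, the two induced actions of \<open>\<O>\<close> coincide.\<close>

definition is_bimodule ::
  "'o ring \<Rightarrow> ('o, 'a) module \<Rightarrow> ('o, 'b) module \<Rightarrow> ('a, 'b, 'm) bimodule \<Rightarrow> bool" where
  "is_bimodule \<O> A B M \<longleftrightarrow>
     left_module A M \<and> left_module (opp B) (right_part M) \<and>
     (\<forall>a\<in>carrier A. \<forall>b\<in>carrier B. \<forall>m\<in>carrier M. rsmult M (a \<odot>\<^bsub>M\<^esub> m) b = a \<odot>\<^bsub>M\<^esub> rsmult M m b) \<and>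
     (\<forall>c\<in>carrier \<O>. \<forall>m\<in>carrier M. (c \<odot>\<^bsub>A\<^esub> \<one>\<^bsub>A\<^esub>) \<odot>\<^bsub>M\<^esub> m = rsmult M m (c \<odot>\<^bsub>B\<^esub> \<one>\<^bsub>B\<^esub>))"

text \<open>The \<open>\<O>\<close>-dual of an \<open>A\<close>-\<open>B\<close>-bimodule, as a \<open>B\<close>-\<open>A\<close>-bimodule.\<close>

definition dual ::
  "'o ring \<Rightarrow> ('o, 'a) module \<Rightarrow> ('a, 'b, 'm) bimodule \<Rightarrow> ('b, 'a, 'm \<Rightarrow> 'o) bimodule" where
  "dual \<O> A M = mk_bimodule
     (mk_module (lin_hom \<O> (restrict_scalars A M) (regular \<O>))
        (\<lambda>m\<in>carrier M. \<zero>\<^bsub>\<O>\<^esub>) (\<lambda>f g. \<lambda>m\<in>carrier M. f m \<oplus>\<^bsub>\<O>\<^esub> g m)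
        (\<lambda>b f. \<lambda>m\<in>carrier M. f (rsmult M m b)))
     (\<lambda>f a. \<lambda>m\<in>carrier M. f (a \<odot>\<^bsub>M\<^esub> m))"

definition symmetrising_form :: "'o ring \<Rightarrow> ('o, 'a) module \<Rightarrow> ('a \<Rightarrow> 'o) \<Rightarrow> bool" where
  "symmetrising_form \<O> A s \<longleftrightarrow>
     (\<exists>\<Phi>\<in>lin_hom A (regular_bimodule A) (dual \<O> A (regular_bimodule A)).
        bij_betw \<Phi> (carrier A) (carrier (dual \<O> A (regular_bimodule A))) \<and>
        (\<forall>x\<in>carrier A. \<forall>a\<in>carrier A.
           \<Phi> (x \<otimes>\<^bsub>A\<^esub> a) = rsmult (dual \<O> A (regular_bimodule A)) (\<Phi> x) a) \<and>
        s = \<Phi> \<one>\<^bsub>A\<^esub>)"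

definition symmetric_algebra :: "'o ring \<Rightarrow> ('o, 'a) module \<Rightarrow> bool" where
  "symmetric_algebra \<O> A \<longleftrightarrow>
     assoc_algebra \<O> A \<and> fg_projective \<O> A \<and> (\<exists>s. symmetrising_form \<O> A s)"

definition rel_projective_element :: "'o ring \<Rightarrow> ('o, 'a) module \<Rightarrow> ('a \<Rightarrow> 'o) \<Rightarrow> 'a" where
  "rel_projective_element \<O> A s = the_elem {(\<Oplus>\<^bsub>A\<^esub>x\<in>X. x \<otimes>\<^bsub>A\<^esub> d x) | X d.
     finite_basis \<O> A X \<and> d \<in> X \<rightarrow> carrier A \<and>
     (\<forall>x\<in>X. \<forall>y\<in>X. s (x \<otimes>\<^bsub>A\<^esub> d y) = (if x = y then \<one>\<^bsub>\<O>\<^esub> else \<zero>\<^bsub>\<O>\<^esub>))}"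

section \<open>Tensor products\<close>

text \<open>
  \<open>X \<otimes>\<^sub>R Y\<close> for a right \<open>R\<close>-module \<open>X\<close> (given as a bimodule, of which only the right action enters
  here) and a left \<open>R\<close>-module \<open>Y\<close>: the free abelian group on pairs modulo bilinearity and balancedness.
\<close>

definition pairs_group ::
  "('l, 'r, 'x, 'z) bimodule_scheme \<Rightarrow> ('r, 'y, 'w) module_scheme \<Rightarrow> (('x \<times> 'y) \<Rightarrow>\<^sub>0 int) monoid" where
  "pairs_group X Y = free_Abelian_group (carrier X \<times> carrier Y)"

definition tensor_rels ::
  "('r, 'v) ring_scheme \<Rightarrow> ('l, 'r, 'x, 'z) bimodule_scheme \<Rightarrow> ('r, 'y, 'w) module_scheme
     \<Rightarrow> (('x \<times> 'y) \<Rightarrow>\<^sub>0 int) set" where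
  "tensor_rels R X Y = generate (pairs_group X Y)
     ({frag_of (x \<oplus>\<^bsub>X\<^esub> x', y) - frag_of (x, y) - frag_of (x', y) | x x' y.
         x \<in> carrier X \<and> x' \<in> carrier X \<and> y \<in> carrier Y} \<union>
      {frag_of (x, y \<oplus>\<^bsub>Y\<^esub> y') - frag_of (x, y) - frag_of (x, y') | x y y'.
         x \<in> carrier X \<and> y \<in> carrier Y \<and> y' \<in> carrier Y} \<union>
      {frag_of (rsmult X x r, y) - frag_of (x, r \<odot>\<^bsub>Y\<^esub> y) | x r y.
         x \<in> carrier X \<and> r \<in> carrier R \<and> y \<in> carrier Y})"

definition pure ::
  "('r, 'v) ring_scheme \<Rightarrow> ('l, 'r, 'x, 'z) bimodule_scheme \<Rightarrow> ('r, 'y, 'w) module_scheme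
     \<Rightarrow> 'x \<Rightarrow> 'y \<Rightarrow> (('x \<times> 'y) \<Rightarrow>\<^sub>0 int) set" where
  "pure R X Y x y = tensor_rels R X Y #>\<^bsub>pairs_group X Y\<^esub> frag_of (x, y)"

text \<open>The additive map \<open>x \<otimes> y \<mapsto> \<phi> (x, y)\<close> into \<open>G\<close> induced by a balanced map \<open>\<phi>\<close>.\<close>

definition tensor_lift ::
  "('g, 'z) ring_scheme \<Rightarrow> ('x \<times> 'y \<Rightarrow> 'g) \<Rightarrow> (('x \<times> 'y) \<Rightarrow>\<^sub>0 int) set \<Rightarrow> 'g" where
  "tensor_lift G \<phi> S = the_elem
     ((\<lambda>c. \<Oplus>\<^bsub>G\<^esub>p\<in>Poly_Mapping.keys c. add_pow G (Poly_Mapping.lookup c p) (\<phi> p)) ` S)"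

definition tensor_ab ::
  "('r, 'v) ring_scheme \<Rightarrow> ('l, 'r, 'x, 'z) bimodule_scheme \<Rightarrow> ('r, 'y, 'w) module_scheme
     \<Rightarrow> (('x \<times> 'y) \<Rightarrow>\<^sub>0 int) set ring" where
  "tensor_ab R X Y = (let Q = pairs_group X Y Mod tensor_rels R X Y in
     \<lparr>carrier = carrier Q,
       monoid.mult = undefined, one = undefined, ring.zero = one Q, add = monoid.mult Q\<rparr>)"

text \<open>The tensor product with the left action coming from \<open>X\<close>.\<close>

definition tensor ::
  "('r, 'v) ring_scheme \<Rightarrow> ('l, 'r, 'x, 'z) bimodule_scheme \<Rightarrow> ('r, 'y, 'w) module_scheme
     \<Rightarrow> ('l, (('x \<times> 'y) \<Rightarrow>\<^sub>0 int) set) module" where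
  "tensor R X Y = (let T = tensor_ab R X Y in
     mk_module (carrier T) \<zero>\<^bsub>T\<^esub> (add T)
       (\<lambda>a. tensor_lift T (\<lambda>(x, y). pure R X Y (a \<odot>\<^bsub>X\<^esub> x) y)))"

text \<open>The tensor product of two bimodules, with the outer actions.\<close>

definition tensor_bimodule ::
  "('r, 'v) ring_scheme \<Rightarrow> ('l, 'r, 'x, 'z) bimodule_scheme \<Rightarrow> ('r, 'q, 'y, 'w) bimodule_scheme
     \<Rightarrow> ('l, 'q, (('x \<times> 'y) \<Rightarrow>\<^sub>0 int) set) bimodule" where
  "tensor_bimodule R X Y = mk_bimodule (tensor R X Y)
     (\<lambda>p b. tensor_lift (tensor R X Y) (\<lambda>(x, y). pure R X Y x (rsmult Y y b)) p)"

text \<open>\<open>f \<otimes> g : X \<otimes>\<^sub>R Y \<rightarrow> X' \<otimes>\<^sub>R Y'\<close>.\<close>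

definition tensor_map ::
  "('r, 'v) ring_scheme \<Rightarrow> ('l, 'r, 'x, 'z) bimodule_scheme \<Rightarrow> ('r, 'y, 'w) module_scheme
     \<Rightarrow> ('l2, 'r, 'x2, 'z2) bimodule_scheme \<Rightarrow> ('r, 'y2, 'w2) module_scheme
     \<Rightarrow> ('x \<Rightarrow> 'x2) \<Rightarrow> ('y \<Rightarrow> 'y2) \<Rightarrow> (('x \<times> 'y) \<Rightarrow>\<^sub>0 int) set \<Rightarrow> (('x2 \<times> 'y2) \<Rightarrow>\<^sub>0 int) set" where
  "tensor_map R X Y X' Y' f g =
     (\<lambda>p\<in>carrier (tensor R X Y).
        tensor_lift (tensor R X' Y') (\<lambda>(x, y). pure R X' Y' (f x) (g y)) p)"

abbreviation id_tensor ::
  "('r, 'v) ring_scheme \<Rightarrow> ('l, 'r, 'x, 'z) bimodule_scheme \<Rightarrow> ('r, 'y, 'w) module_scheme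
     \<Rightarrow> ('r, 'y2, 'w2) module_scheme \<Rightarrow> ('y \<Rightarrow> 'y2)
     \<Rightarrow> (('x \<times> 'y) \<Rightarrow>\<^sub>0 int) set \<Rightarrow> (('x \<times> 'y2) \<Rightarrow>\<^sub>0 int) set" where
  "id_tensor R X Y Y' \<equiv> tensor_map R X Y X Y' (\<lambda>x. x)"

text \<open>The associativity isomorphism \<open>X \<otimes>\<^sub>R (Y \<otimes>\<^sub>S Z) \<rightarrow> (X \<otimes>\<^sub>R Y) \<otimes>\<^sub>S Z\<close> and its inverse.\<close>

definition assoc_left ::
  "('r, 'v) ring_scheme \<Rightarrow> ('s, 'v2) ring_scheme \<Rightarrow> ('l, 'r, 'x, 'z) bimodule_scheme
     \<Rightarrow> ('r, 's, 'y, 'w) bimodule_scheme \<Rightarrow> ('s, 'u, 'w2) module_scheme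
     \<Rightarrow> (('x \<times> (('y \<times> 'u) \<Rightarrow>\<^sub>0 int) set) \<Rightarrow>\<^sub>0 int) set
     \<Rightarrow> (((('x \<times> 'y) \<Rightarrow>\<^sub>0 int) set \<times> 'u) \<Rightarrow>\<^sub>0 int) set" where
  "assoc_left R S X Y Z = (let T = tensor S (tensor_bimodule R X Y) Z in
     tensor_lift T (\<lambda>(x, q).
       tensor_lift T (\<lambda>(y, z). pure S (tensor_bimodule R X Y) Z (pure R X Y x y) z) q))"

definition assoc_right ::
  "('r, 'v) ring_scheme \<Rightarrow> ('s, 'v2) ring_scheme \<Rightarrow> ('l, 'r, 'x, 'z) bimodule_scheme
     \<Rightarrow> ('r, 's, 'y, 'w) bimodule_scheme \<Rightarrow> ('s, 'u, 'w2) module_scheme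
     \<Rightarrow> (((('x \<times> 'y) \<Rightarrow>\<^sub>0 int) set \<times> 'u) \<Rightarrow>\<^sub>0 int) set
     \<Rightarrow> (('x \<times> (('y \<times> 'u) \<Rightarrow>\<^sub>0 int) set) \<Rightarrow>\<^sub>0 int) set" where
  "assoc_right R S X Y Z = (let T = tensor R X (tensor S Y Z) in
     tensor_lift T (\<lambda>(p, z).
       tensor_lift T (\<lambda>(x, y). pure R X (tensor S Y Z) x (pure S Y Z y z)) p))"

section \<open>Extension of scalars to the field of fractions\<close>

text \<open>\<open>K \<otimes>\<^sub>\<O> W\<close> as a \<open>K\<close>-module, for an \<open>\<O>\<close>-module \<open>W\<close>.\<close>

abbreviation extend_scalars ::
  "'k ring \<Rightarrow> 'k ring \<Rightarrow> ('k, 'w) module \<Rightarrow> ('k, (('k \<times> 'w) \<Rightarrow>\<^sub>0 int) set) module" where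
  "extend_scalars \<O> K W \<equiv> tensor \<O> (regular_bimodule K) W"

text \<open>
  \<open>(k \<otimes> a) \<cdot> (l \<otimes> w) = k l \<otimes> a w\<close>, where \<open>act\<close> is the \<open>\<O>\<close>-bilinear action of \<open>A\<close> on \<open>W\<close>.
\<close>

definition extended_action ::
  "'k ring \<Rightarrow> 'k ring \<Rightarrow> ('k, 'w) module \<Rightarrow> ('a \<Rightarrow> 'w \<Rightarrow> 'w)
     \<Rightarrow> (('k \<times> 'a) \<Rightarrow>\<^sub>0 int) set \<Rightarrow> (('k \<times> 'w) \<Rightarrow>\<^sub>0 int) set \<Rightarrow> (('k \<times> 'w) \<Rightarrow>\<^sub>0 int) set" where
  "extended_action \<O> K W act p q = (let T = extend_scalars \<O> K W in
     tensor_lift T (\<lambda>(k, a).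
       tensor_lift T (\<lambda>(l, w). pure \<O> (regular_bimodule K) W (k \<otimes>\<^bsub>K\<^esub> l) (act a w)) q) p)"

text \<open>The \<open>K\<close>-algebra \<open>K \<otimes>\<^sub>\<O> A\<close>.\<close>

definition extended_algebra ::
  "'k ring \<Rightarrow> 'k ring \<Rightarrow> ('k, 'a) module \<Rightarrow> ('k, (('k \<times> 'a) \<Rightarrow>\<^sub>0 int) set) module" where
  "extended_algebra \<O> K A = (extend_scalars \<O> K A)
     \<lparr>monoid.mult := extended_action \<O> K A (monoid.mult A),
      one := pure \<O> (regular_bimodule K) A \<one>\<^bsub>K\<^esub> \<one>\<^bsub>A\<^esub>\<rparr>"

section \<open>The stable category and shifts\<close>

text \<open>
  Every finitely generated projective \<open>A\<close>-module is isomorphic to a submodule of some \<open>free_module A n\<close>,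
  so nothing is lost by letting \<open>P\<close> range over modules of this one type.
\<close>

definition proj_hom ::
  "('a, 'z) ring_scheme \<Rightarrow> ('a, 'u) module \<Rightarrow> ('a, 'v) module \<Rightarrow> ('u \<Rightarrow> 'v) set" where
  "proj_hom A U V = {f \<in> lin_hom A U V.
     \<exists>P :: ('a, nat \<Rightarrow> 'a) module. left_module A P \<and> fg_projective A P \<and>
       (\<exists>g\<in>lin_hom A U P. \<exists>h\<in>lin_hom A P V. f = compose (carrier U) h g)}"

definition stable_rel ::
  "('a, 'z) ring_scheme \<Rightarrow> ('a, 'u) module \<Rightarrow> ('a, 'v) module \<Rightarrow> (('u \<Rightarrow> 'v) \<times> ('u \<Rightarrow> 'v)) set" where
  "stable_rel A U V = {(f, g). f \<in> lin_hom A U V \<and> g \<in> lin_hom A U V \<and>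
     (\<lambda>x\<in>carrier U. f x \<ominus>\<^bsub>V\<^esub> g x) \<in> proj_hom A U V}"

definition stable_hom ::
  "('a, 'z) ring_scheme \<Rightarrow> ('a, 'u) module \<Rightarrow> ('a, 'v) module \<Rightarrow> ('u \<Rightarrow> 'v) set set" where
  "stable_hom A U V = lin_hom A U V // stable_rel A U V"

definition stable_class ::
  "('a, 'z) ring_scheme \<Rightarrow> ('a, 'u) module \<Rightarrow> ('a, 'v) module \<Rightarrow> ('u \<Rightarrow> 'v) \<Rightarrow> ('u \<Rightarrow> 'v) set" where
  "stable_class A U V f = stable_rel A U V `` {f}"

text \<open>
  A choice of shifts \<open>\<Sigma>\<^sup>i(U) = obj X i\<close> of \<open>U\<close>, for all integers \<open>i\<close>, with \<open>\<Sigma>\<^sup>0(U) = U\<close>: it consists of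
  \<open>\<O>\<close>-split short exact sequences \<open>0 \<rightarrow> obj X i \<rightarrow> prj X i \<rightarrow> obj X (i + 1) \<rightarrow> 0\<close> with
  finitely generated projective middle term.  Such a sequence exhibits \<open>obj X (i + 1)\<close> as the cokernel of
  a relatively \<open>\<O>\<close>-injective envelope of \<open>obj X i\<close>, and \<open>obj X i\<close> as the kernel of a projective cover of
  \<open>obj X (i + 1)\<close>.  The identification \<open>\<Sigma>\<^sup>n\<Sigma>\<^sup>m = \<Sigma>\<^sup>n\<^sup>+\<^sup>m\<close> is built in, since \<open>obj X (m + n)\<close> is
  obtained from \<open>obj X m\<close> by \<open>n\<close> shifts.
\<close>

record ('a, 'u, 'p) shifts =
  obj :: "int \<Rightarrow> ('a, 'u) module"
  prj :: "int \<Rightarrow> ('a, 'p) module"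
  inc :: "int \<Rightarrow> 'u \<Rightarrow> 'p"
  pro :: "int \<Rightarrow> 'p \<Rightarrow> 'u"

definition shifts_of ::
  "'o ring \<Rightarrow> ('o, 'a) module \<Rightarrow> ('a, 'u) module \<Rightarrow> ('a, 'u, 'p) shifts \<Rightarrow> bool" where
  "shifts_of \<O> A U X \<longleftrightarrow> obj X 0 = U \<and>
     (\<forall>i. left_module A (obj X i) \<and> fg_free \<O> (restrict_scalars A (obj X i)) \<and>
          left_module A (prj X i) \<and> fg_projective A (prj X i) \<and>
          inc X i \<in> lin_hom A (obj X i) (prj X i) \<and>
          pro X i \<in> lin_hom A (prj X i) (obj X (i + 1)) \<and>
          inj_on (inc X i) (carrier (obj X i)) \<and>
          inc X i ` carrier (obj X i) = a_kernel (prj X i) (obj X (i + 1)) (pro X i) \<and>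
          pro X i ` carrier (prj X i) = carrier (obj X (i + 1)) \<and>
          (\<exists>\<rho>\<in>lin_hom \<O> (restrict_scalars A (prj X i)) (restrict_scalars A (obj X i)).
             \<forall>x\<in>carrier (obj X i). \<rho> (inc X i x) = x))"

text \<open>
  Families \<open>F i : obj X i \<rightarrow> obj Y (i + d)\<close> in which \<open>F (i + 1)\<close> is obtained from \<open>F i\<close> by applying
  \<open>\<Sigma>\<close>, that is, by completing \<open>F i\<close> to a morphism of short exact sequences.
\<close>

definition shift_family ::
  "('a, 'z) ring_scheme \<Rightarrow> ('a, 'u, 'p) shifts \<Rightarrow> ('a, 'v, 'q) shifts \<Rightarrow> int
     \<Rightarrow> (int \<Rightarrow> 'u \<Rightarrow> 'v) \<Rightarrow> bool" where
  "shift_family A X Y d F \<longleftrightarrow>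
     (\<forall>i. F i \<in> lin_hom A (obj X i) (obj Y (i + d)) \<and>
       (\<exists>g\<in>lin_hom A (prj X i) (prj Y (i + d)).
          (\<forall>x\<in>carrier (obj X i). g (inc X i x) = inc Y (i + d) (F i x)) \<and>
          (\<forall>p\<in>carrier (prj X i). pro Y (i + d) (g p) = F (i + 1) (pro X i p))))"

text \<open>
  For a stable class \<open>c\<close> of homomorphisms \<open>obj X 0 \<rightarrow> obj Y d\<close>, the class
  \<open>\<Sigma>\<^sup>k(c)\<close> of homomorphisms \<open>obj X k \<rightarrow> obj Y (k + d)\<close>.
\<close>

definition shift_class ::
  "('a, 'z) ring_scheme \<Rightarrow> ('a, 'u, 'p) shifts \<Rightarrow> ('a, 'v, 'q) shifts \<Rightarrow> int \<Rightarrow> int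
     \<Rightarrow> ('u \<Rightarrow> 'v) set \<Rightarrow> ('u \<Rightarrow> 'v) set" where
  "shift_class A X Y d k c =
     {h. \<exists>F. shift_family A X Y d F \<and> F 0 \<in> c \<and> (F k, h) \<in> stable_rel A (obj X k) (obj Y (k + d))}"

text \<open>\<open>tate_ext A U Y n\<close> is the Tate-Ext group of degree \<open>n\<close> of \<open>U\<close> and \<open>V\<close>, for \<open>Y\<close> a choice of shifts of \<open>V\<close>.\<close>

definition tate_ext ::
  "('a, 'z) ring_scheme \<Rightarrow> ('a, 'u) module \<Rightarrow> ('a, 'v, 'q) shifts \<Rightarrow> int \<Rightarrow> ('u \<Rightarrow> 'v) set set" where
  "tate_ext A U Y n = stable_hom A U (obj Y n)"

section \<open>Tate duality\<close>

text \<open>The trace on \<open>K \<otimes>\<^sub>\<O> U\<close> of \<open>z\<^sub>A\<^sup>-\<^sup>1 \<cdot> (Id\<^sub>K \<otimes> \<phi>)\<close>, for an endomorphism \<open>\<phi>\<close> of \<open>U\<close>.\<close>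

definition twisted_trace ::
  "'k ring \<Rightarrow> 'k ring \<Rightarrow> ('k, 'a) module \<Rightarrow> ('a \<Rightarrow> 'k) \<Rightarrow> ('a, 'u) module \<Rightarrow> ('u \<Rightarrow> 'u) \<Rightarrow> 'k" where
  "twisted_trace \<O> K A s U \<phi> = (let
      W = restrict_scalars A U;
      KA = extended_algebra \<O> K A;
      zinv = inv\<^bsub>KA\<^esub> (pure \<O> (regular_bimodule K) A \<one>\<^bsub>K\<^esub> (rel_projective_element \<O> A s))
    in trace_on K (extend_scalars \<O> K W)
         (\<lambda>q. extended_action \<O> K W (smult U) zinv (id_tensor \<O> (regular_bimodule K) W W \<phi> q)))"

text \<open>
  The pairing of \<open>a\<close> in degree \<open>n\<close> from \<open>U\<close> to \<open>V\<close> with \<open>c\<close> in degree \<open>-n\<close> from \<open>V\<close> to \<open>U\<close>,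
  where \<open>X\<close>, \<open>Y\<close> are choices of shifts of \<open>U\<close>, \<open>V\<close>; its value is a coset of \<open>\<O>\<close> in \<open>K\<close>.
\<close>

definition tate_pairing ::
  "'k ring \<Rightarrow> 'k ring \<Rightarrow> ('k, 'a) module \<Rightarrow> ('a \<Rightarrow> 'k) \<Rightarrow> ('a, 'u, 'p) shifts \<Rightarrow> ('a, 'v, 'q) shifts
     \<Rightarrow> int \<Rightarrow> ('u \<Rightarrow> 'v) set \<Rightarrow> ('v \<Rightarrow> 'u) set \<Rightarrow> 'k set" where
  "tate_pairing \<O> K A s X Y n a c = the_elem
     {carrier \<O> +>\<^bsub>K\<^esub> twisted_trace \<O> K A s (obj X 0) (compose (carrier (obj X 0)) h f) | f h.
        f \<in> a \<and> h \<in> shift_class A Y X (-n) n c}"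

section \<open>Adjunction maps\<close>

text \<open>
  \<open>\<eta>\<^sub>M : M \<otimes>\<^sub>B M\<^sup>\<or> \<rightarrow> A\<close>, \<open>m \<otimes> (s \<circ> \<alpha>) \<mapsto> \<alpha> m\<close>.
\<close>

definition adj_eta ::
  "'o ring \<Rightarrow> ('o, 'a) module \<Rightarrow> ('a, 'b, 'm) bimodule \<Rightarrow> ('a \<Rightarrow> 'o)
     \<Rightarrow> (('m \<times> ('m \<Rightarrow> 'o)) \<Rightarrow>\<^sub>0 int) set \<Rightarrow> 'a" where
  "adj_eta \<O> A M s = tensor_lift A (\<lambda>(m, f).
     (THE \<alpha>. \<alpha> \<in> lin_hom A M (regular A) \<and> f = compose (carrier M) s \<alpha>) m)"

text \<open>
  The image of \<open>1\<^sub>A\<close> under \<open>\<epsilon>\<close>.  Note that \<open>\<beta> j \<in> Hom\<^bsub>B\<^sup>o\<^sup>p\<^esub>(M, B)\<close>.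
\<close>

definition adj_eps_one ::
  "'o ring \<Rightarrow> ('o, 'a) module \<Rightarrow> ('o, 'b) module \<Rightarrow> ('a, 'b, 'm) bimodule \<Rightarrow> ('b \<Rightarrow> 'o)
     \<Rightarrow> (('m \<times> ('m \<Rightarrow> 'o)) \<Rightarrow>\<^sub>0 int) set" where
  "adj_eps_one \<O> A B M t = (let D = dual \<O> A M in the_elem
     {(\<Oplus>\<^bsub>tensor B M D\<^esub>j\<in>{..<k}. pure B M D (m j) (compose (carrier M) t (\<beta> j))) | (k::nat) m \<beta>.
        (\<forall>j<k. m j \<in> carrier M \<and> \<beta> j \<in> lin_hom (opp B) (right_part M) (regular (opp B))) \<and>
        (\<forall>m'\<in>carrier M. (\<Oplus>\<^bsub>M\<^esub>j\<in>{..<k}. rsmult M (m j) (\<beta> j m')) = m')})"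

definition adj_eps ::
  "'o ring \<Rightarrow> ('o, 'a) module \<Rightarrow> ('o, 'b) module \<Rightarrow> ('a, 'b, 'm) bimodule \<Rightarrow> ('b \<Rightarrow> 'o)
     \<Rightarrow> 'a \<Rightarrow> (('m \<times> ('m \<Rightarrow> 'o)) \<Rightarrow>\<^sub>0 int) set" where
  "adj_eps \<O> A B M t a = a \<odot>\<^bsub>tensor B M (dual \<O> A M)\<^esub> adj_eps_one \<O> A B M t"

section \<open>Transfer\<close>

text \<open>
  \<open>(\<eta>\<^sub>M \<otimes> Id\<^sub>W) \<circ> (Id\<^sub>M \<otimes> \<beta>) \<circ> (\<epsilon> \<otimes> Id\<^sub>U) : U \<rightarrow> W\<close> for \<open>\<beta> : M\<^sup>\<or> \<otimes>\<^sub>A U \<rightarrow> M\<^sup>\<or> \<otimes>\<^sub>A W\<close>, with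
  the identifications \<open>U \<cong> A \<otimes>\<^sub>A U\<close>, \<open>A \<otimes>\<^sub>A W \<cong> W\<close> and the associativity isomorphisms
  written out.
\<close>

definition transfer_hom ::
  "'o ring \<Rightarrow> ('o, 'a) module \<Rightarrow> ('o, 'b) module \<Rightarrow> ('a, 'b, 'm) bimodule \<Rightarrow> ('a \<Rightarrow> 'o) \<Rightarrow> ('b \<Rightarrow> 'o)
     \<Rightarrow> ('a, 'u) module \<Rightarrow> ('a, 'w) module
     \<Rightarrow> ((('m \<Rightarrow> 'o) \<times> 'u \<Rightarrow>\<^sub>0 int) set \<Rightarrow> (('m \<Rightarrow> 'o) \<times> 'w \<Rightarrow>\<^sub>0 int) set) \<Rightarrow> 'u \<Rightarrow> 'w" where
  "transfer_hom \<O> A B M s t U W \<beta> = (let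
      D = dual \<O> A M;
      E = tensor_bimodule B M D;
      R = regular_bimodule A
    in (\<lambda>u\<in>carrier U.
      tensor_lift W (\<lambda>(a, w). a \<odot>\<^bsub>W\<^esub> w)
        (tensor_map A E W R W (adj_eta \<O> A M s) (\<lambda>w. w)
          (assoc_left B A M D W
            (id_tensor B M (tensor A D U) (tensor A D W) \<beta>
              (assoc_right B A M D U
                (tensor_map A R U E U (adj_eps \<O> A B M t) (\<lambda>u. u)
                  (pure A R U \<one>\<^bsub>A\<^esub> u))))))))"

text \<open>Tensoring the sequences of a choice of shifts with an \<open>A\<close>-projective \<open>B\<close>-\<open>A\<close>-bimodule \<open>N\<close>.\<close>

definition tensor_shifts ::
  "('o, 'a) module \<Rightarrow> ('b, 'a, 'n) bimodule \<Rightarrow> ('a, 'u, 'p) shifts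
     \<Rightarrow> ('b, (('n \<times> 'u) \<Rightarrow>\<^sub>0 int) set, (('n \<times> 'p) \<Rightarrow>\<^sub>0 int) set) shifts" where
  "tensor_shifts A N X =
     \<lparr>obj = (\<lambda>i. tensor A N (obj X i)), prj = (\<lambda>i. tensor A N (prj X i)),
      inc = (\<lambda>i. id_tensor A N (obj X i) (prj X i) (inc X i)),
      pro = (\<lambda>i. id_tensor A N (prj X i) (obj X (i + 1)) (pro X i))\<rparr>"

text \<open>
  Given choices of shifts \<open>Y\<close> of the \<open>A\<close>-module \<open>V\<close> and \<open>Y'\<close> of the \<open>B\<close>-module \<open>N \<otimes>\<^sub>A V\<close>, the canonical
  identification \<open>N \<otimes>\<^sub>A \<Sigma>\<^sup>n(V) \<cong> \<Sigma>\<^sup>n(N \<otimes>\<^sub>A V)\<close> in the stable category, as a class of homomorphisms: both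
  sides are \<open>n\<close>-th shifts of \<open>N \<otimes>\<^sub>A V\<close>, and the identification is the \<open>n\<close>-th shift of the identity.
\<close>

definition canonical_shift_iso ::
  "('o, 'a) module \<Rightarrow> ('o, 'b) module \<Rightarrow> ('b, 'a, 'n) bimodule \<Rightarrow> ('a, 'v, 'q) shifts
     \<Rightarrow> ('b, (('n \<times> 'v) \<Rightarrow>\<^sub>0 int) set, 'q2) shifts \<Rightarrow> int
     \<Rightarrow> ((('n \<times> 'v) \<Rightarrow>\<^sub>0 int) set \<Rightarrow> (('n \<times> 'v) \<Rightarrow>\<^sub>0 int) set) set" where
  "canonical_shift_iso A B N Y Y' n = (let T = tensor A N (obj Y 0) in
     shift_class B (tensor_shifts A N Y) Y' 0 n (stable_class B T T (\<lambda>x\<in>carrier T. x)))"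

text \<open>
  \<open>Id\<^sub>N \<otimes> a\<close>, from the degree \<open>n\<close> Tate-Ext of \<open>U\<close> and \<open>V\<close> to that of \<open>N \<otimes>\<^sub>A U\<close> and \<open>N \<otimes>\<^sub>A V\<close>.
\<close>

definition tensor_class ::
  "('o, 'a) module \<Rightarrow> ('o, 'b) module \<Rightarrow> ('b, 'a, 'n) bimodule \<Rightarrow> ('a, 'u) module
     \<Rightarrow> ('a, 'v, 'q) shifts \<Rightarrow> ('b, (('n \<times> 'v) \<Rightarrow>\<^sub>0 int) set, 'q2) shifts \<Rightarrow> int \<Rightarrow> ('u \<Rightarrow> 'v) set
     \<Rightarrow> ((('n \<times> 'u) \<Rightarrow>\<^sub>0 int) set \<Rightarrow> (('n \<times> 'v) \<Rightarrow>\<^sub>0 int) set) set" where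
  "tensor_class A B N U Y Y' n a = the_elem
     {stable_class B (tensor A N U) (obj Y' n)
        (compose (carrier (tensor A N U)) \<theta> (id_tensor A N U (obj Y n) f)) | f \<theta>.
        f \<in> a \<and> \<theta> \<in> canonical_shift_iso A B N Y Y' n}"

text \<open>
  \<open>tr\<^sub>M\<close>, from the degree \<open>n\<close> Tate-Ext over \<open>B\<close> of \<open>M\<^sup>\<or> \<otimes>\<^sub>A U\<close> and \<open>M\<^sup>\<or> \<otimes>\<^sub>A V\<close> to that over \<open>A\<close> of \<open>U\<close> and \<open>V\<close>;
  \<open>\<beta>\<close> runs over the representatives \<open>M\<^sup>\<or> \<otimes>\<^sub>A U \<rightarrow> M\<^sup>\<or> \<otimes>\<^sub>A \<Sigma>\<^sup>n(V)\<close> of the class \<open>b\<close>.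
\<close>

definition transfer_map ::
  "'o ring \<Rightarrow> ('o, 'a) module \<Rightarrow> ('o, 'b) module \<Rightarrow> ('a, 'b, 'm) bimodule \<Rightarrow> ('a \<Rightarrow> 'o) \<Rightarrow> ('b \<Rightarrow> 'o)
     \<Rightarrow> ('a, 'u) module \<Rightarrow> ('a, 'v, 'q) shifts
     \<Rightarrow> ('b, (('m \<Rightarrow> 'o) \<times> 'v \<Rightarrow>\<^sub>0 int) set, 'q2) shifts \<Rightarrow> int
     \<Rightarrow> ((('m \<Rightarrow> 'o) \<times> 'u \<Rightarrow>\<^sub>0 int) set \<Rightarrow> (('m \<Rightarrow> 'o) \<times> 'v \<Rightarrow>\<^sub>0 int) set) set
     \<Rightarrow> ('u \<Rightarrow> 'v) set" where
  "transfer_map \<O> A B M s t U Y Y' n b = (let D = dual \<O> A M in the_elem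
     {stable_class A U (obj Y n) (transfer_hom \<O> A B M s t U (obj Y n) \<beta>) | \<beta>.
        \<beta> \<in> lin_hom B (tensor A D U) (tensor A D (obj Y n)) \<and>
        (\<exists>\<theta>\<in>canonical_shift_iso A B D Y Y' n. compose (carrier (tensor A D U)) \<theta> \<beta> \<in> b)})"

end

theory Submission
  imports Defs
begin

text \<open>
  A homomorphism factors through a projective module iff it is a finite sum of maps \<open>x \<mapsto> g(x) v\<close> with
  \<open>g\<close> in \<open>Hom\<^sub>A(U, A)\<close>.  The trace of \<open>z\<^sub>A\<^sup>-\<^sup>1\<close> times such a map is \<open>s(g(v))\<close>, which lies in \<open>\<O>\<close>, and this
  determines the trace on all endomorphisms of \<open>U\<close>: since \<open>z\<^sub>A\<close> acts on \<open>U\<close> as the relative trace of the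
  identity, a nonzero scalar multiple of any endomorphism has finite rank over \<open>A\<close>.  For an endomorphism
  \<open>\<beta>\<close> of \<open>M\<^sup>\<or> \<otimes> U\<close> of the form \<open>q \<mapsto> g(q) r\<close> one computes directly that the twisted traces of \<open>tr\<^sub>M(\<beta>)\<close> over
  \<open>A\<close> and of \<open>\<beta>\<close> over \<open>B\<close> are both \<open>t(g(r))\<close>, so they agree for every \<open>\<beta>\<close>.  The theorem follows because the
  transfer is compatible with composition and, applied to shifted morphisms, again gives shifted
  morphisms: both pairings become twisted traces of stably equal endomorphisms of \<open>M\<^sup>\<or> \<otimes> U\<close>
  (respectively \<open>M\<^sup>\<or> \<otimes> V\<close>).
\<close>

\<comment> \<open>Two obstacles shape the proof. First, the definitions depend on choices: bases,
  frames of \<open>M\<close>, representatives, shift families. Each choice sits under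
  \<open>the_elem\<close>, so a value is available only once it is known to be the same for all
  choices; this is the task of the Casimir identities and, for shifts, of the fact that a family of
  shifted morphisms is stably determined by any one member. Secondly, the pairing needs the inverse
  of z_A in K \<otimes> A. Splitting 1 along a complement of the left ideal generated by z_A
  produces an idempotent e with e z_A = 0. The trace of left multiplication by e is the rank of its
  image, but also s(e z_A) = 0 up to a scalar, so e = 0 in characteristic zero. Clearing
  denominators gives z' in A and a nonzero c in \<O> with z' z_A = c, and then every twisted trace
  is the inverse of c times a trace over \<O>. The traces on D \<otimes> U and D \<otimes> V, where
  D is the dual of M, require these modules to be free over \<O>; that comes with their given
  shifts.\<close>
syntax "_index_sub" :: "id_position \<Rightarrow> index" ("\<^sub>_" [1000] 1000)
\<comment> \<open>Input shorthand only: a single subscripted identifier is accepted as the index of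
  a structure, as in \<open>x \<oplus>\<^sub>G y\<close>.\<close>
translations "_index_sub x" \<rightharpoonup> "_index x"

section \<open>Additive maps and finite sums\<close>

text \<open>Values outside the carrier are left free, unlike in \<open>lin_hom\<close>, so
  composites and pointwise sums are again additive maps without being restricted to the
  carrier.\<close>

definition addmap :: "('g, 'y) ring_scheme \<Rightarrow> ('h, 'z) ring_scheme \<Rightarrow> ('g \<Rightarrow> 'h) set" where
  "addmap G H = {f \<in> carrier G \<rightarrow> carrier H. \<forall>x\<in>carrier G. \<forall>y\<in>carrier G. f (x \<oplus>\<^sub>G y) = f x \<oplus>\<^sub>H f y}"

lemma addmapI:
  assumes "\<And>x. x \<in> carrier G \<Longrightarrow> f x \<in> carrier H" and "\<And>x y. x \<in> carrier G \<Longrightarrow> y \<in> carrier G \<Longrightarrow> f (x \<oplus>\<^sub>G y) = f x \<oplus>\<^sub>H f y"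
  shows "f \<in> addmap G H"
  using assms by (auto simp: addmap_def)

lemma addmap_closed: "f \<in> addmap G H \<Longrightarrow> x \<in> carrier G \<Longrightarrow> f x \<in> carrier H" by (auto simp: addmap_def)

lemma addmap_add: "f \<in> addmap G H \<Longrightarrow> x \<in> carrier G \<Longrightarrow> y \<in> carrier G \<Longrightarrow> f (x \<oplus>\<^sub>G y) = f x \<oplus>\<^sub>H f y" by (auto simp: addmap_def)

lemma ag_add [simp]: "abelian_group G \<Longrightarrow> x \<in> carrier G \<Longrightarrow> y \<in> carrier G \<Longrightarrow> x \<oplus>\<^sub>G y \<in> carrier G" by (rule abelian_groupE(1))

lemma ag_zero [simp]: "abelian_group G \<Longrightarrow> \<zero>\<^sub>G \<in> carrier G" by (rule abelian_groupE(2))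

lemma ag_neg [simp]: "abelian_group G \<Longrightarrow> x \<in> carrier G \<Longrightarrow> \<ominus>\<^sub>G x \<in> carrier G" by (rule abelian_group.a_inv_closed)

lemma ag_diff [simp]: "abelian_group G \<Longrightarrow> x \<in> carrier G \<Longrightarrow> y \<in> carrier G \<Longrightarrow> x \<ominus>\<^sub>G y \<in> carrier G"
  by (rule abelian_group.minus_closed)

lemma ag_monoid: "abelian_group G \<Longrightarrow> abelian_monoid G" by (rule abelian_group.axioms)

lemma ag_l_zero [simp]: "abelian_group G \<Longrightarrow> x \<in> carrier G \<Longrightarrow> \<zero>\<^sub>G \<oplus>\<^sub>G x = x" by (rule abelian_groupE(5))

lemma ag_r_zero [simp]: "abelian_group G \<Longrightarrow> x \<in> carrier G \<Longrightarrow> x \<oplus>\<^sub>G \<zero>\<^sub>G = x" by (simp add: abelian_monoid.r_zero[OF ag_monoid])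

lemma ag_diff_self [simp]: "abelian_group G \<Longrightarrow> x \<in> carrier G \<Longrightarrow> x \<ominus>\<^sub>G x = \<zero>\<^sub>G" by (simp add: a_minus_def abelian_group.r_neg)

lemma ag_diff_eq_zero:
  assumes "abelian_group G" "x \<in> carrier G" "y \<in> carrier G"
  shows "x \<ominus>\<^sub>G y = \<zero>\<^sub>G \<longleftrightarrow> x = y"
proof -
  interpret abelian_group G by fact
  show ?thesis using assms by (metis a_minus_def add.inv_closed add.inv_inv add.l_inv minus_equality r_neg)
qed

lemma ag_diff_zero [simp]: "abelian_group G \<Longrightarrow> x \<in> carrier G \<Longrightarrow> x \<ominus>\<^sub>G \<zero>\<^sub>G = x"
proof -
  assume "abelian_group G" "x \<in> carrier G"
  interpret abelian_group G by fact
  show ?thesis using \<open>x \<in> carrier G\<close> by (simp add: a_minus_def)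
qed

lemma ag_diff_add_cancel [simp]:
  assumes "abelian_group G" "x \<in> carrier G" "y \<in> carrier G"
  shows "x \<ominus>\<^sub>G y \<oplus>\<^sub>G y = x"
proof -
  interpret abelian_group G by fact
  show ?thesis using assms by (simp add: a_minus_def a_assoc l_neg)
qed

lemma ag_add_diff_cancel [simp]:
  assumes "abelian_group G" "x \<in> carrier G" "y \<in> carrier G"
  shows "(x \<oplus>\<^sub>G y) \<ominus>\<^sub>G y = x"
proof -
  interpret abelian_group G by fact
  show ?thesis using assms by (simp add: a_minus_def a_assoc r_neg)
qed

lemma ag_add4:
  assumes "abelian_group G" "a \<in> carrier G" "b \<in> carrier G" "c \<in> carrier G" "d \<in> carrier G"
  shows "(a \<oplus>\<^sub>G b) \<oplus>\<^sub>G (c \<oplus>\<^sub>G d) = (a \<oplus>\<^sub>G c) \<oplus>\<^sub>G (b \<oplus>\<^sub>G d)"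
proof -
  interpret abelian_group G by fact
  show ?thesis using assms by (simp add: a_ac)
qed

lemma ag_neg_add:
  assumes "abelian_group G" "a \<in> carrier G" "b \<in> carrier G"
  shows "\<ominus>\<^sub>G (a \<oplus>\<^sub>G b) = \<ominus>\<^sub>G a \<oplus>\<^sub>G \<ominus>\<^sub>G b"
  using assms by (simp add: abelian_group.minus_add)

lemma ag_diff_add4:
  assumes "abelian_group G" "a \<in> carrier G" "b \<in> carrier G" "c \<in> carrier G" "d \<in> carrier G"
  shows "(a \<oplus>\<^sub>G b) \<ominus>\<^sub>G (c \<oplus>\<^sub>G d) = (a \<ominus>\<^sub>G c) \<oplus>\<^sub>G (b \<ominus>\<^sub>G d)"
  using assms by (simp add: a_minus_def ag_neg_add ag_add4)

lemma ag_diff_trans: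
  assumes "abelian_group G" "a \<in> carrier G" "b \<in> carrier G" "c \<in> carrier G"
  shows "(a \<ominus>\<^sub>G b) \<oplus>\<^sub>G (b \<ominus>\<^sub>G c) = a \<ominus>\<^sub>G c"
proof -
  interpret abelian_group G by fact
  have "(a \<ominus>\<^sub>G b) \<oplus>\<^sub>G (b \<ominus>\<^sub>G c) = ((a \<ominus>\<^sub>G b) \<oplus>\<^sub>G b) \<ominus>\<^sub>G c" using assms by (simp add: a_minus_def a_assoc)
  then show ?thesis using assms by simp
qed

lemma ag_neg_diff:
  assumes "abelian_group G" "a \<in> carrier G" "b \<in> carrier G"
  shows "\<ominus>\<^sub>G (a \<ominus>\<^sub>G b) = b \<ominus>\<^sub>G a"
proof -
  interpret abelian_group G by fact
  show ?thesis using assms by (simp add: a_minus_def minus_add a_comm)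
qed

lemma addmap_zero [simp]:
  assumes "abelian_group G" "abelian_group H" "f \<in> addmap G H"
  shows "f \<zero>\<^sub>G = \<zero>\<^sub>H"
proof -
  interpret H: abelian_group H by fact
  have z: "\<zero>\<^sub>G \<in> carrier G" using assms by simp
  have "f \<zero>\<^sub>G \<oplus>\<^sub>H f \<zero>\<^sub>G = f \<zero>\<^sub>G" using addmap_add[OF assms(3) z z] assms z by simp
  then show ?thesis using addmap_closed[OF assms(3) z] by (simp add: H.add.l_cancel_one)
qed

lemma addmap_neg:
  assumes "abelian_group G" "abelian_group H" "f \<in> addmap G H" "x \<in> carrier G"
  shows "f (\<ominus>\<^sub>G x) = \<ominus>\<^sub>H f x"
proof -
  interpret H: abelian_group H by fact
  interpret G: abelian_group G by fact
  have "f (\<ominus>\<^sub>G x) \<oplus>\<^sub>H f x = \<zero>\<^sub>H" using addmap_add[OF assms(3), of "\<ominus>\<^sub>G x" x] assms by (simp add: G.l_neg)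
  then show ?thesis using addmap_closed[OF assms(3)] assms by (simp add: H.minus_equality)
qed

lemma addmap_diff:
  assumes "abelian_group G" "abelian_group H" "f \<in> addmap G H" "x \<in> carrier G" "y \<in> carrier G"
  shows "f (x \<ominus>\<^sub>G y) = f x \<ominus>\<^sub>H f y"
  using assms by (simp add: a_minus_def addmap_add addmap_neg)

lemma addmap_comp: "f \<in> addmap G H \<Longrightarrow> g \<in> addmap H L \<Longrightarrow> (\<lambda>x. g (f x)) \<in> addmap G L" by (auto simp: addmap_def Pi_def)

lemma addmap_sum2:
  assumes "abelian_group H" "f \<in> addmap G H" "g \<in> addmap G H"
  shows "(\<lambda>x. f x \<oplus>\<^sub>H g x) \<in> addmap G H"
  by (rule addmapI) (use assms in "auto simp: addmap_closed addmap_add ag_add4")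

section \<open>Finite sums in abelian groups\<close>

lemma fs_closed [simp]: "abelian_group G \<Longrightarrow> (\<And>i. i \<in> I \<Longrightarrow> f i \<in> carrier G) \<Longrightarrow> finsum G f I \<in> carrier G"
  by (rule abelian_monoid.finsum_closed[OF ag_monoid]) auto

lemma fs_cong:
  assumes "abelian_group G" "\<And>i. i \<in> I \<Longrightarrow> f i = g i" "\<And>i. i \<in> I \<Longrightarrow> g i \<in> carrier G"
  shows "finsum G f I = finsum G g I"
  by (rule abelian_monoid.finsum_cong'[OF ag_monoid]) (use assms in auto)

lemma fs_add:
  assumes "abelian_group G" "\<And>i. i \<in> I \<Longrightarrow> f i \<in> carrier G" "\<And>i. i \<in> I \<Longrightarrow> g i \<in> carrier G"
  shows "finsum G (\<lambda>i. f i \<oplus>\<^sub>G g i) I = finsum G f I \<oplus>\<^sub>G finsum G g I"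
  by (rule abelian_monoid.finsum_addf[OF ag_monoid]) (use assms in auto)

lemma fs_zero [simp]: "abelian_group G \<Longrightarrow> finsum G (\<lambda>i. \<zero>\<^sub>G) I = \<zero>\<^sub>G" by (rule abelian_monoid.finsum_zero[OF ag_monoid])

lemma fs_empty [simp]: "abelian_group G \<Longrightarrow> finsum G f {} = \<zero>\<^sub>G" by (rule abelian_monoid.finsum_empty[OF ag_monoid])

lemma fs_insert:
  assumes "abelian_group G" "finite I" "j \<notin> I" "f j \<in> carrier G" "\<And>i. i \<in> I \<Longrightarrow> f i \<in> carrier G"
  shows "finsum G f (insert j I) = f j \<oplus>\<^sub>G finsum G f I"
  by (rule abelian_monoid.finsum_insert[OF ag_monoid]) (use assms in auto)

lemma addmap_fs:
  assumes "abelian_group G" "abelian_group H" "f \<in> addmap G H" "\<And>i. i \<in> I \<Longrightarrow> x i \<in> carrier G"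
  shows "f (finsum G x I) = finsum H (\<lambda>i. f (x i)) I"
proof (cases "finite I")
  case True
  then show ?thesis using assms(4)
  proof (induction I rule: finite_induct)
    case empty then show ?case using assms by simp
  next
    case (insert j I)
    then show ?case using assms(1,2) by (simp add: fs_insert addmap_add[OF assms(3)] addmap_closed[OF assms(3)])
  qed
next
  case False
  \<comment> \<open>Sums over an infinite index set are zero by convention, and \<open>f\<close>
    preserves zero.\<close>
  then show ?thesis using assms by (simp add: abelian_monoid.finsum_infinite[OF ag_monoid])
qed

lemma addmap_sum:
  assumes "abelian_group G" "abelian_group H" "\<And>i. i \<in> I \<Longrightarrow> f i \<in> addmap G H"
  shows "(\<lambda>x. finsum H (\<lambda>i. f i x) I) \<in> addmap G H"
  by (rule addmapI) (use assms in "auto simp: fs_add[symmetric] addmap_closed[OF assms(3)] addmap_add[OF assms(3)] intro!: fs_cong fs_closed")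

lemma fs_swap:
  assumes G: "abelian_group G" and fin: "finite I" and cl: "\<And>i j. i \<in> I \<Longrightarrow> j \<in> J \<Longrightarrow> f i j \<in> carrier G"
  shows "finsum G (\<lambda>i. finsum G (\<lambda>j. f i j) J) I = finsum G (\<lambda>j. finsum G (\<lambda>i. f i j) I) J"
  using fin cl
proof (induction I rule: finite_induct)
  case empty then show ?case using G by simp
next
  case (insert k I)
  have "finsum G (\<lambda>j. finsum G (\<lambda>i. f i j) (insert k I)) J
      = finsum G (\<lambda>j. f k j \<oplus>\<^sub>G finsum G (\<lambda>i. f i j) I) J" using G insert by (intro fs_cong) (auto simp: fs_insert)
  also have "\<dots> = finsum G (\<lambda>j. f k j) J \<oplus>\<^sub>G finsum G (\<lambda>j. finsum G (\<lambda>i. f i j) I) J" using G insert by (intro fs_add) auto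
  finally show ?case using G insert by (simp add: fs_insert)
qed

lemma fs_Times:
  assumes G: "abelian_group G" and fin: "finite I" "finite J" and cl: "\<And>i j. i \<in> I \<Longrightarrow> j \<in> J \<Longrightarrow> f (i, j) \<in> carrier G"
  shows "finsum G f (I \<times> J) = finsum G (\<lambda>i. finsum G (\<lambda>j. f (i, j)) J) I"
  using fin(1) cl
proof (induction I rule: finite_induct)
  case empty then show ?case using G by simp
next
  case (insert k I)
  interpret abelian_group G by fact
  have inj: "inj_on (Pair k) J" by (auto simp: inj_on_def)
  have "finsum G f (insert k I \<times> J) = finsum G f ((Pair k ` J) \<union> (I \<times> J))" by (rule arg_cong[of _ _ "finsum G f"]) auto
  also have "\<dots> = finsum G f (Pair k ` J) \<oplus>\<^sub>G finsum G f (I \<times> J)" using insert fin(2) by (intro finsum_Un_disjoint) auto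
  also have "finsum G f (Pair k ` J) = finsum G (\<lambda>j. f (k, j)) J" using insert inj by (intro finsum_reindex) auto
  finally show ?case using G insert by (simp add: fs_insert)
qed

lemma fs_delta:
  assumes "abelian_group G" "finite I" "j \<in> I" "f j \<in> carrier G"
  shows "finsum G (\<lambda>i. if i = j then f i else \<zero>\<^sub>G) I = f j"
proof -
  interpret abelian_group G by fact
  have "finsum G (\<lambda>i. if i = j then f i else \<zero>\<^sub>G) (insert j (I - {j}))
      = f j \<oplus>\<^sub>G finsum G (\<lambda>i. if i = j then f i else \<zero>\<^sub>G) (I - {j})" using assms by (subst fs_insert) auto
  also have "finsum G (\<lambda>i. if i = j then f i else \<zero>\<^sub>G) (I - {j}) = finsum G (\<lambda>i. \<zero>\<^sub>G) (I - {j})"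
    using assms by (intro fs_cong) auto
  finally show ?thesis using assms by (simp add: insert_absorb)
qed

text \<open>The value of \<^const>\<open>finsum\<close> depends only on carrier, zero and addition of the record.\<close>

lemma fs_same:
  assumes "abelian_group G" "abelian_group H" "carrier G = carrier H" "add G = add H" and "\<And>i. i \<in> I \<Longrightarrow> x i \<in> carrier G"
  shows "finsum G x I = finsum H x I"
  using addmap_fs[of G H "\<lambda>x. x" I x] assms by (auto simp: addmap_def)

section \<open>Left modules and homomorphisms\<close>

lemma lm_ring: "left_module R M \<Longrightarrow> ring R" and lm_ag: "left_module R M \<Longrightarrow> abelian_group M" by (auto simp: left_module_def)

lemma ring_ag: "ring R \<Longrightarrow> abelian_group R" by (rule ringE(1))

lemma rg_mult [simp]: "ring R \<Longrightarrow> x \<in> carrier R \<Longrightarrow> y \<in> carrier R \<Longrightarrow> x \<otimes>\<^sub>R y \<in> carrier R"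
  by (meson monoid.m_closed ring.is_monoid)

lemma rg_one [simp]: "ring R \<Longrightarrow> \<one>\<^sub>R \<in> carrier R" by (meson monoid.one_closed ring.is_monoid)

lemma lm_smult [simp]: "left_module R M \<Longrightarrow> a \<in> carrier R \<Longrightarrow> x \<in> carrier M \<Longrightarrow> a \<odot>\<^sub>M x \<in> carrier M"
  by (rule left_module.lm_closed)

lemma left_moduleI:
  assumes "ring R" "abelian_group M" and "\<And>a x. a \<in> carrier R \<Longrightarrow> x \<in> carrier M \<Longrightarrow> a \<odot>\<^sub>M x \<in> carrier M"
    and "\<And>a b x. a \<in> carrier R \<Longrightarrow> b \<in> carrier R \<Longrightarrow> x \<in> carrier M \<Longrightarrow> (a \<oplus>\<^sub>R b) \<odot>\<^sub>M x = a \<odot>\<^sub>M x \<oplus>\<^sub>M b \<odot>\<^sub>M x"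
    and "\<And>a x y. a \<in> carrier R \<Longrightarrow> x \<in> carrier M \<Longrightarrow> y \<in> carrier M \<Longrightarrow>
      a \<odot>\<^sub>M (x \<oplus>\<^sub>M y) = a \<odot>\<^sub>M x \<oplus>\<^sub>M a \<odot>\<^sub>M y" and "\<And>a b x. a \<in> carrier R \<Longrightarrow> b \<in> carrier R \<Longrightarrow> x \<in> carrier M \<Longrightarrow>
      (a \<otimes>\<^sub>R b) \<odot>\<^sub>M x = a \<odot>\<^sub>M (b \<odot>\<^sub>M x)" and "\<And>x. x \<in> carrier M \<Longrightarrow> \<one>\<^sub>R \<odot>\<^sub>M x = x"
  shows "left_module R M"
  by (intro left_module.intro left_module_axioms.intro assms)

lemma lm_addmap_r: "left_module R M \<Longrightarrow> a \<in> carrier R \<Longrightarrow> (\<lambda>x. a \<odot>\<^sub>M x) \<in> addmap M M"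
  by (rule addmapI) (auto simp: left_module.lm_r_distr)

lemma lm_addmap_l: "left_module R M \<Longrightarrow> x \<in> carrier M \<Longrightarrow> (\<lambda>a. a \<odot>\<^sub>M x) \<in> addmap R M"
  by (rule addmapI) (auto simp: left_module.lm_l_distr)

lemma lm_zero_r [simp]: "left_module R M \<Longrightarrow> a \<in> carrier R \<Longrightarrow> a \<odot>\<^sub>M \<zero>\<^sub>M = \<zero>\<^sub>M" by (rule addmap_zero[OF lm_ag lm_ag lm_addmap_r])

lemma lm_zero_l [simp]: "left_module R M \<Longrightarrow> x \<in> carrier M \<Longrightarrow> \<zero>\<^sub>R \<odot>\<^sub>M x = \<zero>\<^sub>M"
  using addmap_zero[OF _ _ lm_addmap_l] by (metis lm_ag lm_ring ring_ag)

lemma lm_fs_r: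
  assumes "left_module R M" "a \<in> carrier R" "\<And>i. i \<in> I \<Longrightarrow> x i \<in> carrier M"
  shows "a \<odot>\<^sub>M finsum M x I = finsum M (\<lambda>i. a \<odot>\<^sub>M x i) I"
  by (rule addmap_fs[OF lm_ag[OF assms(1)] lm_ag[OF assms(1)] lm_addmap_r[OF assms(1,2)] assms(3)])

lemma lm_fs_l:
  assumes "left_module R M" "x \<in> carrier M" "\<And>i. i \<in> I \<Longrightarrow> a i \<in> carrier R"
  shows "finsum R a I \<odot>\<^sub>M x = finsum M (\<lambda>i. a i \<odot>\<^sub>M x) I"
  by (rule addmap_fs[OF ring_ag[OF lm_ring[OF assms(1)]] lm_ag[OF assms(1)] lm_addmap_l[OF assms(1,2)] assms(3)])

lemma lm_diff_r:
  assumes "left_module R M" "a \<in> carrier R" "x \<in> carrier M" "y \<in> carrier M"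
  shows "a \<odot>\<^sub>M (x \<ominus>\<^sub>M y) = a \<odot>\<^sub>M x \<ominus>\<^sub>M a \<odot>\<^sub>M y"
  by (rule addmap_diff[OF lm_ag[OF assms(1)] lm_ag[OF assms(1)] lm_addmap_r[OF assms(1,2)] assms(3,4)])

lemma lin_homI:
  assumes "f \<in> extensional (carrier M)" "\<And>x. x \<in> carrier M \<Longrightarrow> f x \<in> carrier N"
    "\<And>x y. x \<in> carrier M \<Longrightarrow> y \<in> carrier M \<Longrightarrow> f (x \<oplus>\<^sub>M y) = f x \<oplus>\<^sub>N f y"
    "\<And>a x. a \<in> carrier R \<Longrightarrow> x \<in> carrier M \<Longrightarrow> f (a \<odot>\<^sub>M x) = a \<odot>\<^sub>N f x"
  shows "f \<in> lin_hom R M N"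
  using assms unfolding lin_hom_def PiE_def Pi_def by blast

lemma lin_hom_restrictI:
  assumes "abelian_group M" "\<And>a x. a \<in> carrier R \<Longrightarrow> x \<in> carrier M \<Longrightarrow> a \<odot>\<^sub>M x \<in> carrier M" "\<And>x. x \<in> carrier M \<Longrightarrow> f x \<in> carrier N"
    "\<And>x y. x \<in> carrier M \<Longrightarrow> y \<in> carrier M \<Longrightarrow> f (x \<oplus>\<^sub>M y) = f x \<oplus>\<^sub>N f y"
    "\<And>a x. a \<in> carrier R \<Longrightarrow> x \<in> carrier M \<Longrightarrow> f (a \<odot>\<^sub>M x) = a \<odot>\<^sub>N f x"
  shows "(\<lambda>x\<in>carrier M. f x) \<in> lin_hom R M N"
  by (rule lin_homI) (use assms in auto)

lemma lin_hom_closed: "f \<in> lin_hom R M N \<Longrightarrow> x \<in> carrier M \<Longrightarrow> f x \<in> carrier N" by (auto simp: lin_hom_def)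

lemma lin_hom_add: "f \<in> lin_hom R M N \<Longrightarrow> x \<in> carrier M \<Longrightarrow> y \<in> carrier M \<Longrightarrow> f (x \<oplus>\<^sub>M y) = f x \<oplus>\<^sub>N f y" by (auto simp: lin_hom_def)

lemma lin_hom_smult: "f \<in> lin_hom R M N \<Longrightarrow> a \<in> carrier R \<Longrightarrow> x \<in> carrier M \<Longrightarrow> f (a \<odot>\<^sub>M x) = a \<odot>\<^sub>N f x" by (auto simp: lin_hom_def)

lemma lin_hom_ext: "f \<in> lin_hom R M N \<Longrightarrow> f \<in> extensional (carrier M)" by (auto simp: lin_hom_def PiE_def)

lemma lin_hom_addmap: "f \<in> lin_hom R M N \<Longrightarrow> f \<in> addmap M N" by (auto simp: lin_hom_def addmap_def)

lemma lin_hom_eqI: "f \<in> lin_hom R M N \<Longrightarrow> g \<in> lin_hom R' M N' \<Longrightarrow> (\<And>x. x \<in> carrier M \<Longrightarrow> f x = g x) \<Longrightarrow> f = g"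
  using extensionalityI lin_hom_ext by metis

lemma lin_hom_compose:
  assumes "f \<in> lin_hom R L M" "g \<in> lin_hom R M N" "left_module R L"
  shows "compose (carrier L) g f \<in> lin_hom R L N"
  unfolding compose_def by (rule lin_hom_restrictI)
     (use assms in "auto simp: lm_ag lin_hom_closed lin_hom_add lin_hom_smult")

lemma lin_hom_id: "left_module R M \<Longrightarrow> (\<lambda>x\<in>carrier M. x) \<in> lin_hom R M M" by (rule lin_hom_restrictI) (auto simp: lm_ag)

lemma lin_hom_zero: "left_module R M \<Longrightarrow> left_module R N \<Longrightarrow> (\<lambda>x\<in>carrier M. \<zero>\<^sub>N) \<in> lin_hom R M N"
  by (rule lin_hom_restrictI) (auto simp: lm_ag)

lemma lin_hom_plus:
  assumes "f \<in> lin_hom R M N" "g \<in> lin_hom R M N" "left_module R M" "left_module R N"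
  shows "(\<lambda>x\<in>carrier M. f x \<oplus>\<^sub>N g x) \<in> lin_hom R M N"
  by (rule lin_hom_restrictI) (use assms in "auto simp: lm_ag lin_hom_closed lin_hom_add lin_hom_smult ag_add4
        left_module.lm_r_distr")

lemma lin_hom_minus:
  assumes "f \<in> lin_hom R M N" "g \<in> lin_hom R M N" "left_module R M" "left_module R N"
  shows "(\<lambda>x\<in>carrier M. f x \<ominus>\<^sub>N g x) \<in> lin_hom R M N"
  by (rule lin_hom_restrictI) (use assms in "auto simp: lm_ag lin_hom_closed lin_hom_add lin_hom_smult ag_diff_add4
        lm_diff_r")

lemma compose_apply [simp]: "x \<in> S \<Longrightarrow> compose S g f x = g (f x)" by (simp add: compose_def)

lemma mk_module_simps [simp]: "carrier (mk_module C z p a) = C" "ring.zero (mk_module C z p a) = z"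
  "add (mk_module C z p a) = p" "smult (mk_module C z p a) = a" by (simp_all add: mk_module_def)

lemma regular_simps [simp]: "carrier (regular R) = carrier R" "ring.zero (regular R) = ring.zero R"
  "add (regular R) = add R" "smult (regular R) = monoid.mult R" by (simp_all add: regular_def)

lemma mk_bimodule_simps [simp]: "carrier (mk_bimodule M r) = carrier M" "ring.zero (mk_bimodule M r) = ring.zero M"
  "add (mk_bimodule M r) = add M" "smult (mk_bimodule M r) = smult M" "rsmult (mk_bimodule M r) = r"
  by (simp_all add: mk_bimodule_def module.extend_def)

lemma right_part_simps [simp]: "carrier (right_part M) = carrier M" "ring.zero (right_part M) = ring.zero M"
  "add (right_part M) = add M" "smult (right_part M) b m = rsmult M m b" by (simp_all add: right_part_def)

lemma regular_bimodule_simps [simp]: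
  "carrier (regular_bimodule R) = carrier R" "ring.zero (regular_bimodule R) = ring.zero R"
  "add (regular_bimodule R) = add R" "smult (regular_bimodule R) = monoid.mult R"
  "rsmult (regular_bimodule R) = monoid.mult R" by (simp_all add: regular_bimodule_def)

lemma opp_simps [simp]: "carrier (opp R) = carrier R" "ring.zero (opp R) = ring.zero R" "one (opp R) = one R"
  "add (opp R) = add R" "monoid.mult (opp R) x y = y \<otimes>\<^sub>R x" by (simp_all add: opp_def)

lemma restrict_scalars_simps [simp]:
  "carrier (restrict_scalars A M) = carrier M" "ring.zero (restrict_scalars A M) = ring.zero M"
  "add (restrict_scalars A M) = add M" "smult (restrict_scalars A M) c m = (c \<odot>\<^sub>A \<one>\<^sub>A) \<odot>\<^sub>M m"
  by (simp_all add: restrict_scalars_def)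

lemma free_module_simps [simp]: "carrier (free_module R n) = ({..<n} \<rightarrow>\<^sub>E carrier R)"
  "ring.zero (free_module R n) = (\<lambda>i\<in>{..<n}. \<zero>\<^sub>R)" "add (free_module R n) = (\<lambda>x y. \<lambda>i\<in>{..<n}. x i \<oplus>\<^sub>R y i)"
  "smult (free_module R n) = (\<lambda>a x. \<lambda>i\<in>{..<n}. a \<otimes>\<^sub>R x i)" by (simp_all add: free_module_def)

lemma ag_same:
  assumes "abelian_group G" "carrier H = carrier G" "add H = add G" "ring.zero H = ring.zero G"
  shows "abelian_group H"
  by (rule abelian_groupI) (use abelian_groupE[OF assms(1)] assms(2-4) in auto)

lemma left_module_regular: "ring R \<Longrightarrow> left_module R (regular R)"
proof -
  assume R: "ring R"
  interpret ring R by fact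
  have "abelian_group (regular R)" by (rule ag_same[of R]) (auto intro: ring_ag R)
  then show ?thesis by (intro left_moduleI) (auto simp: R l_distr r_distr m_assoc)
qed

lemma left_module_free_module:
  assumes R: "ring R" shows "left_module R (free_module R n)"
proof -
  interpret ring R by fact
  note fm = PiE_iff extensional_def fun_eq_iff
  have "abelian_group (free_module R n)"
  proof (rule abelian_groupI)
    fix x assume "x \<in> carrier (free_module R n)"
    then show "\<exists>y\<in>carrier (free_module R n). y \<oplus>\<^bsub>free_module R n\<^esub> x = \<zero>\<^bsub>free_module R n\<^esub>"
      by (intro bexI[of _ "\<lambda>i\<in>{..<n}. \<ominus>\<^sub>R x i"]) (auto simp: fm l_neg)
  qed (auto simp: fm a_ac)
  then show ?thesis by (rule left_moduleI[OF R]) (auto simp: fm l_distr r_distr m_assoc)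
qed

section \<open>Tensor products\<close>

text \<open>The condition on a map of pairs under which its extension to formal sums vanishes on
  \<open>tensor_rels\<close>, so that \<open>tensor_lift\<close> is well defined.\<close>

definition balanced :: "('r, 'v) ring_scheme \<Rightarrow> ('l, 'r, 'x, 'z) bimodule_scheme \<Rightarrow> ('r, 'y, 'w) module_scheme
     \<Rightarrow> ('g, 'q) ring_scheme \<Rightarrow> ('x \<times> 'y \<Rightarrow> 'g) \<Rightarrow> bool" where "balanced R X Y G \<phi> \<longleftrightarrow>
     (\<forall>x\<in>carrier X. (\<lambda>y. \<phi> (x, y)) \<in> addmap Y G) \<and> (\<forall>y\<in>carrier Y. (\<lambda>x. \<phi> (x, y)) \<in> addmap X G) \<and>
     (\<forall>x\<in>carrier X. \<forall>r\<in>carrier R. \<forall>y\<in>carrier Y. \<phi> (rsmult X x r, y) = \<phi> (x, r \<odot>\<^sub>Y y))"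

lemma balancedI:
  assumes "\<And>x y. x \<in> carrier X \<Longrightarrow> y \<in> carrier Y \<Longrightarrow> \<phi> (x, y) \<in> carrier G"
    "\<And>x y y'. x \<in> carrier X \<Longrightarrow> y \<in> carrier Y \<Longrightarrow> y' \<in> carrier Y \<Longrightarrow> \<phi> (x, y \<oplus>\<^sub>Y y') = \<phi> (x, y) \<oplus>\<^sub>G \<phi> (x, y')"
    "\<And>x x' y. x \<in> carrier X \<Longrightarrow> x' \<in> carrier X \<Longrightarrow> y \<in> carrier Y \<Longrightarrow> \<phi> (x \<oplus>\<^sub>X x', y) = \<phi> (x, y) \<oplus>\<^sub>G \<phi> (x', y)"
    "\<And>x r y. x \<in> carrier X \<Longrightarrow> r \<in> carrier R \<Longrightarrow> y \<in> carrier Y \<Longrightarrow> \<phi> (rsmult X x r, y) = \<phi> (x, r \<odot>\<^sub>Y y)"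
  shows "balanced R X Y G \<phi>"
  using assms by (auto simp: balanced_def addmap_def)

lemma tensor_simps [simp]: "carrier (tensor R X Y) = carrier (tensor_ab R X Y)"
  "ring.zero (tensor R X Y) = ring.zero (tensor_ab R X Y)" "add (tensor R X Y) = add (tensor_ab R X Y)"
  by (simp_all add: tensor_def Let_def)

lemma tensor_bimodule_simps [simp]: "carrier (tensor_bimodule R X Y) = carrier (tensor_ab R X Y)"
  "ring.zero (tensor_bimodule R X Y) = ring.zero (tensor_ab R X Y)" "add (tensor_bimodule R X Y) = add (tensor_ab R X Y)"
  "smult (tensor_bimodule R X Y) = smult (tensor R X Y)" by (simp_all add: tensor_bimodule_def)

section \<open>Extending a map of pairs to formal integer combinations\<close>

definition free_lift :: "('g, 'q) ring_scheme \<Rightarrow> ('p \<Rightarrow> 'g) \<Rightarrow> ('p \<Rightarrow>\<^sub>0 int) \<Rightarrow> 'g" where "free_lift G \<phi> c =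
     (\<Oplus>\<^sub>G p\<in>Poly_Mapping.keys c. add_pow G (Poly_Mapping.lookup c p) (\<phi> p))"

lemma tensor_lift_alt: "tensor_lift G \<phi> S = the_elem (free_lift G \<phi> ` S)" by (simp add: tensor_lift_def free_lift_def)

lemma ag_add_pow [simp]: "abelian_group G \<Longrightarrow> x \<in> carrier G \<Longrightarrow> add_pow G (k::int) x \<in> carrier G"
proof -
  assume "abelian_group G" "x \<in> carrier G"
  interpret abelian_group G by fact
  show ?thesis using \<open>x \<in> carrier G\<close> by (rule add.int_pow_closed)
qed

lemma add_pow_0: "add_pow G (0::int) x = \<zero>\<^sub>G" by (simp add: add_pow_def)

lemma ag_neg_zero: "abelian_group G \<Longrightarrow> \<ominus>\<^sub>G \<zero>\<^sub>G = \<zero>\<^sub>G" by (rule abelian_group.minus_equality) simp_all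

text \<open>Pairs outside the support have coefficient zero; formal sums with different supports can
  therefore be added over one common finite set.\<close>

lemma free_lift_superset:
  assumes G: "abelian_group G" and S: "finite S" "Poly_Mapping.keys c \<subseteq> S" and \<phi>: "\<And>p. p \<in> S \<Longrightarrow> \<phi> p \<in> carrier G"
  shows "free_lift G \<phi> c = (\<Oplus>\<^sub>G p\<in>S. add_pow G (Poly_Mapping.lookup c p) (\<phi> p))"
proof -
  interpret abelian_group G by fact
  show ?thesis unfolding free_lift_def using assms by (intro add.finprod_mono_neutral_cong_left)
      (auto simp: in_keys_iff add_pow_0)
qed

lemma free_lift_add:
  assumes G: "abelian_group G" and \<phi>: "\<And>p. p \<in> S \<Longrightarrow> \<phi> p \<in> carrier G"
    and c: "Poly_Mapping.keys c \<subseteq> S" and d: "Poly_Mapping.keys d \<subseteq> S"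
  shows "free_lift G \<phi> (c + d) = free_lift G \<phi> c \<oplus>\<^sub>G free_lift G \<phi> d"
proof -
  interpret abelian_group G by fact
  let ?T = "Poly_Mapping.keys c \<union> Poly_Mapping.keys d"
  have \<phi>': "\<And>p. p \<in> ?T \<Longrightarrow> \<phi> p \<in> carrier G" using \<phi> c d by auto
  have "free_lift G \<phi> (c + d) = (\<Oplus>\<^sub>G p\<in>?T. add_pow G (Poly_Mapping.lookup (c + d) p) (\<phi> p))"
    using \<phi>' Poly_Mapping.keys_add[of c d] by (intro free_lift_superset G) auto
  also have "\<dots> = (\<Oplus>\<^sub>G p\<in>?T. add_pow G (Poly_Mapping.lookup c p) (\<phi> p) \<oplus>\<^sub>G
      add_pow G (Poly_Mapping.lookup d p) (\<phi> p))" using G \<phi>' by (intro fs_cong) (auto simp: lookup_add add.int_pow_mult)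
  also have "\<dots> = (\<Oplus>\<^sub>G p\<in>?T. add_pow G (Poly_Mapping.lookup c p) (\<phi> p)) \<oplus>\<^sub>G
      (\<Oplus>\<^sub>G p\<in>?T. add_pow G (Poly_Mapping.lookup d p) (\<phi> p))" using G \<phi>' by (intro fs_add) auto
  also have "(\<Oplus>\<^sub>G p\<in>?T. add_pow G (Poly_Mapping.lookup c p) (\<phi> p)) = free_lift G \<phi> c"
    using \<phi>' by (intro free_lift_superset[symmetric] G) auto
  also have "(\<Oplus>\<^sub>G p\<in>?T. add_pow G (Poly_Mapping.lookup d p) (\<phi> p)) = free_lift G \<phi> d"
    using \<phi>' by (intro free_lift_superset[symmetric] G) auto
  finally show ?thesis .
qed

lemma free_lift_closed:
  assumes "abelian_group G" "\<And>p. p \<in> S \<Longrightarrow> \<phi> p \<in> carrier G" "Poly_Mapping.keys c \<subseteq> S"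
  shows "free_lift G \<phi> c \<in> carrier G"
  unfolding free_lift_def using assms by (intro fs_closed) auto

lemma free_lift_zero: "abelian_group G \<Longrightarrow> free_lift G \<phi> 0 = \<zero>\<^sub>G" by (simp add: free_lift_def)

lemma free_lift_frag_of:
  assumes "abelian_group G" "\<phi> p \<in> carrier G"
  shows "free_lift G \<phi> (frag_of p) = \<phi> p"
proof -
  interpret abelian_group G by fact
  show ?thesis unfolding free_lift_def keys_frag_of using assms by (simp add: fs_insert add.int_pow_1)
qed

lemma free_lift_diff:
  assumes G: "abelian_group G" and \<phi>: "\<And>p. p \<in> S \<Longrightarrow> \<phi> p \<in> carrier G"
    and c: "Poly_Mapping.keys c \<subseteq> S" and d: "Poly_Mapping.keys d \<subseteq> S"
  shows "free_lift G \<phi> (c - d) = free_lift G \<phi> c \<ominus>\<^sub>G free_lift G \<phi> d"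
proof -
  have k: "Poly_Mapping.keys (c - d) \<subseteq> S" using keys_diff[of c d] c d by auto
  have "free_lift G \<phi> ((c - d) + d) = free_lift G \<phi> (c - d) \<oplus>\<^sub>G free_lift G \<phi> d"
    using k by (intro free_lift_add[OF G]) (use \<phi> d in auto)
  then have "free_lift G \<phi> c = free_lift G \<phi> (c - d) \<oplus>\<^sub>G free_lift G \<phi> d" by simp
  then show ?thesis using G free_lift_closed[OF G \<phi> k] free_lift_closed[OF G \<phi> d] by simp
qed

text \<open>The closure properties that make the defining relations elements of the free abelian
  group on pairs; the module structures come with the locales that extend this one.\<close>

locale tensor_data =
  fixes R :: "('r, 'v) ring_scheme" and X :: "('l, 'r, 'x, 'z) bimodule_scheme" and Y :: "('r, 'y, 'w) module_scheme"
  assumes X_ag: "abelian_group X" and Y_ag: "abelian_group Y"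
    and X_rs: "x \<in> carrier X \<Longrightarrow> r \<in> carrier R \<Longrightarrow> rsmult X x r \<in> carrier X"
    and Y_ls: "r \<in> carrier R \<Longrightarrow> y \<in> carrier Y \<Longrightarrow> r \<odot>\<^sub>Y y \<in> carrier Y"
begin

definition rel_gens where "rel_gens = ({frag_of (x \<oplus>\<^sub>X x', y) - frag_of (x, y) - frag_of (x', y) | x x' y.
         x \<in> carrier X \<and> x' \<in> carrier X \<and> y \<in> carrier Y} \<union>
      {frag_of (x, y \<oplus>\<^sub>Y y') - frag_of (x, y) - frag_of (x, y') | x y y'.
         x \<in> carrier X \<and> y \<in> carrier Y \<and> y' \<in> carrier Y} \<union>
      {frag_of (rsmult X x r, y) - frag_of (x, r \<odot>\<^sub>Y y) | x r y.
         x \<in> carrier X \<and> r \<in> carrier R \<and> y \<in> carrier Y})"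

abbreviation (input) "PG \<equiv> pairs_group X Y"
abbreviation (input) "TR \<equiv> tensor_rels R X Y"

lemma PG_simps [simp]: "c \<in> carrier PG \<longleftrightarrow> Poly_Mapping.keys c \<subseteq> carrier X \<times> carrier Y" "c \<otimes>\<^sub>PG d = c + d" "\<one>\<^sub>PG = 0"
  "Poly_Mapping.keys c \<subseteq> carrier X \<times> carrier Y \<Longrightarrow> inv\<^bsub>PG\<^esub> c = - c" by (simp_all add: pairs_group_def)

lemma PG_comm_group: "comm_group PG" by (simp add: pairs_group_def abelian_free_Abelian_group)

lemma PG_group: "group PG" by (simp add: pairs_group_def)

lemma TR_eq: "TR = generate PG rel_gens" by (simp add: tensor_rels_def rel_gens_def)

lemma PG_diff: "a \<in> carrier PG \<Longrightarrow> b \<in> carrier PG \<Longrightarrow> a - b \<in> carrier PG" using keys_diff[of a b] by auto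

lemma PG_frag: "x \<in> carrier X \<Longrightarrow> y \<in> carrier Y \<Longrightarrow> frag_of (x, y) \<in> carrier PG" by (simp add: keys_frag_of)

lemma rel_gens_sub: "rel_gens \<subseteq> carrier PG" unfolding rel_gens_def
  by (auto simp only: X_ag Y_ag X_rs Y_ls ag_add intro!: PG_diff PG_frag)

lemma TR_subgroup: "subgroup TR PG" unfolding TR_eq by (rule group.generate_is_subgroup[OF PG_group rel_gens_sub])

lemma TR_normal: "normal TR PG" by (rule comm_group.subgroup_imp_normal[OF PG_comm_group TR_subgroup])

lemma TR_gen: "c \<in> rel_gens \<Longrightarrow> c \<in> TR" unfolding TR_eq by (rule generate.incl)

lemma ab_simps: "carrier (tensor_ab R X Y) = (\<lambda>c. TR #>\<^bsub>PG\<^esub> c) ` carrier PG" "ring.zero (tensor_ab R X Y) = TR"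
  "add (tensor_ab R X Y) = set_mult PG" by (simp_all add: tensor_ab_def Let_def carrier_FactGroup)

lemma ab_ag: "abelian_group (tensor_ab R X Y)"
proof -
  have "comm_group (PG Mod TR)" by (rule comm_group.abelian_FactGroup[OF PG_comm_group TR_subgroup])
  then interpret Q: comm_group "PG Mod TR" .
  have eq: "carrier (tensor_ab R X Y) = carrier (PG Mod TR)" "ring.zero (tensor_ab R X Y) = one (PG Mod TR)"
    "add (tensor_ab R X Y) = monoid.mult (PG Mod TR)" by (simp_all add: tensor_ab_def Let_def)
  show ?thesis by (rule abelian_groupI; unfold eq)
       (rule Q.m_closed Q.one_closed Q.m_assoc Q.m_comm Q.l_one Q.l_inv_ex; assumption?)+
qed

lemma T_ag [simp]: "abelian_group (tensor R X Y)" by (rule ag_same[OF ab_ag]) simp_all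

lemma coset_add: "c \<in> carrier PG \<Longrightarrow> d \<in> carrier PG \<Longrightarrow> (TR #>\<^bsub>PG\<^esub> c) \<oplus>\<^bsub>tensor R X Y\<^esub> (TR #>\<^bsub>PG\<^esub> d) = TR #>\<^bsub>PG\<^esub> (c + d)"
  using normal.rcos_sum[OF TR_normal, of c d] by (simp add: ab_simps)

lemma coset_eq:
  assumes "c \<in> carrier PG" "d \<in> carrier PG" "c - d \<in> TR"
  shows "TR #>\<^bsub>PG\<^esub> c = TR #>\<^bsub>PG\<^esub> d"
proof (rule group.repr_independence[OF PG_group, symmetric])
  show "c \<in> TR #>\<^bsub>PG\<^esub> d" using assms by (auto simp: r_coset_def intro!: bexI[of _ "c - d"])
qed (use assms TR_subgroup in auto)

lemma pure_closed [simp]: "x \<in> carrier X \<Longrightarrow> y \<in> carrier Y \<Longrightarrow> pure R X Y x y \<in> carrier (tensor_ab R X Y)"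
  using PG_frag by (auto simp: ab_simps pure_def)

lemma pure_add_l:
  assumes "x \<in> carrier X" "x' \<in> carrier X" "y \<in> carrier Y"
  shows "pure R X Y (x \<oplus>\<^sub>X x') y = pure R X Y x y \<oplus>\<^bsub>tensor R X Y\<^esub> pure R X Y x' y"
proof -
  have "TR #>\<^bsub>PG\<^esub> frag_of (x \<oplus>\<^sub>X x', y) = TR #>\<^bsub>PG\<^esub> (frag_of (x, y) + frag_of (x', y))"
  proof (rule coset_eq)
    have "frag_of (x \<oplus>\<^sub>X x', y) - (frag_of (x, y) + frag_of (x', y)) \<in> rel_gens"
      using assms unfolding rel_gens_def diff_diff_add[symmetric] by blast
    then show "frag_of (x \<oplus>\<^sub>X x', y) - (frag_of (x, y) + frag_of (x', y)) \<in> TR" by (rule TR_gen)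
  qed (use assms X_ag group.is_monoid[OF PG_group, THEN monoid.m_closed, of "frag_of (x, y)" "frag_of (x', y)"]
       in \<open>auto simp: keys_frag_of\<close>)
  then show ?thesis using coset_add[OF PG_frag PG_frag] assms by (simp add: pure_def)
qed

lemma pure_add_r:
  assumes "x \<in> carrier X" "y \<in> carrier Y" "y' \<in> carrier Y"
  shows "pure R X Y x (y \<oplus>\<^sub>Y y') = pure R X Y x y \<oplus>\<^bsub>tensor R X Y\<^esub> pure R X Y x y'"
proof -
  have "TR #>\<^bsub>PG\<^esub> frag_of (x, y \<oplus>\<^sub>Y y') = TR #>\<^bsub>PG\<^esub> (frag_of (x, y) + frag_of (x, y'))"
  proof (rule coset_eq)
    have "frag_of (x, y \<oplus>\<^sub>Y y') - (frag_of (x, y) + frag_of (x, y')) \<in> rel_gens"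
      using assms unfolding rel_gens_def diff_diff_add[symmetric] by blast
    then show "frag_of (x, y \<oplus>\<^sub>Y y') - (frag_of (x, y) + frag_of (x, y')) \<in> TR" by (rule TR_gen)
  qed (use assms Y_ag group.is_monoid[OF PG_group, THEN monoid.m_closed, of "frag_of (x, y)" "frag_of (x, y')"]
       in \<open>auto simp: keys_frag_of\<close>)
  then show ?thesis using coset_add[OF PG_frag PG_frag] assms by (simp add: pure_def)
qed

lemma pure_bal:
  assumes "x \<in> carrier X" "r \<in> carrier R" "y \<in> carrier Y"
  shows "pure R X Y (rsmult X x r) y = pure R X Y x (r \<odot>\<^sub>Y y)"
proof -
  have "TR #>\<^bsub>PG\<^esub> frag_of (rsmult X x r, y) = TR #>\<^bsub>PG\<^esub> frag_of (x, r \<odot>\<^sub>Y y)"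
  proof (rule coset_eq)
    have "frag_of (rsmult X x r, y) - frag_of (x, r \<odot>\<^sub>Y y) \<in> rel_gens" using assms unfolding rel_gens_def by blast
    then show "frag_of (rsmult X x r, y) - frag_of (x, r \<odot>\<^sub>Y y) \<in> TR" by (rule TR_gen)
  qed (use assms X_rs Y_ls in "auto simp: keys_frag_of")
  then show ?thesis by (simp add: pure_def)
qed

lemma pure_addmap_l: "y \<in> carrier Y \<Longrightarrow> (\<lambda>x. pure R X Y x y) \<in> addmap X (tensor R X Y)"
  by (rule addmapI) (auto simp: pure_add_l)

lemma pure_addmap_r: "x \<in> carrier X \<Longrightarrow> (\<lambda>y. pure R X Y x y) \<in> addmap Y (tensor R X Y)"
  by (rule addmapI) (auto simp: pure_add_r)

lemma pure_balanced: "balanced R X Y (tensor R X Y) (\<lambda>(x, y). pure R X Y x y)"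
  by (rule balancedI) (auto simp: pure_add_l pure_add_r pure_bal)

text \<open>Formal sums are built from differences, so the claim is carried along for a class and
  its negative together. Negatives need no case of their own in the rule, since -(x \<otimes> y) is
  the pure tensor of -x and y.\<close>

lemma tensor_induct [consumes 1, case_names pure add]:
  assumes q: "q \<in> carrier (tensor_ab R X Y)" and pure: "\<And>x y. x \<in> carrier X \<Longrightarrow> y \<in> carrier Y \<Longrightarrow> Q (pure R X Y x y)"
    and add: "\<And>a b. a \<in> carrier (tensor_ab R X Y) \<Longrightarrow> b \<in> carrier (tensor_ab R X Y) \<Longrightarrow> Q a \<Longrightarrow> Q b \<Longrightarrow>
      Q (a \<oplus>\<^bsub>tensor_ab R X Y\<^esub> b)"
  shows "Q q"
proof -
  interpret T: abelian_group "tensor R X Y" by simp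
  have negpure: "pure R X Y (\<ominus>\<^sub>X x) y = \<ominus>\<^bsub>tensor R X Y\<^esub> pure R X Y x y" if "x \<in> carrier X" "y \<in> carrier Y" for x y
    using addmap_neg[OF X_ag T_ag pure_addmap_l] that by simp
  obtain c where c: "Poly_Mapping.keys c \<subseteq> carrier X \<times> carrier Y" and qc: "q = TR #>\<^bsub>PG\<^esub> c" using q by (auto simp: ab_simps)
  have "c \<in> carrier PG \<and> Q (TR #>\<^bsub>PG\<^esub> c) \<and> Q (\<ominus>\<^bsub>tensor R X Y\<^esub> (TR #>\<^bsub>PG\<^esub> c))" using c
  proof (induction c rule: frag_induction)
    case zero
    have "TR #>\<^bsub>PG\<^esub> 0 = \<zero>\<^bsub>tensor R X Y\<^esub>"
      using group.coset_join2[OF PG_group _ TR_subgroup, of 0] subgroup.one_closed[OF TR_subgroup] by (simp add: ab_simps)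
    moreover have "Q \<zero>\<^bsub>tensor R X Y\<^esub>"
    proof -
      have z: "\<zero>\<^sub>X \<in> carrier X" "\<zero>\<^sub>Y \<in> carrier Y" using X_ag Y_ag by simp_all
      have "pure R X Y \<zero>\<^sub>X \<zero>\<^sub>Y = \<zero>\<^bsub>tensor R X Y\<^esub>" using addmap_zero[OF X_ag T_ag pure_addmap_l] z by simp
      then show ?thesis using pure[OF z] by simp
    qed
    ultimately show ?case using ag_neg_zero[OF T_ag] by simp
  next
    case (one p)
    obtain x y where p: "p = (x, y)" "x \<in> carrier X" "y \<in> carrier Y" using one by auto
    have "Q (pure R X Y x y)" "Q (pure R X Y (\<ominus>\<^sub>X x) y)" using p X_ag by (auto intro!: pure)
    then show ?case using p PG_frag by (simp add: negpure) (simp add: pure_def keys_frag_of)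
  next
    case (diff a b)
    have ca: "TR #>\<^bsub>PG\<^esub> a \<in> carrier (tensor_ab R X Y)" and cb: "TR #>\<^bsub>PG\<^esub> b \<in> carrier (tensor_ab R X Y)"
      using diff by (auto simp: ab_simps)
    have cab: "TR #>\<^bsub>PG\<^esub> (a - b) \<in> carrier (tensor_ab R X Y)" using diff PG_diff by (auto simp: ab_simps)
    have "(TR #>\<^bsub>PG\<^esub> (a - b)) \<oplus>\<^bsub>tensor R X Y\<^esub> (TR #>\<^bsub>PG\<^esub> b) = TR #>\<^bsub>PG\<^esub> a"
      using coset_add[of "a - b" b] PG_diff[of a b] diff by simp
    then have "TR #>\<^bsub>PG\<^esub> (a - b) = (TR #>\<^bsub>PG\<^esub> a) \<ominus>\<^bsub>tensor R X Y\<^esub> (TR #>\<^bsub>PG\<^esub> b)"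
      using ag_add_diff_cancel[OF T_ag] cab cb by (metis tensor_simps(1))
    then have eq: "TR #>\<^bsub>PG\<^esub> (a - b) = (TR #>\<^bsub>PG\<^esub> a) \<oplus>\<^bsub>tensor R X Y\<^esub> \<ominus>\<^bsub>tensor R X Y\<^esub> (TR #>\<^bsub>PG\<^esub> b)"
      and eq': "\<ominus>\<^bsub>tensor R X Y\<^esub> (TR #>\<^bsub>PG\<^esub> (a - b)) = (TR #>\<^bsub>PG\<^esub> b) \<oplus>\<^bsub>tensor R X Y\<^esub> \<ominus>\<^bsub>tensor R X Y\<^esub> (TR #>\<^bsub>PG\<^esub> a)"
      using ag_neg_diff[OF T_ag] ca cb by (simp_all add: a_minus_def)
    have negs: "\<ominus>\<^bsub>tensor R X Y\<^esub> (TR #>\<^bsub>PG\<^esub> a) \<in> carrier (tensor_ab R X Y)"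
      "\<ominus>\<^bsub>tensor R X Y\<^esub> (TR #>\<^bsub>PG\<^esub> b) \<in> carrier (tensor_ab R X Y)" using T.a_inv_closed ca cb by simp_all
    have "Q (TR #>\<^bsub>PG\<^esub> (a - b))" unfolding eq tensor_simps(3) by (rule add) (use diff ca cb negs in auto)
    moreover have "Q (\<ominus>\<^bsub>tensor R X Y\<^esub> (TR #>\<^bsub>PG\<^esub> (a - b)))" unfolding eq' tensor_simps(3)
      by (rule add) (use diff ca cb negs in auto)
    ultimately show ?case using PG_diff[of a b] diff by simp
  qed
  then show ?thesis using qc by simp
qed

section \<open>The universal property of the tensor product\<close>

context
  fixes G :: "('g, 'q) ring_scheme" and \<phi> :: "'x \<times> 'y \<Rightarrow> 'g"
  assumes G: "abelian_group G" and bal: "balanced R X Y G \<phi>"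
begin

lemma bal_closed: "p \<in> carrier X \<times> carrier Y \<Longrightarrow> \<phi> p \<in> carrier G" using bal by (auto simp: balanced_def dest!: addmap_closed)

lemma fl_closed: "Poly_Mapping.keys c \<subseteq> carrier X \<times> carrier Y \<Longrightarrow> free_lift G \<phi> c \<in> carrier G"
  by (rule free_lift_closed[OF G]) (use bal_closed in auto)

lemma fl_add:
  assumes "Poly_Mapping.keys c \<subseteq> carrier X \<times> carrier Y" "Poly_Mapping.keys d \<subseteq> carrier X \<times> carrier Y"
  shows "free_lift G \<phi> (c + d) = free_lift G \<phi> c \<oplus>\<^sub>G free_lift G \<phi> d"
  by (rule free_lift_add[OF G _ assms]) (use bal_closed in auto)

lemma fl_diff:
  assumes "Poly_Mapping.keys c \<subseteq> carrier X \<times> carrier Y" "Poly_Mapping.keys d \<subseteq> carrier X \<times> carrier Y"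
  shows "free_lift G \<phi> (c - d) = free_lift G \<phi> c \<ominus>\<^sub>G free_lift G \<phi> d"
  by (rule free_lift_diff[OF G _ assms]) (use bal_closed in auto)

lemma fl_frag: "p \<in> carrier X \<times> carrier Y \<Longrightarrow> free_lift G \<phi> (frag_of p) = \<phi> p"
  by (rule free_lift_frag_of[where \<phi> = \<phi>, OF G]) (use bal_closed in auto)

text \<open>The formal sums sent to zero form a subgroup, and balancedness says that it contains the
  generating relations.\<close>

lemma free_lift_rels:
  assumes "c \<in> TR" shows "Poly_Mapping.keys c \<subseteq> carrier X \<times> carrier Y \<and> free_lift G \<phi> c = \<zero>\<^sub>G"
proof -
  let ?S = "carrier X \<times> carrier Y"
  interpret G: abelian_group G by (rule G)
  let ?N = "{c \<in> carrier PG. free_lift G \<phi> c = \<zero>\<^sub>G}"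
  have "subgroup ?N PG"
  proof
    fix c d assume "c \<in> ?N" "d \<in> ?N"
    then show "c \<otimes>\<^sub>PG d \<in> ?N" using fl_add[of c d] G
        group.is_monoid[OF PG_group, THEN monoid.m_closed, of c d] by simp
  next
    fix c assume c: "c \<in> ?N"
    then have "- c = 0 - c" by simp
    then show "inv\<^bsub>PG\<^esub> c \<in> ?N" using c
      fl_diff[of 0 c] fl_closed[of c] G by (simp add: free_lift_zero)
  qed (use G in "auto simp: free_lift_zero")
  moreover have "rel_gens \<subseteq> ?N"
  proof
    fix c assume "c \<in> rel_gens"
    then have cc: "c \<in> carrier PG" using rel_gens_sub by blast
    have k: "x \<in> carrier X \<Longrightarrow> y \<in> carrier Y \<Longrightarrow> Poly_Mapping.keys (frag_of (x, y)) \<subseteq> ?S" for x y by (simp add: keys_frag_of)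
    have k3: "free_lift G \<phi> (frag_of p - frag_of q - frag_of r) = \<phi> p \<ominus>\<^sub>G \<phi> q \<ominus>\<^sub>G \<phi> r" if "p \<in> ?S" "q \<in> ?S" "r \<in> ?S" for p q r
    proof -
      have kk: "Poly_Mapping.keys (frag_of p - frag_of q) \<subseteq> ?S"
        using keys_diff[of "frag_of p" "frag_of q"] that by (auto simp: keys_frag_of)
      show ?thesis using fl_diff[OF kk, of "frag_of r"] fl_diff[of "frag_of p" "frag_of q"] that
        by (simp add: keys_frag_of fl_frag)
    qed
    have k2: "free_lift G \<phi> (frag_of p - frag_of q) = \<phi> p \<ominus>\<^sub>G \<phi> q" if "p \<in> ?S" "q \<in> ?S" for p q
      using fl_diff[of "frag_of p" "frag_of q"] that by (simp add: keys_frag_of fl_frag)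
    have canc: "a \<in> carrier G \<Longrightarrow> b \<in> carrier G \<Longrightarrow> a \<oplus>\<^sub>G b \<ominus>\<^sub>G a \<ominus>\<^sub>G b = \<zero>\<^sub>G" for a b
      using ag_add_diff_cancel[OF G, of b a] by (simp add: G.a_comm[of a b] G)
    have badd: "\<phi> (x \<oplus>\<^sub>X x', y) = \<phi> (x, y) \<oplus>\<^sub>G \<phi> (x', y)" if "x \<in> carrier X" "x' \<in> carrier X" "y \<in> carrier Y" for x x' y
      using that bal addmap_add[of "\<lambda>x. \<phi> (x, y)" X G x x'] by (simp add: balanced_def)
    have badd': "\<phi> (x, y \<oplus>\<^sub>Y y') = \<phi> (x, y) \<oplus>\<^sub>G \<phi> (x, y')" if "x \<in> carrier X" "y \<in> carrier Y" "y' \<in> carrier Y" for x y y'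
      using that bal addmap_add[of "\<lambda>y. \<phi> (x, y)" Y G y y'] by (simp add: balanced_def)
    have bbal: "\<phi> (rsmult X x r, y) = \<phi> (x, r \<odot>\<^sub>Y y)" if "x \<in> carrier X" "r \<in> carrier R" "y \<in> carrier Y" for x r y
      using that bal by (simp add: balanced_def)
    have "free_lift G \<phi> c = \<zero>\<^sub>G" using \<open>c \<in> rel_gens\<close> bal_closed unfolding rel_gens_def
      by (auto simp: k3 k2 G X_ag Y_ag X_rs Y_ls badd badd' bbal canc)
    then show "c \<in> ?N" using cc by simp
  qed
  ultimately have "TR \<subseteq> ?N" unfolding TR_eq by (intro group.generate_subgroup_incl[OF PG_group])
  then show ?thesis using assms by auto
qed

text \<open>Elements of one coset differ by relations, so the set under \<open>the_elem\<close> is a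
  singleton.\<close>

lemma lift_coset:
  assumes c: "c \<in> carrier PG"
  shows "tensor_lift G \<phi> (TR #>\<^bsub>PG\<^esub> c) = free_lift G \<phi> c"
proof -
  have "free_lift G \<phi> ` (TR #>\<^bsub>PG\<^esub> c) = {free_lift G \<phi> c}"
  proof (intro equalityI subsetI)
    fix g assume "g \<in> free_lift G \<phi> ` (TR #>\<^bsub>PG\<^esub> c)"
    then obtain h where h: "h \<in> TR" "g = free_lift G \<phi> (h + c)" by (auto simp: r_coset_def)
    then show "g \<in> {free_lift G \<phi> c}" using free_lift_rels[OF h(1)] fl_add[of h c] c fl_closed[of c] G by simp
  next
    fix g assume "g \<in> {free_lift G \<phi> c}"
    then show "g \<in> free_lift G \<phi> ` (TR #>\<^bsub>PG\<^esub> c)" using group.rcos_self[OF PG_group c TR_subgroup] by auto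
  qed
  then show ?thesis by (simp add: tensor_lift_alt)
qed

lemma lift_addmap: "tensor_lift G \<phi> \<in> addmap (tensor R X Y) G"
proof (rule addmapI)
  fix q assume "q \<in> carrier (tensor R X Y)"
  then obtain c where "c \<in> carrier PG" "q = TR #>\<^bsub>PG\<^esub> c" by (auto simp: ab_simps)
  then show "tensor_lift G \<phi> q \<in> carrier G" using fl_closed[of c] lift_coset by simp
next
  fix q r assume "q \<in> carrier (tensor R X Y)" "r \<in> carrier (tensor R X Y)"
  then obtain c d where "c \<in> carrier PG" "q = TR #>\<^bsub>PG\<^esub> c" "d \<in> carrier PG" "r = TR #>\<^bsub>PG\<^esub> d" by (auto simp: ab_simps)
  then show "tensor_lift G \<phi> (q \<oplus>\<^bsub>tensor R X Y\<^esub> r) = tensor_lift G \<phi> q \<oplus>\<^sub>G tensor_lift G \<phi> r"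
    using fl_add[of c d] coset_add[of c d]
      group.is_monoid[OF PG_group, THEN monoid.m_closed, of c d] by (simp add: lift_coset del: tensor_simps)
qed

lemma lift_pure: "x \<in> carrier X \<Longrightarrow> y \<in> carrier Y \<Longrightarrow> tensor_lift G \<phi> (pure R X Y x y) = \<phi> (x, y)"
  using lift_coset[OF PG_frag] fl_frag by (simp add: pure_def)

end

text \<open>The uniqueness half of the universal property; through it, identities between maps out
  of tensor products are reduced to pure tensors.\<close>

lemma tensor_ext:
  assumes "f \<in> addmap (tensor R X Y) G" "g \<in> addmap (tensor R X Y) G"
    and "\<And>x y. x \<in> carrier X \<Longrightarrow> y \<in> carrier Y \<Longrightarrow> f (pure R X Y x y) = g (pure R X Y x y)" and "q \<in> carrier (tensor_ab R X Y)"
  shows "f q = g q"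
  using assms(4)
proof (induction q rule: tensor_induct)
  case (pure x y) then show ?case using assms(3) by simp
next
  case (add a b)
  then show ?case using addmap_add[OF assms(1), of a b] addmap_add[OF assms(2), of a b] by simp
qed

end

section \<open>Module structures and maps on tensor products\<close>

locale tensor_left = tensor_data R X Y for R :: "('r, 'v) ring_scheme" and X :: "('l, 'r, 'x, 'z) bimodule_scheme"
    and Y :: "('r, 'y, 'w) module_scheme" +
  fixes L :: "('l, 'u) ring_scheme"
  assumes X_lm: "left_module L X" and X_lr: "a \<in> carrier L \<Longrightarrow> x \<in> carrier X \<Longrightarrow> r \<in> carrier R \<Longrightarrow>
      rsmult X (a \<odot>\<^sub>X x) r = a \<odot>\<^sub>X rsmult X x r"
begin

lemma smult_balanced: "a \<in> carrier L \<Longrightarrow> balanced R X Y (tensor_ab R X Y) (\<lambda>(x, y). pure R X Y (a \<odot>\<^sub>X x) y)"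
  using X_lm by (intro balancedI) (auto simp: pure_add_l[simplified] pure_add_r[simplified]
      left_module.lm_r_distr X_lr[symmetric] X_rs pure_bal)

lemma smult_addmap: "a \<in> carrier L \<Longrightarrow> (\<lambda>q. a \<odot>\<^bsub>tensor R X Y\<^esub> q) \<in> addmap (tensor R X Y) (tensor R X Y)"
  using lift_addmap[OF ab_ag smult_balanced] by (simp add: tensor_def Let_def addmap_def)

lemma smult_pure: "a \<in> carrier L \<Longrightarrow> x \<in> carrier X \<Longrightarrow> y \<in> carrier Y \<Longrightarrow>
    a \<odot>\<^bsub>tensor R X Y\<^esub> pure R X Y x y = pure R X Y (a \<odot>\<^sub>X x) y"
  using lift_pure[OF ab_ag smult_balanced] by (simp add: tensor_def Let_def)

lemma T_left_module: "left_module L (tensor R X Y)"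
proof (rule left_moduleI)
  show "ring L" using X_lm by (rule lm_ring)
  then have rg: "abelian_group L" by (rule ring_ag)
  show "abelian_group (tensor R X Y)" by simp
  fix a x assume a: "a \<in> carrier L" and "x \<in> carrier (tensor R X Y)"
  then show "a \<odot>\<^bsub>tensor R X Y\<^esub> x \<in> carrier (tensor R X Y)" using addmap_closed[OF smult_addmap] by blast
  fix y assume "y \<in> carrier (tensor R X Y)"
  then show "a \<odot>\<^bsub>tensor R X Y\<^esub> (x \<oplus>\<^bsub>tensor R X Y\<^esub> y) =
      a \<odot>\<^bsub>tensor R X Y\<^esub> x \<oplus>\<^bsub>tensor R X Y\<^esub> a \<odot>\<^bsub>tensor R X Y\<^esub> y" using addmap_add[OF smult_addmap] a \<open>x \<in> _\<close> by blast
next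
  fix a b q assume a: "a \<in> carrier L" and b: "b \<in> carrier L" and q: "q \<in> carrier (tensor R X Y)"
  interpret L: ring L using X_lm by (rule lm_ring)
  show "(a \<oplus>\<^sub>L b) \<odot>\<^bsub>tensor R X Y\<^esub> q = a \<odot>\<^bsub>tensor R X Y\<^esub> q \<oplus>\<^bsub>tensor R X Y\<^esub> b \<odot>\<^bsub>tensor R X Y\<^esub> q"
    by (rule tensor_ext[of "\<lambda>q. (a \<oplus>\<^sub>L b) \<odot>\<^bsub>tensor R X Y\<^esub> q" "tensor R X Y"
          "\<lambda>q. a \<odot>\<^bsub>tensor R X Y\<^esub> q \<oplus>\<^bsub>tensor R X Y\<^esub> b \<odot>\<^bsub>tensor R X Y\<^esub> q"])
       (use a b q X_lm in "auto intro!: smult_addmap addmap_sum2 simp del: tensor_simps(3)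
          simp: smult_pure left_module.lm_l_distr pure_add_l")
  show "(a \<otimes>\<^sub>L b) \<odot>\<^bsub>tensor R X Y\<^esub> q = a \<odot>\<^bsub>tensor R X Y\<^esub> (b \<odot>\<^bsub>tensor R X Y\<^esub> q)"
    by (rule tensor_ext[of "\<lambda>q. (a \<otimes>\<^sub>L b) \<odot>\<^bsub>tensor R X Y\<^esub> q" "tensor R X Y" "\<lambda>q. a \<odot>\<^bsub>tensor R X Y\<^esub> (b \<odot>\<^bsub>tensor R X Y\<^esub> q)"])
       (use a b q X_lm in "auto intro!: smult_addmap addmap_comp[OF smult_addmap[of b] smult_addmap[of a]]
          simp: smult_pure left_module.lm_assoc")
next
  fix q assume q: "q \<in> carrier (tensor R X Y)"
  interpret L: ring L using X_lm by (rule lm_ring)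
  show "\<one>\<^sub>L \<odot>\<^bsub>tensor R X Y\<^esub> q = q" by (rule tensor_ext[of "\<lambda>q. \<one>\<^sub>L \<odot>\<^bsub>tensor R X Y\<^esub> q" "tensor R X Y" "\<lambda>q. q"])
       (use q X_lm in "auto intro!: smult_addmap addmapI simp: ab_ag
          smult_pure left_module.lm_one")
qed

end

locale tensor_right = tensor_data R X Y for R :: "('r, 'v) ring_scheme" and X :: "('l, 'r, 'x, 'z) bimodule_scheme"
    and Y :: "('r, 'q, 'y, 'w) bimodule_scheme" +
  fixes Q :: "('q, 'u) ring_scheme"
  assumes Y_rag: "b \<in> carrier Q \<Longrightarrow> (\<lambda>y. rsmult Y y b) \<in> addmap Y Y"
    and Y_lr: "b \<in> carrier Q \<Longrightarrow> r \<in> carrier R \<Longrightarrow> y \<in> carrier Y \<Longrightarrow>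
      rsmult Y (r \<odot>\<^sub>Y y) b = r \<odot>\<^sub>Y rsmult Y y b"
begin

lemma rsmult_balanced: "b \<in> carrier Q \<Longrightarrow> balanced R X Y (tensor R X Y) (\<lambda>(x, y). pure R X Y x (rsmult Y y b))"
  using addmap_closed[OF Y_rag] addmap_add[OF Y_rag]
  by (intro balancedI) (auto simp: pure_add_l[simplified] pure_add_r[simplified] pure_bal Y_lr)

lemma rsmult_addmap: "b \<in> carrier Q \<Longrightarrow> (\<lambda>q. rsmult (tensor_bimodule R X Y) q b) \<in> addmap (tensor R X Y) (tensor R X Y)"
  using lift_addmap[OF T_ag rsmult_balanced] by (simp add: tensor_bimodule_def)

lemma rsmult_pure: "b \<in> carrier Q \<Longrightarrow> x \<in> carrier X \<Longrightarrow> y \<in> carrier Y \<Longrightarrow>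
    rsmult (tensor_bimodule R X Y) (pure R X Y x y) b = pure R X Y x (rsmult Y y b)"
  using lift_pure[OF T_ag rsmult_balanced] by (simp add: tensor_bimodule_def)

end

locale tensor_maps = T1: tensor_data R X Y + T2: tensor_data R X' Y'
  for R :: "('r, 'v) ring_scheme" and X :: "('l, 'r, 'x, 'z) bimodule_scheme"
    and Y :: "('r, 'y, 'w) module_scheme" and X' :: "('l2, 'r, 'x2, 'z2) bimodule_scheme"
    and Y' :: "('r, 'y2, 'w2) module_scheme" +
  fixes f g
  assumes f: "f \<in> addmap X X'" and g: "g \<in> addmap Y Y'"
    and f_r: "x \<in> carrier X \<Longrightarrow> r \<in> carrier R \<Longrightarrow> f (rsmult X x r) = rsmult X' (f x) r"
    and g_r: "y \<in> carrier Y \<Longrightarrow> r \<in> carrier R \<Longrightarrow> g (r \<odot>\<^sub>Y y) = r \<odot>\<^sub>Y' g y"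
begin

lemma tmap_balanced: "balanced R X Y (tensor R X' Y') (\<lambda>(x, y). pure R X' Y' (f x) (g y))" by (intro balancedI)
     (auto simp: addmap_closed[OF f] addmap_closed[OF g] addmap_add[OF f] addmap_add[OF g]
       f_r g_r T2.pure_add_l[simplified] T2.pure_add_r[simplified] T2.pure_bal)

lemma tmap_addmap: "tensor_map R X Y X' Y' f g \<in> addmap (tensor R X Y) (tensor R X' Y')"
  using T2.T_ag T1.lift_addmap[OF T2.T_ag tmap_balanced] ag_add[OF T1.T_ag] unfolding tensor_map_def addmap_def by auto

lemma tmap_pure: "x \<in> carrier X \<Longrightarrow> y \<in> carrier Y \<Longrightarrow>
    tensor_map R X Y X' Y' f g (pure R X Y x y) = pure R X' Y' (f x) (g y)"
  using T1.lift_pure[OF T2.T_ag tmap_balanced] by (simp add: tensor_map_def)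

end

section \<open>Linear maps, frames and maps of finite rank\<close>

text \<open>Non-extensional counterpart of \<open>lin_hom\<close>, in the same spirit as
  \<open>addmap\<close>; \<open>linmap_restrict\<close> and \<open>lin_hom_linmap\<close> translate
  between the two.\<close>

definition linmap :: "('r, 'y) ring_scheme \<Rightarrow> ('r, 'm, 'z) module_scheme \<Rightarrow> ('r, 'n, 'w) module_scheme \<Rightarrow> ('m \<Rightarrow> 'n) set" where
  "linmap R M N = {f \<in> addmap M N. \<forall>a\<in>carrier R. \<forall>x\<in>carrier M. f (a \<odot>\<^sub>M x) = a \<odot>\<^sub>N f x}"

lemma linmapI:
  assumes "\<And>x. x \<in> carrier M \<Longrightarrow> f x \<in> carrier N" "\<And>x y. x \<in> carrier M \<Longrightarrow> y \<in> carrier M \<Longrightarrow> f (x \<oplus>\<^sub>M y) = f x \<oplus>\<^sub>N f y"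
    "\<And>a x. a \<in> carrier R \<Longrightarrow> x \<in> carrier M \<Longrightarrow> f (a \<odot>\<^sub>M x) = a \<odot>\<^sub>N f x"
  shows "f \<in> linmap R M N"
  using assms unfolding linmap_def addmap_def by blast

lemma linmap_addmap: "f \<in> linmap R M N \<Longrightarrow> f \<in> addmap M N" by (simp add: linmap_def)

lemma linmap_closed: "f \<in> linmap R M N \<Longrightarrow> x \<in> carrier M \<Longrightarrow> f x \<in> carrier N" by (rule addmap_closed[OF linmap_addmap])

lemma linmap_add: "f \<in> linmap R M N \<Longrightarrow> x \<in> carrier M \<Longrightarrow> y \<in> carrier M \<Longrightarrow> f (x \<oplus>\<^sub>M y) = f x \<oplus>\<^sub>N f y"
  by (rule addmap_add[OF linmap_addmap])

lemma linmap_smult: "f \<in> linmap R M N \<Longrightarrow> a \<in> carrier R \<Longrightarrow> x \<in> carrier M \<Longrightarrow> f (a \<odot>\<^sub>M x) = a \<odot>\<^sub>N f x" by (simp add: linmap_def)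

lemma lin_hom_linmap: "f \<in> lin_hom R M N \<Longrightarrow> f \<in> linmap R M N" unfolding lin_hom_def linmap_def addmap_def by blast

lemma linmap_restrict:
  assumes "left_module R M" "f \<in> linmap R M N"
  shows "(\<lambda>x\<in>carrier M. f x) \<in> lin_hom R M N"
  by (rule lin_hom_restrictI) (use assms in "auto intro: lm_ag linmap_closed linmap_add linmap_smult")

lemma linmap_comp: "f \<in> linmap R M N \<Longrightarrow> g \<in> linmap R N L \<Longrightarrow> (\<lambda>x. g (f x)) \<in> linmap R M L"
  by (rule linmapI) (auto simp: linmap_add linmap_smult linmap_closed)

lemma linmap_smult_elt:
  assumes "left_module R U" "left_module R V" "g \<in> linmap R U (regular R)" "v \<in> carrier V"
  shows "(\<lambda>x. g x \<odot>\<^sub>V v) \<in> linmap R U V"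
proof (rule linmapI)
  note cl = linmap_closed[OF assms(3), simplified]
  fix x assume x: "x \<in> carrier U"
  show "g x \<odot>\<^sub>V v \<in> carrier V" using cl[OF x] assms by simp
  fix y assume y: "y \<in> carrier U"
  show "g (x \<oplus>\<^sub>U y) \<odot>\<^sub>V v = g x \<odot>\<^sub>V v \<oplus>\<^sub>V g y \<odot>\<^sub>V v"
    using cl[OF x] cl[OF y] assms linmap_add[OF assms(3) x y] left_module.lm_l_distr[OF assms(2)] by simp
next
  note cl = linmap_closed[OF assms(3), simplified]
  fix a x assume a: "a \<in> carrier R" and x: "x \<in> carrier U"
  show "g (a \<odot>\<^sub>U x) \<odot>\<^sub>V v = a \<odot>\<^sub>V (g x \<odot>\<^sub>V v)"
    using cl[OF x] assms linmap_smult[OF assms(3) a x] left_module.lm_assoc[OF assms(2)] a by simp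
qed

lemma linmap_plus:
  assumes "left_module R N" "f \<in> linmap R M N" "g \<in> linmap R M N"
  shows "(\<lambda>x. f x \<oplus>\<^sub>N g x) \<in> linmap R M N"
proof (rule linmapI)
  note cl = linmap_closed[OF assms(2)] linmap_closed[OF assms(3)]
  have ag: "abelian_group N" by (rule lm_ag[OF assms(1)])
  fix x assume x: "x \<in> carrier M"
  show "f x \<oplus>\<^sub>N g x \<in> carrier N" using cl x ag by simp
  fix y assume y: "y \<in> carrier M"
  show "f (x \<oplus>\<^sub>M y) \<oplus>\<^sub>N g (x \<oplus>\<^sub>M y) = f x \<oplus>\<^sub>N g x \<oplus>\<^sub>N (f y \<oplus>\<^sub>N g y)"
    using cl x y ag by (simp add: linmap_add[OF assms(2)] linmap_add[OF assms(3)] ag_add4)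
next
  note cl = linmap_closed[OF assms(2)] linmap_closed[OF assms(3)]
  fix a x assume a: "a \<in> carrier R" and x: "x \<in> carrier M"
  show "f (a \<odot>\<^sub>M x) \<oplus>\<^sub>N g (a \<odot>\<^sub>M x) = a \<odot>\<^sub>N (f x \<oplus>\<^sub>N g x)" using cl x a linmap_smult[OF assms(2)] linmap_smult[OF assms(3)]
      left_module.lm_r_distr[OF assms(1)] by simp
qed

lemma linmap_sum:
  assumes "left_module R N" "finite I" "\<And>i. i \<in> I \<Longrightarrow> f i \<in> linmap R M N"
  shows "(\<lambda>x. finsum N (\<lambda>i. f i x) I) \<in> linmap R M N"
proof (rule linmapI)
  have ag: "abelian_group N" by (rule lm_ag[OF assms(1)])
  fix x assume x: "x \<in> carrier M"
  show "finsum N (\<lambda>i. f i x) I \<in> carrier N" using ag linmap_closed[OF assms(3)] x by simp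
  fix y assume y: "y \<in> carrier M"
  show "finsum N (\<lambda>i. f i (x \<oplus>\<^sub>M y)) I = finsum N (\<lambda>i. f i x) I \<oplus>\<^sub>N finsum N (\<lambda>i. f i y) I"
    using ag x y linmap_closed[OF assms(3)]
    by (subst fs_add[symmetric]) (auto intro!: fs_cong simp: linmap_add[OF assms(3)])
next
  have ag: "abelian_group N" by (rule lm_ag[OF assms(1)])
  fix a x assume a: "a \<in> carrier R" and x: "x \<in> carrier M"
  show "finsum N (\<lambda>i. f i (a \<odot>\<^sub>M x)) I = a \<odot>\<^sub>N finsum N (\<lambda>i. f i x) I" using ag a x linmap_closed[OF assms(3)]
    by (subst lm_fs_r[OF assms(1)]) (auto intro!: fs_cong simp: linmap_smult[OF assms(3)] lm_smult[OF assms(1)])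
qed

text \<open>The pairs of families in the dual basis lemma: a module has a frame exactly when it is
  finitely generated projective. Arguments with projective modules run through frames, because sums
  over a frame are easy to push through additive maps.\<close>

definition frame :: "('r, 'y) ring_scheme \<Rightarrow> ('r, 'm, 'z) module_scheme \<Rightarrow> 'i set \<Rightarrow> ('i \<Rightarrow> 'm) \<Rightarrow> ('i \<Rightarrow> 'm \<Rightarrow> 'r) \<Rightarrow> bool" where
  "frame R P I p \<phi> \<longleftrightarrow> finite I \<and> (\<forall>i\<in>I. p i \<in> carrier P) \<and> (\<forall>i\<in>I. \<phi> i \<in> linmap R P (regular R)) \<and>
     (\<forall>x\<in>carrier P. (\<Oplus>\<^sub>P i\<in>I. \<phi> i x \<odot>\<^sub>P p i) = x)"

lemma frame_finite: "frame R P I p \<phi> \<Longrightarrow> finite I" and frame_elt: "frame R P I p \<phi> \<Longrightarrow> i \<in> I \<Longrightarrow> p i \<in> carrier P"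
  and frame_fun: "frame R P I p \<phi> \<Longrightarrow> i \<in> I \<Longrightarrow> \<phi> i \<in> linmap R P (regular R)"
  and frame_sum: "frame R P I p \<phi> \<Longrightarrow> x \<in> carrier P \<Longrightarrow> (\<Oplus>\<^sub>P i\<in>I. \<phi> i x \<odot>\<^sub>P p i) = x" by (auto simp: frame_def)

lemma frame_coeff: "frame R P I p \<phi> \<Longrightarrow> i \<in> I \<Longrightarrow> x \<in> carrier P \<Longrightarrow> \<phi> i x \<in> carrier R"
  using linmap_closed[OF frame_fun] by fastforce

lemma frame_reindex:
  assumes lm: "left_module R P" and fr: "frame R P I p \<phi>" and h: "bij_betw h J I"
  shows "frame R P J (\<lambda>j. p (h j)) (\<lambda>j. \<phi> (h j))"
proof -
  interpret P: abelian_group P by (rule lm_ag[OF lm])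
  have hI: "j \<in> J \<Longrightarrow> h j \<in> I" for j using h by (auto simp: bij_betw_def)
  have "(\<Oplus>\<^sub>P j\<in>J. \<phi> (h j) x \<odot>\<^sub>P p (h j)) = x" if x: "x \<in> carrier P" for x
  proof -
    have "(\<Oplus>\<^sub>P i\<in>h ` J. \<phi> i x \<odot>\<^sub>P p i) = (\<Oplus>\<^sub>P j\<in>J. \<phi> (h j) x \<odot>\<^sub>P p (h j))" using h lm frame_coeff[OF fr] frame_elt[OF fr] x
      by (intro P.finsum_reindex) (auto simp: bij_betw_def)
    then show ?thesis using h frame_sum[OF fr x] by (simp add: bij_betw_def)
  qed
  moreover have "finite J" using h frame_finite[OF fr] bij_betw_finite by blast
  ultimately show ?thesis using hI frame_elt[OF fr] frame_fun[OF fr] by (auto simp: frame_def)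
qed

lemma frame_nat:
  assumes "left_module R P" "frame R P I p \<phi>"
  obtains p' \<phi>' where "frame R P {..<card I} p' \<phi>'"
proof -
  obtain h where "bij_betw h {..<card I} I"
    using ex_bij_betw_nat_finite[OF frame_finite[OF assms(2)]] by (auto simp: atLeast0LessThan)
  then show ?thesis using frame_reindex[OF assms] that by blast
qed

text \<open>The images under \<open>q\<close> of the standard basis vectors and the coordinates of
  \<open>i\<close> are the two halves of the frame.\<close>

lemma fg_projective_frame:
  assumes lm: "left_module R P" and pr: "fg_projective R P"
  obtains n :: nat and p \<phi> where "frame R P {..<n} p \<phi>"
proof -
  obtain n i q where i: "i \<in> lin_hom R P (free_module R n)" and q: "q \<in> lin_hom R (free_module R n) P"
    and qi: "\<And>x. x \<in> carrier P \<Longrightarrow> q (i x) = x" using pr by (auto simp: fg_projective_def)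
  let ?F = "free_module R n"
  have R: "ring R" by (rule lm_ring[OF lm])
  have F: "left_module R ?F" by (rule left_module_free_module[OF R])
  have agF: "abelian_group ?F" by (rule lm_ag[OF F])
  have agR: "abelian_group R" by (rule ring_ag[OF R])
  define e where "e k = (\<lambda>j\<in>{..<n}. if k = j then \<one>\<^sub>R else \<zero>\<^sub>R)" for k
  have e: "e k \<in> carrier ?F" for k using R agR by (auto simp: e_def)
  have coord: "(\<lambda>y. y j) \<in> addmap ?F R" if "j < n" for j using that by (intro addmapI) (auto dest: PiE_mem)
  have ex: "(\<Oplus>\<^bsub>?F\<^esub>k\<in>{..<n}. y k \<odot>\<^bsub>?F\<^esub> e k) = y" if y: "y \<in> carrier ?F" for y
  proof (rule PiE_ext[of _ "{..<n}" "\<lambda>_. carrier R"])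
    have yk: "k < n \<Longrightarrow> y k \<in> carrier R" for k using y by (auto dest: PiE_mem)
    have cl: "k < n \<Longrightarrow> y k \<odot>\<^bsub>?F\<^esub> e k \<in> carrier ?F" for k using lm_smult[OF F yk e] by blast
    then show "(\<Oplus>\<^bsub>?F\<^esub>k\<in>{..<n}. y k \<odot>\<^bsub>?F\<^esub> e k) \<in> {..<n} \<rightarrow>\<^sub>E carrier R"
      using fs_closed[OF agF, of "{..<n}" "\<lambda>k. y k \<odot>\<^bsub>?F\<^esub> e k"] by simp
    show "y \<in> {..<n} \<rightarrow>\<^sub>E carrier R" using y by simp
    fix j assume j: "j \<in> {..<n}"
    have "(\<Oplus>\<^bsub>?F\<^esub>k\<in>{..<n}. y k \<odot>\<^bsub>?F\<^esub> e k) j = (\<Oplus>\<^sub>R k\<in>{..<n}. (y k \<odot>\<^bsub>?F\<^esub> e k) j)"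
      using j cl by (intro addmap_fs[OF agF agR coord]) auto
    also have "\<dots> = (\<Oplus>\<^sub>R k\<in>{..<n}. if k = j then y k else \<zero>\<^sub>R)"
    proof (rule fs_cong[OF agR])
      fix k assume "k \<in> {..<n}"
      interpret ring R by fact
      show "(y k \<odot>\<^bsub>?F\<^esub> e k) j = (if k = j then y k else \<zero>\<^sub>R)" using j yk[of k] \<open>k \<in> _\<close> by (cases "k = j") (auto simp: e_def)
      show "(if k = j then y k else \<zero>\<^sub>R) \<in> carrier R" using yk[of k] \<open>k \<in> _\<close> agR by auto
    qed
    also have "\<dots> = y j" using fs_delta[OF agR, of "{..<n}" j y] j yk by simp
    finally show "(\<Oplus>\<^bsub>?F\<^esub>k\<in>{..<n}. y k \<odot>\<^bsub>?F\<^esub> e k) j = y j" .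
  qed
  have "frame R P {..<n} (\<lambda>k. q (e k)) (\<lambda>k x. i x k)" unfolding frame_def
  proof (intro conjI ballI)
    fix k assume k: "k \<in> {..<n}"
    show "q (e k) \<in> carrier P" by (rule lin_hom_closed[OF q e])
    have icl: "x \<in> carrier P \<Longrightarrow> i x \<in> carrier ?F" for x by (rule lin_hom_closed[OF i])
    show "(\<lambda>x. i x k) \<in> linmap R P (regular R)" by (rule linmapI)
         (use k icl in "auto simp: lin_hom_add[OF i] lin_hom_smult[OF i] dest: PiE_mem")
  next
    fix x assume x: "x \<in> carrier P"
    have ix: "i x \<in> carrier ?F" by (rule lin_hom_closed[OF i x])
    have ixk: "k < n \<Longrightarrow> i x k \<in> carrier R" for k using ix by (auto dest: PiE_mem)
    have "x = q (\<Oplus>\<^bsub>?F\<^esub>k\<in>{..<n}. i x k \<odot>\<^bsub>?F\<^esub> e k)" using ex[OF ix] qi[OF x] by simp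
    also have "\<dots> = (\<Oplus>\<^sub>P k\<in>{..<n}. q (i x k \<odot>\<^bsub>?F\<^esub> e k))"
      by (rule addmap_fs[OF agF lm_ag[OF lm] lin_hom_addmap[OF q]]) (use ixk e lm_smult[OF F] in blast)
    also have "\<dots> = (\<Oplus>\<^sub>P k\<in>{..<n}. i x k \<odot>\<^sub>P q (e k))" by (rule fs_cong[OF lm_ag[OF lm]])
         (use ixk e lin_hom_smult[OF q] lm_smult[OF lm] lin_hom_closed[OF q e] in auto)
    finally show "(\<Oplus>\<^sub>P k\<in>{..<n}. i x k \<odot>\<^sub>P q (e k)) = x" by simp
  qed simp
  then show ?thesis by (rule that)
qed

lemma sum_smult_linmap:
  assumes "left_module R V" "\<And>k. k < n \<Longrightarrow> v k \<in> carrier V"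
  shows "(\<lambda>y. \<Oplus>\<^sub>V k\<in>{..<n}. y k \<odot>\<^sub>V v k) \<in> linmap R (free_module R n) V"
proof (rule linmap_sum[OF assms(1)])
  have R: "ring R" by (rule lm_ring[OF assms(1)])
  fix k assume k: "k \<in> {..<n}"
  show "(\<lambda>y. y k \<odot>\<^sub>V v k) \<in> linmap R (free_module R n) V"
    by (rule linmap_smult_elt[OF left_module_free_module[OF R] assms(1)])
       (use k assms(2) in "auto intro!: linmapI dest: PiE_mem")
qed simp

lemma tuple_linmap:
  assumes "left_module R U" "\<And>k. k < n \<Longrightarrow> g k \<in> linmap R U (regular R)"
  shows "(\<lambda>x. \<lambda>k\<in>{..<n}. g k x) \<in> linmap R U (free_module R n)"
  by (rule linmapI) (use linmap_closed[OF assms(2)] linmap_add[OF assms(2)] linmap_smult[OF assms(2)] in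
       \<open>auto simp: fun_eq_iff lm_ag[OF assms(1)] lm_smult[OF assms(1)]\<close>)

lemma frame_fg_projective:
  assumes lm: "left_module R P" and fr: "frame R P I p \<phi>"
  shows "fg_projective R P"
proof -
  obtain p' \<phi>' where f: "frame R P {..<card I} p' \<phi>'" by (rule frame_nat[OF lm fr])
  let ?n = "card I" let ?F = "free_module R ?n"
  have F: "left_module R ?F" by (rule left_module_free_module[OF lm_ring[OF lm]])
  have i: "(\<lambda>x\<in>carrier P. \<lambda>k\<in>{..<?n}. \<phi>' k x) \<in> lin_hom R P ?F"
    by (rule linmap_restrict[OF lm tuple_linmap[OF lm]]) (use frame_fun[OF f] in auto)
  have q: "(\<lambda>y\<in>carrier ?F. \<Oplus>\<^sub>P k\<in>{..<?n}. y k \<odot>\<^sub>P p' k) \<in> lin_hom R ?F P"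
    by (rule linmap_restrict[OF F sum_smult_linmap[OF lm]]) (use frame_elt[OF f] in auto)
  show ?thesis unfolding fg_projective_def
  proof (intro exI bexI ballI)
    fix x assume x: "x \<in> carrier P"
    have "(\<lambda>k\<in>{..<?n}. \<phi>' k x) \<in> carrier ?F" using frame_coeff[OF f _ x] by auto
    moreover have "(\<Oplus>\<^sub>P k\<in>{..<?n}. (\<lambda>k\<in>{..<?n}. \<phi>' k x) k \<odot>\<^sub>P p' k) = (\<Oplus>\<^sub>P k\<in>{..<?n}. \<phi>' k x \<odot>\<^sub>P p' k)"
      by (rule fs_cong[OF lm_ag[OF lm]]) (use frame_coeff[OF f _ x] frame_elt[OF f] lm_smult[OF lm] in auto)
    ultimately show "(\<lambda>y\<in>carrier ?F. \<Oplus>\<^sub>P k\<in>{..<?n}. y k \<odot>\<^sub>P p' k) ((\<lambda>x\<in>carrier P. \<lambda>k\<in>{..<?n}. \<phi>' k x) x) = x"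
      using x frame_sum[OF f x] by simp
  qed (rule i q)+
qed

lemma fg_projective_free_module: "ring R \<Longrightarrow> fg_projective R (free_module R n)" unfolding fg_projective_def
  by (intro exI[of _ n] bexI[of _ "\<lambda>x\<in>carrier (free_module R n). x"] ballI)
     (auto intro: lin_hom_id[OF left_module_free_module] simp del: free_module_simps)

text \<open>Adding one term at a time gives an induction rule by which additive statements about
  traces and transfers reduce to a single map x \<mapsto> g(x) v. Only extensional functions arise,
  so that the notion can be compared with \<open>proj_hom\<close>.\<close>

inductive fin_rank :: "('r, 'y) ring_scheme \<Rightarrow> ('r, 'u, 'z) module_scheme \<Rightarrow> ('r, 'v, 'w) module_scheme \<Rightarrow> ('u \<Rightarrow> 'v) \<Rightarrow> bool"
  for R U V where
  zero: "fin_rank R U V (\<lambda>x\<in>carrier U. \<zero>\<^sub>V)"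
| step: "fin_rank R U V f \<Longrightarrow> g \<in> linmap R U (regular R) \<Longrightarrow> v \<in> carrier V \<Longrightarrow>
     fin_rank R U V (\<lambda>x\<in>carrier U. f x \<oplus>\<^sub>V g x \<odot>\<^sub>V v)"

lemma fin_rank_lin_hom:
  assumes "left_module R U" "left_module R V" "fin_rank R U V f"
  shows "f \<in> lin_hom R U V"
  using assms(3)
proof induction
  case zero then show ?case using lin_hom_zero[OF assms(1,2)] .
next
  case (step f g v)
  show ?case by (rule linmap_restrict[OF assms(1) linmap_plus[OF assms(2)]])
       (use step in "auto intro: lin_hom_linmap linmap_smult_elt[OF assms(1,2)]")
qed

lemma fin_rank_add:
  assumes U: "left_module R U" and V: "left_module R V" and f: "fin_rank R U V f" and f': "fin_rank R U V f'"
  shows "fin_rank R U V (\<lambda>x\<in>carrier U. f x \<oplus>\<^sub>V f' x)"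
  using f'
proof induction
  case zero
  have fh: "f \<in> lin_hom R U V" by (rule fin_rank_lin_hom[OF U V f])
  have eq: "(\<lambda>x\<in>carrier U. f x \<oplus>\<^sub>V (\<lambda>x\<in>carrier U. \<zero>\<^sub>V) x) = f" by (rule extensionalityI[OF _ lin_hom_ext[OF fh]])
       (auto simp: lin_hom_closed[OF fh] lm_ag[OF V])
  show ?case unfolding eq by (rule f)
next
  case (step f' g v)
  have fh: "f \<in> lin_hom R U V" "f' \<in> lin_hom R U V" using fin_rank_lin_hom[OF U V] f step by auto
  have eq: "(\<lambda>x\<in>carrier U. f x \<oplus>\<^sub>V (\<lambda>x\<in>carrier U. f' x \<oplus>\<^sub>V g x \<odot>\<^sub>V v) x) =
      (\<lambda>x\<in>carrier U. (\<lambda>x\<in>carrier U. f x \<oplus>\<^sub>V f' x) x \<oplus>\<^sub>V g x \<odot>\<^sub>V v)"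
    using step lin_hom_closed[OF fh(1)] lin_hom_closed[OF fh(2)]
      linmap_closed[OF linmap_smult_elt[OF U V]]
    by (auto simp: fun_eq_iff abelian_monoid.a_assoc[OF ag_monoid[OF lm_ag[OF V]]])
  show ?case unfolding eq by (rule fin_rank.step[OF step.IH step.hyps(2,3)])
qed

lemma fin_rank_compose_left:
  assumes U: "left_module R U" and V: "left_module R V" and W: "left_module R W"
    and f: "fin_rank R U V f" and h: "h \<in> linmap R V W"
  shows "fin_rank R U W (\<lambda>x\<in>carrier U. h (f x))"
  using f
proof induction
  case zero
  have "h \<zero>\<^sub>V = \<zero>\<^sub>W" by (rule addmap_zero[OF lm_ag[OF V] lm_ag[OF W] linmap_addmap[OF h]])
  then have eq: "(\<lambda>x\<in>carrier U. h ((\<lambda>x\<in>carrier U. \<zero>\<^sub>V) x)) = (\<lambda>x\<in>carrier U. \<zero>\<^sub>W)" by auto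
  show ?case unfolding eq by (rule fin_rank.zero)
next
  case (step f g v)
  have fh: "f \<in> lin_hom R U V" using fin_rank_lin_hom[OF U V] step by auto
  have "h (f x \<oplus>\<^sub>V g x \<odot>\<^sub>V v) = h (f x) \<oplus>\<^sub>W g x \<odot>\<^sub>W h v" if x: "x \<in> carrier U" for x
    using linmap_add[OF h] linmap_smult[OF h] linmap_closed[OF step.hyps(2) x] step.hyps(3)
      lin_hom_closed[OF fh x] lm_smult[OF V] by simp
  then have eq: "(\<lambda>x\<in>carrier U. h ((\<lambda>x\<in>carrier U. f x \<oplus>\<^sub>V g x \<odot>\<^sub>V v) x)) =
      (\<lambda>x\<in>carrier U. (\<lambda>x\<in>carrier U. h (f x)) x \<oplus>\<^sub>W g x \<odot>\<^sub>W h v)" by auto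
  show ?case unfolding eq by (rule fin_rank.step[OF step.IH step.hyps(2) linmap_closed[OF h step.hyps(3)]])
qed

lemma fin_rank_compose_right:
  assumes T: "left_module R T" and U: "left_module R U" and V: "left_module R V"
    and f: "fin_rank R U V f" and k: "k \<in> linmap R T U"
  shows "fin_rank R T V (\<lambda>x\<in>carrier T. f (k x))"
  using f
proof induction
  case zero
  have eq: "(\<lambda>x\<in>carrier T. (\<lambda>x\<in>carrier U. \<zero>\<^sub>V) (k x)) = (\<lambda>x\<in>carrier T. \<zero>\<^sub>V)" using linmap_closed[OF k] by auto
  show ?case unfolding eq by (rule fin_rank.zero)
next
  case (step f g v)
  have eq: "(\<lambda>x\<in>carrier T. (\<lambda>x\<in>carrier U. f x \<oplus>\<^sub>V g x \<odot>\<^sub>V v) (k x)) =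
      (\<lambda>x\<in>carrier T. (\<lambda>x\<in>carrier T. f (k x)) x \<oplus>\<^sub>V g (k x) \<odot>\<^sub>V v)" using linmap_closed[OF k] by auto
  show ?case unfolding eq by (rule fin_rank.step[OF step.IH linmap_comp[OF k step.hyps(2)] step.hyps(3)])
qed

lemma fin_rank_sum:
  assumes U: "left_module R U" and V: "left_module R V" and "finite I"
    and "\<And>i. i \<in> I \<Longrightarrow> g i \<in> linmap R U (regular R)" "\<And>i. i \<in> I \<Longrightarrow> v i \<in> carrier V"
  shows "fin_rank R U V (\<lambda>x\<in>carrier U. \<Oplus>\<^sub>V i\<in>I. g i x \<odot>\<^sub>V v i)"
  using assms(3-)
proof (induction I rule: finite_induct)
  case empty
  have eq: "(\<lambda>x\<in>carrier U. \<Oplus>\<^sub>V i\<in>{}. g i x \<odot>\<^sub>V v i) = (\<lambda>x\<in>carrier U. \<zero>\<^sub>V)" using lm_ag[OF V] by simp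
  show ?case unfolding eq by (rule fin_rank.zero)
next
  case (insert j I)
  have cl: "g i x \<odot>\<^sub>V v i \<in> carrier V" if "i \<in> insert j I" "x \<in> carrier U" for i x
    using linmap_closed[OF linmap_smult_elt[OF U V insert.prems]] that by blast
  interpret V: abelian_group V by (rule lm_ag[OF V])
  have "(\<lambda>x\<in>carrier U. \<Oplus>\<^sub>V i\<in>insert j I. g i x \<odot>\<^sub>V v i) =
     (\<lambda>x\<in>carrier U. (\<lambda>x\<in>carrier U. \<Oplus>\<^sub>V i\<in>I. g i x \<odot>\<^sub>V v i) x \<oplus>\<^sub>V g j x \<odot>\<^sub>V v j)"
    using cl insert.hyps lm_ag[OF V] by (auto simp: fun_eq_iff fs_insert V.a_comm)
  moreover have "fin_rank R U V (\<lambda>x\<in>carrier U. \<Oplus>\<^sub>V i\<in>I. g i x \<odot>\<^sub>V v i)" using insert.IH insert.prems by blast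
  moreover have "g j \<in> linmap R U (regular R)" "v j \<in> carrier V" using insert.prems by blast+
  ultimately show ?case by (simp only: fin_rank.step)
qed

text \<open>A frame of P inserted between the two maps produces the sum. The type of P is arbitrary
  here, whereas \<open>proj_hom\<close> fixes one.\<close>

lemma fin_rank_factor:
  assumes U: "left_module R U" and V: "left_module R V" and P: "left_module R P"
    and pr: "fg_projective R P" and g: "g \<in> linmap R U P" and h: "h \<in> linmap R P V"
  shows "fin_rank R U V (\<lambda>x\<in>carrier U. h (g x))"
proof -
  obtain n :: nat and p \<phi> where fr: "frame R P {..<n} p \<phi>" by (rule fg_projective_frame[OF P pr])
  have "fin_rank R U V (\<lambda>x\<in>carrier U. \<Oplus>\<^sub>V i\<in>{..<n}. \<phi> i (g x) \<odot>\<^sub>V h (p i))"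
    by (intro fin_rank_sum[OF U V] linmap_comp[OF g frame_fun[OF fr]]
        linmap_closed[OF h frame_elt[OF fr]]) auto
  moreover have "h (g x) = (\<Oplus>\<^sub>V i\<in>{..<n}. \<phi> i (g x) \<odot>\<^sub>V h (p i))" if x: "x \<in> carrier U" for x
  proof -
    have gx: "g x \<in> carrier P" by (rule linmap_closed[OF g x])
    have c: "i \<in> {..<n} \<Longrightarrow> \<phi> i (g x) \<in> carrier R" for i using frame_coeff[OF fr _ gx] .
    have "h (g x) = h (\<Oplus>\<^sub>P i\<in>{..<n}. \<phi> i (g x) \<odot>\<^sub>P p i)" using frame_sum[OF fr gx] by simp
    also have "\<dots> = (\<Oplus>\<^sub>V i\<in>{..<n}. h (\<phi> i (g x) \<odot>\<^sub>P p i))" using c frame_elt[OF fr] lm_smult[OF P]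
      by (intro addmap_fs[OF lm_ag[OF P] lm_ag[OF V] linmap_addmap[OF h]]) auto
    also have "\<dots> = (\<Oplus>\<^sub>V i\<in>{..<n}. \<phi> i (g x) \<odot>\<^sub>V h (p i))"
      using c frame_elt[OF fr] linmap_smult[OF h] lm_smult[OF V] linmap_closed[OF h] by (intro fs_cong[OF lm_ag[OF V]]) auto
    finally show ?thesis .
  qed
  ultimately show ?thesis by (simp cong: restrict_cong)
qed

lemma fin_rank_explicit:
  assumes U: "left_module R U" and V: "left_module R V" and f: "fin_rank R U V f"
  obtains n :: nat and g v where "\<And>k. k < n \<Longrightarrow> g k \<in> linmap R U (regular R)"
    "\<And>k. k < n \<Longrightarrow> v k \<in> carrier V" "f = (\<lambda>x\<in>carrier U. \<Oplus>\<^sub>V k\<in>{..<n}. g k x \<odot>\<^sub>V v k)"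
proof -
  have "\<exists>n::nat. \<exists>g v. (\<forall>k<n. g k \<in> linmap R U (regular R)) \<and> (\<forall>k<n. v k \<in> carrier V) \<and>
    f = (\<lambda>x\<in>carrier U. \<Oplus>\<^sub>V k\<in>{..<n}. g k x \<odot>\<^sub>V v k)" using f
  proof induction
    case zero
    show ?case by (rule exI[of _ 0]) (simp add: lm_ag[OF V])
  next
    case (step f g v)
    then obtain n :: nat and g' v' where *: "\<forall>k<n. g' k \<in> linmap R U (regular R)" "\<forall>k<n. v' k \<in> carrier V"
      "f = (\<lambda>x\<in>carrier U. \<Oplus>\<^sub>V k\<in>{..<n}. g' k x \<odot>\<^sub>V v' k)" by blast
    interpret V: abelian_group V by (rule lm_ag[OF V])
    have "(\<Oplus>\<^sub>V k\<in>{..<Suc n}. (g'(n := g)) k x \<odot>\<^sub>V (v'(n := v)) k) =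
        (\<Oplus>\<^sub>V k\<in>{..<n}. g' k x \<odot>\<^sub>V v' k) \<oplus>\<^sub>V g x \<odot>\<^sub>V v" if x: "x \<in> carrier U" for x
    proof -
      have c: "g' k x \<odot>\<^sub>V v' k \<in> carrier V" if "k < n" for k
        by (rule linmap_closed[OF linmap_smult_elt[OF U V] x]) (use that * in auto)
      have c0: "g x \<odot>\<^sub>V v \<in> carrier V" by (rule linmap_closed[OF linmap_smult_elt[OF U V] x]) (use step.hyps in auto)
      have eq: "(\<Oplus>\<^sub>V k\<in>{..<n}. (g'(n := g)) k x \<odot>\<^sub>V (v'(n := v)) k) = (\<Oplus>\<^sub>V k\<in>{..<n}. g' k x \<odot>\<^sub>V v' k)"
        by (intro fs_cong[OF lm_ag[OF V]]) (use c in auto)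
      have cs: "(\<Oplus>\<^sub>V k\<in>{..<n}. g' k x \<odot>\<^sub>V v' k) \<in> carrier V" by (intro fs_closed[OF lm_ag[OF V]]) (use c in auto)
      have "(\<Oplus>\<^sub>V k\<in>insert n {..<n}. (g'(n := g)) k x \<odot>\<^sub>V (v'(n := v)) k) = (g'(n := g)) n x \<odot>\<^sub>V (v'(n := v)) n \<oplus>\<^sub>V
          (\<Oplus>\<^sub>V k\<in>{..<n}. (g'(n := g)) k x \<odot>\<^sub>V (v'(n := v)) k)" by (intro fs_insert[OF lm_ag[OF V]]) (use c c0 in auto)
      then show ?thesis unfolding lessThan_Suc eq using V.a_comm[OF c0 cs] by simp
    qed
    then have "(\<lambda>x\<in>carrier U. f x \<oplus>\<^sub>V g x \<odot>\<^sub>V v) = (\<lambda>x\<in>carrier U. \<Oplus>\<^sub>V k\<in>{..<Suc n}. (g'(n := g)) k x \<odot>\<^sub>V (v'(n := v)) k)"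
      using * by (auto simp: fun_eq_iff)
    then show ?case using * step.hyps by (intro exI[of _ "Suc n"] exI[of _ "g'(n := g)"] exI[of _ "v'(n := v)"])
         (auto simp: less_Suc_eq)
  qed
  then show ?thesis using that by blast
qed

text \<open>A sum of n terms factors through the free module of rank n: the functionals form a
  tuple, and the basis vectors go to the \<open>v k\<close>. From here on stable equality is a
  matter of finite rank and independent of the type used in \<open>proj_hom\<close>.\<close>

lemma proj_hom_iff_fin_rank:
  assumes U: "left_module R U" and V: "left_module R V"
  shows "f \<in> proj_hom R U V \<longleftrightarrow> fin_rank R U V f"
proof
  assume "f \<in> proj_hom R U V"
  then obtain P :: "('a, nat \<Rightarrow> 'a) module" and g h where P: "left_module R P" "fg_projective R P"
    and g: "g \<in> lin_hom R U P" and h: "h \<in> lin_hom R P V" and f: "f = compose (carrier U) h g" by (auto simp: proj_hom_def)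
  show "fin_rank R U V f" unfolding f compose_def
    by (rule fin_rank_factor[OF U V P lin_hom_linmap[OF g] lin_hom_linmap[OF h]])
next
  assume f: "fin_rank R U V f"
  obtain n :: nat and g v where g: "\<And>k. k < n \<Longrightarrow> g k \<in> linmap R U (regular R)"
    and v: "\<And>k. k < n \<Longrightarrow> v k \<in> carrier V" and fe: "f = (\<lambda>x\<in>carrier U. \<Oplus>\<^sub>V k\<in>{..<n}. g k x \<odot>\<^sub>V v k)"
    by (rule fin_rank_explicit[OF U V f]) blast
  have R: "ring R" by (rule lm_ring[OF U])
  let ?F = "free_module R n"
  have F: "left_module R ?F" by (rule left_module_free_module[OF R])
  have i: "(\<lambda>x\<in>carrier U. \<lambda>k\<in>{..<n}. g k x) \<in> lin_hom R U ?F" by (rule linmap_restrict[OF U tuple_linmap[OF U g]])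
  have q: "(\<lambda>y\<in>carrier ?F. \<Oplus>\<^sub>V k\<in>{..<n}. y k \<odot>\<^sub>V v k) \<in> lin_hom R ?F V"
    by (rule linmap_restrict[OF F sum_smult_linmap[OF V v]])
  have "f = compose (carrier U) (\<lambda>y\<in>carrier ?F. \<Oplus>\<^sub>V k\<in>{..<n}. y k \<odot>\<^sub>V v k) (\<lambda>x\<in>carrier U. \<lambda>k\<in>{..<n}. g k x)"
  proof (rule extensionalityI[of _ "carrier U"])
    fix x assume x: "x \<in> carrier U"
    have c: "k < n \<Longrightarrow> g k x \<in> carrier R" for k using linmap_closed[OF g x] by simp
    have "(\<lambda>k\<in>{..<n}. g k x) \<in> carrier ?F" using c by auto
    moreover have "(\<Oplus>\<^sub>V k\<in>{..<n}. (\<lambda>k\<in>{..<n}. g k x) k \<odot>\<^sub>V v k) = (\<Oplus>\<^sub>V k\<in>{..<n}. g k x \<odot>\<^sub>V v k)"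
      by (rule fs_cong[OF lm_ag[OF V]]) (use c v lm_smult[OF V] in auto)
    ultimately show "f x = compose (carrier U) (\<lambda>y\<in>carrier ?F. \<Oplus>\<^sub>V k\<in>{..<n}. y k \<odot>\<^sub>V v k)
      (\<lambda>x\<in>carrier U. \<lambda>k\<in>{..<n}. g k x) x" using x by (simp add: fe)
  qed (auto simp: fe)
  then show "f \<in> proj_hom R U V"
    unfolding proj_hom_def using fin_rank_lin_hom[OF U V f] F fg_projective_free_module[OF R] i q by blast
qed

section \<open>Traces over commutative rings\<close>

text \<open>The identity tr(f g) = tr(g f): expand \<open>g (q j)\<close> in the frame of P and
  interchange the sums, reordering coefficients by commutativity of R. The system \<open>q\<close>,
  \<open>\<psi>\<close> stays arbitrary; once it is a frame of Q, the inner sum collapses to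
  \<open>f (p i)\<close>.\<close>

lemma trace_exchange:
  assumes R: "cring R" and P: "left_module R P" and Q: "left_module R Q" and fr: "frame R P I p \<phi>"
    and J: "finite J" and q: "\<And>j. j \<in> J \<Longrightarrow> q j \<in> carrier Q" and \<psi>: "\<And>j. j \<in> J \<Longrightarrow> \<psi> j \<in> linmap R Q (regular R)"
    and f: "f \<in> linmap R P Q" and g: "g \<in> linmap R Q P"
  shows "(\<Oplus>\<^sub>R j\<in>J. \<psi> j (f (g (q j)))) = (\<Oplus>\<^sub>R i\<in>I. \<phi> i (g (\<Oplus>\<^sub>Q j\<in>J. \<psi> j (f (p i)) \<odot>\<^sub>Q q j)))"
proof -
  interpret R: cring R by fact
  have agR: "abelian_group R" and agP: "abelian_group P" and agQ: "abelian_group Q"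
    using R.abelian_group_axioms lm_ag[OF P] lm_ag[OF Q] by auto
  have agr: "abelian_group (regular R)" by (rule lm_ag[OF left_module_regular[OF R.ring_axioms]])
  have \<phi>c: "\<phi> i x \<in> carrier R" if "i \<in> I" "x \<in> carrier P" for i x using frame_coeff[OF fr that] .
  have \<psi>c: "\<psi> j x \<in> carrier R" if "j \<in> J" "x \<in> carrier Q" for j x using linmap_closed[OF \<psi>[OF that(1)] that(2)] by simp
  note pc = frame_elt[OF fr] and fc = linmap_closed[OF f] and gc = linmap_closed[OF g]
  have 1: "\<psi> j (f (g (q j))) = (\<Oplus>\<^sub>R i\<in>I. \<phi> i (g (q j)) \<otimes>\<^sub>R \<psi> j (f (p i)))" if j: "j \<in> J" for j
  proof -
    have h: "(\<lambda>x. \<psi> j (f x)) \<in> linmap R P (regular R)" by (rule linmap_comp[OF f \<psi>[OF j]])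
    have "\<psi> j (f (g (q j))) = \<psi> j (f (\<Oplus>\<^sub>P i\<in>I. \<phi> i (g (q j)) \<odot>\<^sub>P p i))" using frame_sum[OF fr gc[OF q[OF j]]] by simp
    also have "\<dots> = (\<Oplus>\<^bsub>regular R\<^esub>i\<in>I. \<psi> j (f (\<phi> i (g (q j)) \<odot>\<^sub>P p i)))" by (rule addmap_fs[OF agP agr linmap_addmap[OF h]])
         (use \<phi>c gc q j pc lm_smult[OF P] in auto)
    also have "\<dots> = (\<Oplus>\<^sub>R i\<in>I. \<psi> j (f (\<phi> i (g (q j)) \<odot>\<^sub>P p i)))" by (rule fs_same[OF agr agR])
         (use \<phi>c fc gc q j pc lm_smult[OF P] \<psi>c in auto)
    also have "\<dots> = (\<Oplus>\<^sub>R i\<in>I. \<phi> i (g (q j)) \<otimes>\<^sub>R \<psi> j (f (p i)))"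
      by (rule fs_cong[OF agR]) (use \<phi>c fc gc q j pc \<psi>c linmap_smult[OF h] in auto)
    finally show ?thesis .
  qed
  have 2: "(\<Oplus>\<^sub>R j\<in>J. \<phi> i (g (q j)) \<otimes>\<^sub>R \<psi> j (f (p i))) = \<phi> i (g (\<Oplus>\<^sub>Q j\<in>J. \<psi> j (f (p i)) \<odot>\<^sub>Q q j))" if i: "i \<in> I" for i
  proof -
    let ?h = "\<lambda>x. \<phi> i (g x)"
    have h: "?h \<in> linmap R Q (regular R)" by (rule linmap_comp[OF g frame_fun[OF fr i]])
    have "(\<Oplus>\<^sub>R j\<in>J. \<phi> i (g (q j)) \<otimes>\<^sub>R \<psi> j (f (p i))) = (\<Oplus>\<^sub>R j\<in>J. ?h (\<psi> j (f (p i)) \<odot>\<^sub>Q q j))"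
      using q \<psi>c pc i linmap_smult[OF h] \<phi>c fc gc by (intro fs_cong[OF agR]) (auto simp: R.m_comm)
    also have "\<dots> = (\<Oplus>\<^bsub>regular R\<^esub>j\<in>J. ?h (\<psi> j (f (p i)) \<odot>\<^sub>Q q j))" by (rule fs_same[OF agR agr])
         (use \<phi>c fc gc q i pc lm_smult[OF Q] \<psi>c in auto)
    also have "\<dots> = ?h (\<Oplus>\<^sub>Q j\<in>J. \<psi> j (f (p i)) \<odot>\<^sub>Q q j)" by (rule addmap_fs[OF agQ agr linmap_addmap[OF h], symmetric])
         (use q i fc pc lm_smult[OF Q] \<psi>c in auto)
    finally show ?thesis .
  qed
  have "(\<Oplus>\<^sub>R j\<in>J. \<psi> j (f (g (q j)))) = (\<Oplus>\<^sub>R j\<in>J. \<Oplus>\<^sub>R i\<in>I. \<phi> i (g (q j)) \<otimes>\<^sub>R \<psi> j (f (p i)))"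
    by (rule fs_cong[OF agR 1]) (use \<phi>c fc gc q \<psi>c pc agR in auto)
  also have "\<dots> = (\<Oplus>\<^sub>R i\<in>I. \<Oplus>\<^sub>R j\<in>J. \<phi> i (g (q j)) \<otimes>\<^sub>R \<psi> j (f (p i)))"
    by (rule fs_swap[OF agR J]) (use \<phi>c fc gc q \<psi>c pc in auto)
  also have "\<dots> = (\<Oplus>\<^sub>R i\<in>I. \<phi> i (g (\<Oplus>\<^sub>Q j\<in>J. \<psi> j (f (p i)) \<odot>\<^sub>Q q j)))"
    by (rule fs_cong[OF agR 2]) (auto intro!: \<phi>c gc fs_closed[OF agQ] lm_smult[OF Q] \<psi>c fc pc q)
  finally show ?thesis .
qed

text \<open>This is \<open>trace_exchange\<close> with the identity as second map, both frames
  belonging to the same module.\<close>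

lemma trace_unique:
  assumes R: "cring R" and P: "left_module R P" and fr: "frame R P I p \<phi>" and fr': "frame R P J q \<psi>"
    and f: "f \<in> linmap R P P"
  shows "(\<Oplus>\<^sub>R j\<in>J. \<psi> j (f (q j))) = (\<Oplus>\<^sub>R i\<in>I. \<phi> i (f (p i)))"
proof -
  have id: "(\<lambda>x. x) \<in> linmap R P P" by (rule linmapI) auto
  have c: "f (p i) \<in> carrier P" if "i \<in> I" for i by (rule linmap_closed[OF f frame_elt[OF fr that]])
  have "(\<Oplus>\<^sub>R j\<in>J. \<psi> j (f (q j))) = (\<Oplus>\<^sub>R i\<in>I. \<phi> i (\<Oplus>\<^sub>P j\<in>J. \<psi> j (f (p i)) \<odot>\<^sub>P q j))"
    by (rule trace_exchange[OF R P P fr frame_finite[OF fr'] frame_elt[OF fr'] frame_fun[OF fr'] f id])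
  also have "\<dots> = (\<Oplus>\<^sub>R i\<in>I. \<phi> i (f (p i)))" by (rule fs_cong[OF ring_ag[OF cring.axioms(1)[OF R]]])
       (use frame_sum[OF fr' c] frame_coeff[OF fr _ c] in auto)
  finally show ?thesis .
qed

text \<open>Uniqueness of coordinates makes them linear. The second conclusion recovers the
  coordinates from any expression in the basis, which is the form in which \<open>trace_on\<close>
  presents a matrix.\<close>

lemma basis_frame:
  assumes P: "left_module R P" and X: "finite_basis R P X"
  obtains \<phi> where "frame R P X (\<lambda>x. x) \<phi>" and "\<And>y c. c \<in> X \<rightarrow> carrier R \<Longrightarrow> y = (\<Oplus>\<^sub>P x\<in>X. c x \<odot>\<^sub>P x) \<Longrightarrow> (\<forall>x\<in>X. \<phi> x y = c x)"
proof -
  have fin: "finite X" and XP: "X \<subseteq> carrier P"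
    and ex: "\<And>y. y \<in> carrier P \<Longrightarrow> \<exists>!c. c \<in> X \<rightarrow>\<^sub>E carrier R \<and> y = (\<Oplus>\<^sub>P x\<in>X. c x \<odot>\<^sub>P x)" using X by (auto simp: finite_basis_def)
  have agP: "abelian_group P" by (rule lm_ag[OF P])
  interpret R: ring R by (rule lm_ring[OF P])
  define \<kappa> where "\<kappa> y = (THE c. c \<in> X \<rightarrow>\<^sub>E carrier R \<and> y = (\<Oplus>\<^sub>P x\<in>X. c x \<odot>\<^sub>P x))" for y
  have \<kappa>: "\<kappa> y \<in> X \<rightarrow>\<^sub>E carrier R" "y = (\<Oplus>\<^sub>P x\<in>X. \<kappa> y x \<odot>\<^sub>P x)" if "y \<in> carrier P" for y
    using theI'[OF ex[OF that]] by (auto simp: \<kappa>_def)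
  have uniq: "\<forall>x\<in>X. \<kappa> y x = c x" if c: "c \<in> X \<rightarrow> carrier R" and y: "y = (\<Oplus>\<^sub>P x\<in>X. c x \<odot>\<^sub>P x)" for y c
  proof -
    have cl: "x \<in> X \<Longrightarrow> c x \<odot>\<^sub>P x \<in> carrier P" for x using c XP lm_smult[OF P] by auto
    have yP: "y \<in> carrier P" unfolding y using cl agP by simp
    have "y = (\<Oplus>\<^sub>P x\<in>X. restrict c X x \<odot>\<^sub>P x)" unfolding y using cl by (intro fs_cong[OF agP]) auto
    moreover have "restrict c X \<in> X \<rightarrow>\<^sub>E carrier R" using c by auto
    ultimately have "restrict c X = \<kappa> y" using ex[OF yP] \<kappa>[OF yP] by blast
    then show ?thesis by (metis restrict_apply')
  qed
  have \<kappa>c: "\<kappa> y x \<in> carrier R" if "y \<in> carrier P" "x \<in> X" for x y using \<kappa>(1)[OF that(1)] that(2) by (auto dest: PiE_mem)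
  have \<kappa>m: "\<kappa> y x \<odot>\<^sub>P x \<in> carrier P" if "y \<in> carrier P" "x \<in> X" for x y using \<kappa>c[OF that] lm_smult[OF P] XP that by auto
  have "frame R P X (\<lambda>x. x) (\<lambda>x y. \<kappa> y x)" unfolding frame_def
  proof (intro conjI ballI)
    fix x assume x: "x \<in> X"
    show "(\<lambda>y. \<kappa> y x) \<in> linmap R P (regular R)"
    proof (rule linmapI)
      fix y w assume y: "y \<in> carrier P" and w: "w \<in> carrier P"
      have "y \<oplus>\<^sub>P w = (\<Oplus>\<^sub>P x\<in>X. \<kappa> y x \<odot>\<^sub>P x) \<oplus>\<^sub>P (\<Oplus>\<^sub>P x\<in>X. \<kappa> w x \<odot>\<^sub>P x)" using \<kappa> y w by simp
      also have "\<dots> = (\<Oplus>\<^sub>P x\<in>X. \<kappa> y x \<odot>\<^sub>P x \<oplus>\<^sub>P \<kappa> w x \<odot>\<^sub>P x)" using \<kappa>m y w by (intro fs_add[OF agP, symmetric]) auto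
      also have "\<dots> = (\<Oplus>\<^sub>P x\<in>X. (\<kappa> y x \<oplus>\<^sub>R \<kappa> w x) \<odot>\<^sub>P x)"
        using \<kappa>c[OF y] \<kappa>c[OF w] subsetD[OF XP] lm_smult[OF P] R.a_closed ag_add[OF agP]
        by (intro fs_cong[OF agP]) (auto simp: left_module.lm_l_distr[OF P])
      finally have "\<forall>x\<in>X. \<kappa> (y \<oplus>\<^sub>P w) x = \<kappa> y x \<oplus>\<^sub>R \<kappa> w x" using \<kappa>c[OF y] \<kappa>c[OF w] by (intro uniq) auto
      then show "\<kappa> (y \<oplus>\<^sub>P w) x = \<kappa> y x \<oplus>\<^bsub>regular R\<^esub> \<kappa> w x" using x by simp
    next
      fix a y assume a: "a \<in> carrier R" and y: "y \<in> carrier P"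
      have "a \<odot>\<^sub>P y = a \<odot>\<^sub>P (\<Oplus>\<^sub>P x\<in>X. \<kappa> y x \<odot>\<^sub>P x)" using \<kappa> y by simp
      also have "\<dots> = (\<Oplus>\<^sub>P x\<in>X. a \<odot>\<^sub>P (\<kappa> y x \<odot>\<^sub>P x))" using \<kappa>m y by (intro lm_fs_r[OF P a]) auto
      also have "\<dots> = (\<Oplus>\<^sub>P x\<in>X. (a \<otimes>\<^sub>R \<kappa> y x) \<odot>\<^sub>P x)" using \<kappa>c[OF y] XP lm_smult[OF P] a
        by (intro fs_cong[OF agP]) (auto simp: left_module.lm_assoc[OF P])
      finally have "\<forall>x\<in>X. \<kappa> (a \<odot>\<^sub>P y) x = a \<otimes>\<^sub>R \<kappa> y x" using \<kappa>c[OF y] a by (intro uniq) auto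
      then show "\<kappa> (a \<odot>\<^sub>P y) x = a \<odot>\<^bsub>regular R\<^esub> \<kappa> y x" using x by simp
    qed (use \<kappa>c x in simp)
  qed (use fin XP \<kappa> in auto)
  then show ?thesis using uniq by (rule that)
qed

lemma the_elem_eqI: "v \<in> S \<Longrightarrow> (\<And>a. a \<in> S \<Longrightarrow> a = v) \<Longrightarrow> the_elem S = v"
  by (metis is_singletonI' is_singleton_the_elem singletonD empty_iff)

text \<open>Freeness provides a basis, so the set in \<open>trace_on\<close> is nonempty, and by
  \<open>trace_unique\<close> every matrix trace in it agrees with the sum over the given
  frame.\<close>

lemma trace_on_frame:
  assumes R: "cring R" and P: "left_module R P" and free: "fg_free R P" and fr: "frame R P I p \<phi>" and f: "f \<in> linmap R P P"
  shows "trace_on R P f = (\<Oplus>\<^sub>R i\<in>I. \<phi> i (f (p i)))"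
proof -
  interpret R: cring R by fact
  have agR: "abelian_group R" by (rule R.abelian_group_axioms)
  let ?S = "{(\<Oplus>\<^sub>R x\<in>X. c x x) | X c. finite_basis R P X \<and> (\<forall>x\<in>X. c x \<in> X \<rightarrow> carrier R \<and> f x = (\<Oplus>\<^sub>P y\<in>X. c x y \<odot>\<^sub>P y))}"
  have val: "(\<Oplus>\<^sub>R x\<in>X. c x x) = (\<Oplus>\<^sub>R i\<in>I. \<phi> i (f (p i)))"
    if X: "finite_basis R P X" and c: "\<forall>x\<in>X. c x \<in> X \<rightarrow> carrier R \<and> f x = (\<Oplus>\<^sub>P y\<in>X. c x y \<odot>\<^sub>P y)" for X c
  proof -
    obtain \<psi> where \<psi>: "frame R P X (\<lambda>x. x) \<psi>"
      and u: "\<And>y c. c \<in> X \<rightarrow> carrier R \<Longrightarrow> y = (\<Oplus>\<^sub>P x\<in>X. c x \<odot>\<^sub>P x) \<Longrightarrow> (\<forall>x\<in>X. \<psi> x y = c x)"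
      by (rule basis_frame[OF P X]) (rule that)
    have "(\<Oplus>\<^sub>R x\<in>X. c x x) = (\<Oplus>\<^sub>R x\<in>X. \<psi> x (f x))"
    proof (rule fs_cong[OF agR])
      fix x assume x: "x \<in> X"
      show "c x x = \<psi> x (f x)" using u[of "c x" "f x"] c x by auto
      show "\<psi> x (f x) \<in> carrier R" using frame_coeff[OF \<psi> x linmap_closed[OF f frame_elt[OF \<psi> x]]] .
    qed
    then show ?thesis using trace_unique[OF R P fr \<psi> f] by simp
  qed
  obtain X where X: "finite_basis R P X" using free by (auto simp: fg_free_def)
  obtain \<psi> where \<psi>: "frame R P X (\<lambda>x. x) \<psi>" by (rule basis_frame[OF P X])
  have A: "\<forall>x\<in>X. (\<lambda>y. \<psi> y (f x)) \<in> X \<rightarrow> carrier R \<and> f x = (\<Oplus>\<^sub>P y\<in>X. \<psi> y (f x) \<odot>\<^sub>P y)"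
    using frame_coeff[OF \<psi> _ linmap_closed[OF f frame_elt[OF \<psi>]]]
      frame_sum[OF \<psi> linmap_closed[OF f frame_elt[OF \<psi>]]] by auto
  have "(\<Oplus>\<^sub>R x\<in>X. \<psi> x (f x)) \<in> ?S" by (intro CollectI exI[of _ X] exI[of _ "\<lambda>x y. \<psi> y (f x)"] conjI refl X A)
  then have mem: "(\<Oplus>\<^sub>R i\<in>I. \<phi> i (f (p i))) \<in> ?S" unfolding trace_unique[OF R P fr \<psi> f] .
  have uni: "a = (\<Oplus>\<^sub>R i\<in>I. \<phi> i (f (p i)))" if a: "a \<in> ?S" for a using a by (elim CollectE exE conjE) (erule trans, rule val)
  show ?thesis unfolding trace_on_def by (rule the_elem_eqI[OF mem uni])
qed

section \<open>Freeness of finitely generated projective modules over a principal ideal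
  domain\<close>

definition orthonormal :: "('r, 'z) ring_scheme \<Rightarrow> 'i set \<Rightarrow> ('i \<Rightarrow> 'm) \<Rightarrow> ('i \<Rightarrow> 'm \<Rightarrow> 'r) \<Rightarrow> bool" where
  "orthonormal R I w \<psi> \<longleftrightarrow> (\<forall>i\<in>I. \<forall>j\<in>I. \<psi> i (w j) = (if i = j then \<one>\<^sub>R else \<zero>\<^sub>R))"

lemma orthonormal_basis:
  assumes P: "left_module R P" and nz: "\<one>\<^sub>R \<noteq> \<zero>\<^sub>R" and fr: "frame R P I w \<psi>" and o: "orthonormal R I w \<psi>"
  shows "finite_basis R P (w ` I)" "inj_on w I"
proof -
  interpret R: ring R by (rule lm_ring[OF P])
  interpret P: abelian_group P by (rule lm_ag[OF P])
  have agR: "abelian_group R" by (rule R.abelian_group_axioms)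
  have agP: "abelian_group P" by (rule P.abelian_group_axioms)
  have ort: "\<psi> i (w j) = (if i = j then \<one>\<^sub>R else \<zero>\<^sub>R)" if "i \<in> I" "j \<in> I" for i j using o that by (auto simp: orthonormal_def)
  show inj: "inj_on w I"
  proof (rule inj_onI)
    fix i j assume ij: "i \<in> I" "j \<in> I" "w i = w j"
    then show "i = j" using ort[of i i] ort[of i j] nz by (auto split: if_splits)
  qed
  have wP: "i \<in> I \<Longrightarrow> w i \<in> carrier P" for i by (rule frame_elt[OF fr])
  have re: "(\<Oplus>\<^sub>P x\<in>w ` I. c x \<odot>\<^sub>P x) = (\<Oplus>\<^sub>P i\<in>I. c (w i) \<odot>\<^sub>P w i)" if "\<And>i. i \<in> I \<Longrightarrow> c (w i) \<in> carrier R" for c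
    using that wP lm_smult[OF P] by (intro P.finsum_reindex inj) auto
  have co: "\<psi> j (\<Oplus>\<^sub>P i\<in>I. d i \<odot>\<^sub>P w i) = d j" if d: "\<And>i. i \<in> I \<Longrightarrow> d i \<in> carrier R" and j: "j \<in> I" for d j
  proof -
    have "\<psi> j (\<Oplus>\<^sub>P i\<in>I. d i \<odot>\<^sub>P w i) = (\<Oplus>\<^bsub>regular R\<^esub>i\<in>I. \<psi> j (d i \<odot>\<^sub>P w i))"
      by (rule addmap_fs[OF agP lm_ag[OF left_module_regular[OF R.ring_axioms]] linmap_addmap[OF frame_fun[OF fr j]]])
         (use d wP lm_smult[OF P] in auto)
    also have "\<dots> = (\<Oplus>\<^sub>R i\<in>I. \<psi> j (d i \<odot>\<^sub>P w i))" by (rule fs_same[OF lm_ag[OF left_module_regular[OF R.ring_axioms]] agR])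
         (use d wP lm_smult[OF P] frame_coeff[OF fr j] in auto)
    also have "\<dots> = (\<Oplus>\<^sub>R i\<in>I. if i = j then d i else \<zero>\<^sub>R)"
      by (rule fs_cong[OF agR]) (use d wP j linmap_smult[OF frame_fun[OF fr j]] ort in auto)
    also have "\<dots> = d j" by (rule fs_delta[OF agR frame_finite[OF fr] j]) (use d j in auto)
    finally show ?thesis .
  qed
  show "finite_basis R P (w ` I)" unfolding finite_basis_def
  proof (intro conjI ballI)
    show "finite (w ` I)" using frame_finite[OF fr] by simp
    show "w ` I \<subseteq> carrier P" using wP by auto
    fix m assume m: "m \<in> carrier P"
    show "\<exists>!c. c \<in> w ` I \<rightarrow>\<^sub>E carrier R \<and> m = (\<Oplus>\<^sub>P x\<in>w ` I. c x \<odot>\<^sub>P x)"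
    proof (rule ex1I)
      let ?c = "\<lambda>x\<in>w ` I. \<psi> (the_inv_into I w x) m"
      have cw: "?c (w i) = \<psi> i m" if "i \<in> I" for i using that by (simp add: the_inv_into_f_f[OF inj])
      have "(\<Oplus>\<^sub>P x\<in>w ` I. ?c x \<odot>\<^sub>P x) = (\<Oplus>\<^sub>P i\<in>I. ?c (w i) \<odot>\<^sub>P w i)" by (rule re) (use cw frame_coeff[OF fr _ m] in simp)
      also have "\<dots> = (\<Oplus>\<^sub>P i\<in>I. \<psi> i m \<odot>\<^sub>P w i)"
        by (rule fs_cong[OF agP]) (use cw frame_coeff[OF fr _ m] wP lm_smult[OF P] in auto)
      also have "\<dots> = m" by (rule frame_sum[OF fr m])
      finally show "?c \<in> w ` I \<rightarrow>\<^sub>E carrier R \<and> m = (\<Oplus>\<^sub>P x\<in>w ` I. ?c x \<odot>\<^sub>P x)" using cw frame_coeff[OF fr _ m] by auto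
      fix c assume c: "c \<in> w ` I \<rightarrow>\<^sub>E carrier R \<and> m = (\<Oplus>\<^sub>P x\<in>w ` I. c x \<odot>\<^sub>P x)"
      have cc: "i \<in> I \<Longrightarrow> c (w i) \<in> carrier R" for i using c by (auto dest: PiE_mem)
      have "m = (\<Oplus>\<^sub>P i\<in>I. c (w i) \<odot>\<^sub>P w i)" using re[of c, OF cc] c by simp
      then have "\<psi> i m = c (w i)" if "i \<in> I" for i using co[OF cc that] by simp
      then show "c = ?c" using c cw by (intro PiE_ext[of c "w ` I" "\<lambda>_. carrier R" ?c]) (auto simp: cw cc)
    qed
  qed
qed

text \<open>The n functionals embed P in a free module of rank n, and the classical induction on n
  applies: the image of the last functional is a principal ideal, and P is either its kernel or the
  kernel plus one free generator lying above a generator of the ideal.\<close>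

lemma pid_free:
  assumes R: "principal_domain R"
  shows "left_module R P \<Longrightarrow> (\<And>k. k < (n::nat) \<Longrightarrow> \<phi> k \<in> linmap R P (regular R)) \<Longrightarrow>
    (\<And>x. x \<in> carrier P \<Longrightarrow> (\<And>k. k < n \<Longrightarrow> \<phi> k x = \<zero>\<^sub>R) \<Longrightarrow> x = \<zero>\<^sub>P) \<Longrightarrow>
    \<exists>(m::nat) w \<psi>. frame R P {..<m} w \<psi> \<and> orthonormal R {..<m} w \<psi>"
proof (induction n arbitrary: P)
  case 0
  have agP: "abelian_group P" by (rule lm_ag[OF 0(1)])
  have "frame R P {..<0::nat} w \<psi>" for w \<psi> using 0 agP by (auto simp: frame_def)
  then show ?case by (metis lessThan_0 empty_iff orthonormal_def)
next
  case (Suc n)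
  interpret R: principal_domain R by fact
  have agR: "abelian_group R" by (rule R.abelian_group_axioms)
  note P = Suc.prems(1)
  have agP: "abelian_group P" by (rule lm_ag[OF P])
  interpret P: abelian_group P by fact
  have \<phi>n: "\<phi> n \<in> linmap R P (regular R)" using Suc.prems(2) by simp
  note \<phi>nc = linmap_closed[OF \<phi>n, simplified]
  note \<phi>na = linmap_add[OF \<phi>n, simplified]
  note \<phi>ns = linmap_smult[OF \<phi>n, simplified]
  have \<phi>n0: "\<phi> n \<zero>\<^sub>P = \<zero>\<^sub>R"
    using addmap_zero[OF agP lm_ag[OF left_module_regular[OF R.ring_axioms]] linmap_addmap[OF \<phi>n]] by simp
  \<comment> \<open>The kernel of the last functional; on it the remaining n functionals still
    separate points.\<close>
  define N where "N = P\<lparr>carrier := {x \<in> carrier P. \<phi> n x = \<zero>\<^sub>R}\<rparr>"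
  have Ns: "carrier N = {x \<in> carrier P. \<phi> n x = \<zero>\<^sub>R}" "add N = add P" "ring.zero N = ring.zero P" "smult N = smult P"
    by (simp_all add: N_def)
  have \<phi>nneg: "\<phi> n (\<ominus>\<^sub>P x) = \<ominus>\<^sub>R \<phi> n x" if "x \<in> carrier P" for x
    using addmap_neg[of P R "\<phi> n" x] agP agR that \<phi>nc \<phi>na by (auto simp: addmap_def)
  have agN: "abelian_group N"
  proof (rule abelian_groupI; unfold Ns)
    fix x assume "x \<in> {x \<in> carrier P. \<phi> n x = \<zero>\<^sub>R}"
    then show "\<exists>y\<in>{x \<in> carrier P. \<phi> n x = \<zero>\<^sub>R}. y \<oplus>\<^sub>P x = \<zero>\<^sub>P"
      by (intro bexI[of _ "\<ominus>\<^sub>P x"]) (auto simp: P.l_neg \<phi>nneg ag_neg_zero[OF agR])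
  qed (auto simp: \<phi>na \<phi>n0 P.a_ac)
  have N: "left_module R N" by (rule left_moduleI[OF R.ring_axioms agN])
       (auto simp: Ns \<phi>ns lm_smult[OF P] left_module.lm_l_distr[OF P] left_module.lm_r_distr[OF P]
         left_module.lm_assoc[OF P] left_module.lm_one[OF P])
  have incl: "(\<lambda>x. x) \<in> addmap N P" by (rule addmapI) (auto simp: Ns)
  have fsN: "finsum N x I = finsum P x I" if "\<And>i. i \<in> I \<Longrightarrow> x i \<in> carrier N" for x and I :: "nat set"
    using addmap_fs[OF agN agP incl, of I x] that by simp
  have \<phi>N: "k < n \<Longrightarrow> \<phi> k \<in> linmap R N (regular R)" for k using Suc.prems(2)[of k] by (auto simp: linmap_def addmap_def Ns)
  have "\<exists>(m::nat) w \<psi>. frame R N {..<m} w \<psi> \<and> orthonormal R {..<m} w \<psi>"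
  proof (rule Suc.IH[OF N \<phi>N])
    fix x assume x: "x \<in> carrier N" and z: "\<And>k. k < n \<Longrightarrow> \<phi> k x = \<zero>\<^sub>R"
    show "x = \<zero>\<^sub>N" unfolding Ns
    proof (rule Suc.prems(3))
      fix k assume "k < Suc n" then show "\<phi> k x = \<zero>\<^sub>R" using z x by (auto simp: less_Suc_eq Ns)
    qed (use x in "simp add: Ns")
  qed
  then obtain m :: nat and w \<psi> where fN: "frame R N {..<m} w \<psi>" and oN: "orthonormal R {..<m} w \<psi>" by blast
  have "ideal (\<phi> n ` carrier P) R"
  proof (rule idealI[OF R.ring_axioms])
    show "subgroup (\<phi> n ` carrier P) (add_monoid R)"
    proof (rule R.add.subgroupI)
      fix a b assume "a \<in> \<phi> n ` carrier P" "b \<in> \<phi> n ` carrier P"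
      then show "a \<oplus>\<^sub>R b \<in> \<phi> n ` carrier P" by (auto simp: \<phi>na[symmetric])
    next
      fix a assume "a \<in> \<phi> n ` carrier P"
      then show "\<ominus>\<^sub>R a \<in> \<phi> n ` carrier P" by (auto simp: \<phi>nneg[symmetric])
    qed (use \<phi>nc P.zero_closed in auto)
    fix a x assume "a \<in> \<phi> n ` carrier P" and x: "x \<in> carrier R"
    then obtain y where y: "y \<in> carrier P" "a = \<phi> n y" by auto
    show "x \<otimes>\<^sub>R a \<in> \<phi> n ` carrier P" using \<phi>ns[OF x y(1)] y lm_smult[OF P x y(1)] by (metis image_eqI)
    then show "a \<otimes>\<^sub>R x \<in> \<phi> n ` carrier P" using R.m_comm[OF x \<phi>nc[OF y(1)]] y by simp
  qed
  then obtain g where g: "g \<in> carrier R" "\<phi> n ` carrier P = PIdl\<^bsub>R\<^esub> g" using R.exists_gen by blast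
  show ?case
  proof (cases "g = \<zero>\<^sub>R")
    case True
    then have "\<phi> n x = \<zero>\<^sub>R" if "x \<in> carrier P" for x using g that by (auto simp: cgenideal_def)
    then have c: "carrier N = carrier P" by (auto simp: Ns)
    have "frame R P {..<m} w \<psi>" unfolding frame_def
    proof (intro conjI ballI)
      fix i assume i: "i \<in> {..<m}"
      show "w i \<in> carrier P" using frame_elt[OF fN i] c by simp
      show "\<psi> i \<in> linmap R P (regular R)" using frame_fun[OF fN i] unfolding linmap_def addmap_def c Ns(2,3,4) .
    next
      fix x assume x: "x \<in> carrier P"
      then have xN: "x \<in> carrier N" using c by simp
      have "(\<Oplus>\<^sub>P i\<in>{..<m}. \<psi> i x \<odot>\<^sub>N w i) = (\<Oplus>\<^sub>N i\<in>{..<m}. \<psi> i x \<odot>\<^sub>N w i)"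
        by (rule fsN[symmetric], rule lm_smult[OF N frame_coeff[OF fN _ xN] frame_elt[OF fN]])
      then show "(\<Oplus>\<^sub>P i\<in>{..<m}. \<psi> i x \<odot>\<^sub>P w i) = x" using frame_sum[OF fN xN] by (simp add: Ns)
    qed simp
    then show ?thesis using oN by blast
  next
    case False
    have "g \<in> \<phi> n ` carrier P" using g R.cgenideal_self by simp
    then obtain p0 where p0: "p0 \<in> carrier P" "\<phi> n p0 = g" by auto
    have ex: "\<exists>r\<in>carrier R. \<phi> n x = r \<otimes>\<^sub>R g" if "x \<in> carrier P" for x using that g(2) by (auto simp: cgenideal_def)
    have canc: "r = r'" if "r \<in> carrier R" "r' \<in> carrier R" "r \<otimes>\<^sub>R g = r' \<otimes>\<^sub>R g" for r r'
      using R.m_rcancel[OF False g(1) that(1,2)] that(3) by simp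
    \<comment> \<open>The last functional divided by the generator g of its image; the quotient is
      unique, hence linear, because g cancels.\<close>
    define \<psi>0 where "\<psi>0 x = (SOME r. r \<in> carrier R \<and> \<phi> n x = r \<otimes>\<^sub>R g)" for x
    have \<psi>0: "\<psi>0 x \<in> carrier R" "\<phi> n x = \<psi>0 x \<otimes>\<^sub>R g" if "x \<in> carrier P" for x
      using someI_ex[of "\<lambda>r. r \<in> carrier R \<and> \<phi> n x = r \<otimes>\<^sub>R g"] ex[OF that] by (auto simp: \<psi>0_def)
    have \<psi>0u: "\<psi>0 x = r" if "x \<in> carrier P" "r \<in> carrier R" "\<phi> n x = r \<otimes>\<^sub>R g" for x r using canc \<psi>0[OF that(1)] that by metis
    have \<psi>0l: "\<psi>0 \<in> linmap R P (regular R)"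
    proof (rule linmapI)
      fix x y assume x: "x \<in> carrier P" and y: "y \<in> carrier P"
      show "\<psi>0 (x \<oplus>\<^sub>P y) = \<psi>0 x \<oplus>\<^bsub>regular R\<^esub> \<psi>0 y" unfolding regular_simps
        by (rule \<psi>0u) (use x y \<psi>0[OF x] \<psi>0[OF y] \<phi>na[OF x y] g(1) in "auto simp: R.l_distr simp flip: \<psi>0(2)")
    next
      fix a x assume a: "a \<in> carrier R" and x: "x \<in> carrier P"
      show "\<psi>0 (a \<odot>\<^sub>P x) = a \<odot>\<^bsub>regular R\<^esub> \<psi>0 x" unfolding regular_simps
        by (rule \<psi>0u) (use a x \<psi>0[OF x] \<phi>ns[OF a x] g(1) lm_smult[OF P a x] in "auto simp: R.m_assoc simp flip: \<psi>0(2)")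
    qed (use \<psi>0 in simp)
    have \<psi>0N: "\<psi>0 x = \<zero>\<^sub>R" if "x \<in> carrier N" for x using that g(1) by (intro \<psi>0u) (auto simp: Ns)
    have \<psi>0p: "\<psi>0 p0 = \<one>\<^sub>R" using p0 g(1) by (intro \<psi>0u) auto
    \<comment> \<open>The projection onto the kernel along \<open>p0\<close>, which works because
      \<open>\<psi>0 p0\<close> is 1.\<close>
    define \<pi> where "\<pi> x = x \<ominus>\<^sub>P \<psi>0 x \<odot>\<^sub>P p0" for x
    have \<pi>N: "\<pi> x \<in> carrier N" if x: "x \<in> carrier P" for x
    proof -
      have sp: "\<psi>0 x \<odot>\<^sub>P p0 \<in> carrier P" using \<psi>0[OF x] p0 lm_smult[OF P] by blast
      have "\<phi> n (\<pi> x) = \<phi> n x \<ominus>\<^sub>R \<phi> n (\<psi>0 x \<odot>\<^sub>P p0)"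
        unfolding \<pi>_def using addmap_diff[of P R "\<phi> n"] agP agR x sp \<phi>nc \<phi>na by (auto simp: addmap_def)
      also have "\<dots> = \<zero>\<^sub>R" using \<psi>0[OF x] p0 \<phi>ns[of "\<psi>0 x" p0] g(1) agR by simp
      finally show ?thesis using x sp agP by (simp add: Ns \<pi>_def)
    qed
    have \<pi>_lin: "\<pi> \<in> linmap R P N"
    proof (rule linmapI[OF \<pi>N])
      fix x y assume x: "x \<in> carrier P" and y: "y \<in> carrier P"
      show "\<pi> (x \<oplus>\<^sub>P y) = \<pi> x \<oplus>\<^sub>N \<pi> y" using x y \<psi>0[OF x] \<psi>0[OF y] p0 linmap_add[OF \<psi>0l x y] lm_smult[OF P]
        by (simp add: \<pi>_def Ns left_module.lm_l_distr[OF P] ag_diff_add4[OF agP])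
    next
      fix a x assume a: "a \<in> carrier R" and x: "x \<in> carrier P"
      show "\<pi> (a \<odot>\<^sub>P x) = a \<odot>\<^sub>N \<pi> x" using a x \<psi>0[OF x] p0 linmap_smult[OF \<psi>0l a x] lm_smult[OF P]
        by (simp add: \<pi>_def Ns left_module.lm_assoc[OF P] lm_diff_r[OF P])
    qed
    define w' where "w' i = (if i < m then w i else p0)" for i
    define \<psi>' where "\<psi>' i x = (if i < m then \<psi> i (\<pi> x) else \<psi>0 x)" for i x
    have wN: "i < m \<Longrightarrow> w i \<in> carrier N" for i using frame_elt[OF fN] by simp
    have wP: "i < m \<Longrightarrow> w i \<in> carrier P" for i using wN by (simp add: Ns)
    have \<psi>c: "i < m \<Longrightarrow> x \<in> carrier P \<Longrightarrow> \<psi> i (\<pi> x) \<in> carrier R" for i x using frame_coeff[OF fN _ \<pi>N] by simp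
    have "frame R P {..<Suc m} w' \<psi>'" unfolding frame_def
    proof (intro conjI ballI)
      fix i assume "i \<in> {..<Suc m}"
      show "w' i \<in> carrier P" using wP p0 by (simp add: w'_def)
      show "\<psi>' i \<in> linmap R P (regular R)" using linmap_comp[OF \<pi>_lin frame_fun[OF fN, of i]] \<psi>0l
        by (cases "i < m") (auto simp: \<psi>'_def[abs_def])
    next
      fix x assume x: "x \<in> carrier P"
      have "(\<Oplus>\<^sub>P i\<in>insert m {..<m}. \<psi>' i x \<odot>\<^sub>P w' i) = \<psi>' m x \<odot>\<^sub>P w' m \<oplus>\<^sub>P (\<Oplus>\<^sub>P i\<in>{..<m}. \<psi>' i x \<odot>\<^sub>P w' i)"
        by (rule fs_insert[OF agP]) (use lm_smult[OF P] \<psi>0[OF x] p0 wP \<psi>c[OF _ x] in "auto simp: \<psi>'_def w'_def")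
      also have "(\<Oplus>\<^sub>P i\<in>{..<m}. \<psi>' i x \<odot>\<^sub>P w' i) = (\<Oplus>\<^sub>P i\<in>{..<m}. \<psi> i (\<pi> x) \<odot>\<^sub>N w i)" by (rule fs_cong[OF agP])
           (use lm_smult[OF P] wP \<psi>c[OF _ x] in "auto simp: \<psi>'_def w'_def Ns")
      also have "\<dots> = (\<Oplus>\<^sub>N i\<in>{..<m}. \<psi> i (\<pi> x) \<odot>\<^sub>N w i)" by (rule fsN[symmetric]) (use lm_smult[OF N] wN \<psi>c[OF _ x] in auto)
      also have "\<dots> = \<pi> x" by (rule frame_sum[OF fN \<pi>N[OF x]])
      also have "\<psi>' m x \<odot>\<^sub>P w' m \<oplus>\<^sub>P \<pi> x = x"
      proof -
        have sp: "\<psi>0 x \<odot>\<^sub>P p0 \<in> carrier P" using \<psi>0[OF x] p0 lm_smult[OF P] by blast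
        show ?thesis using ag_diff_add_cancel[OF agP x sp] P.a_comm[OF sp, of "\<pi> x"] ag_diff[OF agP x sp]
          by (simp add: \<psi>'_def w'_def \<pi>_def)
      qed
      finally show "(\<Oplus>\<^sub>P i\<in>{..<Suc m}. \<psi>' i x \<odot>\<^sub>P w' i) = x" by (simp add: lessThan_Suc)
    qed simp
    moreover have "orthonormal R {..<Suc m} w' \<psi>'" unfolding orthonormal_def
    proof (intro ballI)
      fix i j assume i: "i \<in> {..<Suc m}" and j: "j \<in> {..<Suc m}"
      have \<pi>w: "\<pi> x = x" if "x \<in> carrier N" for x using that \<psi>0N[OF that] p0 lm_zero_l[OF P] agP by (simp add: \<pi>_def Ns)
      have \<pi>p: "\<pi> p0 = \<zero>\<^sub>P" using p0 \<psi>0p left_module.lm_one[OF P] agP by (simp add: \<pi>_def)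
      have \<psi>z: "\<psi> i \<zero>\<^sub>P = \<zero>\<^sub>R" if "i < m"
        using addmap_zero[OF agN lm_ag[OF left_module_regular[OF R.ring_axioms]] linmap_addmap[OF frame_fun[OF fN, of i]]] that
        by (simp add: Ns)
      show "\<psi>' i (w' j) = (if i = j then \<one>\<^sub>R else \<zero>\<^sub>R)" using i j oN wN \<psi>0N \<psi>0p
        by (auto simp: \<psi>'_def w'_def orthonormal_def \<pi>w \<pi>p \<psi>z)
    qed
    ultimately show ?thesis by blast
  qed
qed

text \<open>The functionals of a frame separate points, which is what \<open>pid_free\<close> asks
  for.\<close>

lemma frame_fg_free:
  assumes R: "principal_domain R" and P: "left_module R P" and fr: "frame R P I p \<phi>"
  shows "fg_free R P"
proof -
  obtain p' \<phi>' where f: "frame R P {..<card I} p' \<phi>'" by (rule frame_nat[OF P fr])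
  have z: "x = \<zero>\<^sub>P" if x: "x \<in> carrier P" and "\<And>k. k < card I \<Longrightarrow> \<phi>' k x = \<zero>\<^sub>R" for x
  proof -
    have "x = (\<Oplus>\<^sub>P k\<in>{..<card I}. \<phi>' k x \<odot>\<^sub>P p' k)" using frame_sum[OF f x] by simp
    also have "\<dots> = (\<Oplus>\<^sub>P k\<in>{..<card I}. \<zero>\<^sub>P)" by (rule fs_cong[OF lm_ag[OF P]])
         (use that(2) lm_zero_l[OF P] frame_elt[OF f] lm_ag[OF P] in auto)
    finally show ?thesis using lm_ag[OF P] by simp
  qed
  have "\<exists>(m::nat) w \<psi>. frame R P {..<m} w \<psi> \<and> orthonormal R {..<m} w \<psi>"
    by (rule pid_free[OF R P, of "card I" \<phi>']) (use frame_fun[OF f] z in auto)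
  moreover have "\<one>\<^sub>R \<noteq> \<zero>\<^sub>R" using R by (simp add: principal_domain_def domain_def domain_axioms_def)
  ultimately show ?thesis unfolding fg_free_def using orthonormal_basis(1)[OF P] by blast
qed

section \<open>Symmetric algebras\<close>

lemma dual_simps [simp]: "carrier (dual \<O> A M) = lin_hom \<O> (restrict_scalars A M) (regular \<O>)"
  "ring.zero (dual \<O> A M) = (\<lambda>m\<in>carrier M. \<zero>\<^sub>\<O>)" "add (dual \<O> A M) = (\<lambda>f g. \<lambda>m\<in>carrier M. f m \<oplus>\<^sub>\<O> g m)"
  "smult (dual \<O> A M) = (\<lambda>b f. \<lambda>m\<in>carrier M. f (rsmult M m b))" "rsmult (dual \<O> A M) = (\<lambda>f a. \<lambda>m\<in>carrier M. f (a \<odot>\<^sub>M m))"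
  by (simp_all add: dual_def)

lemma fs_const:
  assumes "abelian_group G" "c \<in> carrier G"
  shows "finsum G (\<lambda>i. c) I = add_pow G (card I) c"
proof -
  interpret abelian_group G by fact
  show ?thesis by (rule add.finprod_const[OF assms(2)])
qed

lemma rg_add_pow_l:
  assumes "ring R" "c \<in> carrier R"
  shows "add_pow R (m::nat) c = add_pow R m \<one>\<^sub>R \<otimes>\<^sub>R c"
proof -
  interpret ring R by fact
  show ?thesis using add_pow_ldistr[of "\<one>\<^sub>R" c m] assms(2) by simp
qed

locale algebra_over = assoc_algebra \<O> A for \<O> :: "'k ring" and A :: "('k, 'a) module"
begin

abbreviation RS :: "('a, 'w, 'z) module_scheme \<Rightarrow> ('k, 'w) module" where
  "RS \<equiv> restrict_scalars A"

abbreviation is_mod :: "('a, 'w) module \<Rightarrow> bool" where "is_mod \<equiv> left_module A"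

lemma cringO: "cring \<O>" by (rule R.is_cring)

lemma ringO: "ring \<O>" using cringO by (rule cring.axioms)

lemma ringA: "ring A" by (rule ring_axioms)

lemma agO [simp]: "abelian_group \<O>" by (rule ring_ag[OF ringO])

lemma agA [simp]: "abelian_group A" by (rule ring_ag[OF ringA])

lemma lmA: "left_module \<O> A" by (rule left_moduleI[OF ringO agA]) (auto simp: smult_l_distr smult_r_distr smult_assoc1)

lemma lmO: "left_module \<O> (regular \<O>)" by (rule left_module_regular[OF ringO])

lemma smult_one_mult: "c \<in> carrier \<O> \<Longrightarrow> x \<in> carrier A \<Longrightarrow> (c \<odot>\<^sub>A \<one>\<^sub>A) \<otimes>\<^sub>A x = c \<odot>\<^sub>A x" by (simp add: smult_mult_l)

lemma lm_rs:
  assumes U: "left_module A U" shows "left_module \<O> (RS U)"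
proof -
  have agU: "abelian_group U" by (rule lm_ag[OF U])
  have ag: "abelian_group (RS U)" by (rule ag_same[OF agU]) simp_all
  have c1: "c \<in> carrier \<O> \<Longrightarrow> c \<odot>\<^sub>A \<one>\<^sub>A \<in> carrier A" for c by simp
  show ?thesis
  proof (rule left_moduleI[OF ringO ag]; unfold restrict_scalars_simps)
    fix a b x assume "a \<in> carrier \<O>" "b \<in> carrier \<O>" "x \<in> carrier U"
    then show "((a \<oplus>\<^sub>\<O> b) \<odot>\<^sub>A \<one>\<^sub>A) \<odot>\<^sub>U x = (a \<odot>\<^sub>A \<one>\<^sub>A) \<odot>\<^sub>U x \<oplus>\<^sub>U (b \<odot>\<^sub>A \<one>\<^sub>A) \<odot>\<^sub>U x"
      by (simp add: smult_l_distr left_module.lm_l_distr[OF U])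
    show "((a \<otimes>\<^sub>\<O> b) \<odot>\<^sub>A \<one>\<^sub>A) \<odot>\<^sub>U x = (a \<odot>\<^sub>A \<one>\<^sub>A) \<odot>\<^sub>U ((b \<odot>\<^sub>A \<one>\<^sub>A) \<odot>\<^sub>U x)" using \<open>a \<in> _\<close> \<open>b \<in> _\<close> \<open>x \<in> _\<close>
      by (simp add: left_module.lm_assoc[OF U, symmetric] smult_one_mult smult_assoc1)
  qed (use U c1 in "auto simp: left_module.lm_r_distr[OF U] left_module.lm_one[OF U]")
qed

lemma linmap_rs: "f \<in> linmap A U V \<Longrightarrow> f \<in> linmap \<O> (RS U) (RS V)"
  by (auto simp: linmap_def addmap_def)

lemma linmap_rs_reg:
  assumes f: "f \<in> linmap A U (regular A)" shows "f \<in> linmap \<O> (RS U) A"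
proof (rule linmapI)
  fix c x assume c: "c \<in> carrier \<O>" and x: "x \<in> carrier (RS U)"
  show "f (c \<odot>\<^bsub>RS U\<^esub> x) = c \<odot>\<^sub>A f x" using linmap_smult[OF f, of "c \<odot>\<^sub>A \<one>\<^sub>A" x] linmap_closed[OF f, of x] c x
    by (simp add: smult_one_mult)
qed (use linmap_closed[OF f] linmap_add[OF f] in auto)

lemma agU_rs: "left_module A U \<Longrightarrow> abelian_group (RS U)" by (rule lm_ag[OF lm_rs])

lemma rs_smult_comm:
  assumes "left_module A U" "c \<in> carrier \<O>" "a \<in> carrier A" "u \<in> carrier U"
  shows "a \<odot>\<^sub>U ((c \<odot>\<^sub>A \<one>\<^sub>A) \<odot>\<^sub>U u) = (c \<odot>\<^sub>A \<one>\<^sub>A) \<odot>\<^sub>U (a \<odot>\<^sub>U u)"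
  using assms by (simp add: left_module.lm_assoc[symmetric] smult_mult_l smult_mult_r)

lemma lm_rs_smult_linmap:
  assumes U: "left_module A U" and a: "a \<in> carrier A"
  shows "(\<lambda>u. a \<odot>\<^sub>U u) \<in> linmap \<O> (RS U) (RS U)"
  by (rule linmapI) (use assms in "auto simp: left_module.lm_r_distr[OF U] rs_smult_comm[OF U]")

end

locale sym_alg = algebra_over \<O> A for \<O> :: "'k ring" and A :: "('k, 'a) module" +
  fixes s :: "'a \<Rightarrow> 'k"
  assumes pid: "principal_domain \<O>" and A_proj: "fg_projective \<O> A" and sform: "symmetrising_form \<O> A s"
begin

lemma rs_regular_bimodule: "lin_hom \<O> (RS (regular_bimodule A)) N = lin_hom \<O> A N"
  by (auto simp: lin_hom_def smult_one_mult)

text \<open>Left linearity of the bimodule isomorphism gives \<Phi>(a) = s(- a), right linearity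
  gives \<Phi>(a) = s(a -). Comparing the two yields symmetry, and bijectivity yields the two halves
  of non-degeneracy.\<close>

lemma form_props:
  shows s_lin: "s \<in> linmap \<O> A (regular \<O>)"
    and s_sym: "\<And>a b. a \<in> carrier A \<Longrightarrow> b \<in> carrier A \<Longrightarrow> s (a \<otimes>\<^sub>A b) = s (b \<otimes>\<^sub>A a)"
    and s_surj: "\<And>g. g \<in> lin_hom \<O> A (regular \<O>) \<Longrightarrow> \<exists>x\<in>carrier A. \<forall>a\<in>carrier A. g a = s (a \<otimes>\<^sub>A x)"
    and s_inj: "\<And>x y. x \<in> carrier A \<Longrightarrow> y \<in> carrier A \<Longrightarrow> (\<And>a. a \<in> carrier A \<Longrightarrow> s (a \<otimes>\<^sub>A x) = s (a \<otimes>\<^sub>A y)) \<Longrightarrow> x = y"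
proof -
  let ?D = "dual \<O> A (regular_bimodule A)"
  obtain \<Phi> where \<Phi>: "\<Phi> \<in> lin_hom A (regular_bimodule A) ?D" and bij: "bij_betw \<Phi> (carrier A) (carrier ?D)"
    and \<Phi>r: "\<And>x a. x \<in> carrier A \<Longrightarrow> a \<in> carrier A \<Longrightarrow> \<Phi> (x \<otimes>\<^sub>A a) = rsmult ?D (\<Phi> x) a" and s: "s = \<Phi> \<one>\<^sub>A"
    using sform by (auto simp: symmetrising_form_def)
  have \<Phi>l: "\<Phi> (x \<otimes>\<^sub>A a) = smult ?D x (\<Phi> a)" if "x \<in> carrier A" "a \<in> carrier A" for x a
    using lin_hom_smult[OF \<Phi>, of x a] that by simp
  have 1: "\<Phi> a = (\<lambda>m\<in>carrier A. s (m \<otimes>\<^sub>A a))" if a: "a \<in> carrier A" for a using \<Phi>l[OF a one_closed] a s by simp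
  have 2: "\<Phi> a = (\<lambda>m\<in>carrier A. s (a \<otimes>\<^sub>A m))" if a: "a \<in> carrier A" for a using \<Phi>r[OF one_closed a] a s by simp
  have "s \<in> carrier ?D" using lin_hom_closed[OF \<Phi>, of "\<one>\<^sub>A"] s by simp
  then show "s \<in> linmap \<O> A (regular \<O>)" by (simp add: rs_regular_bimodule lin_hom_linmap)
  show "s (a \<otimes>\<^sub>A b) = s (b \<otimes>\<^sub>A a)" if "a \<in> carrier A" "b \<in> carrier A" for a b
    using 1[OF that(2)] 2[OF that(2)] that by (metis restrict_apply')
  show "\<exists>x\<in>carrier A. \<forall>a\<in>carrier A. g a = s (a \<otimes>\<^sub>A x)" if g: "g \<in> lin_hom \<O> A (regular \<O>)" for g
  proof -
    have "g \<in> \<Phi> ` carrier A" using bij g by (simp add: bij_betw_def rs_regular_bimodule)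
    then show ?thesis using 1 by auto
  qed
  show "x = y" if x: "x \<in> carrier A" and y: "y \<in> carrier A" and e: "\<And>a. a \<in> carrier A \<Longrightarrow> s (a \<otimes>\<^sub>A x) = s (a \<otimes>\<^sub>A y)" for x y
  proof -
    have "\<Phi> x = \<Phi> y" unfolding 1[OF x] 1[OF y] using e by auto
    then show ?thesis using bij x y by (auto simp: bij_betw_def inj_on_def)
  qed
qed

lemma s_closed [simp]: "a \<in> carrier A \<Longrightarrow> s a \<in> carrier \<O>" using linmap_closed[OF s_lin] by simp

lemma s_add: "a \<in> carrier A \<Longrightarrow> b \<in> carrier A \<Longrightarrow> s (a \<oplus>\<^sub>A b) = s a \<oplus>\<^sub>\<O> s b" using linmap_add[OF s_lin] by simp

lemma s_smult: "c \<in> carrier \<O> \<Longrightarrow> a \<in> carrier A \<Longrightarrow> s (c \<odot>\<^sub>A a) = c \<otimes>\<^sub>\<O> s a" using linmap_smult[OF s_lin] by simp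

lemma s_addmap: "s \<in> addmap A \<O>" by (rule addmapI) (auto simp: s_add)

text \<open>The inverse of \<alpha> \<mapsto> s \<circ> \<alpha> from A-linear maps N \<rightarrow>
  A to \<O>-valued functionals on N, described pointwise: \<open>hat N f n\<close> is the element of
  A representing a \<mapsto> f(a n).\<close>

definition hat :: "('a, 'n, 'z) module_scheme \<Rightarrow> ('n \<Rightarrow> 'k) \<Rightarrow> 'n \<Rightarrow> 'a" where
  "hat N f n = (THE x. x \<in> carrier A \<and> (\<forall>a\<in>carrier A. f (a \<odot>\<^sub>N n) = s (a \<otimes>\<^sub>A x)))"

lemma hat_eqI:
  assumes "x \<in> carrier A" "\<And>a. a \<in> carrier A \<Longrightarrow> f (a \<odot>\<^sub>N n) = s (a \<otimes>\<^sub>A x)"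
  shows "hat N f n = x"
  unfolding hat_def by (rule the_equality) (use assms in "auto intro: s_inj")

text \<open>The functional a \<mapsto> f(a n) on A is \<O>-linear, so non-degeneracy of s represents
  it.\<close>

lemma hat_spec:
  assumes N: "left_module A N" and f: "f \<in> linmap \<O> (RS N) (regular \<O>)" and n: "n \<in> carrier N"
  shows "hat N f n \<in> carrier A" "\<And>a. a \<in> carrier A \<Longrightarrow> f (a \<odot>\<^sub>N n) = s (a \<otimes>\<^sub>A hat N f n)"
proof -
  have "(\<lambda>a. f (a \<odot>\<^sub>N n)) \<in> linmap \<O> A (regular \<O>)"
  proof (rule linmapI)
    fix c a assume c: "c \<in> carrier \<O>" and a: "a \<in> carrier A"
    have "(c \<odot>\<^sub>A a) \<odot>\<^sub>N n = (c \<odot>\<^sub>A \<one>\<^sub>A) \<odot>\<^sub>N (a \<odot>\<^sub>N n)"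
      using c a n by (simp add: left_module.lm_assoc[OF N, symmetric] smult_one_mult)
    then show "f ((c \<odot>\<^sub>A a) \<odot>\<^sub>N n) = c \<odot>\<^bsub>regular \<O>\<^esub> f (a \<odot>\<^sub>N n)"
      using linmap_smult[OF f c, of "a \<odot>\<^sub>N n"] a n lm_smult[OF N a n] by simp
  qed (use n linmap_closed[OF f] linmap_add[OF f] lm_smult[OF N] in "auto simp: left_module.lm_l_distr[OF N]")
  then have "(\<lambda>a\<in>carrier A. f (a \<odot>\<^sub>N n)) \<in> lin_hom \<O> A (regular \<O>)" by (rule linmap_restrict[OF lmA])
  from s_surj[OF this] obtain x where x: "x \<in> carrier A" "\<And>a. a \<in> carrier A \<Longrightarrow> f (a \<odot>\<^sub>N n) = s (a \<otimes>\<^sub>A x)" by auto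
  then have "hat N f n = x" by (rule hat_eqI)
  then show "hat N f n \<in> carrier A" "\<And>a. a \<in> carrier A \<Longrightarrow> f (a \<odot>\<^sub>N n) = s (a \<otimes>\<^sub>A hat N f n)" using x by auto
qed

lemma hat_s:
  assumes N: "left_module A N" and f: "f \<in> linmap \<O> (RS N) (regular \<O>)" and n: "n \<in> carrier N"
  shows "s (hat N f n) = f n"
  using hat_spec(2)[OF assms one_closed] hat_spec(1)[OF assms] left_module.lm_one[OF N n] by simp

lemma hat_linmap:
  assumes N: "left_module A N" and f: "f \<in> linmap \<O> (RS N) (regular \<O>)"
  shows "hat N f \<in> linmap A N (regular A)"
proof (rule linmapI)
  note h = hat_spec[OF N f]
  fix x y assume x: "x \<in> carrier N" and y: "y \<in> carrier N"
  show "hat N f x \<in> carrier (regular A)" using h(1)[OF x] by simp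
  show "hat N f (x \<oplus>\<^sub>N y) = hat N f x \<oplus>\<^bsub>regular A\<^esub> hat N f y"
  proof (rule hat_eqI)
    fix a assume a: "a \<in> carrier A"
    have "f (a \<odot>\<^sub>N (x \<oplus>\<^sub>N y)) = f (a \<odot>\<^sub>N x) \<oplus>\<^sub>\<O> f (a \<odot>\<^sub>N y)" using linmap_add[OF f, of "a \<odot>\<^sub>N x" "a \<odot>\<^sub>N y"] a x y lm_smult[OF N]
      by (simp add: left_module.lm_r_distr[OF N])
    then show "f (a \<odot>\<^sub>N (x \<oplus>\<^sub>N y)) = s (a \<otimes>\<^sub>A (hat N f x \<oplus>\<^bsub>regular A\<^esub> hat N f y))"
      using h(1)[OF x] h(1)[OF y] h(2)[OF x a] h(2)[OF y a] a by (simp add: r_distr s_add)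
  qed (use h(1)[OF x] h(1)[OF y] in simp)
next
  note h = hat_spec[OF N f]
  fix b x assume b: "b \<in> carrier A" and x: "x \<in> carrier N"
  show "hat N f (b \<odot>\<^sub>N x) = b \<odot>\<^bsub>regular A\<^esub> hat N f x"
  proof (rule hat_eqI)
    fix a assume a: "a \<in> carrier A"
    show "f (a \<odot>\<^sub>N (b \<odot>\<^sub>N x)) = s (a \<otimes>\<^sub>A (b \<odot>\<^bsub>regular A\<^esub> hat N f x))" using h(1)[OF x] h(2)[OF x, of "a \<otimes>\<^sub>A b"] a b
      by (simp add: left_module.lm_assoc[OF N a b x, symmetric] m_assoc)
  qed (use h(1)[OF x] b in simp)
qed

subsection \<open>Dual bases and the relative projective element\<close>

text \<open>Dual bases reduced to their expansion property, as families over an index set. This is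
  enough for the Casimir identities and is at once a frame of A over \<O>.\<close>

definition dual_frame :: "'i set \<Rightarrow> ('i \<Rightarrow> 'a) \<Rightarrow> ('i \<Rightarrow> 'a) \<Rightarrow> bool" where
  "dual_frame I x y \<longleftrightarrow> finite I \<and> (\<forall>i\<in>I. x i \<in> carrier A \<and> y i \<in> carrier A) \<and>
     (\<forall>a\<in>carrier A. (\<Oplus>\<^sub>A i\<in>I. s (a \<otimes>\<^sub>A y i) \<odot>\<^sub>A x i) = a)"

definition casimir_sum :: "'i set \<Rightarrow> ('i \<Rightarrow> 'a) \<Rightarrow> ('i \<Rightarrow> 'a) \<Rightarrow> 'a" where "casimir_sum I x y = (\<Oplus>\<^sub>A i\<in>I. x i \<otimes>\<^sub>A y i)"

lemma s_mult_linmap: "y \<in> carrier A \<Longrightarrow> (\<lambda>a. s (a \<otimes>\<^sub>A y)) \<in> linmap \<O> A (regular \<O>)"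
  by (rule linmapI) (auto simp: l_distr s_add smult_mult_l s_smult)

lemma dual_frame_frame: "dual_frame I x y \<Longrightarrow> frame \<O> A I x (\<lambda>i a. s (a \<otimes>\<^sub>A y i))"
  by (auto simp: dual_frame_def frame_def s_mult_linmap)

lemma dual_frameD: "dual_frame I x y \<Longrightarrow> finite I" "dual_frame I x y \<Longrightarrow> i \<in> I \<Longrightarrow> x i \<in> carrier A"
  "dual_frame I x y \<Longrightarrow> i \<in> I \<Longrightarrow> y i \<in> carrier A" "dual_frame I x y \<Longrightarrow> a \<in> carrier A \<Longrightarrow> (\<Oplus>\<^sub>A i\<in>I. s (a \<otimes>\<^sub>A y i) \<odot>\<^sub>A x i) = a"
  by (auto simp: dual_frame_def)

lemma mult_addmap_l: "b \<in> carrier A \<Longrightarrow> (\<lambda>a. a \<otimes>\<^sub>A b) \<in> addmap A A" by (rule addmapI) (auto simp: l_distr)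

lemma mult_addmap_r: "b \<in> carrier A \<Longrightarrow> (\<lambda>a. b \<otimes>\<^sub>A a) \<in> addmap A A" by (rule addmapI) (auto simp: r_distr)

text \<open>Tested against s(b -), the coefficients move onto b, where the defining expansion
  applies. The two families may thus exchange roles.\<close>

lemma dual_frame_other:
  assumes d: "dual_frame I x y" and a: "a \<in> carrier A"
  shows "(\<Oplus>\<^sub>A i\<in>I. s (x i \<otimes>\<^sub>A a) \<odot>\<^sub>A y i) = a"
proof (rule s_inj)
  note D = dual_frameD[OF d]
  show cl: "(\<Oplus>\<^sub>A i\<in>I. s (x i \<otimes>\<^sub>A a) \<odot>\<^sub>A y i) \<in> carrier A" using D a by simp
  fix b assume b: "b \<in> carrier A"
  have "s (b \<otimes>\<^sub>A (\<Oplus>\<^sub>A i\<in>I. s (x i \<otimes>\<^sub>A a) \<odot>\<^sub>A y i))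
      = (\<Oplus>\<^sub>\<O> i\<in>I. s (b \<otimes>\<^sub>A (s (x i \<otimes>\<^sub>A a) \<odot>\<^sub>A y i)))"
    by (rule addmap_fs[OF agA agO addmap_comp[OF mult_addmap_r[OF b] s_addmap]]) (use D a in simp)
  also have "\<dots> = (\<Oplus>\<^sub>\<O> i\<in>I. s ((s (b \<otimes>\<^sub>A y i) \<odot>\<^sub>A x i) \<otimes>\<^sub>A a))" by (rule fs_cong[OF agO])
       (use D a b in "auto simp: smult_mult_r smult_mult_l s_smult R.m_comm")
  also have "\<dots> = s ((\<Oplus>\<^sub>A i\<in>I. s (b \<otimes>\<^sub>A y i) \<odot>\<^sub>A x i) \<otimes>\<^sub>A a)"
    by (rule addmap_fs[OF agA agO addmap_comp[OF mult_addmap_l[OF a] s_addmap], symmetric]) (use D b in simp)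
  also have "\<dots> = s (b \<otimes>\<^sub>A a)" using D(4)[OF b] by simp
  finally show "s (b \<otimes>\<^sub>A (\<Oplus>\<^sub>A i\<in>I. s (x i \<otimes>\<^sub>A a) \<odot>\<^sub>A y i)) = s (b \<otimes>\<^sub>A a)" .
qed (rule a)

text \<open>The Casimir element \<open>\<Sum> x\<^sub>i \<otimes> y\<^sub>i\<close> does not depend on the dual frame, and it
  commutes with \<open>A\<close>; here in the form of its image under a biadditive map \<open>\<Psi>\<close>.\<close>

lemma casimir:
  assumes d: "dual_frame I x y" and d': "dual_frame J x' y'" and b: "b \<in> carrier A" and G: "abelian_group G"
    and l: "\<And>v. v \<in> carrier A \<Longrightarrow> (\<lambda>u. \<Psi> u v) \<in> addmap A G" and r: "\<And>u. u \<in> carrier A \<Longrightarrow> (\<lambda>v. \<Psi> u v) \<in> addmap A G"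
    and bal: "\<And>u v c. u \<in> carrier A \<Longrightarrow> v \<in> carrier A \<Longrightarrow> c \<in> carrier \<O> \<Longrightarrow> \<Psi> (c \<odot>\<^sub>A u) v = \<Psi> u (c \<odot>\<^sub>A v)"
  shows "(\<Oplus>\<^sub>G i\<in>I. \<Psi> (b \<otimes>\<^sub>A x i) (y i)) = (\<Oplus>\<^sub>G j\<in>J. \<Psi> (x' j) (y' j \<otimes>\<^sub>A b))"
proof -
  note D = dual_frameD[OF d] and D' = dual_frameD[OF d']
  have cl: "\<Psi> u v \<in> carrier G" if "u \<in> carrier A" "v \<in> carrier A" for u v using addmap_closed[OF l] that by simp
  let ?k = "\<lambda>i j. s ((b \<otimes>\<^sub>A x i) \<otimes>\<^sub>A y' j)"
  have "(\<Oplus>\<^sub>G i\<in>I. \<Psi> (b \<otimes>\<^sub>A x i) (y i)) = (\<Oplus>\<^sub>G i\<in>I. \<Oplus>\<^sub>G j\<in>J. \<Psi> (x' j) (?k i j \<odot>\<^sub>A y i))"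
  proof (rule fs_cong[OF G])
    fix i assume i: "i \<in> I"
    have "\<Psi> (b \<otimes>\<^sub>A x i) (y i) = \<Psi> (\<Oplus>\<^sub>A j\<in>J. ?k i j \<odot>\<^sub>A x' j) (y i)" using D'(4)[of "b \<otimes>\<^sub>A x i"] D i b by simp
    also have "\<dots> = (\<Oplus>\<^sub>G j\<in>J. \<Psi> (?k i j \<odot>\<^sub>A x' j) (y i))" by (rule addmap_fs[OF agA G l]) (use D D' i b in auto)
    also have "\<dots> = (\<Oplus>\<^sub>G j\<in>J. \<Psi> (x' j) (?k i j \<odot>\<^sub>A y i))" by (rule fs_cong[OF G]) (use D D' i b bal cl in auto)
    finally show "\<Psi> (b \<otimes>\<^sub>A x i) (y i) = (\<Oplus>\<^sub>G j\<in>J. \<Psi> (x' j) (?k i j \<odot>\<^sub>A y i))" .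
    show "(\<Oplus>\<^sub>G j\<in>J. \<Psi> (x' j) (?k i j \<odot>\<^sub>A y i)) \<in> carrier G" using D D' i b cl G by (intro fs_closed) auto
  qed
  also have "\<dots> = (\<Oplus>\<^sub>G j\<in>J. \<Oplus>\<^sub>G i\<in>I. \<Psi> (x' j) (?k i j \<odot>\<^sub>A y i))" by (rule fs_swap[OF G D(1)]) (use D D' b cl in auto)
  also have "\<dots> = (\<Oplus>\<^sub>G j\<in>J. \<Psi> (x' j) (y' j \<otimes>\<^sub>A b))"
  proof (rule fs_cong[OF G])
    fix j assume j: "j \<in> J"
    have "(\<Oplus>\<^sub>G i\<in>I. \<Psi> (x' j) (?k i j \<odot>\<^sub>A y i)) = \<Psi> (x' j) (\<Oplus>\<^sub>A i\<in>I. ?k i j \<odot>\<^sub>A y i)"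
      by (rule addmap_fs[OF agA G r, symmetric]) (use D D' j b in auto)
    also have "(\<Oplus>\<^sub>A i\<in>I. ?k i j \<odot>\<^sub>A y i) = (\<Oplus>\<^sub>A i\<in>I. s (x i \<otimes>\<^sub>A (y' j \<otimes>\<^sub>A b)) \<odot>\<^sub>A y i)"
    proof (rule fs_cong[OF agA])
      fix i assume i: "i \<in> I"
      have "?k i j = s (x i \<otimes>\<^sub>A (y' j \<otimes>\<^sub>A b))" using s_sym[of b "x i \<otimes>\<^sub>A y' j"] b D(2)[OF i] D'(3)[OF j] by (simp add: m_assoc)
      then show "?k i j \<odot>\<^sub>A y i = s (x i \<otimes>\<^sub>A (y' j \<otimes>\<^sub>A b)) \<odot>\<^sub>A y i" by simp
    qed (use D D' j b in auto)
    also have "\<dots> = y' j \<otimes>\<^sub>A b" by (rule dual_frame_other[OF d]) (use D' j b in auto)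
    finally show "(\<Oplus>\<^sub>G i\<in>I. \<Psi> (x' j) (?k i j \<odot>\<^sub>A y i)) = \<Psi> (x' j) (y' j \<otimes>\<^sub>A b)" .
    show "\<Psi> (x' j) (y' j \<otimes>\<^sub>A b) \<in> carrier G" using D' j b cl by simp
  qed
  finally show ?thesis .
qed

lemma casimir_sum_closed: "dual_frame I x y \<Longrightarrow> casimir_sum I x y \<in> carrier A"
  unfolding casimir_sum_def by (intro fs_closed) (auto dest: dual_frameD)

text \<open>This is \<open>casimir\<close> for the multiplication of A. With b = 1 it gives
  independence of the dual frame, with equal frames centrality.\<close>

lemma casimir_sum_comm:
  assumes d: "dual_frame I x y" and d': "dual_frame J x' y'" and b: "b \<in> carrier A"
  shows "b \<otimes>\<^sub>A casimir_sum I x y = casimir_sum J x' y' \<otimes>\<^sub>A b"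
proof -
  note D = dual_frameD[OF d] and D' = dual_frameD[OF d']
  have "b \<otimes>\<^sub>A casimir_sum I x y = (\<Oplus>\<^sub>A i\<in>I. b \<otimes>\<^sub>A (x i \<otimes>\<^sub>A y i))" unfolding casimir_sum_def
    by (rule addmap_fs[OF agA agA mult_addmap_r[OF b]]) (use D in auto)
  also have "\<dots> = (\<Oplus>\<^sub>A i\<in>I. (b \<otimes>\<^sub>A x i) \<otimes>\<^sub>A y i)" by (rule fs_cong[OF agA]) (use D b in "auto simp: m_assoc")
  also have "\<dots> = (\<Oplus>\<^sub>A j\<in>J. x' j \<otimes>\<^sub>A (y' j \<otimes>\<^sub>A b))" by (rule casimir[OF d d' b agA mult_addmap_l mult_addmap_r])
       (auto simp: smult_mult_l smult_mult_r)
  also have "\<dots> = (\<Oplus>\<^sub>A j\<in>J. (x' j \<otimes>\<^sub>A y' j) \<otimes>\<^sub>A b)" by (rule fs_cong[OF agA]) (use D' b in "auto simp: m_assoc")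
  also have "\<dots> = casimir_sum J x' y' \<otimes>\<^sub>A b" unfolding casimir_sum_def
    by (rule addmap_fs[OF agA agA mult_addmap_l[OF b], symmetric]) (use D' in auto)
  finally show ?thesis .
qed

lemma casimir_sum_unique:
  assumes d: "dual_frame I x y" and d': "dual_frame J x' y'"
  shows "casimir_sum I x y = casimir_sum J x' y'"
  using casimir_sum_comm[OF assms one_closed] casimir_sum_closed[OF d] casimir_sum_closed[OF d'] by simp

lemma dual_basis_dual_frame:
  assumes X: "finite_basis \<O> A X" and d: "d \<in> X \<rightarrow> carrier A" and o: "\<forall>x\<in>X. \<forall>y\<in>X. s (x \<otimes>\<^sub>A d y) = (if x = y then \<one>\<^sub>\<O> else \<zero>\<^sub>\<O>)"
  shows "dual_frame X (\<lambda>x. x) d"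
proof -
  obtain \<phi> where fr: "frame \<O> A X (\<lambda>x. x) \<phi>" by (rule basis_frame[OF lmA X])
  have XA: "x \<in> X \<Longrightarrow> x \<in> carrier A" for x by (rule frame_elt[OF fr])
  have "s (a \<otimes>\<^sub>A d y) = \<phi> y a" if a: "a \<in> carrier A" and y: "y \<in> X" for a y
  proof -
    have dy: "d y \<in> carrier A" using d y by auto
    have "s (a \<otimes>\<^sub>A d y) = s ((\<Oplus>\<^sub>A x\<in>X. \<phi> x a \<odot>\<^sub>A x) \<otimes>\<^sub>A d y)" using frame_sum[OF fr a] by simp
    also have "\<dots> = (\<Oplus>\<^sub>\<O> x\<in>X. s ((\<phi> x a \<odot>\<^sub>A x) \<otimes>\<^sub>A d y))"
      by (rule addmap_fs[OF agA agO addmap_comp[OF mult_addmap_l[OF dy] s_addmap]]) (use frame_coeff[OF fr _ a] XA in auto)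
    also have "\<dots> = (\<Oplus>\<^sub>\<O> x\<in>X. if x = y then \<phi> x a else \<zero>\<^sub>\<O>)" by (rule fs_cong[OF agO])
         (use frame_coeff[OF fr _ a] XA dy o y in "auto simp: smult_mult_l s_smult")
    also have "\<dots> = \<phi> y a" by (rule fs_delta[where f = "\<lambda>x. \<phi> x a", OF agO frame_finite[OF fr] y frame_coeff[OF fr y a]])
    finally show ?thesis .
  qed
  note e = this
  show ?thesis unfolding dual_frame_def
  proof (intro conjI ballI)
    fix a assume a: "a \<in> carrier A"
    have "(\<Oplus>\<^sub>A x\<in>X. s (a \<otimes>\<^sub>A d x) \<odot>\<^sub>A x) = (\<Oplus>\<^sub>A x\<in>X. \<phi> x a \<odot>\<^sub>A x)"
      by (rule fs_cong[OF agA]) (use e[OF a] frame_coeff[OF fr _ a] XA in auto)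
    then show "(\<Oplus>\<^sub>A x\<in>X. s (a \<otimes>\<^sub>A d x) \<odot>\<^sub>A x) = a" using frame_sum[OF fr a] by simp
  qed (use XA d frame_finite[OF fr] in auto)
qed

text \<open>A is projective, hence free, over the principal ideal domain \<O>, and non-degeneracy of
  s represents each coordinate functional as s(- d).\<close>

lemma dual_basis_exists:
  obtains X d where "finite_basis \<O> A X" "d \<in> X \<rightarrow> carrier A" "\<forall>x\<in>X. \<forall>y\<in>X. s (x \<otimes>\<^sub>A d y) = (if x = y then \<one>\<^sub>\<O> else \<zero>\<^sub>\<O>)"
proof -
  obtain n :: nat and p \<phi> where "frame \<O> A {..<n} p \<phi>" by (rule fg_projective_frame[OF lmA A_proj])
  then have "fg_free \<O> A" by (rule frame_fg_free[OF pid lmA])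
  then obtain X where X: "finite_basis \<O> A X" by (auto simp: fg_free_def)
  obtain \<phi> where fr: "frame \<O> A X (\<lambda>x. x) \<phi>" and u: "\<And>y c. c \<in> X \<rightarrow> carrier \<O> \<Longrightarrow> y = (\<Oplus>\<^sub>A x\<in>X. c x \<odot>\<^sub>A x) \<Longrightarrow> \<forall>x\<in>X. \<phi> x y = c x"
    by (rule basis_frame[OF lmA X]) (rule that)
  have XA: "x \<in> X \<Longrightarrow> x \<in> carrier A" for x by (rule frame_elt[OF fr])
  have "\<exists>d. d \<in> carrier A \<and> (\<forall>a\<in>carrier A. \<phi> y a = s (a \<otimes>\<^sub>A d))" if y: "y \<in> X" for y
    using s_surj[OF linmap_restrict[OF lmA frame_fun[OF fr y]]] by auto
  then obtain d where d: "\<And>y. y \<in> X \<Longrightarrow> d y \<in> carrier A" "\<And>y a. y \<in> X \<Longrightarrow> a \<in> carrier A \<Longrightarrow> \<phi> y a = s (a \<otimes>\<^sub>A d y)" by metis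
  have "s (x \<otimes>\<^sub>A d y) = (if x = y then \<one>\<^sub>\<O> else \<zero>\<^sub>\<O>)" if x: "x \<in> X" and y: "y \<in> X" for x y
  proof -
    have "(\<Oplus>\<^sub>A v\<in>X. (if v = x then \<one>\<^sub>\<O> else \<zero>\<^sub>\<O>) \<odot>\<^sub>A v) = (\<Oplus>\<^sub>A v\<in>X. if v = x then v else \<zero>\<^sub>A)"
      by (rule fs_cong[OF agA]) (use XA lm_zero_l[OF lmA] in auto)
    also have "\<dots> = x" by (rule fs_delta[where f = "\<lambda>v. v", OF agA frame_finite[OF fr] x XA[OF x]])
    finally have "\<forall>v\<in>X. \<phi> v x = (if v = x then \<one>\<^sub>\<O> else \<zero>\<^sub>\<O>)" by (intro u) auto
    then show ?thesis using d(2)[OF y XA[OF x]] y by auto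
  qed
  then show ?thesis using that[OF X, of d] d by auto
qed

abbreviation "zA \<equiv> rel_projective_element \<O> A s"

lemma zA_eq: "dual_frame I x y \<Longrightarrow> zA = casimir_sum I x y"
proof -
  assume d: "dual_frame I x y"
  let ?S = "{(\<Oplus>\<^sub>A x\<in>X. x \<otimes>\<^sub>A d x) | X d. finite_basis \<O> A X \<and> d \<in> X \<rightarrow> carrier A \<and>
     (\<forall>x\<in>X. \<forall>y\<in>X. s (x \<otimes>\<^sub>A d y) = (if x = y then \<one>\<^sub>\<O> else \<zero>\<^sub>\<O>))}"
  have val: "(\<Oplus>\<^sub>A x\<in>X. x \<otimes>\<^sub>A e x) = casimir_sum I x y" if "finite_basis \<O> A X" "e \<in> X \<rightarrow> carrier A"
     "\<forall>x\<in>X. \<forall>y\<in>X. s (x \<otimes>\<^sub>A e y) = (if x = y then \<one>\<^sub>\<O> else \<zero>\<^sub>\<O>)" for X e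
    using casimir_sum_unique[OF dual_basis_dual_frame[OF that] d] by (simp add: casimir_sum_def)
  obtain X e where Xe: "finite_basis \<O> A X" "e \<in> X \<rightarrow> carrier A" "\<forall>x\<in>X. \<forall>y\<in>X. s (x \<otimes>\<^sub>A e y) = (if x = y then \<one>\<^sub>\<O> else \<zero>\<^sub>\<O>)"
    by (rule dual_basis_exists)
  have "(\<Oplus>\<^sub>A x\<in>X. x \<otimes>\<^sub>A e x) \<in> ?S" by (intro CollectI exI[of _ X] exI[of _ e] conjI refl Xe)
  then have mem: "casimir_sum I x y \<in> ?S" unfolding val[OF Xe] .
  show ?thesis unfolding rel_projective_element_def
    by (rule the_elem_eqI[OF mem]) (elim CollectE exE conjE, erule trans, rule val)
qed

lemma dual_frame_exists: obtains X :: "'a set" and d where "dual_frame X (\<lambda>x. x) d"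
  using dual_basis_exists dual_basis_dual_frame by metis

lemma zA_closed [simp]: "zA \<in> carrier A"
proof -
  obtain X :: "'a set" and d where d: "dual_frame X (\<lambda>x. x) d" by (rule dual_frame_exists)
  show ?thesis unfolding zA_eq[OF d] by (rule casimir_sum_closed[OF d])
qed

lemma zA_central: "b \<in> carrier A \<Longrightarrow> b \<otimes>\<^sub>A zA = zA \<otimes>\<^sub>A b"
proof -
  assume b: "b \<in> carrier A"
  obtain X :: "'a set" and d where d: "dual_frame X (\<lambda>x. x) d" by (rule dual_frame_exists)
  show ?thesis unfolding zA_eq[OF d] by (rule casimir_sum_comm[OF d d b])
qed

subsection \<open>Relative injectivity of projective modules\<close>

text \<open>Each coordinate of f, followed by s, is an \<O>-valued functional on W. It extends to P
  by composition with the \<O>-linear retraction \<open>\<rho>\<close>, and \<open>hat\<close> turns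
  the extension back into an A-linear functional. Here the symmetrising form makes projective
  modules injective relative to \<O>.\<close>

lemma relatively_injective:
  assumes W: "left_module A W" and P: "left_module A P" and Q: "left_module A Q"
    and pr: "fg_projective A Q" and j: "j \<in> linmap A W P"
    and \<rho>: "\<rho> \<in> linmap \<O> (RS P) (RS W)"
    and \<rho>j: "\<And>w. w \<in> carrier W \<Longrightarrow> \<rho> (j w) = w" and f: "f \<in> linmap A W Q"
  obtains g where "g \<in> lin_hom A P Q" "\<And>w. w \<in> carrier W \<Longrightarrow> g (j w) = f w"
proof -
  obtain n :: nat and q \<chi> where fr: "frame A Q {..<n} q \<chi>" by (rule fg_projective_frame[OF Q pr])
  define \<gamma> where "\<gamma> k p = s (\<chi> k (f (\<rho> p)))" for k p
  have \<chi>f: "(\<lambda>w. \<chi> k (f w)) \<in> linmap A W (regular A)" if "k < n" for k using linmap_comp[OF f frame_fun[OF fr]] that by simp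
  have \<gamma>: "\<gamma> k \<in> linmap \<O> (RS P) (regular \<O>)" if "k < n" for k
    unfolding \<gamma>_def[abs_def] using linmap_comp[OF \<rho> linmap_comp[OF linmap_rs_reg[OF \<chi>f[OF that]] s_lin]] .
  have h: "hat P (\<gamma> k) \<in> linmap A P (regular A)" if "k < n" for k by (rule hat_linmap[OF P \<gamma>[OF that]])
  let ?g = "\<lambda>p. \<Oplus>\<^sub>Q k\<in>{..<n}. hat P (\<gamma> k) p \<odot>\<^sub>Q q k"
  have "?g \<in> linmap A P Q" by (rule linmap_sum[OF Q]) (use h frame_elt[OF fr] in "auto intro: linmap_smult_elt[OF P Q]")
  then have g: "(\<lambda>p\<in>carrier P. ?g p) \<in> lin_hom A P Q" by (rule linmap_restrict[OF P])
  have "(\<lambda>p\<in>carrier P. ?g p) (j w) = f w" if w: "w \<in> carrier W" for w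
  proof -
    have fw: "f w \<in> carrier Q" by (rule linmap_closed[OF f w])
    have "hat P (\<gamma> k) (j w) = \<chi> k (f w)" if k: "k < n" for k
    proof (rule hat_eqI)
      show "\<chi> k (f w) \<in> carrier A" using frame_coeff[OF fr _ fw] k by simp
      fix a assume a: "a \<in> carrier A"
      have aw: "a \<odot>\<^sub>W w \<in> carrier W" by (rule lm_smult[OF W a w])
      show "\<gamma> k (a \<odot>\<^sub>P j w) = s (a \<otimes>\<^sub>A \<chi> k (f w))"
        using linmap_smult[OF j a w] \<rho>j[OF aw] linmap_smult[OF \<chi>f[OF k] a w] by (simp add: \<gamma>_def flip: linmap_smult[OF j a w])
    qed
    then have "?g (j w) = (\<Oplus>\<^sub>Q k\<in>{..<n}. \<chi> k (f w) \<odot>\<^sub>Q q k)" using frame_coeff[OF fr _ fw] frame_elt[OF fr] lm_smult[OF Q]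
      by (intro fs_cong[OF lm_ag[OF Q]]) auto
    then show ?thesis using frame_sum[OF fr fw] linmap_closed[OF j w] by simp
  qed
  then show ?thesis using that g by blast
qed

subsection \<open>Traces of maps of finite rank\<close>

text \<open>The element \<open>z\<close> acts on \<open>U\<close> as the relative trace of the identity. Hence if \<open>z' z = c\<close>, then \<open>c f\<close>
  has finite rank over \<open>A\<close> for every endomorphism \<open>f\<close>.\<close>

lemma zA_expand:
  assumes U: "left_module A U" and fr: "frame \<O> (RS U) K u \<upsilon>" and v: "v \<in> carrier U"
  shows "(\<Oplus>\<^sub>U k\<in>K. hat U (\<upsilon> k) v \<odot>\<^sub>U u k) = zA \<odot>\<^sub>U v"
proof -
  obtain X :: "'a set" and d where d: "dual_frame X (\<lambda>x. x) d" by (rule dual_frame_exists)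
  note D = dual_frameD[OF d] and ag = lm_ag[OF U] and rs = agU_rs[OF U]
  have uc: "u k \<in> carrier U" if "k \<in> K" for k using frame_elt[OF fr that] by simp
  have dv: "d x \<odot>\<^sub>U v \<in> carrier U" if "x \<in> X" for x by (rule lm_smult[OF U D(3)[OF that] v])
  have co: "\<upsilon> k (d x \<odot>\<^sub>U v) \<in> carrier \<O>" if "k \<in> K" "x \<in> X" for k x using frame_coeff[OF fr that(1)] dv[OF that(2)] by simp
  have cu: "(\<upsilon> k (d x \<odot>\<^sub>U v) \<odot>\<^sub>A \<one>\<^sub>A) \<odot>\<^sub>U u k \<in> carrier U" if "k \<in> K" "x \<in> X" for k x
    by (rule lm_smult[OF U _ uc[OF that(1)]]) (use co[OF that] in simp)
  have "(\<Oplus>\<^sub>U k\<in>K. hat U (\<upsilon> k) v \<odot>\<^sub>U u k) = (\<Oplus>\<^sub>U k\<in>K. \<Oplus>\<^sub>U x\<in>X. x \<odot>\<^sub>U ((\<upsilon> k (d x \<odot>\<^sub>U v) \<odot>\<^sub>A \<one>\<^sub>A) \<odot>\<^sub>U u k))"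
  proof (rule fs_cong[OF ag])
    fix k assume k: "k \<in> K"
    note h = hat_spec[OF U frame_fun[OF fr k] v]
    have "hat U (\<upsilon> k) v = (\<Oplus>\<^sub>A x\<in>X. s (hat U (\<upsilon> k) v \<otimes>\<^sub>A d x) \<odot>\<^sub>A x)" by (rule D(4)[OF h(1), symmetric])
    also have "\<dots> = (\<Oplus>\<^sub>A x\<in>X. \<upsilon> k (d x \<odot>\<^sub>U v) \<odot>\<^sub>A x)" by (rule fs_cong[OF agA]) (use h D s_sym[OF h(1)] co[OF k] in simp_all)
    also have "\<dots> \<odot>\<^sub>U u k = (\<Oplus>\<^sub>U x\<in>X. (\<upsilon> k (d x \<odot>\<^sub>U v) \<odot>\<^sub>A x) \<odot>\<^sub>U u k)" by (rule lm_fs_l[OF U uc[OF k]]) (use co[OF k] D in simp)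
    also have "\<dots> = (\<Oplus>\<^sub>U x\<in>X. x \<odot>\<^sub>U ((\<upsilon> k (d x \<odot>\<^sub>U v) \<odot>\<^sub>A \<one>\<^sub>A) \<odot>\<^sub>U u k))" by (rule fs_cong[OF ag])
         (use co[OF k] D(2) uc[OF k] cu[OF k] lm_smult[OF U] in
           \<open>simp_all add: left_module.lm_assoc[OF U, symmetric] smult_mult_r\<close>)
    finally show "hat U (\<upsilon> k) v \<odot>\<^sub>U u k = (\<Oplus>\<^sub>U x\<in>X. x \<odot>\<^sub>U ((\<upsilon> k (d x \<odot>\<^sub>U v) \<odot>\<^sub>A \<one>\<^sub>A) \<odot>\<^sub>U u k))" .
    show "(\<Oplus>\<^sub>U x\<in>X. x \<odot>\<^sub>U ((\<upsilon> k (d x \<odot>\<^sub>U v) \<odot>\<^sub>A \<one>\<^sub>A) \<odot>\<^sub>U u k)) \<in> carrier U"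
      by (rule fs_closed[OF ag lm_smult[OF U D(2) cu[OF k]]])
  qed
  also have "\<dots> = (\<Oplus>\<^sub>U x\<in>X. \<Oplus>\<^sub>U k\<in>K. x \<odot>\<^sub>U ((\<upsilon> k (d x \<odot>\<^sub>U v) \<odot>\<^sub>A \<one>\<^sub>A) \<odot>\<^sub>U u k))"
    by (rule fs_swap[OF ag frame_finite[OF fr] lm_smult[OF U D(2) cu]])
  also have "\<dots> = (\<Oplus>\<^sub>U x\<in>X. (x \<otimes>\<^sub>A d x) \<odot>\<^sub>U v)"
  proof (rule fs_cong[OF ag])
    fix x assume x: "x \<in> X"
    have "(\<Oplus>\<^sub>U k\<in>K. (\<upsilon> k (d x \<odot>\<^sub>U v) \<odot>\<^sub>A \<one>\<^sub>A) \<odot>\<^sub>U u k) = d x \<odot>\<^sub>U v"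
      using frame_sum[OF fr, of "d x \<odot>\<^sub>U v"] dv[OF x] fs_same[OF ag rs, of K "\<lambda>k. (\<upsilon> k (d x \<odot>\<^sub>U v) \<odot>\<^sub>A \<one>\<^sub>A) \<odot>\<^sub>U u k"] cu[OF _ x] by simp
    then show "(\<Oplus>\<^sub>U k\<in>K. x \<odot>\<^sub>U ((\<upsilon> k (d x \<odot>\<^sub>U v) \<odot>\<^sub>A \<one>\<^sub>A) \<odot>\<^sub>U u k)) = (x \<otimes>\<^sub>A d x) \<odot>\<^sub>U v"
      using lm_fs_r[OF U D(2)[OF x], of K "\<lambda>k. (\<upsilon> k (d x \<odot>\<^sub>U v) \<odot>\<^sub>A \<one>\<^sub>A) \<odot>\<^sub>U u k"] cu[OF _ x] left_module.lm_assoc[OF U D(2)[OF x] D(3)[OF x] v] by simp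
  qed (use D lm_smult[OF U _ v] in simp)
  also have "\<dots> = zA \<odot>\<^sub>U v" unfolding zA_eq[OF d] casimir_sum_def by (rule lm_fs_l[OF U v, symmetric]) (use D in simp)
  finally show ?thesis .
qed

text \<open>Symmetry of s and centrality of z' move the factor \<open>hat U (\<upsilon> k) v\<close>
  inside g, where the sum over k collapses by \<open>zA_expand\<close> to the action of z_A on v;
  then z' z_A = c finishes. The twist by the inverse of z_A is exactly what leaves s(g v).\<close>

lemma trace_rank_one:
  assumes U: "left_module A U" and fr: "frame \<O> (RS U) K u \<upsilon>"
    and g: "g \<in> linmap A U (regular A)" and v: "v \<in> carrier U"
    and z': "z' \<in> carrier A" and z'c: "\<And>a. a \<in> carrier A \<Longrightarrow> z' \<otimes>\<^sub>A a = a \<otimes>\<^sub>A z'"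
    and c: "c \<in> carrier \<O>" and zz: "z' \<otimes>\<^sub>A zA = c \<odot>\<^sub>A \<one>\<^sub>A"
  shows "(\<Oplus>\<^sub>\<O> k\<in>K. \<upsilon> k (z' \<odot>\<^sub>U (g (u k) \<odot>\<^sub>U v))) = c \<otimes>\<^sub>\<O> s (g v)"
proof -
  have uc: "u k \<in> carrier U" if "k \<in> K" for k using frame_elt[OF fr that] by simp
  have gc: "g w \<in> carrier A" if "w \<in> carrier U" for w using linmap_closed[OF g that] by simp
  note h = hat_spec[OF U frame_fun[OF fr] v]
  have hu: "hat U (\<upsilon> k) v \<odot>\<^sub>U u k \<in> carrier U" if "k \<in> K" for k by (rule lm_smult[OF U h(1)[OF that] uc[OF that]])
  have sm: "(\<lambda>w. s (z' \<otimes>\<^sub>A g w)) \<in> addmap U \<O>"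
    using addmap_comp[OF _ addmap_comp[OF mult_addmap_r[OF z'] s_addmap], of g U] linmap_addmap[OF g]
    by (simp add: addmap_def)
  have "(\<Oplus>\<^sub>\<O> k\<in>K. \<upsilon> k (z' \<odot>\<^sub>U (g (u k) \<odot>\<^sub>U v))) = (\<Oplus>\<^sub>\<O> k\<in>K. s (z' \<otimes>\<^sub>A g (hat U (\<upsilon> k) v \<odot>\<^sub>U u k)))"
  proof (rule fs_cong[OF agO])
    fix k assume k: "k \<in> K"
    have "\<upsilon> k (z' \<odot>\<^sub>U (g (u k) \<odot>\<^sub>U v)) = s ((z' \<otimes>\<^sub>A g (u k)) \<otimes>\<^sub>A hat U (\<upsilon> k) v)"
      using h(2)[OF k, of "z' \<otimes>\<^sub>A g (u k)"] gc[OF uc[OF k]] z' v by (simp add: left_module.lm_assoc[OF U])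
    also have "\<dots> = s (z' \<otimes>\<^sub>A g (hat U (\<upsilon> k) v \<odot>\<^sub>U u k))"
      using s_sym[of "z' \<otimes>\<^sub>A g (u k)" "hat U (\<upsilon> k) v"] gc[OF uc[OF k]] z' h(1)[OF k] z'c[OF h(1)[OF k]]
        linmap_smult[OF g h(1)[OF k] uc[OF k]] by (simp add: m_assoc[symmetric])
    finally show "\<upsilon> k (z' \<odot>\<^sub>U (g (u k) \<odot>\<^sub>U v)) = s (z' \<otimes>\<^sub>A g (hat U (\<upsilon> k) v \<odot>\<^sub>U u k))" .
  qed (use addmap_closed[OF sm hu] in blast)
  also have "\<dots> = s (z' \<otimes>\<^sub>A g (zA \<odot>\<^sub>U v))"
    unfolding zA_expand[OF U fr v, symmetric] by (rule addmap_fs[OF lm_ag[OF U] agO sm hu, symmetric])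
  also have "z' \<otimes>\<^sub>A g (zA \<odot>\<^sub>U v) = c \<odot>\<^sub>A g v"
    using linmap_smult[OF g zA_closed v] gc[OF v] z' zz c by (simp add: m_assoc[symmetric] smult_one_mult)
  finally show ?thesis using s_smult[OF c gc[OF v]] by simp
qed

text \<open>Since c = z_A z', the map c f is z_A acting after z' f, and \<open>zA_expand\<close>
  writes the action of z_A as a finite sum of maps x \<mapsto> g(x) u.\<close>

lemma scaled_fin_rank:
  assumes W: "left_module A W" and U: "left_module A U" and fr: "frame \<O> (RS U) K u \<upsilon>"
    and z': "z' \<in> carrier A" and z'c: "\<And>a. a \<in> carrier A \<Longrightarrow> z' \<otimes>\<^sub>A a = a \<otimes>\<^sub>A z'"
    and c: "c \<in> carrier \<O>" and zz: "z' \<otimes>\<^sub>A zA = c \<odot>\<^sub>A \<one>\<^sub>A" and f: "f \<in> linmap A W U"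
  shows "fin_rank A W U (\<lambda>x\<in>carrier W. (c \<odot>\<^sub>A \<one>\<^sub>A) \<odot>\<^sub>U f x)"
proof -
  have fz: "(\<lambda>x. z' \<odot>\<^sub>U f x) \<in> linmap A W U"
  proof (rule linmapI)
    show "z' \<odot>\<^sub>U f (a \<odot>\<^sub>W x) = a \<odot>\<^sub>U (z' \<odot>\<^sub>U f x)" if "a \<in> carrier A" "x \<in> carrier W" for a x
      using linmap_smult[OF f that] linmap_closed[OF f that(2)] z'c[OF that(1)] z' that(1)
      by (simp add: left_module.lm_assoc[OF U, symmetric])
  qed (use linmap_add[OF f] linmap_closed[OF f] z' U left_module.lm_r_distr[OF U] in auto)
  have "(\<lambda>x\<in>carrier W. (c \<odot>\<^sub>A \<one>\<^sub>A) \<odot>\<^sub>U f x) = (\<lambda>x\<in>carrier W. \<Oplus>\<^sub>U k\<in>K. hat U (\<upsilon> k) (z' \<odot>\<^sub>U f x) \<odot>\<^sub>U u k)"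
  proof (rule restrict_ext)
    fix x assume x: "x \<in> carrier W"
    show "(c \<odot>\<^sub>A \<one>\<^sub>A) \<odot>\<^sub>U f x = (\<Oplus>\<^sub>U k\<in>K. hat U (\<upsilon> k) (z' \<odot>\<^sub>U f x) \<odot>\<^sub>U u k)"
      using zA_expand[OF U fr linmap_closed[OF fz x]] linmap_closed[OF f x] z' z'c[OF zA_closed] zz
      by (simp add: left_module.lm_assoc[OF U, symmetric])
  qed
  moreover have "fin_rank A W U (\<lambda>x\<in>carrier W. \<Oplus>\<^sub>U k\<in>K. hat U (\<upsilon> k) (z' \<odot>\<^sub>U f x) \<odot>\<^sub>U u k)"
    by (rule fin_rank_sum[OF W U frame_finite[OF fr]])
       (use linmap_comp[OF fz hat_linmap[OF U frame_fun[OF fr]]] frame_elt[OF fr] in auto)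
  ultimately show ?thesis by simp
qed

subsection \<open>The relative projective element is not a zero divisor in characteristic zero\<close>

lemma A_torsion_free:
  assumes c: "c \<in> carrier \<O>" "c \<noteq> \<zero>\<^sub>\<O>" and a: "a \<in> carrier A" and ca: "c \<odot>\<^sub>A a = \<zero>\<^sub>A"
  shows "a = \<zero>\<^sub>A"
proof (rule s_inj[OF a])
  interpret D: principal_domain \<O> by (rule pid)
  have s0: "s \<zero>\<^sub>A = \<zero>\<^sub>\<O>" by (rule addmap_zero[OF agA agO s_addmap])
  fix b assume b: "b \<in> carrier A"
  have "c \<otimes>\<^sub>\<O> s (b \<otimes>\<^sub>A a) = s (b \<otimes>\<^sub>A (c \<odot>\<^sub>A a))" using c a b by (simp add: smult_mult_r s_smult)
  also have "\<dots> = \<zero>\<^sub>\<O>" using ca b s0 by simp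
  finally have "s (b \<otimes>\<^sub>A a) = \<zero>\<^sub>\<O>" using D.integral[of c "s (b \<otimes>\<^sub>A a)"] c a b by auto
  then show "s (b \<otimes>\<^sub>A a) = s (b \<otimes>\<^sub>A \<zero>\<^sub>A)" using b s0 by simp
qed simp

text \<open>The trace of left multiplication by \<open>e\<close> on \<open>A\<close> is \<open>s (e z)\<close>; if \<open>e\<close> is idempotent up to
  the scalar \<open>c\<close>, it is also \<open>c\<close> times the rank of \<open>e A\<close>.\<close>

lemma scaled_idempotent_zero:
  assumes ch: "char_zero \<O>" and e: "e \<in> carrier A" and c: "c \<in> carrier \<O>" "c \<noteq> \<zero>\<^sub>\<O>"
    and ee: "e \<otimes>\<^sub>A e = c \<odot>\<^sub>A e" and ez: "e \<otimes>\<^sub>A zA = \<zero>\<^sub>A"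
  shows "e = \<zero>\<^sub>A"
proof -
  interpret D: principal_domain \<O> by (rule pid)
  obtain X :: "'a set" and d where d: "dual_frame X (\<lambda>x. x) d" by (rule dual_frame_exists)
  have frA: "frame \<O> A X (\<lambda>x. x) (\<lambda>x a. s (a \<otimes>\<^sub>A d x))" by (rule dual_frame_frame[OF d])
  note Dd = dual_frameD[OF d]
  define N where "N = A\<lparr>carrier := (\<lambda>a. e \<otimes>\<^sub>A a) ` carrier A\<rparr>"
  have Ns: "carrier N = (\<lambda>a. e \<otimes>\<^sub>A a) ` carrier A" "add N = add A" "ring.zero N = ring.zero A"
    "smult N = smult A" by (simp_all add: N_def)
  have NA: "x \<in> carrier N \<Longrightarrow> x \<in> carrier A" for x using e by (auto simp: Ns)
  have agN: "abelian_group N"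
  proof (rule abelian_groupI)
    fix x y assume "x \<in> carrier N" "y \<in> carrier N"
    then show "x \<oplus>\<^sub>N y \<in> carrier N" using e by (auto simp: Ns r_distr[symmetric])
  next
    show "\<zero>\<^sub>N \<in> carrier N" unfolding Ns using e by (intro image_eqI[of _ _ "\<zero>\<^sub>A"]) auto
  next
    fix x assume "x \<in> carrier N"
    then obtain a where a: "a \<in> carrier A" "x = e \<otimes>\<^sub>A a" by (auto simp: Ns)
    have "e \<otimes>\<^sub>A (\<ominus>\<^sub>A a) \<in> carrier N" unfolding Ns by (rule imageI) (use a in simp)
    moreover have "e \<otimes>\<^sub>A (\<ominus>\<^sub>A a) \<oplus>\<^sub>A x = \<zero>\<^sub>A" using a e by (simp add: r_minus l_neg)
    ultimately show "\<exists>y\<in>carrier N. y \<oplus>\<^sub>N x = \<zero>\<^sub>N" by (auto simp: Ns)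
  qed (use NA in "auto simp: Ns(2,3) a_ac")
  have N: "left_module \<O> N"
  proof (rule left_moduleI[OF ringO agN])
    fix k x assume k: "k \<in> carrier \<O>" and "x \<in> carrier N"
    then obtain a where a: "a \<in> carrier A" "x = e \<otimes>\<^sub>A a" by (auto simp: Ns)
    then show "k \<odot>\<^sub>N x \<in> carrier N" unfolding Ns using k e by (intro image_eqI[of _ _ "k \<odot>\<^sub>A a"]) (auto simp: smult_mult_r)
  qed (use NA in "auto simp: Ns(2,3,4) smult_l_distr smult_r_distr smult_assoc1")
  obtain p \<phi> where fA: "frame \<O> A {..<card X} p \<phi>" by (rule frame_nat[OF lmA frA])
  have incl: "(\<lambda>x. x) \<in> linmap \<O> N A" by (rule linmapI) (auto simp: Ns(2,3,4) NA)
  have "\<exists>(m::nat) w \<psi>. frame \<O> N {..<m} w \<psi> \<and> orthonormal \<O> {..<m} w \<psi>"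
  proof (rule pid_free[OF pid N, of "card X" \<phi>])
    show "\<phi> k \<in> linmap \<O> N (regular \<O>)" if "k < card X" for k using linmap_comp[OF incl frame_fun[OF fA]] that by simp
    fix x assume x: "x \<in> carrier N" and z: "\<And>k. k < card X \<Longrightarrow> \<phi> k x = \<zero>\<^sub>\<O>"
    have "x = (\<Oplus>\<^sub>A k\<in>{..<card X}. \<phi> k x \<odot>\<^sub>A p k)" using frame_sum[OF fA NA[OF x]] by simp
    also have "\<dots> = (\<Oplus>\<^sub>A k\<in>{..<card X}. \<zero>\<^sub>A)" by (rule fs_cong[OF agA]) (use z frame_elt[OF fA] lm_zero_l[OF lmA] in auto)
    finally show "x = \<zero>\<^sub>N" by (simp add: Ns)
  qed
  then obtain m :: nat and w \<psi> where fN: "frame \<O> N {..<m} w \<psi>" and o: "orthonormal \<O> {..<m} w \<psi>" by blast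
  have el: "(\<lambda>a. e \<otimes>\<^sub>A a) \<in> linmap \<O> A N" by (rule linmapI) (use e in "auto simp: Ns r_distr smult_mult_r")
  have ew: "e \<otimes>\<^sub>A x = c \<odot>\<^sub>A x" if x: "x \<in> carrier N" for x
  proof -
    obtain a where a: "a \<in> carrier A" "x = e \<otimes>\<^sub>A a" using x by (auto simp: Ns)
    then show ?thesis using ee e c by (simp add: m_assoc[symmetric] smult_mult_l)
  qed
  have "(\<Oplus>\<^sub>\<O> j\<in>{..<m}. \<psi> j (e \<otimes>\<^sub>A w j)) = (\<Oplus>\<^sub>\<O> x\<in>X. s ((\<Oplus>\<^sub>N j\<in>{..<m}. \<psi> j (e \<otimes>\<^sub>A x) \<odot>\<^sub>N w j) \<otimes>\<^sub>A d x))"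
    by (rule trace_exchange[OF cringO lmA N frA frame_finite[OF fN] frame_elt[OF fN] frame_fun[OF fN] el incl])
  also have "\<dots> = (\<Oplus>\<^sub>\<O> x\<in>X. s (e \<otimes>\<^sub>A (x \<otimes>\<^sub>A d x)))"
  proof (rule fs_cong[OF agO])
    fix x assume x: "x \<in> X"
    have "e \<otimes>\<^sub>A x \<in> carrier N" using Dd(2)[OF x] by (auto simp: Ns)
    then show "s ((\<Oplus>\<^sub>N j\<in>{..<m}. \<psi> j (e \<otimes>\<^sub>A x) \<odot>\<^sub>N w j) \<otimes>\<^sub>A d x) = s (e \<otimes>\<^sub>A (x \<otimes>\<^sub>A d x))"
      using frame_sum[OF fN] Dd(2,3)[OF x] e by (simp add: m_assoc)
    show "s (e \<otimes>\<^sub>A (x \<otimes>\<^sub>A d x)) \<in> carrier \<O>" using Dd(2,3)[OF x] e by simp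
  qed
  also have "\<dots> = s (e \<otimes>\<^sub>A casimir_sum X (\<lambda>x. x) d)" unfolding casimir_sum_def
    by (rule addmap_fs[OF agA agO addmap_comp[OF mult_addmap_r[OF e] s_addmap], symmetric]) (use Dd in auto)
  also have "\<dots> = \<zero>\<^sub>\<O>" using ez zA_eq[OF d] addmap_zero[OF agA agO s_addmap] by simp
  finally have "(\<Oplus>\<^sub>\<O> j\<in>{..<m}. \<psi> j (e \<otimes>\<^sub>A w j)) = \<zero>\<^sub>\<O>" .
  moreover have "(\<Oplus>\<^sub>\<O> j\<in>{..<m}. \<psi> j (e \<otimes>\<^sub>A w j)) = (\<Oplus>\<^sub>\<O> j\<in>{..<m}. c)"
  proof (rule fs_cong[OF agO])
    fix j assume j: "j \<in> {..<m}"
    have "\<psi> j (c \<odot>\<^sub>N w j) = c \<otimes>\<^sub>\<O> \<psi> j (w j)" using linmap_smult[OF frame_fun[OF fN j] c(1) frame_elt[OF fN j]] by simp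
    then show "\<psi> j (e \<otimes>\<^sub>A w j) = c" using ew[OF frame_elt[OF fN j]] o j c by (simp add: Ns orthonormal_def)
  qed (use c in simp)
  moreover have "(\<Oplus>\<^sub>\<O> j\<in>{..<m}. c) = add_pow \<O> m c" using fs_const[OF agO c(1), of "{..<m}"] by simp
  moreover have "add_pow \<O> m c = add_pow \<O> m \<one>\<^sub>\<O> \<otimes>\<^sub>\<O> c" by (rule rg_add_pow_l[OF ringO c(1)])
  ultimately have "add_pow \<O> m \<one>\<^sub>\<O> = \<zero>\<^sub>\<O>" using D.integral[of "add_pow \<O> m \<one>\<^sub>\<O>" c] c by auto
  then have m0: "m = 0" using ch by (auto simp: char_zero_def)
  have eN: "e \<in> carrier N" unfolding Ns using e by (intro image_eqI[of _ _ "\<one>\<^sub>A"]) auto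
  have "e = (\<Oplus>\<^sub>N j\<in>{..<m}. \<psi> j e \<odot>\<^sub>N w j)" using frame_sum[OF fN eN] by simp
  then show ?thesis using m0 agN by (simp add: Ns)
qed

text \<open>One has c z' a = z' a z_A z' = z' z_A a z' = c a z', and A is torsion free over
  \<O>.\<close>

lemma inverse_central:
  assumes z': "z' \<in> carrier A" and c: "c \<in> carrier \<O>" "c \<noteq> \<zero>\<^sub>\<O>" and zz: "z' \<otimes>\<^sub>A zA = c \<odot>\<^sub>A \<one>\<^sub>A" and a: "a \<in> carrier A"
  shows "z' \<otimes>\<^sub>A a = a \<otimes>\<^sub>A z'"
proof -
  have zz2: "zA \<otimes>\<^sub>A z' = c \<odot>\<^sub>A \<one>\<^sub>A" using zz zA_central[OF z'] by simp
  have "c \<odot>\<^sub>A (z' \<otimes>\<^sub>A a) = (z' \<otimes>\<^sub>A a) \<otimes>\<^sub>A (zA \<otimes>\<^sub>A z')" using zz2 z' a c by (simp add: smult_mult_r)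
  also have "\<dots> = z' \<otimes>\<^sub>A (a \<otimes>\<^sub>A zA) \<otimes>\<^sub>A z'" using z' a by (simp add: m_assoc)
  also have "\<dots> = (z' \<otimes>\<^sub>A zA) \<otimes>\<^sub>A (a \<otimes>\<^sub>A z')" using z' a zA_central[OF a] by (simp add: m_assoc)
  also have "\<dots> = c \<odot>\<^sub>A (a \<otimes>\<^sub>A z')" using zz z' a c by (simp add: smult_mult_l)
  finally have "c \<odot>\<^sub>A (z' \<otimes>\<^sub>A a \<ominus>\<^sub>A a \<otimes>\<^sub>A z') = \<zero>\<^sub>A" using z' a c lm_diff_r[OF lmA c(1)] by simp
  then have "z' \<otimes>\<^sub>A a \<ominus>\<^sub>A a \<otimes>\<^sub>A z' = \<zero>\<^sub>A" using A_torsion_free[OF c] z' a by simp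
  then show ?thesis using ag_diff_eq_zero[OF agA] z' a by simp
qed

end

section \<open>The stable category\<close>

lemma stable_rel_iff:
  assumes U: "left_module A U" and V: "left_module A V"
  shows "(f, g) \<in> stable_rel A U V \<longleftrightarrow> f \<in> lin_hom A U V \<and> g \<in> lin_hom A U V \<and>
    fin_rank A U V (\<lambda>x\<in>carrier U. f x \<ominus>\<^sub>V g x)" by (simp add: stable_rel_def proj_hom_iff_fin_rank[OF U V])

lemma stable_hom: "(f, g) \<in> stable_rel A U V \<Longrightarrow> f \<in> lin_hom A U V" "(f, g) \<in> stable_rel A U V \<Longrightarrow> g \<in> lin_hom A U V"
  by (auto simp: stable_rel_def)

lemma stable_refl:
  assumes U: "left_module A U" and V: "left_module A V" and f: "f \<in> lin_hom A U V"
  shows "(f, f) \<in> stable_rel A U V"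
proof -
  have eq: "(\<lambda>x\<in>carrier U. f x \<ominus>\<^sub>V f x) = (\<lambda>x\<in>carrier U. \<zero>\<^sub>V)"
    using lin_hom_closed[OF f] lm_ag[OF V] by (intro restrict_ext) simp
  show ?thesis unfolding stable_rel_iff[OF U V] eq using f fin_rank.zero by blast
qed

lemma stable_sym:
  assumes U: "left_module A U" and V: "left_module A V" and fg: "(f, g) \<in> stable_rel A U V"
  shows "(g, f) \<in> stable_rel A U V"
proof -
  note f = stable_hom(1)[OF fg] and g = stable_hom(2)[OF fg]
  have agV: "abelian_group V" by (rule lm_ag[OF V])
  have fr: "fin_rank A U V (\<lambda>x\<in>carrier U. f x \<ominus>\<^sub>V g x)" using fg by (simp add: stable_rel_iff[OF U V])
  have neg: "(\<lambda>v. \<ominus>\<^sub>V v) \<in> linmap A V V"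
  proof (rule linmapI)
    fix a x assume "a \<in> carrier A" "x \<in> carrier V"
    then show "\<ominus>\<^sub>V (a \<odot>\<^sub>V x) = a \<odot>\<^sub>V (\<ominus>\<^sub>V x)" using addmap_neg[OF agV agV lm_addmap_r[OF V]] by simp
  qed (use agV in "auto simp: ag_neg_add")
  have eq: "(\<lambda>x\<in>carrier U. \<ominus>\<^sub>V ((\<lambda>x\<in>carrier U. f x \<ominus>\<^sub>V g x) x)) = (\<lambda>x\<in>carrier U. g x \<ominus>\<^sub>V f x)"
    using lin_hom_closed[OF f] lin_hom_closed[OF g] agV by (intro restrict_ext) (simp add: ag_neg_diff)
  show ?thesis using fin_rank_compose_left[OF U V V fr neg] f g unfolding stable_rel_iff[OF U V] eq by blast
qed

lemma stable_trans:
  assumes U: "left_module A U" and V: "left_module A V" and fg: "(f, g) \<in> stable_rel A U V"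
    and gh: "(g, h) \<in> stable_rel A U V"
  shows "(f, h) \<in> stable_rel A U V"
proof -
  note f = stable_hom(1)[OF fg] and g = stable_hom(2)[OF fg] and h = stable_hom(2)[OF gh]
  have agV: "abelian_group V" by (rule lm_ag[OF V])
  have fr: "fin_rank A U V (\<lambda>x\<in>carrier U. f x \<ominus>\<^sub>V g x)" "fin_rank A U V (\<lambda>x\<in>carrier U. g x \<ominus>\<^sub>V h x)"
    using fg gh by (simp_all add: stable_rel_iff[OF U V])
  have eq: "(\<lambda>x\<in>carrier U. (\<lambda>x\<in>carrier U. f x \<ominus>\<^sub>V g x) x \<oplus>\<^sub>V (\<lambda>x\<in>carrier U. g x \<ominus>\<^sub>V h x) x) = (\<lambda>x\<in>carrier U. f x \<ominus>\<^sub>V h x)"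
    using lin_hom_closed[OF f] lin_hom_closed[OF g] lin_hom_closed[OF h] agV
    by (intro restrict_ext) (simp add: ag_diff_trans)
  show ?thesis using fin_rank_add[OF U V fr] f h unfolding stable_rel_iff[OF U V] eq by blast
qed

lemma stable_comp_left:
  assumes U: "left_module A U" and V: "left_module A V" and W: "left_module A W"
    and fg: "(f, g) \<in> stable_rel A U V" and h: "h \<in> lin_hom A V W"
  shows "(compose (carrier U) h f, compose (carrier U) h g) \<in> stable_rel A U W"
proof -
  note f = stable_hom(1)[OF fg] and g = stable_hom(2)[OF fg]
  have fr: "fin_rank A U V (\<lambda>x\<in>carrier U. f x \<ominus>\<^sub>V g x)" using fg by (simp add: stable_rel_iff[OF U V])
  have eq: "(\<lambda>x\<in>carrier U. h ((\<lambda>x\<in>carrier U. f x \<ominus>\<^sub>V g x) x)) =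
      (\<lambda>x\<in>carrier U. compose (carrier U) h f x \<ominus>\<^sub>W compose (carrier U) h g x)"
    using lin_hom_closed[OF f] lin_hom_closed[OF g]
      addmap_diff[OF lm_ag[OF V] lm_ag[OF W] lin_hom_addmap[OF h]] by (intro restrict_ext) simp
  show ?thesis
    using fin_rank_compose_left[OF U V W fr lin_hom_linmap[OF h]] lin_hom_compose[OF f h U] lin_hom_compose[OF g h U]
    unfolding stable_rel_iff[OF U W] eq by blast
qed

lemma stable_comp_right:
  assumes U: "left_module A U" and V: "left_module A V" and W: "left_module A W"
    and fg: "(f, g) \<in> stable_rel A V W" and h: "h \<in> lin_hom A U V"
  shows "(compose (carrier U) f h, compose (carrier U) g h) \<in> stable_rel A U W"
proof -
  note f = stable_hom(1)[OF fg] and g = stable_hom(2)[OF fg]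
  have fr: "fin_rank A V W (\<lambda>x\<in>carrier V. f x \<ominus>\<^sub>W g x)" using fg by (simp add: stable_rel_iff[OF V W])
  have eq: "(\<lambda>x\<in>carrier U. (\<lambda>x\<in>carrier V. f x \<ominus>\<^sub>W g x) (h x)) =
      (\<lambda>x\<in>carrier U. compose (carrier U) f h x \<ominus>\<^sub>W compose (carrier U) g h x)"
    using lin_hom_closed[OF h] by (intro restrict_ext) simp
  show ?thesis
    using fin_rank_compose_right[OF U V W fr lin_hom_linmap[OF h]] lin_hom_compose[OF h f U] lin_hom_compose[OF h g U]
    unfolding stable_rel_iff[OF U W] eq by blast
qed

lemma stable_comp:
  assumes U: "left_module A U" and V: "left_module A V" and W: "left_module A W"
    and f: "(f, f') \<in> stable_rel A U V" and g: "(g, g') \<in> stable_rel A V W"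
  shows "(compose (carrier U) g f, compose (carrier U) g' f') \<in> stable_rel A U W"
  using stable_trans[OF U W stable_comp_left[OF U V W f stable_hom(1)[OF g]]
      stable_comp_right[OF U V W g stable_hom(2)[OF f]]] .

lemma stable_class_eq:
  assumes U: "left_module A U" and V: "left_module A V" and fg: "(f, g) \<in> stable_rel A U V"
  shows "stable_class A U V f = stable_class A U V g"
  using stable_trans[OF U V] stable_sym[OF U V] fg unfolding stable_class_def by blast

lemma stable_class_mem: "g \<in> stable_class A U V f \<longleftrightarrow> (f, g) \<in> stable_rel A U V" by (simp add: stable_class_def)

lemma stable_hom_obtain:
  assumes U: "left_module A U" and V: "left_module A V" and c: "c \<in> stable_hom A U V"
  obtains f where "f \<in> lin_hom A U V" "f \<in> c" "c = stable_class A U V f"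
  using c stable_refl[OF U V] that unfolding stable_hom_def stable_class_def quotient_def by blast

section \<open>Factoring homomorphisms\<close>

lemma factor_surj:
  assumes P: "left_module A P" and Q: "left_module A Q" and W: "left_module A W"
    and \<pi>: "\<pi> \<in> lin_hom A P Q" and sur: "\<pi> ` carrier P = carrier Q" and h: "h \<in> lin_hom A P W"
    and ker: "\<And>p. p \<in> carrier P \<Longrightarrow> \<pi> p = \<zero>\<^sub>Q \<Longrightarrow> h p = \<zero>\<^sub>W"
  obtains h' where "h' \<in> lin_hom A Q W" "\<And>p. p \<in> carrier P \<Longrightarrow> h' (\<pi> p) = h p"
proof -
  have agP: "abelian_group P" and agQ: "abelian_group Q" and agW: "abelian_group W"
    using lm_ag[OF P] lm_ag[OF Q] lm_ag[OF W] by auto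
  have eq: "h p = h p'" if "p \<in> carrier P" "p' \<in> carrier P" "\<pi> p = \<pi> p'" for p p'
  proof -
    have "\<pi> (p \<ominus>\<^sub>P p') = \<zero>\<^sub>Q"
      using addmap_diff[OF agP agQ lin_hom_addmap[OF \<pi>] that(1,2)] that lin_hom_closed[OF \<pi>] agQ by simp
    then have "h p \<ominus>\<^sub>W h p' = \<zero>\<^sub>W"
      using ker[of "p \<ominus>\<^sub>P p'"] addmap_diff[OF agP agW lin_hom_addmap[OF h] that(1,2)] that agP by simp
    then show ?thesis using ag_diff_eq_zero[OF agW] lin_hom_closed[OF h] that by simp
  qed
  define r where "r q = (SOME p. p \<in> carrier P \<and> \<pi> p = q)" for q
  have r: "r q \<in> carrier P" "\<pi> (r q) = q" if "q \<in> carrier Q" for q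
  proof -
    have "\<exists>p. p \<in> carrier P \<and> \<pi> p = q" using sur that by (metis imageE)
    from someI_ex[OF this] show "r q \<in> carrier P" "\<pi> (r q) = q" by (auto simp: r_def)
  qed
  have hr: "h (r (\<pi> p)) = h p" if "p \<in> carrier P" for p
    using eq[of "r (\<pi> p)" p] r[OF lin_hom_closed[OF \<pi> that]] that by simp
  have "(\<lambda>q\<in>carrier Q. h (r q)) \<in> lin_hom A Q W"
  proof (rule lin_hom_restrictI[OF agQ lm_smult[OF Q]])
    fix x y assume x: "x \<in> carrier Q" and y: "y \<in> carrier Q"
    show "h (r x) \<in> carrier W" using lin_hom_closed[OF h] r x by blast
    have "h (r (x \<oplus>\<^sub>Q y)) = h (r x \<oplus>\<^sub>P r y)" by (rule eq) (use r x y agP agQ lin_hom_add[OF \<pi>] in auto)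
    then show "h (r (x \<oplus>\<^sub>Q y)) = h (r x) \<oplus>\<^sub>W h (r y)" using lin_hom_add[OF h] r x y by simp
  next
    fix a x assume a: "a \<in> carrier A" and x: "x \<in> carrier Q"
    have "h (r (a \<odot>\<^sub>Q x)) = h (a \<odot>\<^sub>P r x)" by (rule eq) (use r x a lin_hom_smult[OF \<pi>] lm_smult[OF P] lm_smult[OF Q] in auto)
    then show "h (r (a \<odot>\<^sub>Q x)) = a \<odot>\<^sub>W h (r x)" using lin_hom_smult[OF h] r x a by simp
  qed
  then show ?thesis using that hr lin_hom_closed[OF \<pi>] by (metis (no_types, lifting) restrict_apply')
qed

lemma factor_inj:
  assumes U: "left_module A U" and V: "left_module A V" and P: "left_module A P"
    and j: "j \<in> lin_hom A V P" and inj: "inj_on j (carrier V)"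
    and h: "h \<in> linmap A U P" and im: "\<And>u. u \<in> carrier U \<Longrightarrow> h u \<in> j ` carrier V"
  obtains h' where "h' \<in> lin_hom A U V" "\<And>u. u \<in> carrier U \<Longrightarrow> j (h' u) = h u"
proof -
  define r where "r u = the_inv_into (carrier V) j (h u)" for u
  have r: "r u \<in> carrier V" "j (r u) = h u" if "u \<in> carrier U" for u
    unfolding r_def using the_inv_into_into[OF inj im[OF that]] f_the_inv_into_f[OF inj im[OF that]] by auto
  have eq: "v = v'" if "v \<in> carrier V" "v' \<in> carrier V" "j v = j v'" for v v' using inj that by (auto simp: inj_on_def)
  have agU: "abelian_group U" and agV: "abelian_group V" using lm_ag[OF U] lm_ag[OF V] .
  have "(\<lambda>u\<in>carrier U. r u) \<in> lin_hom A U V"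
  proof (rule lin_hom_restrictI[OF agU lm_smult[OF U]])
    fix x y assume x: "x \<in> carrier U" and y: "y \<in> carrier U"
    show "r x \<in> carrier V" by (rule r(1)[OF x])
    show "r (x \<oplus>\<^sub>U y) = r x \<oplus>\<^sub>V r y" by (rule eq) (use r x y agU agV lin_hom_add[OF j] linmap_add[OF h] in auto)
  next
    fix a x assume a: "a \<in> carrier A" and x: "x \<in> carrier U"
    show "r (a \<odot>\<^sub>U x) = a \<odot>\<^sub>V r x"
      by (rule eq) (use r x a lin_hom_smult[OF j] linmap_smult[OF h] lm_smult[OF U] lm_smult[OF V] in auto)
  qed
  then show ?thesis using that r(2) by (metis (no_types, lifting) restrict_apply')
qed

text \<open>Lifts of the images of the frame elements are combined with the coefficients of the
  frame.\<close>

lemma projective_lift: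
  assumes P: "left_module A P" and V: "left_module A V" and Q: "left_module A Q"
    and pr: "fg_projective A P" and f: "f \<in> linmap A P Q" and \<pi>: "\<pi> \<in> lin_hom A V Q" and sur: "\<pi> ` carrier V = carrier Q"
  obtains g where "g \<in> lin_hom A P V" "\<And>p. p \<in> carrier P \<Longrightarrow> \<pi> (g p) = f p"
proof -
  obtain n :: nat and p \<phi> where fr: "frame A P {..<n} p \<phi>" by (rule fg_projective_frame[OF P pr])
  have "\<exists>v. v \<in> carrier V \<and> \<pi> v = f (p k)" if "k < n" for k
    using sur linmap_closed[OF f frame_elt[OF fr]] that by (metis imageE lessThan_iff)
  then obtain v where v: "\<And>k. k < n \<Longrightarrow> v k \<in> carrier V" "\<And>k. k < n \<Longrightarrow> \<pi> (v k) = f (p k)" by metis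
  let ?g = "\<lambda>x. \<Oplus>\<^sub>V k\<in>{..<n}. \<phi> k x \<odot>\<^sub>V v k"
  have "?g \<in> linmap A P V" by (rule linmap_sum[OF V]) (use v frame_fun[OF fr] in "auto intro: linmap_smult_elt[OF P V]")
  then have g: "(\<lambda>x\<in>carrier P. ?g x) \<in> lin_hom A P V" by (rule linmap_restrict[OF P])
  have "\<pi> (?g x) = f x" if x: "x \<in> carrier P" for x
  proof -
    have c: "k < n \<Longrightarrow> \<phi> k x \<in> carrier A" for k using frame_coeff[OF fr _ x] by simp
    have "\<pi> (?g x) = (\<Oplus>\<^sub>Q k\<in>{..<n}. \<pi> (\<phi> k x \<odot>\<^sub>V v k))" by (rule addmap_fs[OF lm_ag[OF V] lm_ag[OF Q] lin_hom_addmap[OF \<pi>]])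
         (use c v lm_smult[OF V] in auto)
    also have "\<dots> = (\<Oplus>\<^sub>Q k\<in>{..<n}. f (\<phi> k x \<odot>\<^sub>P p k))" by (rule fs_cong[OF lm_ag[OF Q]])
         (use c v frame_elt[OF fr] linmap_smult[OF f] lin_hom_smult[OF \<pi>] linmap_closed[OF f]
            lm_smult[OF Q] lm_smult[OF P] in auto)
    also have "\<dots> = f (\<Oplus>\<^sub>P k\<in>{..<n}. \<phi> k x \<odot>\<^sub>P p k)"
      by (rule addmap_fs[OF lm_ag[OF P] lm_ag[OF Q] linmap_addmap[OF f], symmetric])
         (use c frame_elt[OF fr] lm_smult[OF P] in auto)
    finally show ?thesis using frame_sum[OF fr x] by simp
  qed
  then show ?thesis using that g by (metis (no_types, lifting) restrict_apply')
qed

section \<open>Shift families\<close>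

text \<open>Dependent choice starting at 0 in both directions: a shift family is indexed by all
  integers, and each member is a choice that depends on its neighbour.\<close>

lemma int_dependent_choice:
  fixes P :: "int \<Rightarrow> 'f \<Rightarrow> bool"
  assumes 0: "P 0 f0" and up: "\<And>i f. P i f \<Longrightarrow> \<exists>f'. P (i + 1) f' \<and> S i f f'"
    and down: "\<And>i f'. P (i + 1) f' \<Longrightarrow> \<exists>f. P i f \<and> S i f f'"
  obtains F where "F 0 = f0" "\<And>i. P i (F i)" "\<And>i. S i (F i) (F (i + 1))"
proof -
  obtain u where u: "\<And>i f. P i f \<Longrightarrow> P (i + 1) (u i f) \<and> S i f (u i f)" using up by metis
  obtain d where d: "\<And>i f. P (i + 1) f \<Longrightarrow> P i (d i f) \<and> S i (d i f) f" using down by metis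
  define g where "g n = rec_nat f0 (\<lambda>n. u (int n)) n" for n
  \<comment> \<open>\<open>h n\<close> is the member at index -n, so the step from
    \<open>h n\<close> to its successor uses \<open>down\<close> at i = -n - 1.\<close>
  define h where "h n = rec_nat f0 (\<lambda>n. d (- int n - 1)) n" for n
  have g: "P (int n) (g n)" for n using 0 u[of "int n" for n] by (induction n) (simp_all add: g_def add.commute)
  have h: "P (- int n) (h n)" for n
  proof (induction n)
    case (Suc n)
    then have "P (- int n - 1) (h (Suc n))" using d[of "- int n - 1" "h n"] by (simp add: h_def)
    moreover have "- int n - 1 = - int (Suc n)" by simp
    ultimately show ?case by metis
  qed (simp add: h_def 0)
  define F where "F i = (if 0 \<le> i then g (nat i) else h (nat (- i)))" for i
  show ?thesis
  proof (rule that)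
    show "F 0 = f0" by (simp add: F_def g_def)
    fix i :: int
    show "P i (F i)" using g[of "nat i"] h[of "nat (- i)"] by (cases "0 \<le> i") (simp_all add: F_def)
    show "S i (F i) (F (i + 1))"
    proof (cases "0 \<le> i")
      case True
      then have "F (i + 1) = g (Suc (nat i))" by (simp add: F_def Suc_nat_eq_nat_zadd1 add.commute)
      also have "\<dots> = u i (F i)" using True by (simp add: F_def g_def)
      finally show ?thesis using u[OF g, of "nat i"] True by (simp add: F_def)
    next
      case False
      define n where "n = nat (- i - 1)"
      have i: "i = - int n - 1" "nat (- i) = Suc n" using False by (simp_all add: n_def)
      \<comment> \<open>For n = 0 the index i + 1 is 0, where F takes its value from
        \<open>g\<close>; both branches start at \<open>f0\<close>.\<close>
      have "F (i + 1) = h n" using i by (cases "n = 0") (auto simp: F_def g_def h_def)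
      then show ?thesis using False i d[of "- int n - 1" "h n"] h[of n] by (simp add: F_def h_def)
    qed
  qed
qed

lemma shift_familyD:
  assumes "shift_family A X Y d F"
  shows "F i \<in> lin_hom A (obj X i) (obj Y (i + d))"
    and "\<exists>g\<in>lin_hom A (prj X i) (prj Y (i + d)). (\<forall>x\<in>carrier (obj X i). g (inc X i x) = inc Y (i + d) (F i x)) \<and>
          (\<forall>p\<in>carrier (prj X i). pro Y (i + d) (g p) = F (i + 1) (pro X i p))"
  using assms by (simp_all add: shift_family_def)

context sym_alg begin

text \<open>Freeness over \<open>\<O>\<close> is left out, which makes it evident that tensoring preserves these sequences.\<close>

definition shift_seq :: "('a, 'u, 'p) shifts \<Rightarrow> bool" where
  "shift_seq X \<longleftrightarrow> (\<forall>i. left_module A (obj X i) \<and> left_module A (prj X i) \<and> fg_projective A (prj X i) \<and>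
     inc X i \<in> lin_hom A (obj X i) (prj X i) \<and> pro X i \<in> lin_hom A (prj X i) (obj X (i + 1)) \<and>
     inj_on (inc X i) (carrier (obj X i)) \<and>
     inc X i ` carrier (obj X i) = {p \<in> carrier (prj X i). pro X i p = \<zero>\<^bsub>obj X (i + 1)\<^esub>} \<and>
     pro X i ` carrier (prj X i) = carrier (obj X (i + 1)) \<and>
     (\<exists>\<rho>\<in>linmap \<O> (RS (prj X i)) (RS (obj X i)). \<forall>x\<in>carrier (obj X i). \<rho> (inc X i x) = x))"

lemma shifts_of_seq: "shifts_of \<O> A U X \<Longrightarrow> shift_seq X"
  by (auto simp: shifts_of_def shift_seq_def a_kernel_def kernel_def) (meson lin_hom_linmap)

context
  fixes X :: "('a, 'u, 'p) shifts" assumes X: "shift_seq X"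
begin

lemma sq_obj: "left_module A (obj X i)" and sq_prj: "left_module A (prj X i)" and sq_proj: "fg_projective A (prj X i)"
  and sq_inc: "inc X i \<in> lin_hom A (obj X i) (prj X i)" and sq_pro: "pro X i \<in> lin_hom A (prj X i) (obj X (i + 1))"
  and sq_inj: "inj_on (inc X i) (carrier (obj X i))"
  and sq_ker: "inc X i ` carrier (obj X i) = {p \<in> carrier (prj X i). pro X i p = \<zero>\<^bsub>obj X (i + 1)\<^esub>}"
  and sq_sur: "pro X i ` carrier (prj X i) = carrier (obj X (i + 1))"
  and sq_split: "\<exists>\<rho>\<in>linmap \<O> (RS (prj X i)) (RS (obj X i)).
             \<forall>x\<in>carrier (obj X i). \<rho> (inc X i x) = x" using X[unfolded shift_seq_def, rule_format, of i] by blast+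

lemma sq_kerE:
  assumes "p \<in> carrier (prj X i)" "pro X i p = \<zero>\<^bsub>obj X (i + 1)\<^esub>"
  obtains x where "x \<in> carrier (obj X i)" "p = inc X i x"
proof -
  have "p \<in> inc X i ` carrier (obj X i)" unfolding sq_ker using assms by simp
  then show ?thesis using that by blast
qed

lemma sq_imI:
  assumes "p \<in> carrier (prj X i)" "pro X i p = \<zero>\<^bsub>obj X (i + 1)\<^esub>"
  shows "p \<in> inc X i ` carrier (obj X i)"
  unfolding sq_ker using assms by simp

lemma sq_pro_inc: "x \<in> carrier (obj X i) \<Longrightarrow> pro X i (inc X i x) = \<zero>\<^bsub>obj X (i + 1)\<^esub>"
  using imageI[of x "carrier (obj X i)" "inc X i"] unfolding sq_ker by simp

end

text \<open>The link between consecutive members of a \<open>shift_family\<close>, isolated so that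
  the members can be chosen one after another.\<close>

definition shift_step :: "('a, 'u, 'p) shifts \<Rightarrow> ('a, 'v, 'q) shifts \<Rightarrow> int \<Rightarrow> int \<Rightarrow> ('u \<Rightarrow> 'v) \<Rightarrow> ('u \<Rightarrow> 'v) \<Rightarrow> bool" where
  "shift_step X Y d i f f' \<longleftrightarrow> (\<exists>g\<in>lin_hom A (prj X i) (prj Y (i + d)).
          (\<forall>x\<in>carrier (obj X i). g (inc X i x) = inc Y (i + d) (f x)) \<and>
          (\<forall>p\<in>carrier (prj X i). pro Y (i + d) (g p) = f' (pro X i p)))"

text \<open>Relative injectivity of the middle term of Y extends f over the inclusion, and the
  extension passes to cokernels.\<close>

lemma shift_step_forward:
  assumes X: "shift_seq X" and Y: "shift_seq Y" and f: "f \<in> lin_hom A (obj X i) (obj Y (i + d))"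
  shows "\<exists>f'. f' \<in> lin_hom A (obj X (i + 1)) (obj Y (i + 1 + d)) \<and> shift_step X Y d i f f'"
proof -
  obtain \<rho> where \<rho>: "\<rho> \<in> linmap \<O> (RS (prj X i)) (RS (obj X i))"
    "\<And>x. x \<in> carrier (obj X i) \<Longrightarrow> \<rho> (inc X i x) = x" using sq_split[OF X] by metis
  have jf: "(\<lambda>x. inc Y (i + d) (f x)) \<in> linmap A (obj X i) (prj Y (i + d))"
    by (rule linmap_comp[OF lin_hom_linmap[OF f] lin_hom_linmap[OF sq_inc[OF Y]]])
  obtain g where g: "g \<in> lin_hom A (prj X i) (prj Y (i + d))"
    "\<And>x. x \<in> carrier (obj X i) \<Longrightarrow> g (inc X i x) = inc Y (i + d) (f x)"
    by (rule relatively_injective[OF sq_obj[OF X] sq_prj[OF X] sq_prj[OF Y] sq_proj[OF Y]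
        lin_hom_linmap[OF sq_inc[OF X]] \<rho> jf]) (blast intro: that)+
  have pg: "compose (carrier (prj X i)) (pro Y (i + d)) g \<in> lin_hom A (prj X i) (obj Y (i + d + 1))"
    by (rule lin_hom_compose[OF g(1) sq_pro[OF Y] sq_prj[OF X]])
  have ker: "compose (carrier (prj X i)) (pro Y (i + d)) g p = \<zero>\<^bsub>obj Y (i + d + 1)\<^esub>"
    if p: "p \<in> carrier (prj X i)" "pro X i p = \<zero>\<^bsub>obj X (i + 1)\<^esub>" for p
  proof -
    obtain x where x: "x \<in> carrier (obj X i)" "p = inc X i x" by (rule sq_kerE[OF X p])
    then show ?thesis using g(2)[OF x(1)] p sq_pro_inc[OF Y lin_hom_closed[OF f x(1)]] by simp
  qed
  obtain f' where f': "f' \<in> lin_hom A (obj X (i + 1)) (obj Y (i + d + 1))"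
    "\<And>p. p \<in> carrier (prj X i) \<Longrightarrow> f' (pro X i p) = compose (carrier (prj X i)) (pro Y (i + d)) g p"
    by (rule factor_surj[OF sq_prj[OF X] sq_obj[OF X] sq_obj[OF Y] sq_pro[OF X] sq_sur[OF X] pg ker]) (blast intro: that)+
  have e: "i + d + 1 = i + 1 + d" by simp
  show ?thesis unfolding shift_step_def using f' g unfolding e by (intro exI[of _ f'] conjI bexI[of _ g]) auto
qed

text \<open>Dually, projectivity of the middle term of X gives a lift of f', and the lift restricts
  to kernels.\<close>

lemma shift_step_backward:
  assumes X: "shift_seq X" and Y: "shift_seq Y" and f': "f' \<in> lin_hom A (obj X (i + 1)) (obj Y (i + 1 + d))"
  shows "\<exists>f. f \<in> lin_hom A (obj X i) (obj Y (i + d)) \<and> shift_step X Y d i f f'"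
proof -
  have e: "i + 1 + d = i + d + 1" by simp
  note f'' = f'[unfolded e]
  have fp: "(\<lambda>p. f' (pro X i p)) \<in> linmap A (prj X i) (obj Y (i + d + 1))"
    by (rule linmap_comp[OF lin_hom_linmap[OF sq_pro[OF X]] lin_hom_linmap[OF f'']])
  obtain g where g: "g \<in> lin_hom A (prj X i) (prj Y (i + d))"
    "\<And>p. p \<in> carrier (prj X i) \<Longrightarrow> pro Y (i + d) (g p) = f' (pro X i p)"
    by (rule projective_lift[OF sq_prj[OF X] sq_prj[OF Y] sq_obj[OF Y] sq_proj[OF X] fp sq_pro[OF Y] sq_sur[OF Y]]) (blast intro: that)+
  have gi: "(\<lambda>x. g (inc X i x)) \<in> linmap A (obj X i) (prj Y (i + d))"
    by (rule linmap_comp[OF lin_hom_linmap[OF sq_inc[OF X]] lin_hom_linmap[OF g(1)]])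
  have im: "g (inc X i x) \<in> inc Y (i + d) ` carrier (obj Y (i + d))" if x: "x \<in> carrier (obj X i)" for x
  proof -
    have ix: "inc X i x \<in> carrier (prj X i)" by (rule lin_hom_closed[OF sq_inc[OF X] x])
    have "pro Y (i + d) (g (inc X i x)) = \<zero>\<^bsub>obj Y (i + d + 1)\<^esub>" using g(2)[OF ix] sq_pro_inc[OF X x]
        addmap_zero[OF lm_ag[OF sq_obj[OF X]] lm_ag[OF sq_obj[OF Y]] lin_hom_addmap[OF f'']] by simp
    then show ?thesis by (rule sq_imI[OF Y lin_hom_closed[OF g(1) ix]])
  qed
  obtain f where f: "f \<in> lin_hom A (obj X i) (obj Y (i + d))"
    "\<And>x. x \<in> carrier (obj X i) \<Longrightarrow> inc Y (i + d) (f x) = g (inc X i x)"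
    by (rule factor_inj[OF sq_obj[OF X] sq_obj[OF Y] sq_prj[OF Y] sq_inc[OF Y] sq_inj[OF Y] gi im]) (blast intro: that)+
  show ?thesis unfolding shift_step_def using f g by (intro exI[of _ f] conjI bexI[of _ g]) auto
qed

lemma shift_family_exists:
  assumes X: "shift_seq X" and Y: "shift_seq Y" and f: "f \<in> lin_hom A (obj X 0) (obj Y d)"
  obtains F where "shift_family A X Y d F" "F 0 = f"
proof -
  obtain F where "F 0 = f" "\<And>i. F i \<in> lin_hom A (obj X i) (obj Y (i + d))" "\<And>i. shift_step X Y d i (F i) (F (i + 1))"
    by (rule int_dependent_choice[where P = "\<lambda>i f. f \<in> lin_hom A (obj X i) (obj Y (i + d))"
          and S = "shift_step X Y d" and ?f0.0 = f]) (use f shift_step_forward[OF X Y] shift_step_backward[OF X Y] in auto)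
  then show ?thesis by (intro that[of F]) (auto simp: shift_family_def shift_step_def)
qed

section \<open>Stable invariance of shift families\<close>

lemma shift_family_diff:
  assumes X: "shift_seq X" and Y: "shift_seq Y" and F: "shift_family A X Y d F" and G: "shift_family A X Y d G"
  shows "shift_family A X Y d (\<lambda>i. \<lambda>x\<in>carrier (obj X i). F i x \<ominus>\<^bsub>obj Y (i + d)\<^esub> G i x)"
  unfolding shift_family_def
proof (intro allI conjI)
  fix i
  note f = shift_familyD(1)[OF F] and g = shift_familyD(1)[OF G]
  show "(\<lambda>x\<in>carrier (obj X i). F i x \<ominus>\<^bsub>obj Y (i + d)\<^esub> G i x) \<in> lin_hom A (obj X i) (obj Y (i + d))"
    by (rule lin_hom_minus[OF f g sq_obj[OF X] sq_obj[OF Y]])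
  obtain g1 where g1: "g1\<in>lin_hom A (prj X i) (prj Y (i + d))"
          "\<forall>x\<in>carrier (obj X i). g1 (inc X i x) = inc Y (i + d) (F i x)"
          "\<forall>p\<in>carrier (prj X i). pro Y (i + d) (g1 p) = F (i + 1) (pro X i p)" using shift_familyD(2)[OF F] by metis
  obtain g2 where g2: "g2\<in>lin_hom A (prj X i) (prj Y (i + d))"
          "\<forall>x\<in>carrier (obj X i). g2 (inc X i x) = inc Y (i + d) (G i x)"
          "\<forall>p\<in>carrier (prj X i). pro Y (i + d) (g2 p) = G (i + 1) (pro X i p)" using shift_familyD(2)[OF G] by metis
  have e: "i + 1 + d = i + d + 1" by simp
  show "\<exists>g\<in>lin_hom A (prj X i) (prj Y (i + d)).
          (\<forall>x\<in>carrier (obj X i). g (inc X i x) = inc Y (i + d) ((\<lambda>x\<in>carrier (obj X i). F i x \<ominus>\<^bsub>obj Y (i + d)\<^esub> G i x) x)) \<and>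
          (\<forall>p\<in>carrier (prj X i). pro Y (i + d) (g p) =
            (\<lambda>x\<in>carrier (obj X (i + 1)). F (i + 1) x \<ominus>\<^bsub>obj Y (i + 1 + d)\<^esub> G (i + 1) x) (pro X i p))"
  proof (intro bexI[of _ "\<lambda>p\<in>carrier (prj X i). g1 p \<ominus>\<^bsub>prj Y (i + d)\<^esub> g2 p"] conjI ballI)
    show "(\<lambda>p\<in>carrier (prj X i). g1 p \<ominus>\<^bsub>prj Y (i + d)\<^esub> g2 p) \<in> lin_hom A (prj X i) (prj Y (i + d))"
      by (rule lin_hom_minus[OF g1(1) g2(1) sq_prj[OF X] sq_prj[OF Y]])
    fix x assume x: "x \<in> carrier (obj X i)"
    show "(\<lambda>p\<in>carrier (prj X i). g1 p \<ominus>\<^bsub>prj Y (i + d)\<^esub> g2 p) (inc X i x) =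
        inc Y (i + d) ((\<lambda>x\<in>carrier (obj X i). F i x \<ominus>\<^bsub>obj Y (i + d)\<^esub> G i x) x)"
      using x g1(2) g2(2) lin_hom_closed[OF sq_inc[OF X] x]
        addmap_diff[OF lm_ag[OF sq_obj[OF Y]] lm_ag[OF sq_prj[OF Y]] lin_hom_addmap[OF sq_inc[OF Y]]
          lin_hom_closed[OF f x] lin_hom_closed[OF g x]] by simp
  next
    fix p assume p: "p \<in> carrier (prj X i)"
    show "pro Y (i + d) ((\<lambda>p\<in>carrier (prj X i). g1 p \<ominus>\<^bsub>prj Y (i + d)\<^esub> g2 p) p) =
        (\<lambda>x\<in>carrier (obj X (i + 1)). F (i + 1) x \<ominus>\<^bsub>obj Y (i + 1 + d)\<^esub> G (i + 1) x) (pro X i p)" unfolding e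
      using p g1(3) g2(3) lin_hom_closed[OF sq_pro[OF X] p]
        addmap_diff[OF lm_ag[OF sq_prj[OF Y]] lm_ag[OF sq_obj[OF Y]] lin_hom_addmap[OF sq_pro[OF Y]]
          lin_hom_closed[OF g1(1) p] lin_hom_closed[OF g2(1) p]] by simp
  qed
qed

text \<open>If F i factors through a projective P, the factor into P extends over the middle term of
  X. Subtracting the resulting map from G leaves one that vanishes on the image of
  \<open>inc\<close>; it descends to r', and F (i + 1) becomes \<open>pro\<close> after r', a
  factorisation through the middle term of Y.\<close>

lemma fin_rank_shift_up:
  assumes X: "shift_seq X" and Y: "shift_seq Y" and F: "shift_family A X Y d F"
    and fr: "fin_rank A (obj X i) (obj Y (i + d)) (F i)"
  shows "fin_rank A (obj X (i + 1)) (obj Y (i + 1 + d)) (F (i + 1))"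
proof -
  have e: "i + 1 + d = i + d + 1" by simp
  note Fl = shift_familyD(1)[OF F]
  obtain G where G: "G\<in>lin_hom A (prj X i) (prj Y (i + d))" "\<forall>x\<in>carrier (obj X i). G (inc X i x) = inc Y (i + d) (F i x)"
          "\<forall>p\<in>carrier (prj X i). pro Y (i + d) (G p) = F (i + 1) (pro X i p)" using shift_familyD(2)[OF F] by metis
  obtain P :: "('a, nat \<Rightarrow> 'a) module" and g h where P: "left_module A P" "fg_projective A P"
    and g: "g \<in> lin_hom A (obj X i) P" and h: "h \<in> lin_hom A P (obj Y (i + d))"
    and Fi: "F i = compose (carrier (obj X i)) h g"
    using fr unfolding proj_hom_iff_fin_rank[OF sq_obj[OF X] sq_obj[OF Y], symmetric] by (auto simp: proj_hom_def)
  obtain \<rho> where \<rho>: "\<rho> \<in> linmap \<O> (RS (prj X i)) (RS (obj X i))"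
    "\<And>x. x \<in> carrier (obj X i) \<Longrightarrow> \<rho> (inc X i x) = x" using sq_split[OF X] by metis
  obtain g' where g': "g' \<in> lin_hom A (prj X i) P" "\<And>x. x \<in> carrier (obj X i) \<Longrightarrow> g' (inc X i x) = g x"
    by (rule relatively_injective[OF sq_obj[OF X] sq_prj[OF X] P lin_hom_linmap[OF sq_inc[OF X]] \<rho> lin_hom_linmap[OF g]]) (blast intro: that)+
  let ?k = "compose (carrier (prj X i)) (inc Y (i + d)) (compose (carrier (prj X i)) h g')"
  have k: "?k \<in> lin_hom A (prj X i) (prj Y (i + d))"
    by (rule lin_hom_compose[OF lin_hom_compose[OF g'(1) h sq_prj[OF X]] sq_inc[OF Y] sq_prj[OF X]])
  let ?r = "\<lambda>p\<in>carrier (prj X i). G p \<ominus>\<^bsub>prj Y (i + d)\<^esub> ?k p"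
  have r: "?r \<in> lin_hom A (prj X i) (prj Y (i + d))" by (rule lin_hom_minus[OF G(1) k sq_prj[OF X] sq_prj[OF Y]])
  have ker: "?r p = \<zero>\<^bsub>prj Y (i + d)\<^esub>" if p: "p \<in> carrier (prj X i)" "pro X i p = \<zero>\<^bsub>obj X (i + 1)\<^esub>" for p
  proof -
    obtain x where x: "x \<in> carrier (obj X i)" "p = inc X i x" by (rule sq_kerE[OF X p])
    then show ?thesis using G(2) g'(2)[OF x(1)] Fi p(1) lin_hom_closed[OF sq_inc[OF Y] lin_hom_closed[OF Fl x(1)]]
        lm_ag[OF sq_prj[OF Y]] by simp
  qed
  obtain r' where r': "r' \<in> lin_hom A (obj X (i + 1)) (prj Y (i + d))" "\<And>p. p \<in> carrier (prj X i) \<Longrightarrow> r' (pro X i p) = ?r p"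
    by (rule factor_surj[OF sq_prj[OF X] sq_obj[OF X] sq_prj[OF Y] sq_pro[OF X] sq_sur[OF X] r ker]) (blast intro: that)+
  have "F (i + 1) = (\<lambda>x\<in>carrier (obj X (i + 1)). pro Y (i + d) (r' x))"
  proof (rule extensionalityI[OF lin_hom_ext[OF Fl]])
    fix x assume x: "x \<in> carrier (obj X (i + 1))"
    then obtain p where p: "p \<in> carrier (prj X i)" "x = pro X i p" unfolding sq_sur[OF X, symmetric] by blast
    have hg: "h (g' p) \<in> carrier (obj Y (i + d))" using lin_hom_closed[OF h lin_hom_closed[OF g'(1) p(1)]] .
    have "pro Y (i + d) (r' x) = pro Y (i + d) (G p) \<ominus>\<^bsub>obj Y (i + d + 1)\<^esub> pro Y (i + d) (inc Y (i + d) (h (g' p)))"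
      using r'(2)[OF p(1)] p addmap_diff[OF lm_ag[OF sq_prj[OF Y]] lm_ag[OF sq_obj[OF Y]] lin_hom_addmap[OF sq_pro[OF Y]]
          lin_hom_closed[OF G(1) p(1)] lin_hom_closed[OF k p(1)]] by simp
    also have "\<dots> = F (i + 1) x"
      using sq_pro_inc[OF Y hg] G(3) p lin_hom_closed[OF Fl x] lm_ag[OF sq_obj[OF Y]] by (simp add: e)
    finally show "F (i + 1) x = (\<lambda>x\<in>carrier (obj X (i + 1)). pro Y (i + d) (r' x)) x" using x by simp
  qed simp
  then show ?thesis unfolding e
    using fin_rank_factor[OF sq_obj[OF X] sq_obj[OF Y] sq_prj[OF Y] sq_proj[OF Y] lin_hom_linmap[OF r'(1)]
        lin_hom_linmap[OF sq_pro[OF Y]]] by simp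
qed

text \<open>The mirror image: the factor out of P lifts along \<open>pro\<close>, the corrected map
  lands in the image of \<open>inc\<close>, and F i factors through the middle term of X.\<close>

lemma fin_rank_shift_down:
  assumes X: "shift_seq X" and Y: "shift_seq Y" and F: "shift_family A X Y d F"
    and fr: "fin_rank A (obj X (i + 1)) (obj Y (i + 1 + d)) (F (i + 1))"
  shows "fin_rank A (obj X i) (obj Y (i + d)) (F i)"
proof -
  have e: "i + 1 + d = i + d + 1" by simp
  note Fl = shift_familyD(1)[OF F]
  obtain G where G: "G\<in>lin_hom A (prj X i) (prj Y (i + d))" "\<forall>x\<in>carrier (obj X i). G (inc X i x) = inc Y (i + d) (F i x)"
          "\<forall>p\<in>carrier (prj X i). pro Y (i + d) (G p) = F (i + 1) (pro X i p)" using shift_familyD(2)[OF F] by metis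
  obtain P :: "('a, nat \<Rightarrow> 'a) module" and g h where P: "left_module A P" "fg_projective A P"
    and g: "g \<in> lin_hom A (obj X (i + 1)) P" and h: "h \<in> lin_hom A P (obj Y (i + d + 1))"
    and Fi: "F (i + 1) = compose (carrier (obj X (i + 1))) h g"
    using fr unfolding e proj_hom_iff_fin_rank[OF sq_obj[OF X] sq_obj[OF Y], symmetric] by (auto simp: proj_hom_def)
  obtain h' where h': "h' \<in> lin_hom A P (prj Y (i + d))" "\<And>x. x \<in> carrier P \<Longrightarrow> pro Y (i + d) (h' x) = h x"
    by (rule projective_lift[OF P(1) sq_prj[OF Y] sq_obj[OF Y] P(2) lin_hom_linmap[OF h] sq_pro[OF Y] sq_sur[OF Y]]) (blast intro: that)+
  let ?k = "compose (carrier (prj X i)) h' (compose (carrier (prj X i)) g (pro X i))"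
  have k: "?k \<in> lin_hom A (prj X i) (prj Y (i + d))"
    by (rule lin_hom_compose[OF lin_hom_compose[OF sq_pro[OF X] g sq_prj[OF X]] h'(1) sq_prj[OF X]])
  let ?r = "\<lambda>p\<in>carrier (prj X i). G p \<ominus>\<^bsub>prj Y (i + d)\<^esub> ?k p"
  have r: "?r \<in> lin_hom A (prj X i) (prj Y (i + d))" by (rule lin_hom_minus[OF G(1) k sq_prj[OF X] sq_prj[OF Y]])
  have im: "?r p \<in> inc Y (i + d) ` carrier (obj Y (i + d))" if p: "p \<in> carrier (prj X i)" for p
  proof -
    have px: "pro X i p \<in> carrier (obj X (i + 1))" by (rule lin_hom_closed[OF sq_pro[OF X] p])
    have "pro Y (i + d) (?r p) = pro Y (i + d) (G p) \<ominus>\<^bsub>obj Y (i + d + 1)\<^esub> pro Y (i + d) (?k p)"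
      using p addmap_diff[OF lm_ag[OF sq_prj[OF Y]] lm_ag[OF sq_obj[OF Y]] lin_hom_addmap[OF sq_pro[OF Y]]
          lin_hom_closed[OF G(1) p] lin_hom_closed[OF k p]] by simp
    also have "\<dots> = \<zero>\<^bsub>obj Y (i + d + 1)\<^esub>" using p px G(3) h'(2)[OF lin_hom_closed[OF g px]] Fi lm_ag[OF sq_obj[OF Y]]
        lin_hom_closed[OF h lin_hom_closed[OF g px]] by simp
    finally show ?thesis by (rule sq_imI[OF Y lin_hom_closed[OF r p]])
  qed
  obtain r' where r': "r' \<in> lin_hom A (prj X i) (obj Y (i + d))" "\<And>p. p \<in> carrier (prj X i) \<Longrightarrow> inc Y (i + d) (r' p) = ?r p"
    by (rule factor_inj[OF sq_prj[OF X] sq_obj[OF Y] sq_prj[OF Y] sq_inc[OF Y] sq_inj[OF Y] lin_hom_linmap[OF r] im]) (blast intro: that)+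
  have "F i = (\<lambda>x\<in>carrier (obj X i). r' (inc X i x))"
  proof (rule extensionalityI[OF lin_hom_ext[OF Fl]])
    fix x assume x: "x \<in> carrier (obj X i)"
    have ix: "inc X i x \<in> carrier (prj X i)" by (rule lin_hom_closed[OF sq_inc[OF X] x])
    have "?k (inc X i x) = \<zero>\<^bsub>prj Y (i + d)\<^esub>"
      using ix sq_pro_inc[OF X x] addmap_zero[OF lm_ag[OF sq_obj[OF X]] lm_ag[OF P(1)] lin_hom_addmap[OF g]]
        addmap_zero[OF lm_ag[OF P(1)] lm_ag[OF sq_prj[OF Y]] lin_hom_addmap[OF h'(1)]] by simp
    then have "?r (inc X i x) = inc Y (i + d) (F i x)"
      using ix G(2) x lm_ag[OF sq_prj[OF Y]] lin_hom_closed[OF sq_inc[OF Y] lin_hom_closed[OF Fl x]] by simp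
    then have "inc Y (i + d) (r' (inc X i x)) = inc Y (i + d) (F i x)" using r'(2)[OF ix] by simp
    then have "r' (inc X i x) = F i x"
      using sq_inj[OF Y, of "i + d"] lin_hom_closed[OF r'(1) ix] lin_hom_closed[OF Fl x] by (auto simp: inj_on_def)
    then show "F i x = (\<lambda>x\<in>carrier (obj X i). r' (inc X i x)) x" using x by simp
  qed simp
  then show ?thesis using fin_rank_factor[OF sq_obj[OF X] sq_obj[OF Y] sq_prj[OF X] sq_proj[OF X]
        lin_hom_linmap[OF sq_inc[OF X]] lin_hom_linmap[OF r'(1)]] by simp
qed

text \<open>The difference of the families is again a shift family, and finite rank passes to both
  neighbours. Stable agreement in one degree therefore spreads to every degree; identities between
  shifted morphisms are proved below by checking them in degree 0.\<close>

lemma shift_family_stable: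
  assumes X: "shift_seq X" and Y: "shift_seq Y" and F: "shift_family A X Y d F" and G: "shift_family A X Y d G"
    and st: "(F i, G i) \<in> stable_rel A (obj X i) (obj Y (i + d))"
  shows "(F k, G k) \<in> stable_rel A (obj X k) (obj Y (k + d))"
proof -
  note D = shift_family_diff[OF X Y F G]
  let ?D = "\<lambda>i. \<lambda>x\<in>carrier (obj X i). F i x \<ominus>\<^bsub>obj Y (i + d)\<^esub> G i x"
  have "fin_rank A (obj X k) (obj Y (k + d)) (?D k)"
  proof (induction k rule: int_induct[where k = i])
    case base then show ?case using st unfolding stable_rel_iff[OF sq_obj[OF X] sq_obj[OF Y]] by blast
  next
    case (step1 j) then show ?case using fin_rank_shift_up[OF X Y D] by blast
  next
    case (step2 j) then show ?case using fin_rank_shift_down[OF X Y D, of "j - 1"] unfolding diff_add_cancel by blast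
  qed
  then show ?thesis using shift_familyD(1)[OF F] shift_familyD(1)[OF G]
    unfolding stable_rel_iff[OF sq_obj[OF X] sq_obj[OF Y]] by blast
qed

lemma shift_family_compose:
  assumes X: "shift_seq X" and Y: "shift_seq Y" and Z: "shift_seq Z"
    and F: "shift_family A X Y d F" and G: "shift_family A Y Z e G"
  shows "shift_family A X Z (d + e) (\<lambda>i. compose (carrier (obj X i)) (G (i + d)) (F i))"
  unfolding shift_family_def
proof (intro allI conjI)
  fix i
  note f = shift_familyD(1)[OF F] and g = shift_familyD(1)[OF G]
  have e: "i + d + e = i + (d + e)" by simp
  show "compose (carrier (obj X i)) (G (i + d)) (F i) \<in> lin_hom A (obj X i) (obj Z (i + (d + e)))"
    unfolding e[symmetric] by (rule lin_hom_compose[OF f g sq_obj[OF X]])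
  obtain g1 where g1: "g1\<in>lin_hom A (prj X i) (prj Y (i + d))"
          "\<forall>x\<in>carrier (obj X i). g1 (inc X i x) = inc Y (i + d) (F i x)"
          "\<forall>p\<in>carrier (prj X i). pro Y (i + d) (g1 p) = F (i + 1) (pro X i p)" using shift_familyD(2)[OF F] by metis
  obtain g2 where g2: "g2\<in>lin_hom A (prj Y (i + d)) (prj Z (i + d + e))"
          "\<forall>x\<in>carrier (obj Y (i + d)). g2 (inc Y (i + d) x) = inc Z (i + d + e) (G (i + d) x)"
          "\<forall>p\<in>carrier (prj Y (i + d)). pro Z (i + d + e) (g2 p) = G (i + d + 1) (pro Y (i + d) p)"
    using shift_familyD(2)[OF G] by metis
  have e': "i + d + 1 = i + 1 + d" by simp
  show "\<exists>g\<in>lin_hom A (prj X i) (prj Z (i + (d + e))).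
          (\<forall>x\<in>carrier (obj X i). g (inc X i x) = inc Z (i + (d + e)) (compose (carrier (obj X i)) (G (i + d)) (F i) x)) \<and>
          (\<forall>p\<in>carrier (prj X i). pro Z (i + (d + e)) (g p) =
            compose (carrier (obj X (i + 1))) (G (i + 1 + d)) (F (i + 1)) (pro X i p))" unfolding e[symmetric]
  proof (intro bexI[of _ "compose (carrier (prj X i)) g2 g1"] conjI ballI)
    show "compose (carrier (prj X i)) g2 g1 \<in> lin_hom A (prj X i) (prj Z (i + d + e))"
      by (rule lin_hom_compose[OF g1(1) g2(1) sq_prj[OF X]])
    fix x assume x: "x \<in> carrier (obj X i)"
    show "compose (carrier (prj X i)) g2 g1 (inc X i x) = inc Z (i + d + e) (compose (carrier (obj X i)) (G (i + d)) (F i) x)"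
      using x g1(2) g2(2) lin_hom_closed[OF sq_inc[OF X] x] lin_hom_closed[OF f x] by simp
  next
    fix p assume p: "p \<in> carrier (prj X i)"
    show "pro Z (i + d + e) (compose (carrier (prj X i)) g2 g1 p) =
            compose (carrier (obj X (i + 1))) (G (i + 1 + d)) (F (i + 1)) (pro X i p)"
      using p g1(3) g2(3)[unfolded e'] lin_hom_closed[OF sq_pro[OF X] p] lin_hom_closed[OF g1(1) p] by simp
  qed
qed

lemma shift_family_id:
  assumes X: "shift_seq X"
  shows "shift_family A X X 0 (\<lambda>i. \<lambda>x\<in>carrier (obj X i). x)"
  unfolding shift_family_def
proof (intro allI conjI)
  fix i
  show "(\<lambda>x\<in>carrier (obj X i). x) \<in> lin_hom A (obj X i) (obj X (i + 0))" using lin_hom_id[OF sq_obj[OF X]] by simp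
  show "\<exists>g\<in>lin_hom A (prj X i) (prj X (i + 0)).
          (\<forall>x\<in>carrier (obj X i). g (inc X i x) = inc X (i + 0) ((\<lambda>x\<in>carrier (obj X i). x) x)) \<and>
          (\<forall>p\<in>carrier (prj X i). pro X (i + 0) (g p) = (\<lambda>x\<in>carrier (obj X (i + 1)). x) (pro X i p))"
    using lin_hom_id[OF sq_prj[OF X]] lin_hom_closed[OF sq_inc[OF X]] lin_hom_closed[OF sq_pro[OF X]]
    by (intro bexI[of _ "\<lambda>x\<in>carrier (prj X i). x"]) auto
qed

end

section \<open>Extension of scalars to the field of fractions\<close>

lemma basis_orthonormal_frame:
  assumes P: "left_module R P" and X: "finite_basis R P X"
  obtains \<phi> where "frame R P X (\<lambda>x. x) \<phi>" "orthonormal R X (\<lambda>x. x) \<phi>"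
proof -
  interpret R: ring R by (rule lm_ring[OF P])
  have agP: "abelian_group P" by (rule lm_ag[OF P])
  obtain \<phi> where fr: "frame R P X (\<lambda>x. x) \<phi>" and u: "\<And>y c. c \<in> X \<rightarrow> carrier R \<Longrightarrow> y = (\<Oplus>\<^sub>P x\<in>X. c x \<odot>\<^sub>P x) \<Longrightarrow> \<forall>x\<in>X. \<phi> x y = c x"
    by (rule basis_frame[OF P X]) (rule that)
  note XP = frame_elt[OF fr]
  have "\<forall>v\<in>X. \<phi> v x = (if v = x then \<one>\<^sub>R else \<zero>\<^sub>R)" if x: "x \<in> X" for x
  proof (rule u)
    have "(\<Oplus>\<^sub>P v\<in>X. (if v = x then \<one>\<^sub>R else \<zero>\<^sub>R) \<odot>\<^sub>P v) = (\<Oplus>\<^sub>P v\<in>X. if v = x then v else \<zero>\<^sub>P)"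
      by (rule fs_cong[OF agP]) (use XP lm_zero_l[OF P] left_module.lm_one[OF P] agP in auto)
    also have "\<dots> = x" by (rule fs_delta[where f = "\<lambda>v. v", OF agP frame_finite[OF fr] x XP[OF x]])
    finally show "x = (\<Oplus>\<^sub>P v\<in>X. (if v = x then \<one>\<^sub>R else \<zero>\<^sub>R) \<odot>\<^sub>P v)" by simp
  qed auto
  then have "orthonormal R X (\<lambda>x. x) \<phi>" by (auto simp: orthonormal_def)
  then show ?thesis using fr by (rule that[rotated])
qed

locale fractions =
  fixes \<O> K :: "'k ring"
  assumes fof: "field_of_fractions \<O> K"
begin

lemma K_field: "field K" using fof by (simp add: field_of_fractions_def)

sublocale K: field K by (rule K_field)

lemma O_eq: "\<O> = K\<lparr>carrier := carrier \<O>\<rparr>" using fof by (simp add: field_of_fractions_def)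

lemma O_ops [simp]: "add \<O> = add K" "monoid.mult \<O> = monoid.mult K" "one \<O> = one K" "ring.zero \<O> = ring.zero K"
  by (subst O_eq, simp)+

lemma O_sub [simp]: "c \<in> carrier \<O> \<Longrightarrow> c \<in> carrier K"
proof -
  have "carrier \<O> \<subseteq> carrier K" using fof subring.axioms(1) subgroup.subset by (fastforce simp: field_of_fractions_def)
  then show "c \<in> carrier \<O> \<Longrightarrow> c \<in> carrier K" by blast
qed

lemma fracE:
  assumes "k \<in> carrier K"
  obtains a b where "a \<in> carrier \<O>" "b \<in> carrier \<O>" "b \<noteq> \<zero>\<^sub>K" "k = inv\<^bsub>K\<^esub> b \<otimes>\<^sub>K a"
proof -
  obtain a b where ab: "a \<in> carrier \<O>" "b \<in> carrier \<O>" "b \<noteq> \<zero>\<^sub>K" "k = a \<otimes>\<^sub>K inv\<^bsub>K\<^esub> b"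
    using fof assms by (auto simp: field_of_fractions_def)
  moreover have "inv\<^bsub>K\<^esub> b \<in> carrier K" using ab by (simp add: K.field_Units)
  ultimately show ?thesis using that[of a b] by (simp add: K.m_comm)
qed

lemma inv_K [simp]:
  assumes "c \<in> carrier K" "c \<noteq> \<zero>\<^sub>K"
  shows "inv\<^bsub>K\<^esub> c \<in> carrier K" "inv\<^bsub>K\<^esub> c \<otimes>\<^sub>K c = \<one>\<^sub>K" "c \<otimes>\<^sub>K inv\<^bsub>K\<^esub> c = \<one>\<^sub>K" "inv\<^bsub>K\<^esub> c \<noteq> \<zero>\<^sub>K"
proof -
  have u: "c \<in> Units K" using assms by (simp add: K.field_Units)
  show 1: "inv\<^bsub>K\<^esub> c \<in> carrier K" "inv\<^bsub>K\<^esub> c \<otimes>\<^sub>K c = \<one>\<^sub>K" "c \<otimes>\<^sub>K inv\<^bsub>K\<^esub> c = \<one>\<^sub>K" using u by simp_all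
  show "inv\<^bsub>K\<^esub> c \<noteq> \<zero>\<^sub>K" using 1 assms K.r_null[OF assms(1)] K.one_not_zero by metis
qed

lemma inv_K_mult:
  assumes "c \<in> carrier K" "c \<noteq> \<zero>\<^sub>K" "d \<in> carrier K" "d \<noteq> \<zero>\<^sub>K"
  shows "inv\<^bsub>K\<^esub> (c \<otimes>\<^sub>K d) \<otimes>\<^sub>K d = inv\<^bsub>K\<^esub> c" "inv\<^bsub>K\<^esub> (c \<otimes>\<^sub>K d) \<otimes>\<^sub>K c = inv\<^bsub>K\<^esub> d"
    "c \<otimes>\<^sub>K d \<noteq> \<zero>\<^sub>K"
proof -
  show nz: "c \<otimes>\<^sub>K d \<noteq> \<zero>\<^sub>K" using assms K.integral by blast
  have cd: "c \<otimes>\<^sub>K d \<in> carrier K" using assms by simp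
  have i: "(inv\<^bsub>K\<^esub> (c \<otimes>\<^sub>K d) \<otimes>\<^sub>K d) \<otimes>\<^sub>K c = \<one>\<^sub>K" using inv_K[OF cd nz] assms by (simp add: K.m_assoc K.m_comm[of d c])
  have j: "(inv\<^bsub>K\<^esub> (c \<otimes>\<^sub>K d) \<otimes>\<^sub>K c) \<otimes>\<^sub>K d = \<one>\<^sub>K" using inv_K[OF cd nz] assms by (simp add: K.m_assoc)
  show "inv\<^bsub>K\<^esub> (c \<otimes>\<^sub>K d) \<otimes>\<^sub>K d = inv\<^bsub>K\<^esub> c" using K.inv_char[of c "inv\<^bsub>K\<^esub> (c \<otimes>\<^sub>K d) \<otimes>\<^sub>K d"] i inv_K[OF cd nz] assms K.m_comm by simp
  show "inv\<^bsub>K\<^esub> (c \<otimes>\<^sub>K d) \<otimes>\<^sub>K c = inv\<^bsub>K\<^esub> d" using K.inv_char[of d "inv\<^bsub>K\<^esub> (c \<otimes>\<^sub>K d) \<otimes>\<^sub>K c"] j inv_K[OF cd nz] assms K.m_comm by simp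
qed

lemma agK [simp]: "abelian_group K" by (rule K.abelian_group_axioms)

lemma K_bimodule_ag: "abelian_group (regular_bimodule K)" by (rule ag_same[of K]) simp_all

lemma K_bimodule_lm: "left_module K (regular_bimodule K)" by (rule left_moduleI[OF K.ring_axioms K_bimodule_ag])
     (auto simp: K.l_distr K.r_distr K.m_assoc)

abbreviation "pk W k w \<equiv> pure \<O> (regular_bimodule K) W k w"

end

locale ext_module = fractions \<O> K for \<O> K :: "'k ring" +
  fixes W :: "('k, 'w) module"
  assumes W: "left_module \<O> W" and ringO': "cring \<O>"
begin

sublocale E: tensor_left \<O> "regular_bimodule K" W K
  by (intro tensor_left.intro tensor_data.intro tensor_left_axioms.intro K_bimodule_ag lm_ag[OF W] K_bimodule_lm)
     (auto simp: lm_smult[OF W] K.m_assoc)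

abbreviation "EW \<equiv> extend_scalars \<O> K W"

lemma EW_lm: "left_module K EW" by (rule E.T_left_module)

lemma pk_simps: "k \<in> carrier K \<Longrightarrow> w \<in> carrier W \<Longrightarrow> pk W k w \<in> carrier (tensor_ab \<O> (regular_bimodule K) W)"
  "k \<in> carrier K \<Longrightarrow> c \<in> carrier \<O> \<Longrightarrow> w \<in> carrier W \<Longrightarrow> pk W (k \<otimes>\<^sub>K c) w = pk W k (c \<odot>\<^sub>W w)"
  "k \<in> carrier K \<Longrightarrow> k' \<in> carrier K \<Longrightarrow> w \<in> carrier W \<Longrightarrow> k \<odot>\<^sub>EW pk W k' w = pk W (k \<otimes>\<^sub>K k') w"
  "k \<in> carrier K \<Longrightarrow> w \<in> carrier W \<Longrightarrow> w' \<in> carrier W \<Longrightarrow>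
     pk W k (w \<oplus>\<^sub>W w') = pk W k w \<oplus>\<^bsub>tensor_ab \<O> (regular_bimodule K) W\<^esub> pk W k w'"
  using E.pure_closed E.pure_bal[of k c w] E.smult_pure E.pure_add_r by simp_all

text \<open>Numerators cross the tensor sign and the fractions get a common denominator, so one pure
  tensor suffices.\<close>

lemma denominator:
  assumes "q \<in> carrier (tensor_ab \<O> (regular_bimodule K) W)"
  shows "\<exists>c\<in>carrier \<O>. \<exists>w\<in>carrier W. c \<noteq> \<zero>\<^sub>K \<and> q = pk W (inv\<^bsub>K\<^esub> c) w"
  using assms
proof (induction q rule: E.tensor_induct)
  case (pure k w)
  have k: "k \<in> carrier K" using pure by simp
  obtain a b where ab: "a \<in> carrier \<O>" "b \<in> carrier \<O>" "b \<noteq> \<zero>\<^sub>K" "k = inv\<^bsub>K\<^esub> b \<otimes>\<^sub>K a" by (rule fracE[OF k])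
  then show ?case using pk_simps(2)[of "inv\<^bsub>K\<^esub> b" a w] pure lm_smult[OF W ab(1)]
    by (intro bexI[of _ b] bexI[of _ "a \<odot>\<^sub>W w"]) auto
next
  case (add q r)
  obtain c w where c: "c \<in> carrier \<O>" "w \<in> carrier W" "c \<noteq> \<zero>\<^sub>K" "q = pk W (inv\<^bsub>K\<^esub> c) w" using add by blast
  obtain d v where d: "d \<in> carrier \<O>" "v \<in> carrier W" "d \<noteq> \<zero>\<^sub>K" "r = pk W (inv\<^bsub>K\<^esub> d) v" using add by blast
  interpret O: cring \<O> by (rule ringO')
  have cd: "c \<otimes>\<^sub>K d \<in> carrier \<O>" using c(1) d(1) O.m_closed by simp
  have nz: "c \<otimes>\<^sub>K d \<noteq> \<zero>\<^sub>K" using inv_K_mult(3) c d by simp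
  have i: "inv\<^bsub>K\<^esub> (c \<otimes>\<^sub>K d) \<in> carrier K" using nz cd by simp
  have "q = pk W (inv\<^bsub>K\<^esub> (c \<otimes>\<^sub>K d)) (d \<odot>\<^sub>W w)" using c d pk_simps(2)[OF i d(1) c(2)] inv_K_mult(1)[of c d] by simp
  moreover have "r = pk W (inv\<^bsub>K\<^esub> (c \<otimes>\<^sub>K d)) (c \<odot>\<^sub>W v)" using c d pk_simps(2)[OF i c(1) d(2)] inv_K_mult(2)[of c d] by simp
  ultimately show ?case using cd nz pk_simps(4)[OF i lm_smult[OF W d(1) c(2)] lm_smult[OF W c(1) d(2)]]
      lm_smult[OF W d(1) c(2)] lm_smult[OF W c(1) d(2)] lm_ag[OF W]
    by (intro bexI[of _ "c \<otimes>\<^sub>K d"] bexI[of _ "d \<odot>\<^sub>W w \<oplus>\<^sub>W c \<odot>\<^sub>W v"]) auto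
qed

definition ext_fun :: "('w \<Rightarrow> 'k) \<Rightarrow> (('k \<times> 'w) \<Rightarrow>\<^sub>0 int) set \<Rightarrow> 'k" where "ext_fun \<phi> = tensor_lift K (\<lambda>(k, x). k \<otimes>\<^sub>K \<phi> x)"

context
  fixes \<phi> assumes \<phi>: "\<phi> \<in> linmap \<O> W (regular \<O>)"
begin

lemma \<phi>_bal: "balanced \<O> (regular_bimodule K) W K (\<lambda>(k, x). k \<otimes>\<^sub>K \<phi> x)"
  using linmap_closed[OF \<phi>] linmap_add[OF \<phi>] linmap_smult[OF \<phi>]
  by (intro balancedI) (auto simp: K.r_distr K.l_distr K.m_assoc)

lemma ext_fun_pure: "k \<in> carrier K \<Longrightarrow> x \<in> carrier W \<Longrightarrow> ext_fun \<phi> (pk W k x) = k \<otimes>\<^sub>K \<phi> x"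
  unfolding ext_fun_def using E.lift_pure[OF agK \<phi>_bal] by simp

lemma ext_fun_linmap: "ext_fun \<phi> \<in> linmap K EW (regular K)"
proof -
  have am: "ext_fun \<phi> \<in> addmap EW K" unfolding ext_fun_def by (rule E.lift_addmap[OF agK \<phi>_bal])
  show ?thesis
  proof (rule linmapI)
    fix a q assume a: "a \<in> carrier K" and q: "q \<in> carrier EW"
    have "(\<lambda>q. ext_fun \<phi> (a \<odot>\<^sub>EW q)) \<in> addmap EW K" by (rule addmap_comp[OF E.smult_addmap[OF a] am])
    moreover have "(\<lambda>q. a \<otimes>\<^sub>K ext_fun \<phi> q) \<in> addmap EW K"
      by (rule addmap_comp[OF am]) (auto intro: addmapI simp: a K.r_distr)
    ultimately show "ext_fun \<phi> (a \<odot>\<^sub>EW q) = a \<odot>\<^bsub>regular K\<^esub> ext_fun \<phi> q" using q a linmap_closed[OF \<phi>] unfolding regular_simps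
      by (rule_tac E.tensor_ext[where G = K]) (auto simp: pk_simps(3) ext_fun_pure K.m_assoc)
  qed (use addmap_closed[OF am] addmap_add[OF am] in auto)
qed

end

text \<open>It is enough to expand pure tensors, and there the coefficient \<open>\<phi> i x\<close>
  in \<O> crosses the tensor sign.\<close>

lemma ext_frame:
  assumes fr: "frame \<O> W I w \<phi>"
  shows "frame K EW I (\<lambda>i. pk W \<one>\<^sub>K (w i)) (\<lambda>i. ext_fun (\<phi> i))"
proof -
  note fl = ext_fun_linmap[OF frame_fun[OF fr]]
  have agE: "abelian_group EW" by simp
  have w1: "pk W \<one>\<^sub>K (w i) \<in> carrier EW" if "i \<in> I" for i using pk_simps(1)[OF K.one_closed frame_elt[OF fr that]] by simp
  have am: "(\<lambda>q. \<Oplus>\<^sub>EW i\<in>I. ext_fun (\<phi> i) q \<odot>\<^sub>EW pk W \<one>\<^sub>K (w i)) \<in> addmap EW EW"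
    by (rule linmap_addmap[OF linmap_sum[OF EW_lm frame_finite[OF fr] linmap_smult_elt[OF EW_lm EW_lm fl w1]]])
  have "(\<Oplus>\<^sub>EW i\<in>I. ext_fun (\<phi> i) q \<odot>\<^sub>EW pk W \<one>\<^sub>K (w i)) = q" if q: "q \<in> carrier EW" for q
  proof (rule E.tensor_ext[OF am, of "\<lambda>q. q"])
    fix k x assume k: "k \<in> carrier (regular_bimodule K)" and x: "x \<in> carrier W"
    have "(\<Oplus>\<^sub>EW i\<in>I. ext_fun (\<phi> i) (pk W k x) \<odot>\<^sub>EW pk W \<one>\<^sub>K (w i)) = (\<Oplus>\<^sub>EW i\<in>I. pk W k (\<phi> i x \<odot>\<^sub>W w i))"
    proof (rule fs_cong[OF agE])
      fix i assume i: "i \<in> I"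
      have c: "\<phi> i x \<in> carrier \<O>" by (rule frame_coeff[OF fr i x])
      show "ext_fun (\<phi> i) (pk W k x) \<odot>\<^sub>EW pk W \<one>\<^sub>K (w i) = pk W k (\<phi> i x \<odot>\<^sub>W w i)" using k x c frame_elt[OF fr i]
        by (simp add: ext_fun_pure[OF frame_fun[OF fr i]] pk_simps(3) pk_simps(2)[symmetric] K.m_assoc)
      show "pk W k (\<phi> i x \<odot>\<^sub>W w i) \<in> carrier EW" using k lm_smult[OF W c frame_elt[OF fr i]] pk_simps(1) by simp
    qed
    also have "\<dots> = pk W k (\<Oplus>\<^sub>W i\<in>I. \<phi> i x \<odot>\<^sub>W w i)" by (rule addmap_fs[OF lm_ag[OF W] agE E.pure_addmap_r[OF k], symmetric])
         (use lm_smult[OF W frame_coeff[OF fr _ x] frame_elt[OF fr]] in auto)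
    also have "\<dots> = pk W k x" using frame_sum[OF fr x] by simp
    finally show "(\<Oplus>\<^sub>EW i\<in>I. ext_fun (\<phi> i) (pk W k x) \<odot>\<^sub>EW pk W \<one>\<^sub>K (w i)) = pk W k x" .
  qed (use q in "auto intro: addmapI simp: E.ab_ag")
  then show ?thesis using w1 fl frame_finite[OF fr] by (auto simp: frame_def)
qed

text \<open>Supplies the basis over K that \<open>trace_on_frame\<close> asks for.\<close>

lemma ext_free: "fg_free \<O> W \<Longrightarrow> fg_free K EW"
proof -
  assume "fg_free \<O> W"
  then obtain X where X: "finite_basis \<O> W X" by (auto simp: fg_free_def)
  obtain \<phi> where fr: "frame \<O> W X (\<lambda>x. x) \<phi>" and o: "orthonormal \<O> X (\<lambda>x. x) \<phi>" by (rule basis_orthonormal_frame[OF W X])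
  have "orthonormal K X (\<lambda>x. pk W \<one>\<^sub>K x) (\<lambda>x. ext_fun (\<phi> x))" unfolding orthonormal_def
  proof (intro ballI)
    fix x y assume x: "x \<in> X" and y: "y \<in> X"
    have yW: "y \<in> carrier W" using frame_elt[OF fr y] .
    have xy: "\<phi> x y \<in> carrier K" using frame_coeff[OF fr x yW] by simp
    show "ext_fun (\<phi> x) (pk W \<one>\<^sub>K y) = (if x = y then \<one>\<^sub>K else \<zero>\<^sub>K)"
      using ext_fun_pure[OF frame_fun[OF fr x] K.one_closed yW] o x y xy by (simp add: orthonormal_def)
  qed
  then show ?thesis using orthonormal_basis(1)[OF EW_lm K.one_not_zero ext_frame[OF fr]] unfolding fg_free_def by blast
qed

text \<open>The coordinates in a frame separate the points of W and extend to K \<otimes> W, where a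
  nonzero k cancels. Equations between pure tensors with the same first factor are thus brought back
  from K \<otimes> W to W.\<close>

lemma pk_inj:
  assumes fr: "frame \<O> W I w \<phi>" and k: "k \<in> carrier K" "k \<noteq> \<zero>\<^sub>K"
    and x: "x \<in> carrier W" and y: "y \<in> carrier W" and e: "pk W k x = pk W k y"
  shows "x = y"
proof -
  have "\<phi> i x = \<phi> i y" if i: "i \<in> I" for i
  proof -
    have "k \<otimes>\<^sub>K \<phi> i x = k \<otimes>\<^sub>K \<phi> i y"
      using ext_fun_pure[OF frame_fun[OF fr i] k(1) x] ext_fun_pure[OF frame_fun[OF fr i] k(1) y] e by simp
    then show ?thesis using K.m_lcancel[OF k(2,1)] frame_coeff[OF fr i x] frame_coeff[OF fr i y] by simp
  qed
  then have "(\<Oplus>\<^sub>W i\<in>I. \<phi> i x \<odot>\<^sub>W w i) = (\<Oplus>\<^sub>W i\<in>I. \<phi> i y \<odot>\<^sub>W w i)"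
    by (intro fs_cong[OF lm_ag[OF W]]) (use lm_smult[OF W frame_coeff[OF fr _ y] frame_elt[OF fr]] in auto)
  then show ?thesis using frame_sum[OF fr x] frame_sum[OF fr y] by simp
qed

end

text \<open>The action of \<open>K \<otimes> A\<close> on \<open>K \<otimes> W\<close>; instances are \<open>W = A\<close> and the underlying
  \<open>\<O>\<close>-module of an \<open>A\<close>-module.\<close>

locale ext_act = EA: ext_module \<O> K A + EWm: ext_module \<O> K W
  for \<O> K :: "'k ring" and A :: "('k, 'a) module" and W :: "('k, 'w) module" +
  fixes act :: "'a \<Rightarrow> 'w \<Rightarrow> 'w"
  assumes act_r: "a \<in> carrier A \<Longrightarrow> act a \<in> linmap \<O> W W" and act_l: "w \<in> carrier W \<Longrightarrow> (\<lambda>a. act a w) \<in> linmap \<O> A W"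
begin

text \<open>The inner of the two nested lifts in \<open>extended_action\<close>, with a pure tensor
  k \<otimes> a in the outer slot.\<close>

definition inner_act where "inner_act k a q = tensor_lift EWm.EW (\<lambda>(l, w). EA.pk W (k \<otimes>\<^sub>K l) (act a w)) q"

lemma inner_bal:
  assumes k: "k \<in> carrier K" and a: "a \<in> carrier A"
  shows "balanced \<O> (regular_bimodule K) W EWm.EW (\<lambda>(l, w). EA.pk W (k \<otimes>\<^sub>K l) (act a w))"
proof -
  note c = linmap_closed[OF act_r[OF a]]
  show ?thesis by (intro balancedI) (use k c linmap_add[OF act_r[OF a]] linmap_smult[OF act_r[OF a]] EWm.E.pure_add_l in
        \<open>auto simp: EWm.pk_simps EA.K.r_distr EA.K.m_assoc simp flip: EWm.pk_simps(2)\<close>)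
qed

lemma inner_addmap: "k \<in> carrier K \<Longrightarrow> a \<in> carrier A \<Longrightarrow> inner_act k a \<in> addmap EWm.EW EWm.EW"
  unfolding inner_act_def[abs_def] by (rule EWm.E.lift_addmap[OF EWm.E.T_ag inner_bal])

lemma inner_pure: "k \<in> carrier K \<Longrightarrow> a \<in> carrier A \<Longrightarrow> l \<in> carrier K \<Longrightarrow> w \<in> carrier W \<Longrightarrow>
    inner_act k a (EA.pk W l w) = EA.pk W (k \<otimes>\<^sub>K l) (act a w)"
  unfolding inner_act_def using EWm.E.lift_pure[OF EWm.E.T_ag inner_bal] by simp

lemma outer_bal:
  assumes q: "q \<in> carrier (tensor_ab \<O> (regular_bimodule K) W)"
  shows "balanced \<O> (regular_bimodule K) A EWm.EW (\<lambda>(k, a). inner_act k a q)"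
proof (rule balancedI)
  fix k a assume k: "k \<in> carrier (regular_bimodule K)" and a: "a \<in> carrier A"
  show "(case (k, a) of (k, a) \<Rightarrow> inner_act k a q) \<in> carrier EWm.EW"
    using addmap_closed[OF inner_addmap, of k a q] k a q by simp
next
  fix k a a' assume k: "k \<in> carrier (regular_bimodule K)" and a: "a \<in> carrier A" "a' \<in> carrier A"
  have "inner_act k (a \<oplus>\<^sub>A a') q = inner_act k a q \<oplus>\<^bsub>EWm.EW\<^esub> inner_act k a' q"
  proof (rule EWm.E.tensor_ext[OF inner_addmap addmap_sum2[OF EWm.E.T_ag inner_addmap inner_addmap] _ q])
    fix l w assume l: "l \<in> carrier (regular_bimodule K)" and w: "w \<in> carrier W"
    show "inner_act k (a \<oplus>\<^sub>A a') (EA.pk W l w) = inner_act k a (EA.pk W l w) \<oplus>\<^bsub>EWm.EW\<^esub> inner_act k a' (EA.pk W l w)"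
      using k l w a linmap_add[OF act_l[OF w] a] linmap_closed[OF act_l[OF w]] lm_ag[OF EA.W]
      by (simp add: inner_pure EWm.pk_simps)
  qed (use k a lm_ag[OF EA.W] in auto)
  then show "(case (k, a \<oplus>\<^sub>A a') of (k, a) \<Rightarrow> inner_act k a q) =
      (case (k, a) of (k, a) \<Rightarrow> inner_act k a q) \<oplus>\<^bsub>EWm.EW\<^esub> (case (k, a') of (k, a) \<Rightarrow> inner_act k a q)" by simp
next
  fix k k' a assume k: "k \<in> carrier (regular_bimodule K)" "k' \<in> carrier (regular_bimodule K)" and a: "a \<in> carrier A"
  have "inner_act (k \<oplus>\<^sub>K k') a q = inner_act k a q \<oplus>\<^bsub>EWm.EW\<^esub> inner_act k' a q"
  proof (rule EWm.E.tensor_ext[OF inner_addmap addmap_sum2[OF EWm.E.T_ag inner_addmap inner_addmap] _ q])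
    fix l w assume l: "l \<in> carrier (regular_bimodule K)" and w: "w \<in> carrier W"
    show "inner_act (k \<oplus>\<^sub>K k') a (EA.pk W l w) = inner_act k a (EA.pk W l w) \<oplus>\<^bsub>EWm.EW\<^esub> inner_act k' a (EA.pk W l w)"
      using k l w a linmap_closed[OF act_l[OF w]]
        EWm.E.pure_add_l[of "k \<otimes>\<^sub>K l" "k' \<otimes>\<^sub>K l" "act a w"] by (simp add: inner_pure EA.K.l_distr)
  qed (use k a in auto)
  then show "(case (k \<oplus>\<^bsub>regular_bimodule K\<^esub> k', a) of (k, a) \<Rightarrow> inner_act k a q) =
      (case (k, a) of (k, a) \<Rightarrow> inner_act k a q) \<oplus>\<^bsub>EWm.EW\<^esub> (case (k', a) of (k, a) \<Rightarrow> inner_act k a q)" by simp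
next
  fix k c a assume k: "k \<in> carrier (regular_bimodule K)" and c: "c \<in> carrier \<O>" and a: "a \<in> carrier A"
  have "inner_act (k \<otimes>\<^sub>K c) a q = inner_act k (c \<odot>\<^sub>A a) q"
  proof (rule EWm.E.tensor_ext[OF inner_addmap inner_addmap _ q])
    fix l w assume l: "l \<in> carrier (regular_bimodule K)" and w: "w \<in> carrier W"
    have "act (c \<odot>\<^sub>A a) w = c \<odot>\<^sub>W act a w" using linmap_smult[OF act_l[OF w] c a] .
    moreover have "(k \<otimes>\<^sub>K c) \<otimes>\<^sub>K l = (k \<otimes>\<^sub>K l) \<otimes>\<^sub>K c" using k c l by (simp add: EA.K.m_ac)
    ultimately show "inner_act (k \<otimes>\<^sub>K c) a (EA.pk W l w) = inner_act k (c \<odot>\<^sub>A a) (EA.pk W l w)"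
      using k l w a c linmap_closed[OF act_l[OF w]] lm_smult[OF EA.W c a] by (simp add: inner_pure EWm.pk_simps(2))
  qed (use k a c lm_smult[OF EA.W c a] in auto)
  then show "(case (rsmult (regular_bimodule K) k c, a) of (k, a) \<Rightarrow> inner_act k a q) =
      (case (k, c \<odot>\<^sub>A a) of (k, a) \<Rightarrow> inner_act k a q)" by simp
qed

lemma act_pure_l:
  assumes "k \<in> carrier K" "a \<in> carrier A" "q \<in> carrier (tensor_ab \<O> (regular_bimodule K) W)"
  shows "extended_action \<O> K W act (EA.pk A k a) q = inner_act k a q"
  using EA.E.lift_pure[OF EWm.E.T_ag outer_bal[OF assms(3)]] assms by (simp add: extended_action_def Let_def inner_act_def)

lemma act_pure:
  assumes "k \<in> carrier K" "a \<in> carrier A" "l \<in> carrier K" "w \<in> carrier W"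
  shows "extended_action \<O> K W act (EA.pk A k a) (EA.pk W l w) = EA.pk W (k \<otimes>\<^sub>K l) (act a w)"
  using act_pure_l[OF assms(1,2)] EWm.pk_simps(1) inner_pure assms by simp

end

section \<open>Inverting the relative projective element over K\<close>

locale ext_sym_alg = sym_alg \<O> A s + fractions \<O> K for \<O> K :: "'k ring" and A :: "('k, 'a) module" and s +
  assumes char0: "char_zero K" and ss: "semisimple_ring (extended_algebra \<O> K A)"
begin

lemma char0_O: "char_zero \<O>" using char0 by (simp add: char_zero_def add_pow_def nat_pow_def)

sublocale EA: ext_module \<O> K A by (intro ext_module.intro ext_module_axioms.intro fractions_axioms lmA cringO)

sublocale AA: ext_act \<O> K A A "monoid.mult A" by (intro ext_act.intro ext_act_axioms.intro EA.ext_module_axioms)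
     (auto intro!: linmapI simp: r_distr l_distr smult_mult_l smult_mult_r)

abbreviation "KA \<equiv> extended_algebra \<O> K A"

lemma KA_simps: "carrier KA = carrier EA.EW" "ring.zero KA = ring.zero EA.EW" "add KA = add EA.EW" "one KA = pk A \<one>\<^sub>K \<one>\<^sub>A"
  "monoid.mult KA = extended_action \<O> K A (monoid.mult A)" by (simp_all add: extended_algebra_def)

lemma KA_ring: "ring KA" using ss by (simp add: semisimple_ring_def)

lemma KA_mult: "k \<in> carrier K \<Longrightarrow> a \<in> carrier A \<Longrightarrow> l \<in> carrier K \<Longrightarrow> b \<in> carrier A \<Longrightarrow>
    pk A k a \<otimes>\<^sub>KA pk A l b = pk A (k \<otimes>\<^sub>K l) (a \<otimes>\<^sub>A b)" by (simp add: KA_simps AA.act_pure)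

lemma KA_pk: "k \<in> carrier K \<Longrightarrow> a \<in> carrier A \<Longrightarrow> pk A k a \<in> carrier KA" using EA.pk_simps(1) by (simp add: KA_simps)

lemma KA_denominator:
  assumes "p \<in> carrier KA"
  obtains c a where "c \<in> carrier \<O>" "c \<noteq> \<zero>\<^sub>K" "a \<in> carrier A" "p = pk A (inv\<^bsub>K\<^esub> c) a"
  using EA.denominator[of p] assms by (auto simp: KA_simps)

text \<open>Along a complement of the left ideal generated by z_A the unit splits as 1 = p z_A + e.
  Both e z_A and e p z_A lie in the ideal and in the complement, so they vanish, and e is an
  idempotent killed by z_A. Cleared of its denominator it is zero by
  \<open>scaled_idempotent_zero\<close>. Then p z_A = 1, and a denominator of p supplies the
  scalar.\<close>

lemma scaled_inverse_exists:
  obtains c z' where "c \<in> carrier \<O>" "c \<noteq> \<zero>\<^sub>K" "z' \<in> carrier A" "z' \<otimes>\<^sub>A zA = c \<odot>\<^sub>A \<one>\<^sub>A"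
proof -
  interpret KA: ring KA by (rule KA_ring)
  define Z where "Z = pk A \<one>\<^sub>K zA"
  have Z: "Z \<in> carrier KA" unfolding Z_def by (rule KA_pk) simp_all
  have Zc: "p \<otimes>\<^sub>KA Z = Z \<otimes>\<^sub>KA p" if p: "p \<in> carrier KA" for p
  proof -
    obtain c a where "c \<in> carrier \<O>" "c \<noteq> \<zero>\<^sub>K" "a \<in> carrier A" "p = pk A (inv\<^bsub>K\<^esub> c) a" by (rule KA_denominator[OF p])
    then show ?thesis unfolding Z_def by (simp add: KA_mult zA_central)
  qed
  have ssm: "\<And>N. submodule N KA (regular KA) \<Longrightarrow>
    \<exists>N'. submodule N' KA (regular KA) \<and> N \<inter> N' = {\<zero>\<^bsub>regular KA\<^esub>} \<and> N <+>\<^bsub>regular KA\<^esub> N' = carrier (regular KA)"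
    using ss by (auto simp: semisimple_ring_def semisimple_module_def)
  define N where "N = (\<lambda>p. p \<otimes>\<^sub>KA Z) ` carrier KA"
  have sub: "submodule N KA (regular KA)"
  proof (rule submodule.intro)
    have "subgroup N (add_monoid KA)"
    proof (rule KA.add.subgroupI)
      show "N \<subseteq> carrier KA" using Z by (auto simp: N_def)
      show "N \<noteq> {}" using KA.zero_closed by (auto simp: N_def)
      fix a assume "a \<in> N"
      then obtain p where p: "p \<in> carrier KA" "a = p \<otimes>\<^sub>KA Z" by (auto simp: N_def)
      show "\<ominus>\<^sub>KA a \<in> N" unfolding N_def using p Z by (intro image_eqI[of _ _ "\<ominus>\<^sub>KA p"]) (simp_all add: KA.l_minus)
      fix b assume "b \<in> N"
      then obtain q where q: "q \<in> carrier KA" "b = q \<otimes>\<^sub>KA Z" by (auto simp: N_def)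
      show "a \<oplus>\<^sub>KA b \<in> N" unfolding N_def using p q Z by (intro image_eqI[of _ _ "p \<oplus>\<^sub>KA q"]) (simp_all add: KA.l_distr)
    qed
    \<comment> \<open>\<open>KA\<close> and its regular module are records of different types, so
      their additive monoids differ in the type of the extension field; inverses do not depend on
      it.\<close>
    moreover have "subgroup N (add_monoid (regular KA)) \<longleftrightarrow> subgroup N (add_monoid KA)"
    proof -
      have "m_inv \<lparr>carrier = carrier KA, monoid.mult = add KA, one = \<zero>\<^sub>KA, \<dots> = (undefined :: 'b)\<rparr> =
        m_inv \<lparr>carrier = carrier KA, monoid.mult = add KA, one = \<zero>\<^sub>KA, \<dots> = (undefined :: 'c)\<rparr>"
        by (simp add: m_inv_def fun_eq_iff)
      then show ?thesis by (simp add: subgroup_def m_inv_def)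
    qed
    ultimately show "subgroup N (add_monoid (regular KA))" by blast
    show "submodule_axioms N KA (regular KA)"
    proof
      fix a x assume a: "a \<in> carrier KA" and "x \<in> N"
      then obtain p where p: "p \<in> carrier KA" "x = p \<otimes>\<^sub>KA Z" by (auto simp: N_def)
      show "a \<odot>\<^bsub>regular KA\<^esub> x \<in> N" unfolding N_def regular_simps using a p Z
        by (intro image_eqI[of _ _ "a \<otimes>\<^sub>KA p"]) (simp_all add: KA.m_assoc)
    qed
  qed
  obtain N' where N': "submodule N' KA (regular KA)" and cap: "N \<inter> N' = {\<zero>\<^sub>KA}" and sum: "N <+>\<^bsub>regular KA\<^esub> N' = carrier KA"
    using ssm[OF sub] unfolding regular_simps by blast
  have N'g: "subgroup N' (add_monoid (regular KA))" using N' by (rule submodule.axioms)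
  have N'sub: "a \<in> carrier KA" if "a \<in> N'" for a using subgroup.mem_carrier[OF N'g that] by simp
  have N'sm: "a \<otimes>\<^sub>KA x \<in> N'" if "a \<in> carrier KA" "x \<in> N'" for a x using submodule.smult_closed[OF N' that] by simp
  have Nsub: "a \<in> carrier KA" if "a \<in> N" for a using that Z by (auto simp: N_def)
  have zero: "x = \<zero>\<^sub>KA" if "x \<in> N" "x \<in> N'" for x using cap that by blast
  have "\<one>\<^sub>KA \<in> N <+>\<^bsub>regular KA\<^esub> N'" using sum KA.one_closed by simp
  then obtain x e where x: "x \<in> N" and e: "e \<in> N'" and one: "\<one>\<^sub>KA = x \<oplus>\<^sub>KA e" by (auto simp: set_add_def')
  obtain p where p: "p \<in> carrier KA" "x = p \<otimes>\<^sub>KA Z" using x by (auto simp: N_def)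
  note eK = N'sub[OF e]
  have eZ: "e \<otimes>\<^sub>KA Z = \<zero>\<^sub>KA"
  proof (rule zero)
    show "e \<otimes>\<^sub>KA Z \<in> N" using eK by (auto simp: N_def)
    show "e \<otimes>\<^sub>KA Z \<in> N'" using N'sm[OF Z e] Zc[OF eK] by simp
  qed
  have "e = e \<otimes>\<^sub>KA (x \<oplus>\<^sub>KA e)" unfolding one[symmetric] using eK by simp
  also have "\<dots> = (e \<otimes>\<^sub>KA p) \<otimes>\<^sub>KA Z \<oplus>\<^sub>KA e \<otimes>\<^sub>KA e" using eK p Z by (simp add: KA.r_distr KA.m_assoc)
  finally have e1: "e = (e \<otimes>\<^sub>KA p) \<otimes>\<^sub>KA Z \<oplus>\<^sub>KA e \<otimes>\<^sub>KA e" .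
  have "(e \<otimes>\<^sub>KA p) \<otimes>\<^sub>KA Z = \<zero>\<^sub>KA"
  proof (rule zero)
    show "(e \<otimes>\<^sub>KA p) \<otimes>\<^sub>KA Z \<in> N" using eK p by (auto simp: N_def)
    have "(e \<otimes>\<^sub>KA p) \<otimes>\<^sub>KA Z = e \<ominus>\<^sub>KA e \<otimes>\<^sub>KA e"
      using ag_add_diff_cancel[OF ring_ag[OF KA_ring], of "(e \<otimes>\<^sub>KA p) \<otimes>\<^sub>KA Z" "e \<otimes>\<^sub>KA e"] e1 eK p Z by simp
    also have "\<dots> = (\<one>\<^sub>KA \<ominus>\<^sub>KA e) \<otimes>\<^sub>KA e" using eK by (simp add: a_minus_def KA.l_distr KA.l_minus)
    also have "\<dots> \<in> N'" by (rule N'sm) (use eK e in simp_all)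
    finally show "(e \<otimes>\<^sub>KA p) \<otimes>\<^sub>KA Z \<in> N'" .
  qed
  then have ee: "e \<otimes>\<^sub>KA e = e" using e1 eK by simp
  obtain c a where ca: "c \<in> carrier \<O>" "c \<noteq> \<zero>\<^sub>K" "a \<in> carrier A" "e = pk A (inv\<^bsub>K\<^esub> c) a" by (rule KA_denominator[OF eK])
  have ic: "inv\<^bsub>K\<^esub> c \<in> carrier K" "inv\<^bsub>K\<^esub> c \<noteq> \<zero>\<^sub>K" using ca by simp_all
  obtain X :: "'a set" and d where df: "dual_frame X (\<lambda>x. x) d" by (rule dual_frame_exists)
  note frA = dual_frame_frame[OF df]
  have pk0: "pk A k \<zero>\<^sub>A = \<zero>\<^sub>KA" if "k \<in> carrier K" for k
    using addmap_zero[OF agA EA.E.T_ag EA.E.pure_addmap_r] that by (simp add: KA_simps)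
  have "pk A (inv\<^bsub>K\<^esub> c) (a \<otimes>\<^sub>A zA) = pk A (inv\<^bsub>K\<^esub> c) \<zero>\<^sub>A" using eZ ca ic unfolding Z_def by (simp add: KA_mult pk0)
  then have az: "a \<otimes>\<^sub>A zA = \<zero>\<^sub>A" using EA.pk_inj[OF frA ic] ca by simp
  have ii: "inv\<^bsub>K\<^esub> c \<otimes>\<^sub>K inv\<^bsub>K\<^esub> c \<in> carrier K" "inv\<^bsub>K\<^esub> c \<otimes>\<^sub>K inv\<^bsub>K\<^esub> c \<noteq> \<zero>\<^sub>K" using ic K.integral by auto
  \<comment> \<open>Here e is the pure tensor of the inverse of c with a. Once both sides carry the
    square of that inverse as first factor, e e = e reads a a = c a.\<close>
  have "pk A (inv\<^bsub>K\<^esub> c \<otimes>\<^sub>K inv\<^bsub>K\<^esub> c) (a \<otimes>\<^sub>A a) = pk A (inv\<^bsub>K\<^esub> c) a" using ee ca ic by (simp add: KA_mult)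
  also have "\<dots> = pk A ((inv\<^bsub>K\<^esub> c \<otimes>\<^sub>K inv\<^bsub>K\<^esub> c) \<otimes>\<^sub>K c) a" using ca ic by (simp add: K.m_assoc)
  also have "\<dots> = pk A (inv\<^bsub>K\<^esub> c \<otimes>\<^sub>K inv\<^bsub>K\<^esub> c) (c \<odot>\<^sub>A a)" by (rule EA.pk_simps(2)[OF ii(1) ca(1,3)])
  finally have aa: "a \<otimes>\<^sub>A a = c \<odot>\<^sub>A a" using EA.pk_inj[OF frA ii] ca by simp
  have "a = \<zero>\<^sub>A" by (rule scaled_idempotent_zero[OF char0_O ca(3,1) _ aa az]) (use ca in simp)
  then have e0: "e = \<zero>\<^sub>KA" using ca ic pk0 by simp
  obtain b z' where bz: "b \<in> carrier \<O>" "b \<noteq> \<zero>\<^sub>K" "z' \<in> carrier A" "p = pk A (inv\<^bsub>K\<^esub> b) z'" by (rule KA_denominator[OF p(1)])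
  have ib: "inv\<^bsub>K\<^esub> b \<in> carrier K" "inv\<^bsub>K\<^esub> b \<noteq> \<zero>\<^sub>K" using bz by simp_all
  have "pk A (inv\<^bsub>K\<^esub> b) (z' \<otimes>\<^sub>A zA) = p \<otimes>\<^sub>KA Z" unfolding Z_def using bz ib by (simp add: KA_mult)
  also have "\<dots> = \<one>\<^sub>KA" using one p e0 Nsub[OF x] by simp
  also have "\<dots> = pk A (inv\<^bsub>K\<^esub> b \<otimes>\<^sub>K b) \<one>\<^sub>A" using bz by (simp add: KA_simps)
  also have "\<dots> = pk A (inv\<^bsub>K\<^esub> b) (b \<odot>\<^sub>A \<one>\<^sub>A)" by (rule EA.pk_simps(2)[OF ib(1) bz(1) one_closed])
  finally have "z' \<otimes>\<^sub>A zA = b \<odot>\<^sub>A \<one>\<^sub>A" using EA.pk_inj[OF frA ib] bz by simp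
  then show ?thesis using that bz by blast
qed

text \<open>A scaled inverse \<open>z'\<close> of the relative projective element, with \<open>z' z = c\<close>, turns
  \<open>z\<^sup>-\<^sup>1\<close> into \<open>c\<^sup>-\<^sup>1 z'\<close> and so reduces twisted traces over \<open>K\<close> to traces over \<open>\<O>\<close>.\<close>

lemma twisted_trace_eq:
  assumes c: "c \<in> carrier \<O>" "c \<noteq> \<zero>\<^sub>K" and z': "z' \<in> carrier A" and zz: "z' \<otimes>\<^sub>A zA = c \<odot>\<^sub>A \<one>\<^sub>A"
    and U: "left_module A U" and free: "fg_free \<O> (RS U)"
    and fr: "frame \<O> (RS U) I u \<upsilon>" and f: "f \<in> lin_hom A U U"
  shows "twisted_trace \<O> K A s U f = inv\<^bsub>K\<^esub> c \<otimes>\<^sub>K (\<Oplus>\<^sub>\<O> i\<in>I. \<upsilon> i (z' \<odot>\<^sub>U f (u i)))"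
proof -
  let ?W = "RS U"
  interpret KA: ring KA by (rule KA_ring)
  interpret EU: ext_module \<O> K ?W by (intro ext_module.intro ext_module_axioms.intro fractions_axioms lm_rs[OF U] cringO)
  interpret AU: ext_act \<O> K A ?W "smult U"
  proof (intro ext_act.intro ext_act_axioms.intro EA.ext_module_axioms EU.ext_module_axioms)
    show "smult U a \<in> linmap \<O> ?W ?W" if "a \<in> carrier A" for a using lm_rs_smult_linmap[OF U that] by simp
    show "(\<lambda>a. a \<odot>\<^sub>U w) \<in> linmap \<O> A ?W" if "w \<in> carrier ?W" for w using that by (intro linmapI)
        (auto simp: left_module.lm_l_distr[OF U] left_module.lm_assoc[OF U, symmetric] smult_one_mult lm_smult[OF U])
  qed
  have fl: "f \<in> linmap A U U" by (rule lin_hom_linmap[OF f])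
  interpret TM: tensor_maps \<O> "regular_bimodule K" ?W "regular_bimodule K" ?W "\<lambda>x. x" f
    by (intro tensor_maps.intro tensor_maps_axioms.intro EU.E.tensor_data_axioms)
       (use linmap_rs[OF fl] in "auto simp: addmap_def linmap_def")
  have ic: "inv\<^bsub>K\<^esub> c \<in> carrier K" using c by simp
  have zinv: "inv\<^bsub>KA\<^esub> (pk A \<one>\<^sub>K zA) = pk A (inv\<^bsub>K\<^esub> c) z'"
  proof (rule KA.inv_unique'[symmetric])
    have e: "pk A (inv\<^bsub>K\<^esub> c) (c \<odot>\<^sub>A \<one>\<^sub>A) = \<one>\<^sub>KA" using EA.pk_simps(2)[OF ic c(1) one_closed] c by (simp add: KA_simps)
    show "pk A \<one>\<^sub>K zA \<otimes>\<^sub>KA pk A (inv\<^bsub>K\<^esub> c) z' = \<one>\<^sub>KA" using ic z' zz zA_central[OF z'] e by (simp add: KA_mult)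
    show "pk A (inv\<^bsub>K\<^esub> c) z' \<otimes>\<^sub>KA pk A \<one>\<^sub>K zA = \<one>\<^sub>KA" using ic z' zz e by (simp add: KA_mult)
  qed (use KA_pk ic z' in simp_all)
  define \<Psi> where "\<Psi> q = extended_action \<O> K ?W (smult U) (pk A (inv\<^bsub>K\<^esub> c) z')
      (id_tensor \<O> (regular_bimodule K) ?W ?W f q)" for q
  have tt: "twisted_trace \<O> K A s U f = trace_on K EU.EW \<Psi>" by (simp add: twisted_trace_def Let_def zinv \<Psi>_def[abs_def])
  have tc: "id_tensor \<O> (regular_bimodule K) ?W ?W f q \<in> carrier EU.EW" if "q \<in> carrier EU.EW" for q
    by (rule addmap_closed[OF TM.tmap_addmap that])
  have \<Psi>e: "\<Psi> q = AU.inner_act (inv\<^bsub>K\<^esub> c) z' (id_tensor \<O> (regular_bimodule K) ?W ?W f q)" if "q \<in> carrier EU.EW" for q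
    unfolding \<Psi>_def using AU.act_pure_l[OF ic z'] tc[OF that] by simp
  have \<Psi>a: "(\<lambda>q. AU.inner_act (inv\<^bsub>K\<^esub> c) z' (id_tensor \<O> (regular_bimodule K) ?W ?W f q)) \<in> addmap EU.EW EU.EW"
    by (rule addmap_comp[OF TM.tmap_addmap AU.inner_addmap[OF ic z']])
  have \<Psi>pure: "\<Psi> (pk ?W k w) = pk ?W (inv\<^bsub>K\<^esub> c \<otimes>\<^sub>K k) (z' \<odot>\<^sub>U f w)" if "k \<in> carrier K" "w \<in> carrier U" for k w
    using that \<Psi>e[of "pk ?W k w"] EU.pk_simps(1)[of k w] TM.tmap_pure[of k w] lin_hom_closed[OF f that(2)]
      AU.inner_pure[OF ic z', of k "f w"] by simp
  have \<Psi>l: "\<Psi> \<in> linmap K EU.EW EU.EW"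
  proof (rule linmapI)
    fix q r assume q: "q \<in> carrier EU.EW" and r: "r \<in> carrier EU.EW"
    show "\<Psi> q \<in> carrier EU.EW" unfolding \<Psi>e[OF q] by (rule addmap_closed[OF \<Psi>a q])
    have qr: "q \<oplus>\<^bsub>EU.EW\<^esub> r \<in> carrier EU.EW" using ag_add[OF EU.E.T_ag q r] .
    show "\<Psi> (q \<oplus>\<^bsub>EU.EW\<^esub> r) = \<Psi> q \<oplus>\<^bsub>EU.EW\<^esub> \<Psi> r" unfolding \<Psi>e[OF q] \<Psi>e[OF r] \<Psi>e[OF qr] by (rule addmap_add[OF \<Psi>a q r])
  next
    fix a q assume a: "a \<in> carrier K" and q: "q \<in> carrier EU.EW"
    have aq: "a \<odot>\<^bsub>EU.EW\<^esub> q \<in> carrier EU.EW" by (rule lm_smult[OF EU.EW_lm a q])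
    have "AU.inner_act (inv\<^bsub>K\<^esub> c) z' (id_tensor \<O> (regular_bimodule K) ?W ?W f (a \<odot>\<^bsub>EU.EW\<^esub> q)) =
      a \<odot>\<^bsub>EU.EW\<^esub> (AU.inner_act (inv\<^bsub>K\<^esub> c) z' (id_tensor \<O> (regular_bimodule K) ?W ?W f q))"
    proof (rule EU.E.tensor_ext[OF addmap_comp[OF EU.E.smult_addmap[OF a] \<Psi>a] addmap_comp[OF \<Psi>a EU.E.smult_addmap[OF a]]])
      fix k w assume k: "k \<in> carrier (regular_bimodule K)" and w: "w \<in> carrier ?W"
      show "AU.inner_act (inv\<^bsub>K\<^esub> c) z' (id_tensor \<O> (regular_bimodule K) ?W ?W f (a \<odot>\<^bsub>EU.EW\<^esub> pk ?W k w)) =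
        a \<odot>\<^bsub>EU.EW\<^esub> (AU.inner_act (inv\<^bsub>K\<^esub> c) z' (id_tensor \<O> (regular_bimodule K) ?W ?W f (pk ?W k w)))"
        using k w a ic lin_hom_closed[OF f] lm_smult[OF U z'] z'
        by (simp add: EU.pk_simps(3) TM.tmap_pure AU.inner_pure K.m_lcomm)
    qed (use q in simp)
    then show "\<Psi> (a \<odot>\<^bsub>EU.EW\<^esub> q) = a \<odot>\<^bsub>EU.EW\<^esub> \<Psi> q" unfolding \<Psi>e[OF q] \<Psi>e[OF aq] .
  qed
  have zf: "z' \<odot>\<^sub>U f (u i) \<in> carrier ?W" if "i \<in> I" for i
    using lm_smult[OF U z'] lin_hom_closed[OF f] frame_elt[OF fr that] by simp
  have "trace_on K EU.EW \<Psi> = (\<Oplus>\<^sub>K i\<in>I. EU.ext_fun (\<upsilon> i) (\<Psi> (pk ?W \<one>\<^sub>K (u i))))"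
    by (rule trace_on_frame[OF K.is_cring EU.EW_lm EU.ext_free[OF free] EU.ext_frame[OF fr] \<Psi>l])
  also have "\<dots> = (\<Oplus>\<^sub>K i\<in>I. inv\<^bsub>K\<^esub> c \<otimes>\<^sub>K \<upsilon> i (z' \<odot>\<^sub>U f (u i)))"
  proof (rule fs_cong[OF agK])
    fix i assume i: "i \<in> I"
    have ui: "u i \<in> carrier U" using frame_elt[OF fr i] by simp
    show "EU.ext_fun (\<upsilon> i) (\<Psi> (pk ?W \<one>\<^sub>K (u i))) = inv\<^bsub>K\<^esub> c \<otimes>\<^sub>K \<upsilon> i (z' \<odot>\<^sub>U f (u i))"
      using \<Psi>pure[OF K.one_closed ui] EU.ext_fun_pure[OF frame_fun[OF fr i] ic zf[OF i]] ic by simp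
    show "inv\<^bsub>K\<^esub> c \<otimes>\<^sub>K \<upsilon> i (z' \<odot>\<^sub>U f (u i)) \<in> carrier K" using ic frame_coeff[OF fr i zf[OF i]] by simp
  qed
  also have "\<dots> = inv\<^bsub>K\<^esub> c \<otimes>\<^sub>K (\<Oplus>\<^sub>K i\<in>I. \<upsilon> i (z' \<odot>\<^sub>U f (u i)))"
    by (rule K.finsum_rdistr[symmetric]) (use frame_finite[OF fr] ic frame_coeff[OF fr _ zf] in auto)
  also have "(\<Oplus>\<^sub>K i\<in>I. \<upsilon> i (z' \<odot>\<^sub>U f (u i))) = (\<Oplus>\<^sub>\<O> i\<in>I. \<upsilon> i (z' \<odot>\<^sub>U f (u i)))"
    by (rule addmap_fs[OF agO agK, of "\<lambda>x. x", symmetric]) (use frame_coeff[OF fr _ zf] in "auto intro: addmapI")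
  finally show ?thesis unfolding tt .
qed

end

section \<open>Bimodules over symmetric algebras and their duals\<close>

locale sym_bimodule = A: sym_alg \<O> A s + B: sym_alg \<O> B t
  for \<O> :: "'k ring" and A :: "('k, 'a) module" and s and B :: "('k, 'b) module" and t +
  fixes M :: "('a, 'b, 'm) bimodule"
  assumes M_bimodule: "is_bimodule \<O> A B M"
    and M_proj_l: "fg_projective A M" and M_proj_r: "fg_projective (opp B) (right_part M)"
begin

lemma lmM: "left_module A M" and lmMr: "left_module (opp B) (right_part M)"
  using M_bimodule by (simp_all add: is_bimodule_def)

lemma agM [simp]: "abelian_group M" by (rule lm_ag[OF lmM])

lemma M_closed [simp]: "a \<in> carrier A \<Longrightarrow> m \<in> carrier M \<Longrightarrow> a \<odot>\<^sub>M m \<in> carrier M" by (rule lm_smult[OF lmM])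

lemma Mr_closed [simp]: "m \<in> carrier M \<Longrightarrow> b \<in> carrier B \<Longrightarrow> rsmult M m b \<in> carrier M" using lm_smult[OF lmMr, of b m] by simp

lemma Mr_add_l: "m \<in> carrier M \<Longrightarrow> m' \<in> carrier M \<Longrightarrow> b \<in> carrier B \<Longrightarrow>
    rsmult M (m \<oplus>\<^sub>M m') b = rsmult M m b \<oplus>\<^sub>M rsmult M m' b" using left_module.lm_r_distr[OF lmMr, of b m m'] by simp

lemma Mr_add_r: "m \<in> carrier M \<Longrightarrow> b \<in> carrier B \<Longrightarrow> b' \<in> carrier B \<Longrightarrow>
    rsmult M m (b \<oplus>\<^sub>B b') = rsmult M m b \<oplus>\<^sub>M rsmult M m b'" using left_module.lm_l_distr[OF lmMr, of b b' m] by simp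

lemma Mr_assoc: "m \<in> carrier M \<Longrightarrow> b \<in> carrier B \<Longrightarrow> b' \<in> carrier B \<Longrightarrow>
    rsmult M m (b \<otimes>\<^sub>B b') = rsmult M (rsmult M m b) b'" using left_module.lm_assoc[OF lmMr, of b' b m] by simp

lemma Mr_one: "m \<in> carrier M \<Longrightarrow> rsmult M m \<one>\<^sub>B = m" using left_module.lm_one[OF lmMr, of m] by simp

lemma M_lr: "a \<in> carrier A \<Longrightarrow> m \<in> carrier M \<Longrightarrow> b \<in> carrier B \<Longrightarrow>
    rsmult M (a \<odot>\<^sub>M m) b = a \<odot>\<^sub>M rsmult M m b" using M_bimodule by (simp add: is_bimodule_def)

lemma M_scalar: "c \<in> carrier \<O> \<Longrightarrow> m \<in> carrier M \<Longrightarrow>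
    rsmult M m (c \<odot>\<^sub>B \<one>\<^sub>B) = (c \<odot>\<^sub>A \<one>\<^sub>A) \<odot>\<^sub>M m" using M_bimodule by (simp add: is_bimodule_def)

section \<open>The dual bimodule D\<close>

abbreviation "D \<equiv> dual \<O> A M"
abbreviation "DT W \<equiv> tensor A D W"

lemma D_closed [simp]: "f \<in> carrier D \<Longrightarrow> m \<in> carrier M \<Longrightarrow> f m \<in> carrier \<O>"
  using lin_hom_closed[of f \<O> "A.RS M" "regular \<O>" m] by simp

lemma D_add: "f \<in> carrier D \<Longrightarrow> m \<in> carrier M \<Longrightarrow> m' \<in> carrier M \<Longrightarrow> f (m \<oplus>\<^sub>M m') = f m \<oplus>\<^sub>\<O> f m'"
  using lin_hom_add[of f \<O> "A.RS M" "regular \<O>" m m'] by simp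

lemma D_smult: "f \<in> carrier D \<Longrightarrow> c \<in> carrier \<O> \<Longrightarrow> m \<in> carrier M \<Longrightarrow>
    f ((c \<odot>\<^sub>A \<one>\<^sub>A) \<odot>\<^sub>M m) = c \<otimes>\<^sub>\<O> f m" using lin_hom_smult[of f \<O> "A.RS M" "regular \<O>" c m] by simp

lemma D_linmap: "f \<in> carrier D \<Longrightarrow> f \<in> linmap \<O> (A.RS M) (regular \<O>)" by (simp add: lin_hom_linmap)

lemma D_addmap: "f \<in> carrier D \<Longrightarrow> f \<in> addmap M \<O>" by (rule addmapI) (simp_all add: D_add del: dual_simps)

lemma DI:
  assumes "\<And>m. m \<in> carrier M \<Longrightarrow> f m \<in> carrier \<O>" "\<And>m m'. m \<in> carrier M \<Longrightarrow> m' \<in> carrier M \<Longrightarrow> f (m \<oplus>\<^sub>M m') = f m \<oplus>\<^sub>\<O> f m'"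
    "\<And>c m. c \<in> carrier \<O> \<Longrightarrow> m \<in> carrier M \<Longrightarrow> f ((c \<odot>\<^sub>A \<one>\<^sub>A) \<odot>\<^sub>M m) = c \<otimes>\<^sub>\<O> f m"
  shows "(\<lambda>m\<in>carrier M. f m) \<in> carrier D"
  using linmap_restrict[OF A.lm_rs[OF lmM], of f "regular \<O>"] assms by (simp add: linmap_def addmap_def)

lemma D_eqI: "f \<in> carrier D \<Longrightarrow> g \<in> carrier D \<Longrightarrow> (\<And>m. m \<in> carrier M \<Longrightarrow> f m = g m) \<Longrightarrow> f = g"
  using lin_hom_eqI[of f \<O> "A.RS M" "regular \<O>" g \<O> "regular \<O>"] by simp

lemma D_plus: "f \<in> carrier D \<Longrightarrow> g \<in> carrier D \<Longrightarrow> f \<oplus>\<^sub>D g \<in> carrier D"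
  and D_l: "b \<in> carrier B \<Longrightarrow> f \<in> carrier D \<Longrightarrow> b \<odot>\<^sub>D f \<in> carrier D"
  and D_r: "a \<in> carrier A \<Longrightarrow> f \<in> carrier D \<Longrightarrow> rsmult D f a \<in> carrier D" and D_zero: "\<zero>\<^sub>D \<in> carrier D"
proof -
  show "f \<oplus>\<^sub>D g \<in> carrier D" if f: "f \<in> carrier D" and g: "g \<in> carrier D" unfolding dual_simps(3)
    by (rule DI) (use f g in "simp_all del: dual_simps add: D_add D_smult ag_add4 A.R.r_distr")
  show "b \<odot>\<^sub>D f \<in> carrier D" if b: "b \<in> carrier B" and f: "f \<in> carrier D" unfolding dual_simps(4)
    by (rule DI) (use f b in "simp_all del: dual_simps add: D_add D_smult Mr_add_l M_lr")
  show "rsmult D f a \<in> carrier D" if a: "a \<in> carrier A" and f: "f \<in> carrier D" unfolding dual_simps(5)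
  proof (rule DI)
    fix c m assume c: "c \<in> carrier \<O>" and m: "m \<in> carrier M"
    show "f (a \<odot>\<^sub>M ((c \<odot>\<^sub>A \<one>\<^sub>A) \<odot>\<^sub>M m)) = c \<otimes>\<^sub>\<O> f (a \<odot>\<^sub>M m)"
      using A.rs_smult_comm[OF lmM c a m] D_smult[OF f c, of "a \<odot>\<^sub>M m"] a m by simp
  qed (use f a in "simp_all del: dual_simps add: D_add left_module.lm_r_distr[OF lmM]")
  show "\<zero>\<^sub>D \<in> carrier D" unfolding dual_simps(2) by (rule DI) simp_all
qed

lemma D_app: "m \<in> carrier M \<Longrightarrow> (f \<oplus>\<^sub>D g) m = f m \<oplus>\<^sub>\<O> g m" "m \<in> carrier M \<Longrightarrow> (b \<odot>\<^sub>D f) m = f (rsmult M m b)"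
  "m \<in> carrier M \<Longrightarrow> (rsmult D f a) m = f (a \<odot>\<^sub>M m)" "m \<in> carrier M \<Longrightarrow> \<zero>\<^sub>D m = \<zero>\<^sub>\<O>" by simp_all

text \<open>Keeps \<open>carrier D\<close> and the carriers of tensor products folded, so that facts
  stated about them continue to match; values of functionals are computed with \<open>D_app\<close>
  instead.\<close>

declare dual_simps [simp del]
declare tensor_simps [simp del]

lemma D_ag [simp]: "abelian_group D"
proof (rule abelian_groupI)
  fix f assume f: "f \<in> carrier D"
  show "\<zero>\<^sub>D \<oplus>\<^sub>D f = f" by (rule D_eqI[OF D_plus[OF D_zero f] f]) (use f in "simp add: D_app")
  let ?g = "\<lambda>m\<in>carrier M. \<ominus>\<^sub>\<O> f m"
  have g: "?g \<in> carrier D" by (rule DI) (use f in "auto simp: D_add D_smult ag_neg_add[OF A.agO] A.R.r_minus")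
  show "\<exists>g\<in>carrier D. g \<oplus>\<^sub>D f = \<zero>\<^sub>D"
    by (intro bexI[OF _ g] D_eqI[OF D_plus[OF g f] D_zero]) (use f in "simp add: D_app A.R.l_neg")
  fix g assume g: "g \<in> carrier D"
  show "f \<oplus>\<^sub>D g = g \<oplus>\<^sub>D f" by (rule D_eqI[OF D_plus[OF f g] D_plus[OF g f]]) (use f g in "simp add: D_app A.R.a_comm")
  fix h assume h: "h \<in> carrier D"
  show "f \<oplus>\<^sub>D g \<oplus>\<^sub>D h = f \<oplus>\<^sub>D (g \<oplus>\<^sub>D h)" by (rule D_eqI[OF D_plus[OF D_plus[OF f g] h] D_plus[OF f D_plus[OF g h]]])
       (use f g h in "simp add: D_app A.R.a_assoc")
qed (rule D_plus D_zero; assumption?)+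

lemma D_lm: "left_module B D"
proof (rule left_moduleI[OF B.ringA D_ag D_l])
  fix b b' f assume b: "b \<in> carrier B" "b' \<in> carrier B" and f: "f \<in> carrier D"
  show "(b \<oplus>\<^sub>B b') \<odot>\<^sub>D f = b \<odot>\<^sub>D f \<oplus>\<^sub>D b' \<odot>\<^sub>D f" by (rule D_eqI) (use b f in "simp_all add: D_l D_plus D_app Mr_add_r D_add")
  show "(b \<otimes>\<^sub>B b') \<odot>\<^sub>D f = b \<odot>\<^sub>D (b' \<odot>\<^sub>D f)" by (rule D_eqI) (use b f in "simp_all add: D_l D_app Mr_assoc")
next
  fix b f g assume b: "b \<in> carrier B" and f: "f \<in> carrier D" "g \<in> carrier D"
  show "b \<odot>\<^sub>D (f \<oplus>\<^sub>D g) = b \<odot>\<^sub>D f \<oplus>\<^sub>D b \<odot>\<^sub>D g" by (rule D_eqI) (use b f in "simp_all add: D_l D_plus D_app")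
next
  fix f assume f: "f \<in> carrier D"
  show "\<one>\<^sub>B \<odot>\<^sub>D f = f" by (rule D_eqI) (use f in "simp_all add: D_l D_app Mr_one")
qed

lemma D_r_addmap: "a \<in> carrier A \<Longrightarrow> (\<lambda>f. rsmult D f a) \<in> addmap D D"
  by (rule addmapI) (auto simp: D_r intro!: D_eqI simp: D_plus D_app)

lemma D_lr: "a \<in> carrier A \<Longrightarrow> b \<in> carrier B \<Longrightarrow> f \<in> carrier D \<Longrightarrow>
    rsmult D (b \<odot>\<^sub>D f) a = b \<odot>\<^sub>D rsmult D f a" by (rule D_eqI) (simp_all add: D_l D_r D_app M_lr)

lemma D_eval: "m \<in> carrier M \<Longrightarrow> (\<lambda>f. f m) \<in> addmap D \<O>" by (rule addmapI) (simp_all add: D_app)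

lemma DT_left: "left_module A W \<Longrightarrow> tensor_left A D W B"
  by (intro tensor_left.intro tensor_data.intro tensor_left_axioms.intro D_ag D_lm) (auto simp: lm_ag D_r D_lr)

lemmas DT_data = tensor_left.axioms(1)[OF DT_left]
lemmas DT_lm = tensor_left.T_left_module[OF DT_left]
lemmas DT_ag = lm_ag[OF DT_lm]
lemmas DT_ext = tensor_data.tensor_ext[OF DT_data, folded tensor_simps(1)]
lemmas DT_smult_pure = tensor_left.smult_pure[OF DT_left]
lemmas DT_pure_closed = tensor_data.pure_closed[OF DT_data, folded tensor_simps(1)]
lemmas DT_pure_l = tensor_data.pure_addmap_l[OF DT_data]
lemmas DT_pure_r = tensor_data.pure_addmap_r[OF DT_data]
lemmas DT_bal = tensor_data.pure_bal[OF DT_data]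

subsection \<open>The maps \<open>D \<otimes> W \<rightarrow> W\<close> given by elements of \<open>M\<close>\<close>

abbreviation "mhat f m \<equiv> A.hat M f m"

lemma mhat_closed [simp]: "f \<in> carrier D \<Longrightarrow> m \<in> carrier M \<Longrightarrow> mhat f m \<in> carrier A" by (rule A.hat_spec(1)[OF lmM D_linmap])

lemma mhat_spec: "f \<in> carrier D \<Longrightarrow> m \<in> carrier M \<Longrightarrow> a \<in> carrier A \<Longrightarrow>
    f (a \<odot>\<^sub>M m) = s (a \<otimes>\<^sub>A mhat f m)" by (rule A.hat_spec(2)[OF lmM D_linmap])

lemma mhat_add: "f \<in> carrier D \<Longrightarrow> m \<in> carrier M \<Longrightarrow> m' \<in> carrier M \<Longrightarrow>
    mhat f (m \<oplus>\<^sub>M m') = mhat f m \<oplus>\<^sub>A mhat f m'" using linmap_add[OF A.hat_linmap[OF lmM D_linmap]] by simp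

lemma mhat_smult: "f \<in> carrier D \<Longrightarrow> m \<in> carrier M \<Longrightarrow> a \<in> carrier A \<Longrightarrow>
    mhat f (a \<odot>\<^sub>M m) = a \<otimes>\<^sub>A mhat f m" using linmap_smult[OF A.hat_linmap[OF lmM D_linmap]] by simp

lemma mhat_plus: "f \<in> carrier D \<Longrightarrow> g \<in> carrier D \<Longrightarrow> m \<in> carrier M \<Longrightarrow>
    mhat (f \<oplus>\<^sub>D g) m = mhat f m \<oplus>\<^sub>A mhat g m"
proof (rule A.hat_eqI)
  fix a assume f: "f \<in> carrier D" "g \<in> carrier D" and m: "m \<in> carrier M" and a: "a \<in> carrier A"
  have "(f \<oplus>\<^sub>D g) (a \<odot>\<^sub>M m) = f (a \<odot>\<^sub>M m) \<oplus>\<^sub>\<O> g (a \<odot>\<^sub>M m)" using m a by (simp only: D_app M_closed)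
  then show "(f \<oplus>\<^sub>D g) (a \<odot>\<^sub>M m) = s (a \<otimes>\<^sub>A (mhat f m \<oplus>\<^sub>A mhat g m))"
    using f m a by (simp add: mhat_spec A.r_distr A.s_add del: D_ag)
qed simp

text \<open>The right action puts a in front of the argument of f; symmetry of s carries it to the
  right end.\<close>

lemma mhat_r: "f \<in> carrier D \<Longrightarrow> m \<in> carrier M \<Longrightarrow> a \<in> carrier A \<Longrightarrow>
    mhat (rsmult D f a) m = mhat f m \<otimes>\<^sub>A a"
proof (rule A.hat_eqI)
  fix b assume f: "f \<in> carrier D" and m: "m \<in> carrier M" and a: "a \<in> carrier A" and b: "b \<in> carrier A"
  have "rsmult D f a (b \<odot>\<^sub>M m) = f ((a \<otimes>\<^sub>A b) \<odot>\<^sub>M m)" using m a b by (simp add: D_app left_module.lm_assoc[OF lmM])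
  also have "\<dots> = s ((a \<otimes>\<^sub>A b) \<otimes>\<^sub>A mhat f m)" using f m a b by (simp add: mhat_spec)
  also have "\<dots> = s (b \<otimes>\<^sub>A (mhat f m \<otimes>\<^sub>A a))" using A.s_sym[of a "b \<otimes>\<^sub>A mhat f m"] f m a b by (simp add: A.m_assoc)
  finally show "rsmult D f a (b \<odot>\<^sub>M m) = s (b \<otimes>\<^sub>A (mhat f m \<otimes>\<^sub>A a))" .
qed simp

lemma mhat_l: "f \<in> carrier D \<Longrightarrow> m \<in> carrier M \<Longrightarrow> b \<in> carrier B \<Longrightarrow>
    mhat (b \<odot>\<^sub>D f) m = mhat f (rsmult M m b)" by (rule A.hat_eqI) (simp_all add: D_app mhat_spec M_lr)

text \<open>With m fixed this is f \<otimes> w \<mapsto> \<eta>(m \<otimes> f) w. Letting m vary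
  identifies D \<otimes> W with the A-linear maps M \<rightarrow> W, since M is projective over
  A.\<close>

definition ev :: "('a, 'w) module \<Rightarrow> 'm \<Rightarrow> ((('m \<Rightarrow> 'k) \<times> 'w) \<Rightarrow>\<^sub>0 int) set \<Rightarrow> 'w" where
  "ev W m = tensor_lift W (\<lambda>(f, w). mhat f m \<odot>\<^sub>W w)"

context
  fixes W :: "('a, 'w) module" assumes W: "left_module A W"
begin

lemma ev_bal: "m \<in> carrier M \<Longrightarrow> balanced A D W W (\<lambda>(f, w). mhat f m \<odot>\<^sub>W w)" by (rule balancedI)
     (simp_all add: lm_smult[OF W] left_module.lm_r_distr[OF W] left_module.lm_l_distr[OF W]
       mhat_plus mhat_r left_module.lm_assoc[OF W])

lemma ev_addmap: "m \<in> carrier M \<Longrightarrow> ev W m \<in> addmap (DT W) W"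
  unfolding ev_def by (rule tensor_data.lift_addmap[OF DT_data[OF W] lm_ag[OF W] ev_bal])

lemma ev_closed: "m \<in> carrier M \<Longrightarrow> q \<in> carrier (DT W) \<Longrightarrow> ev W m q \<in> carrier W" by (rule addmap_closed[OF ev_addmap])

lemma ev_pure: "m \<in> carrier M \<Longrightarrow> f \<in> carrier D \<Longrightarrow> w \<in> carrier W \<Longrightarrow> ev W m (pure A D W f w) = mhat f m \<odot>\<^sub>W w"
  unfolding ev_def using tensor_data.lift_pure[OF DT_data[OF W] lm_ag[OF W] ev_bal] by simp

lemma ev_smult_addmap: "b \<in> carrier B \<Longrightarrow> (\<lambda>q. b \<odot>\<^bsub>DT W\<^esub> q) \<in> addmap (DT W) (DT W)" by (rule lm_addmap_r[OF DT_lm[OF W]])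

lemma ev_add:
  assumes "m \<in> carrier M" "m' \<in> carrier M" "q \<in> carrier (DT W)"
  shows "ev W (m \<oplus>\<^sub>M m') q = ev W m q \<oplus>\<^sub>W ev W m' q"
  by (rule DT_ext[OF W ev_addmap addmap_sum2[OF lm_ag[OF W] ev_addmap ev_addmap]])
     (use assms in "simp_all add: ev_pure mhat_add left_module.lm_l_distr[OF W]")

lemma ev_smult:
  assumes "m \<in> carrier M" "a \<in> carrier A" "q \<in> carrier (DT W)"
  shows "ev W (a \<odot>\<^sub>M m) q = a \<odot>\<^sub>W ev W m q"
  by (rule DT_ext[OF W ev_addmap addmap_comp[OF ev_addmap lm_addmap_r[OF W]]])
     (use assms in "simp_all add: ev_pure mhat_smult left_module.lm_assoc[OF W]")

lemma ev_r:
  assumes "m \<in> carrier M" "b \<in> carrier B" "q \<in> carrier (DT W)"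
  shows "ev W (rsmult M m b) q = ev W m (b \<odot>\<^bsub>DT W\<^esub> q)"
  by (rule DT_ext[OF W ev_addmap addmap_comp[OF ev_smult_addmap ev_addmap]])
     (use assms in "simp_all add: ev_pure mhat_l DT_smult_pure[OF W] D_l")

lemma ev_addmap_m: "q \<in> carrier (DT W) \<Longrightarrow> (\<lambda>m. ev W m q) \<in> addmap M W" by (rule addmapI) (simp_all add: ev_add ev_closed)

lemma ev_linmap:
  assumes m: "m \<in> carrier M"
  shows "ev W m \<in> linmap \<O> (B.RS (DT W)) (A.RS W)"
proof (rule linmapI)
  fix c q assume c: "c \<in> carrier \<O>" and q: "q \<in> carrier (B.RS (DT W))"
  show "ev W m (c \<odot>\<^bsub>B.RS (DT W)\<^esub> q) = c \<odot>\<^bsub>A.RS W\<^esub> ev W m q"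
    using c q m ev_r[of m "c \<odot>\<^sub>B \<one>\<^sub>B" q] ev_smult[of m "c \<odot>\<^sub>A \<one>\<^sub>A" q] by (simp add: M_scalar)
qed (use addmap_closed[OF ev_addmap[OF m]] addmap_add[OF ev_addmap[OF m]] in "simp_all")

end

section \<open>Functoriality of tensoring with D\<close>

lemma tmap_maps:
  fixes W :: "('a, 'w) module" and W' :: "('a, 'v) module"
  assumes W: "left_module A W" and W': "left_module A W'" and g: "g \<in> linmap A W W'"
  shows "tensor_maps A D W D W' (\<lambda>x. x) g"
  by (intro tensor_maps.intro tensor_maps_axioms.intro DT_data W W' linmap_addmap[OF g])
     (use linmap_smult[OF g] in "auto simp: addmap_def D_plus")

abbreviation "idt W W' g \<equiv> id_tensor A D W W' g"

lemma idt_pure: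
  fixes W :: "('a, 'w) module" and W' :: "('a, 'v) module"
  shows "left_module A W \<Longrightarrow> left_module A W' \<Longrightarrow> g \<in> linmap A W W' \<Longrightarrow> f \<in> carrier D \<Longrightarrow> w \<in> carrier W \<Longrightarrow>
    idt W W' g (pure A D W f w) = pure A D W' f (g w)" by (rule tensor_maps.tmap_pure[OF tmap_maps])

lemma idt_addmap:
  fixes W :: "('a, 'w) module" and W' :: "('a, 'v) module"
  shows "left_module A W \<Longrightarrow> left_module A W' \<Longrightarrow> g \<in> linmap A W W' \<Longrightarrow> idt W W' g \<in> addmap (DT W) (DT W')"
  by (rule tensor_maps.tmap_addmap[OF tmap_maps])

lemma idt_lin_hom:
  fixes W :: "('a, 'w) module" and W' :: "('a, 'v) module"
  assumes W: "left_module A W" and W': "left_module A W'" and g: "g \<in> linmap A W W'"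
  shows "idt W W' g \<in> lin_hom B (DT W) (DT W')"
proof (rule lin_homI)
  show "idt W W' g \<in> extensional (carrier (DT W))" by (simp add: tensor_map_def)
  note am = idt_addmap[OF assms]
  show "idt W W' g x \<in> carrier (DT W')" if "x \<in> carrier (DT W)" for x by (rule addmap_closed[OF am that])
  show "idt W W' g (x \<oplus>\<^bsub>DT W\<^esub> y) = idt W W' g x \<oplus>\<^bsub>DT W'\<^esub> idt W W' g y"
    if "x \<in> carrier (DT W)" "y \<in> carrier (DT W)" for x y by (rule addmap_add[OF am that])
  fix b x assume b: "b \<in> carrier B" and x: "x \<in> carrier (DT W)"
  show "idt W W' g (b \<odot>\<^bsub>DT W\<^esub> x) = b \<odot>\<^bsub>DT W'\<^esub> idt W W' g x"
    by (rule DT_ext[OF W addmap_comp[OF ev_smult_addmap[OF W b] am] addmap_comp[OF am ev_smult_addmap[OF W' b]]])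
       (use b x linmap_closed[OF g] in "simp_all add: DT_smult_pure[OF W] DT_smult_pure[OF W'] idt_pure[OF assms] D_l")
qed

lemma ev_idt:
  fixes W :: "('a, 'w) module" and W' :: "('a, 'v) module"
  assumes W: "left_module A W" and W': "left_module A W'" and g: "g \<in> linmap A W W'"
    and m: "m \<in> carrier M" and q: "q \<in> carrier (DT W)"
  shows "ev W' m (idt W W' g q) = g (ev W m q)"
  by (rule DT_ext[OF W addmap_comp[OF idt_addmap[OF W W' g] ev_addmap[OF W' m]] addmap_comp[OF ev_addmap[OF W m] linmap_addmap[OF g]]])
     (use m q linmap_closed[OF g] linmap_smult[OF g] in "simp_all add: ev_pure[OF W] ev_pure[OF W'] idt_pure[OF W W' g]")

lemma idt_id:
  assumes W: "A.is_mod W"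
  shows "idt W W (\<lambda>x\<in>carrier W. x) = (\<lambda>q\<in>carrier (DT W). q)"
proof -
  have l: "(\<lambda>x\<in>carrier W. x) \<in> linmap A W W" by (rule lin_hom_linmap[OF lin_hom_id[OF W]])
  show ?thesis by (rule lin_hom_eqI[OF idt_lin_hom[OF W W l] lin_hom_id[OF DT_lm[OF W]]])
       (rule DT_ext[OF W idt_addmap[OF W W l] lin_hom_addmap[OF lin_hom_id[OF DT_lm[OF W]]]],
        auto simp: idt_pure[OF W W l] DT_pure_closed[OF W])
qed

lemma idt_comp:
  assumes U: "A.is_mod U" and V: "A.is_mod V" and W: "A.is_mod W"
    and f: "f \<in> linmap A U V" and g: "g \<in> linmap A V W" and h: "h \<in> linmap A U W"
    and e: "\<And>u. u \<in> carrier U \<Longrightarrow> h u = g (f u)" and q: "q \<in> carrier (DT U)"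
  shows "idt U W h q = idt V W g (idt U V f q)"
  by (rule DT_ext[OF U idt_addmap[OF U W h] addmap_comp[OF idt_addmap[OF U V f] idt_addmap[OF V W g]]])
     (use q linmap_closed[OF f] e in "simp_all add: idt_pure[OF U W h] idt_pure[OF U V f] idt_pure[OF V W g]")

subsection \<open>Exactness of \<open>D \<otimes> -\<close>, from a frame of \<open>M\<close> over \<open>A\<close>\<close>

lemma M_frame:
  obtains n :: nat and p \<phi> where "frame A M {..<n} p \<phi>" by (rule fg_projective_frame[OF lmM M_proj_l])

definition sD :: "('m \<Rightarrow> 'a) \<Rightarrow> 'm \<Rightarrow> 'k" where "sD \<phi> = (\<lambda>m\<in>carrier M. s (\<phi> m))"

lemma sD_closed: "\<phi> \<in> linmap A M (regular A) \<Longrightarrow> sD \<phi> \<in> carrier D" unfolding sD_def by (rule DI)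
     (use linmap_closed[of \<phi> A M "regular A"] linmap_add[of \<phi> A M "regular A"] linmap_smult[of \<phi> A M "regular A"] in
       \<open>auto simp: A.s_add A.smult_one_mult A.s_smult\<close>)

text \<open>In D itself, f is the sum of the \<open>sD (\<phi> i)\<close> with right coefficients
  \<open>mhat f (p i)\<close>: at m, symmetry of s turns that sum into the value of f on the
  expansion of m in the frame. Tensoring moves the coefficients into W. An element of D \<otimes> W
  is thus recovered from its finitely many values under \<open>ev\<close> at the frame.\<close>

lemma DT_expand:
  assumes fr: "frame A M I p \<phi>" and W: "A.is_mod W" and q: "q \<in> carrier (DT W)"
  shows "(\<Oplus>\<^bsub>DT W\<^esub>i\<in>I. pure A D W (sD (\<phi> i)) (ev W (p i) q)) = q"
proof -
  note pc = frame_elt[OF fr] and sc = sD_closed[OF frame_fun[OF fr]]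
  have am: "(\<lambda>q. \<Oplus>\<^bsub>DT W\<^esub>i\<in>I. pure A D W (sD (\<phi> i)) (ev W (p i) q)) \<in> addmap (DT W) (DT W)"
    by (rule addmap_sum[OF DT_ag[OF W] DT_ag[OF W] addmap_comp[OF ev_addmap[OF W pc] DT_pure_r[OF W sc]]])
  show ?thesis
  proof (rule DT_ext[OF W am, of "\<lambda>q. q"])
    fix f w assume f: "f \<in> carrier D" and w: "w \<in> carrier W"
    have "(\<Oplus>\<^bsub>DT W\<^esub>i\<in>I. pure A D W (sD (\<phi> i)) (ev W (p i) (pure A D W f w))) =
        (\<Oplus>\<^bsub>DT W\<^esub>i\<in>I. pure A D W (rsmult D (sD (\<phi> i)) (mhat f (p i))) w)" by (rule fs_cong[OF DT_ag[OF W]])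
         (use f w pc sc in "auto simp: ev_pure[OF W] DT_bal[OF W] D_r DT_pure_closed[OF W] lm_smult[OF W]")
    also have "\<dots> = pure A D W (\<Oplus>\<^sub>D i\<in>I. rsmult D (sD (\<phi> i)) (mhat f (p i))) w"
      by (rule addmap_fs[OF D_ag DT_ag[OF W] DT_pure_l[OF W w], symmetric]) (use f pc sc in "simp add: D_r")
    also have "(\<Oplus>\<^sub>D i\<in>I. rsmult D (sD (\<phi> i)) (mhat f (p i))) = f"
    proof (rule D_eqI)
      fix m assume m: "m \<in> carrier M"
      have c: "\<phi> i m \<in> carrier A" if "i \<in> I" for i by (rule frame_coeff[OF fr that m])
      have "(\<Oplus>\<^sub>D i\<in>I. rsmult D (sD (\<phi> i)) (mhat f (p i))) m = (\<Oplus>\<^sub>\<O> i\<in>I. rsmult D (sD (\<phi> i)) (mhat f (p i)) m)"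
        by (rule addmap_fs[OF D_ag A.agO D_eval[OF m]]) (use f pc sc in "simp add: D_r")
      also have "\<dots> = (\<Oplus>\<^sub>\<O> i\<in>I. f (\<phi> i m \<odot>\<^sub>M p i))"
      proof (rule fs_cong[OF A.agO])
        fix i assume i: "i \<in> I"
        have "rsmult D (sD (\<phi> i)) (mhat f (p i)) m = s (mhat f (p i) \<otimes>\<^sub>A \<phi> i m)"
          using m f pc[OF i] linmap_smult[OF frame_fun[OF fr i]] by (simp add: D_app sD_def)
        also have "\<dots> = s (\<phi> i m \<otimes>\<^sub>A mhat f (p i))" by (rule A.s_sym) (use f pc i c in auto)
        also have "\<dots> = f (\<phi> i m \<odot>\<^sub>M p i)" using mhat_spec[OF f pc[OF i] c[OF i]] by simp
        finally show "rsmult D (sD (\<phi> i)) (mhat f (p i)) m = f (\<phi> i m \<odot>\<^sub>M p i)" .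
      qed (use f pc c in simp)
      also have "\<dots> = f (\<Oplus>\<^sub>M i\<in>I. \<phi> i m \<odot>\<^sub>M p i)"
        by (rule addmap_fs[OF agM A.agO D_addmap[OF f], symmetric]) (use pc c in simp)
      also have "\<dots> = f m" using frame_sum[OF fr m] by simp
      finally show "(\<Oplus>\<^sub>D i\<in>I. rsmult D (sD (\<phi> i)) (mhat f (p i))) m = f m" .
    qed (use f pc sc in "auto intro!: fs_closed simp: D_r")
    finally show "(\<Oplus>\<^bsub>DT W\<^esub>i\<in>I. pure A D W (sD (\<phi> i)) (ev W (p i) (pure A D W f w))) = pure A D W f w" .
  qed (use q in "auto intro!: addmapI ag_add[OF DT_ag[OF W]]")
qed

text \<open>By \<open>DT_expand\<close> an element is recovered from its values under
  \<open>ev\<close>. Equations in D \<otimes> W are thereby reduced to equations in W.\<close>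

lemma ev_joint_inj:
  assumes fr: "frame A M I p \<phi>" and W: "A.is_mod W" and q: "q \<in> carrier (DT W)" and r: "r \<in> carrier (DT W)"
    and e: "\<And>m. m \<in> carrier M \<Longrightarrow> ev W m q = ev W m r"
  shows "q = r"
proof -
  have "(\<Oplus>\<^bsub>DT W\<^esub>i\<in>I. pure A D W (sD (\<phi> i)) (ev W (p i) q)) = (\<Oplus>\<^bsub>DT W\<^esub>i\<in>I. pure A D W (sD (\<phi> i)) (ev W (p i) r))"
    by (rule fs_cong[OF DT_ag[OF W]]) (use e frame_elt[OF fr] ev_closed[OF W _ r] sD_closed[OF frame_fun[OF fr]] in
         \<open>auto simp: DT_pure_closed[OF W]\<close>)
  then show ?thesis using DT_expand[OF fr W q] DT_expand[OF fr W r] by simp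
qed

end

section \<open>The transfer map\<close>

lemma balancedD:
  assumes "balanced R X Y G \<phi>"
  shows "x \<in> carrier X \<Longrightarrow> (\<lambda>y. \<phi> (x, y)) \<in> addmap Y G"
    "y \<in> carrier Y \<Longrightarrow> (\<lambda>x. \<phi> (x, y)) \<in> addmap X G"
    "x \<in> carrier X \<Longrightarrow> r \<in> carrier R \<Longrightarrow> y \<in> carrier Y \<Longrightarrow> \<phi> (rsmult X x r, y) = \<phi> (x, r \<odot>\<^sub>Y y)"
    "x \<in> carrier X \<Longrightarrow> y \<in> carrier Y \<Longrightarrow> \<phi> (x, y) \<in> carrier G"
  using assms addmap_closed[of "\<lambda>y. \<phi> (x, y)" Y G y] by (auto simp: balanced_def)

declare tensor_bimodule_simps [simp del]

context sym_bimodule begin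

subsection \<open>Frames of \<open>M\<close> over \<open>B\<close>\<close>

text \<open>The data over which \<open>adj_eps_one\<close> chooses: a frame of M as a right
  B-module, with extensional coordinate maps.\<close>

definition rdual :: "nat \<Rightarrow> (nat \<Rightarrow> 'm) \<Rightarrow> (nat \<Rightarrow> 'm \<Rightarrow> 'b) \<Rightarrow> bool" where
  "rdual k m \<beta> \<longleftrightarrow> (\<forall>j<k. m j \<in> carrier M \<and> \<beta> j \<in> lin_hom (opp B) (right_part M) (regular (opp B))) \<and>
     (\<forall>m'\<in>carrier M. (\<Oplus>\<^sub>M j\<in>{..<k}. rsmult M (m j) (\<beta> j m')) = m')"

definition tB :: "('m \<Rightarrow> 'b) \<Rightarrow> 'm \<Rightarrow> 'k" where "tB \<beta> = compose (carrier M) t \<beta>"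

lemma rhom:
  assumes "\<beta> \<in> lin_hom (opp B) (right_part M) (regular (opp B))" "m \<in> carrier M"
  shows "\<beta> m \<in> carrier B" "m' \<in> carrier M \<Longrightarrow> \<beta> (m \<oplus>\<^sub>M m') = \<beta> m \<oplus>\<^sub>B \<beta> m'"
    "b \<in> carrier B \<Longrightarrow> \<beta> (rsmult M m b) = \<beta> m \<otimes>\<^sub>B b"
  using lin_hom_closed[OF assms(1)] lin_hom_add[OF assms(1)] lin_hom_smult[OF assms(1)] assms(2) by auto

lemma tB_app: "m \<in> carrier M \<Longrightarrow> tB \<beta> m = t (\<beta> m)" by (simp add: tB_def)

lemma tB_closed:
  assumes \<beta>: "\<beta> \<in> lin_hom (opp B) (right_part M) (regular (opp B))"
  shows "tB \<beta> \<in> carrier D"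
  unfolding tB_def compose_def
proof (rule DI)
  fix c m assume c: "c \<in> carrier \<O>" and m: "m \<in> carrier M"
  have "\<beta> ((c \<odot>\<^sub>A \<one>\<^sub>A) \<odot>\<^sub>M m) = \<beta> m \<otimes>\<^sub>B (c \<odot>\<^sub>B \<one>\<^sub>B)" using rhom(3)[OF \<beta> m, of "c \<odot>\<^sub>B \<one>\<^sub>B"] M_scalar[OF c m] c by simp
  also have "\<dots> = c \<odot>\<^sub>B \<beta> m" using c rhom(1)[OF \<beta> m] by (simp add: B.smult_mult_r)
  finally show "t (\<beta> ((c \<odot>\<^sub>A \<one>\<^sub>A) \<odot>\<^sub>M m)) = c \<otimes>\<^sub>\<O> t (\<beta> m)" using B.s_smult[OF c rhom(1)[OF \<beta> m]] by simp
qed (use rhom[OF \<beta>] in "simp_all add: B.s_add")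

lemma rdualD:
  assumes "rdual k m \<beta>"
  shows "j \<in> {..<k} \<Longrightarrow> m j \<in> carrier M" "j \<in> {..<k} \<Longrightarrow> \<beta> j \<in> lin_hom (opp B) (right_part M) (regular (opp B))"
    "m' \<in> carrier M \<Longrightarrow> (\<Oplus>\<^sub>M j\<in>{..<k}. rsmult M (m j) (\<beta> j m')) = m'" "j \<in> {..<k} \<Longrightarrow> tB (\<beta> j) \<in> carrier D"
  using assms by (auto simp: rdual_def intro!: tB_closed)

lemma rdual_exists: "\<exists>k m \<beta>. rdual k m \<beta>"
proof -
  obtain n :: nat and p \<phi> where fr: "frame (opp B) (right_part M) {..<n} p \<phi>"
    by (rule fg_projective_frame[OF lmMr M_proj_r])
  let ?\<beta> = "\<lambda>j. \<lambda>m\<in>carrier M. \<phi> j m"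
  have "rdual n p ?\<beta>" unfolding rdual_def
  proof (intro conjI allI impI ballI)
    fix j assume j: "j < n"
    show "p j \<in> carrier M" using frame_elt[OF fr, of j] j by simp
    show "?\<beta> j \<in> lin_hom (opp B) (right_part M) (regular (opp B))"
      using linmap_restrict[OF lmMr frame_fun[OF fr, of j]] j by simp
  next
    fix m' assume m': "m' \<in> carrier M"
    have c: "\<phi> j m' \<in> carrier B" if "j < n" for j using frame_coeff[OF fr, of j m'] that m' by simp
    have pc: "p j \<in> carrier M" if "j < n" for j using frame_elt[OF fr, of j] that by simp
    have "(\<Oplus>\<^sub>M j\<in>{..<n}. rsmult M (p j) (?\<beta> j m')) = (\<Oplus>\<^bsub>right_part M\<^esub>j\<in>{..<n}. \<phi> j m' \<odot>\<^bsub>right_part M\<^esub> p j)"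
      using m' c pc fs_same[OF agM lm_ag[OF lmMr], of "{..<n}" "\<lambda>j. rsmult M (p j) (\<phi> j m')"] by simp
    also have "\<dots> = m'" using frame_sum[OF fr, of m'] m' by simp
    finally show "(\<Oplus>\<^sub>M j\<in>{..<n}. rsmult M (p j) (?\<beta> j m')) = m'" .
  qed
  then show ?thesis by blast
qed

text \<open>The B-valued counterpart of \<open>mhat\<close> on the right module M, with f(m b) = t(b
  chk f m). Here \<open>hat\<close> serves as a formula only: \<open>right_part M\<close> is a
  module over the opposite of B, so the characterising property is proved anew.\<close>

definition chk :: "('m \<Rightarrow> 'k) \<Rightarrow> 'm \<Rightarrow> 'b" where "chk f m = B.hat (right_part M) f m"

lemma chk_spec:
  assumes f: "f \<in> carrier D" and m: "m \<in> carrier M"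
  shows "chk f m \<in> carrier B" "\<And>b. b \<in> carrier B \<Longrightarrow> f (rsmult M m b) = t (b \<otimes>\<^sub>B chk f m)"
proof -
  have "(\<lambda>b\<in>carrier B. f (rsmult M m b)) \<in> lin_hom \<O> B (regular \<O>)"
  proof (rule lin_hom_restrictI)
    fix c b assume c: "c \<in> carrier \<O>" and b: "b \<in> carrier B"
    have "rsmult M m (c \<odot>\<^sub>B b) = rsmult M (rsmult M m b) (c \<odot>\<^sub>B \<one>\<^sub>B)"
      using m b c by (simp add: Mr_assoc[symmetric] B.smult_mult_r)
    then show "f (rsmult M m (c \<odot>\<^sub>B b)) = c \<odot>\<^bsub>regular \<O>\<^esub> f (rsmult M m b)"
      using m b c M_scalar[OF c Mr_closed[OF m b]] D_smult[OF f c Mr_closed[OF m b]] by simp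
  qed (use f m in "simp_all add: Mr_add_r D_add")
  from B.s_surj[OF this] obtain x where x: "x \<in> carrier B" "\<And>b. b \<in> carrier B \<Longrightarrow> f (rsmult M m b) = t (b \<otimes>\<^sub>B x)" by auto
  have "chk f m = x" unfolding chk_def by (rule B.hat_eqI) (use x in auto)
  with x show "chk f m \<in> carrier B" "\<And>b. b \<in> carrier B \<Longrightarrow> f (rsmult M m b) = t (b \<otimes>\<^sub>B chk f m)" by auto
qed

lemma chk_eqI: "x \<in> carrier B \<Longrightarrow> (\<And>b. b \<in> carrier B \<Longrightarrow> f (rsmult M m b) = t (b \<otimes>\<^sub>B x)) \<Longrightarrow> chk f m = x"
  unfolding chk_def by (rule B.hat_eqI) auto

lemma chk_plus:
  assumes "f \<in> carrier D" "g \<in> carrier D" "m \<in> carrier M"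
  shows "chk (f \<oplus>\<^sub>D g) m = chk f m \<oplus>\<^sub>B chk g m"
  by (rule chk_eqI) (use assms chk_spec in "simp_all add: D_app B.r_distr B.s_add")

lemma chk_smult:
  assumes "f \<in> carrier D" "m \<in> carrier M" "b \<in> carrier B"
  shows "chk (b \<odot>\<^sub>D f) m = b \<otimes>\<^sub>B chk f m"
  by (rule chk_eqI) (use assms chk_spec[OF assms(1,2)] in "simp_all add: D_app Mr_assoc[symmetric] B.m_assoc")

text \<open>Each m_j \<delta>_j(x) contributes f(m_j \<delta>_j(x)) = t(\<delta>_j(x) chk f m_j),
  and these add up to f(x). A frame of M on the right thus yields one of D as a left
  B-module.\<close>

lemma D_rdual_expand:
  assumes d: "rdual k m \<delta>" and f: "f \<in> carrier D"
  shows "(\<Oplus>\<^sub>D j\<in>{..<k}. chk f (m j) \<odot>\<^sub>D tB (\<delta> j)) = f"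
proof (rule D_eqI)
  note d1 = rdualD[OF d]
  note c = chk_spec[OF f d1(1)]
  have cl: "chk f (m j) \<odot>\<^sub>D tB (\<delta> j) \<in> carrier D" if "j \<in> {..<k}" for j by (rule D_l[OF c(1)[OF that] d1(4)[OF that]])
  show "(\<Oplus>\<^sub>D j\<in>{..<k}. chk f (m j) \<odot>\<^sub>D tB (\<delta> j)) \<in> carrier D" by (rule fs_closed[OF D_ag cl])
  fix x assume x: "x \<in> carrier M"
  have "(\<Oplus>\<^sub>D j\<in>{..<k}. chk f (m j) \<odot>\<^sub>D tB (\<delta> j)) x = (\<Oplus>\<^sub>\<O> j\<in>{..<k}. (chk f (m j) \<odot>\<^sub>D tB (\<delta> j)) x)"
    by (rule addmap_fs[OF D_ag A.agO D_eval[OF x] cl])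
  also have "\<dots> = (\<Oplus>\<^sub>\<O> j\<in>{..<k}. f (rsmult M (m j) (\<delta> j x)))"
  proof (rule fs_cong[OF A.agO])
    fix j assume j: "j \<in> {..<k}"
    have b: "\<delta> j x \<in> carrier B" by (rule rhom(1)[OF d1(2)[OF j] x])
    show "(chk f (m j) \<odot>\<^sub>D tB (\<delta> j)) x = f (rsmult M (m j) (\<delta> j x))"
      using x c[OF j] b rhom(3)[OF d1(2)[OF j] x c(1)[OF j]] by (simp add: D_app tB_app)
    show "f (rsmult M (m j) (\<delta> j x)) \<in> carrier \<O>" using f b d1(1)[OF j] by simp
  qed
  also have "\<dots> = f (\<Oplus>\<^sub>M j\<in>{..<k}. rsmult M (m j) (\<delta> j x))"
    by (rule addmap_fs[OF agM A.agO D_addmap[OF f], symmetric]) (use d1(1) rhom(1)[OF d1(2) x] in simp)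
  also have "\<dots> = f x" using d1(3)[OF x] by simp
  finally show "(\<Oplus>\<^sub>D j\<in>{..<k}. chk f (m j) \<odot>\<^sub>D tB (\<delta> j)) x = f x" .
qed (rule f)

text \<open>The Casimir identity for \<epsilon>: expand a m_j in the second frame, move the
  coefficients in B across the balanced map, and recognise the expansion of (t \<circ> \<gamma>_i)
  a. With a = 1 it gives independence of the frame, with equal frames the commutation of
  \<epsilon>(1) with A, and for another \<open>\<Psi>\<close> the linearity of the transfer.\<close>

lemma M_casimir:
  assumes d: "rdual k m \<beta>" and d': "rdual l n \<gamma>" and a: "a \<in> carrier A" and G: "abelian_group G"
    and bal: "balanced B M D G \<Psi>"
  shows "(\<Oplus>\<^sub>G j\<in>{..<k}. \<Psi> (a \<odot>\<^sub>M m j, tB (\<beta> j))) = (\<Oplus>\<^sub>G i\<in>{..<l}. \<Psi> (n i, rsmult D (tB (\<gamma> i)) a))"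
proof -
  note d1 = rdualD[OF d] and d2 = rdualD[OF d'] and b = balancedD[OF bal]
  have am: "a \<odot>\<^sub>M m j \<in> carrier M" if "j \<in> {..<k}" for j using d1(1)[OF that] a by simp
  have gc: "\<gamma> i (a \<odot>\<^sub>M m j) \<in> carrier B" if "j \<in> {..<k}" "i \<in> {..<l}" for i j
    by (rule rhom(1)[OF d2(2)[OF that(2)] am[OF that(1)]])
  have "(\<Oplus>\<^sub>G j\<in>{..<k}. \<Psi> (a \<odot>\<^sub>M m j, tB (\<beta> j))) = (\<Oplus>\<^sub>G j\<in>{..<k}. \<Oplus>\<^sub>G i\<in>{..<l}. \<Psi> (n i, \<gamma> i (a \<odot>\<^sub>M m j) \<odot>\<^sub>D tB (\<beta> j)))"
  proof (rule fs_cong[OF G])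
    fix j assume j: "j \<in> {..<k}"
    have "\<Psi> (a \<odot>\<^sub>M m j, tB (\<beta> j)) = \<Psi> ((\<Oplus>\<^sub>M i\<in>{..<l}. rsmult M (n i) (\<gamma> i (a \<odot>\<^sub>M m j))), tB (\<beta> j))"
      using d2(3)[OF am[OF j]] by simp
    also have "\<dots> = (\<Oplus>\<^sub>G i\<in>{..<l}. \<Psi> (rsmult M (n i) (\<gamma> i (a \<odot>\<^sub>M m j)), tB (\<beta> j)))"
      by (rule addmap_fs[OF agM G b(2)[OF d1(4)[OF j]]]) (use d2(1) gc[OF j] in simp)
    also have "\<dots> = (\<Oplus>\<^sub>G i\<in>{..<l}. \<Psi> (n i, \<gamma> i (a \<odot>\<^sub>M m j) \<odot>\<^sub>D tB (\<beta> j)))"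
      by (rule fs_cong[OF G]) (use b(3)[OF d2(1) gc[OF j] d1(4)[OF j]] b(4) d2(1) gc[OF j] d1(4)[OF j] in "auto simp: D_l")
    finally show "\<Psi> (a \<odot>\<^sub>M m j, tB (\<beta> j)) = (\<Oplus>\<^sub>G i\<in>{..<l}. \<Psi> (n i, \<gamma> i (a \<odot>\<^sub>M m j) \<odot>\<^sub>D tB (\<beta> j)))" .
    show "(\<Oplus>\<^sub>G i\<in>{..<l}. \<Psi> (n i, \<gamma> i (a \<odot>\<^sub>M m j) \<odot>\<^sub>D tB (\<beta> j))) \<in> carrier G"
      by (rule fs_closed[OF G]) (use b(4) d2(1) gc[OF j] d1(4)[OF j] in "simp add: D_l")
  qed
  also have "\<dots> = (\<Oplus>\<^sub>G i\<in>{..<l}. \<Oplus>\<^sub>G j\<in>{..<k}. \<Psi> (n i, \<gamma> i (a \<odot>\<^sub>M m j) \<odot>\<^sub>D tB (\<beta> j)))"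
    by (rule fs_swap[OF G]) (use b(4) d2(1) gc d1(4) in "auto simp: D_l")
  also have "\<dots> = (\<Oplus>\<^sub>G i\<in>{..<l}. \<Psi> (n i, rsmult D (tB (\<gamma> i)) a))"
  proof (rule fs_cong[OF G])
    fix i assume i: "i \<in> {..<l}"
    have cl: "\<gamma> i (a \<odot>\<^sub>M m j) \<odot>\<^sub>D tB (\<beta> j) \<in> carrier D" if "j \<in> {..<k}" for j
      using gc[OF that i] d1(4)[OF that] by (simp add: D_l)
    have "(\<Oplus>\<^sub>G j\<in>{..<k}. \<Psi> (n i, \<gamma> i (a \<odot>\<^sub>M m j) \<odot>\<^sub>D tB (\<beta> j))) = \<Psi> (n i, \<Oplus>\<^sub>D j\<in>{..<k}. \<gamma> i (a \<odot>\<^sub>M m j) \<odot>\<^sub>D tB (\<beta> j))"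
      by (rule addmap_fs[OF D_ag G b(1)[OF d2(1)[OF i]], symmetric]) (rule cl)
    also have "(\<Oplus>\<^sub>D j\<in>{..<k}. \<gamma> i (a \<odot>\<^sub>M m j) \<odot>\<^sub>D tB (\<beta> j)) = rsmult D (tB (\<gamma> i)) a"
    proof (rule trans[OF fs_cong[OF D_ag] D_rdual_expand[OF d D_r[OF a d2(4)[OF i]]]])
      fix j assume j: "j \<in> {..<k}"
      \<comment> \<open>The coefficients are those prescribed by \<open>D_rdual_expand\<close>:
        symmetry of t turns t(\<gamma>_i(a m_j) y) into t(y \<gamma>_i(a m_j)).\<close>
      have "chk (rsmult D (tB (\<gamma> i)) a) (m j) = \<gamma> i (a \<odot>\<^sub>M m j)"
      proof (rule chk_eqI[OF gc[OF j i]])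
        fix y assume y: "y \<in> carrier B"
        show "rsmult D (tB (\<gamma> i)) a (rsmult M (m j) y) = t (y \<otimes>\<^sub>B \<gamma> i (a \<odot>\<^sub>M m j))"
          using d1(1)[OF j] a y rhom(3)[OF d2(2)[OF i] am[OF j] y] M_lr[OF a d1(1)[OF j] y] B.s_sym[OF y gc[OF j i]]
          by (simp add: D_app tB_app)
      qed
      then show "\<gamma> i (a \<odot>\<^sub>M m j) \<odot>\<^sub>D tB (\<beta> j) = chk (rsmult D (tB (\<gamma> i)) a) (m j) \<odot>\<^sub>D tB (\<beta> j)" by simp
      then show "chk (rsmult D (tB (\<gamma> i)) a) (m j) \<odot>\<^sub>D tB (\<beta> j) \<in> carrier D" using cl[OF j] by simp
    qed
    finally show "(\<Oplus>\<^sub>G j\<in>{..<k}. \<Psi> (n i, \<gamma> i (a \<odot>\<^sub>M m j) \<odot>\<^sub>D tB (\<beta> j))) = \<Psi> (n i, rsmult D (tB (\<gamma> i)) a)" .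
    show "\<Psi> (n i, rsmult D (tB (\<gamma> i)) a) \<in> carrier G" by (rule b(4)[OF d2(1)[OF i] D_r[OF a d2(4)[OF i]]])
  qed
  finally show ?thesis .
qed

lemma D_r_one: "f \<in> carrier D \<Longrightarrow> rsmult D f \<one>\<^sub>A = f" by (rule D_eqI) (simp_all add: D_r D_app left_module.lm_one[OF lmM])

section \<open>The bimodule M tensor D and the adjunction maps\<close>

lemma MD_left: "tensor_left B M D A" by (intro tensor_left.intro tensor_data.intro tensor_left_axioms.intro D_ag agM lmM)
     (auto simp: D_l M_lr)

lemma MD_right: "tensor_right B M D A"
  by (intro tensor_right.intro tensor_left.axioms(1)[OF MD_left] tensor_right_axioms.intro D_r_addmap D_lr)

abbreviation "MD \<equiv> tensor B M D"
abbreviation "ME \<equiv> tensor_bimodule B M D"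

lemma ME_simps [simp]: "carrier ME = carrier MD" "ring.zero ME = ring.zero MD" "add ME = add MD" "smult ME = smult MD"
  by (simp_all add: tensor_bimodule_simps tensor_simps)

lemmas MD_data = tensor_left.axioms(1)[OF MD_left]
lemmas MD_lm = tensor_left.T_left_module[OF MD_left]
lemmas MD_ag = lm_ag[OF MD_lm]
lemmas MD_ext = tensor_data.tensor_ext[OF MD_data, folded tensor_simps(1)]
lemmas MD_pure_closed = tensor_data.pure_closed[OF MD_data, folded tensor_simps(1)]
lemmas MD_r_addmap = tensor_right.rsmult_addmap[OF MD_right]
lemmas MD_r_pure = tensor_right.rsmult_pure[OF MD_right]
lemmas MD_l_pure = tensor_left.smult_pure[OF MD_left]
lemmas MD_pure_bal = tensor_data.pure_balanced[OF MD_data]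
lemmas MD_lift = tensor_data.lift_addmap[OF MD_data]
lemmas MD_lift_pure = tensor_data.lift_pure[OF MD_data]

lemma ME_ag: "abelian_group ME" by (rule ag_same[OF MD_ag]) simp_all

abbreviation "eps1 \<equiv> adj_eps_one \<O> A B M t"

lemma eps_sum_closed: "rdual k m \<beta> \<Longrightarrow> (\<Oplus>\<^sub>MD j\<in>{..<k}. pure B M D (m j) (tB (\<beta> j))) \<in> carrier MD"
  by (rule fs_closed[OF MD_ag MD_pure_closed]) (auto dest: rdualD)

text \<open>Any two frames give the same sum by \<open>M_casimir\<close> with a = 1, so the set
  under \<open>the_elem\<close> is a singleton.\<close>

lemma eps1_eq: "rdual k m \<beta> \<Longrightarrow> eps1 = (\<Oplus>\<^sub>MD j\<in>{..<k}. pure B M D (m j) (tB (\<beta> j)))"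
proof -
  assume d: "rdual k m \<beta>"
  have val: "(\<Oplus>\<^sub>MD j\<in>{..<l}. pure B M D (n j) (tB (\<gamma> j))) = (\<Oplus>\<^sub>MD j\<in>{..<k}. pure B M D (m j) (tB (\<beta> j)))"
    if e: "rdual l n \<gamma>" for l n \<gamma>
  proof -
    have "(\<Oplus>\<^sub>MD j\<in>{..<l}. pure B M D (n j) (tB (\<gamma> j))) = (\<Oplus>\<^sub>MD j\<in>{..<l}. pure B M D (\<one>\<^sub>A \<odot>\<^sub>M n j) (tB (\<gamma> j)))"
      by (rule fs_cong[OF MD_ag]) (use rdualD[OF e] in "auto simp: left_module.lm_one[OF lmM] MD_pure_closed")
    also have "\<dots> = (\<Oplus>\<^sub>MD j\<in>{..<k}. pure B M D (m j) (rsmult D (tB (\<beta> j)) \<one>\<^sub>A))"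
      using M_casimir[OF e d A.one_closed MD_ag MD_pure_bal] by simp
    also have "\<dots> = (\<Oplus>\<^sub>MD j\<in>{..<k}. pure B M D (m j) (tB (\<beta> j)))"
      by (rule fs_cong[OF MD_ag]) (use rdualD[OF d] in "auto simp: D_r_one MD_pure_closed")
    finally show ?thesis .
  qed
  show ?thesis unfolding adj_eps_one_def Let_def
  proof (rule the_elem_eqI)
    show "(\<Oplus>\<^sub>MD j\<in>{..<k}. pure B M D (m j) (tB (\<beta> j))) \<in>
      {(\<Oplus>\<^sub>MD j\<in>{..<k}. pure B M D (m j) (compose (carrier M) t (\<beta> j))) |(k::nat) m \<beta>.
        (\<forall>j<k. m j \<in> carrier M \<and> \<beta> j \<in> lin_hom (opp B) (right_part M) (regular (opp B))) \<and>
        (\<forall>m'\<in>carrier M. (\<Oplus>\<^sub>M j\<in>{..<k}. rsmult M (m j) (\<beta> j m')) = m')}" unfolding tB_def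
      by (rule CollectI, rule exI[of _ k], rule exI[of _ m], rule exI[of _ \<beta>],
          rule conjI[OF refl d[unfolded rdual_def]])
    fix x assume "x \<in> {(\<Oplus>\<^sub>MD j\<in>{..<k}. pure B M D (m j) (compose (carrier M) t (\<beta> j))) |(k::nat) m \<beta>.
        (\<forall>j<k. m j \<in> carrier M \<and> \<beta> j \<in> lin_hom (opp B) (right_part M) (regular (opp B))) \<and>
        (\<forall>m'\<in>carrier M. (\<Oplus>\<^sub>M j\<in>{..<k}. rsmult M (m j) (\<beta> j m')) = m')}"
    then obtain l :: nat and n \<gamma> where x: "x = (\<Oplus>\<^sub>MD j\<in>{..<l}. pure B M D (n j) (compose (carrier M) t (\<gamma> j)))"
      and e1: "\<forall>j<l. n j \<in> carrier M \<and> \<gamma> j \<in> lin_hom (opp B) (right_part M) (regular (opp B))"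
      and e2: "\<forall>m'\<in>carrier M. (\<Oplus>\<^sub>M j\<in>{..<l}. rsmult M (n j) (\<gamma> j m')) = m'" by (elim CollectE exE conjE) (rule that)
    have e: "rdual l n \<gamma>" unfolding rdual_def by (rule conjI[OF e1 e2])
    show "x = (\<Oplus>\<^sub>MD j\<in>{..<k}. pure B M D (m j) (tB (\<beta> j)))" unfolding x by (rule val[OF e, unfolded tB_def[of "\<gamma> _"]])
  qed
qed

lemma eps1_closed: "eps1 \<in> carrier MD"
proof -
  obtain k m \<beta> where d: "rdual k m \<beta>" using rdual_exists by blast
  show ?thesis unfolding eps1_eq[OF d] by (rule eps_sum_closed[OF d])
qed

lemma MD_lr:
  assumes "a \<in> carrier A" "a' \<in> carrier A" "p \<in> carrier MD"
  shows "rsmult ME (a \<odot>\<^sub>MD p) a' = a \<odot>\<^sub>MD rsmult ME p a'"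
  by (rule MD_ext[OF addmap_comp[OF lm_addmap_r[OF MD_lm] MD_r_addmap] addmap_comp[OF MD_r_addmap lm_addmap_r[OF MD_lm]]])
     (use assms in "simp_all add: MD_l_pure MD_r_pure D_r")

lemma eps1_comm: "a \<in> carrier A \<Longrightarrow> a \<odot>\<^sub>MD eps1 = rsmult ME eps1 a"
proof -
  assume a: "a \<in> carrier A"
  obtain k m \<beta> where d: "rdual k m \<beta>" using rdual_exists by blast
  note d1 = rdualD[OF d]
  have pc: "j \<in> {..<k} \<Longrightarrow> pure B M D (m j) (tB (\<beta> j)) \<in> carrier MD" for j using d1 by (intro MD_pure_closed)
  have "a \<odot>\<^sub>MD eps1 = (\<Oplus>\<^sub>MD j\<in>{..<k}. a \<odot>\<^sub>MD pure B M D (m j) (tB (\<beta> j)))"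
    unfolding eps1_eq[OF d] by (rule lm_fs_r[OF MD_lm a pc])
  also have "\<dots> = (\<Oplus>\<^sub>MD j\<in>{..<k}. pure B M D (a \<odot>\<^sub>M m j) (tB (\<beta> j)))"
    by (rule fs_cong[OF MD_ag]) (use d1 a in "simp_all add: MD_l_pure MD_pure_closed")
  also have "\<dots> = (\<Oplus>\<^sub>MD j\<in>{..<k}. pure B M D (m j) (rsmult D (tB (\<beta> j)) a))"
    using M_casimir[OF d d a MD_ag MD_pure_bal] by simp
  also have "\<dots> = (\<Oplus>\<^sub>MD j\<in>{..<k}. rsmult ME (pure B M D (m j) (tB (\<beta> j))) a)"
    by (rule fs_cong[OF MD_ag]) (use d1 a addmap_closed[OF MD_r_addmap[OF a] pc] in "simp_all add: MD_r_pure")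
  also have "\<dots> = rsmult ME eps1 a"
    unfolding eps1_eq[OF d] by (rule addmap_fs[OF MD_ag MD_ag MD_r_addmap[OF a] pc, symmetric])
  finally show ?thesis .
qed

text \<open>Non-degeneracy of s makes the A-linear \<alpha> with s \<circ> \<alpha> = f unique, and
  \<open>mhat f\<close> is such a map. After this the definite description in \<open>adj_eta\<close>
  no longer appears.\<close>

lemma eta_fun:
  assumes f: "f \<in> carrier D" and m: "m \<in> carrier M"
  shows "(THE \<alpha>. \<alpha> \<in> lin_hom A M (regular A) \<and> f = compose (carrier M) s \<alpha>) m = mhat f m"
proof -
  let ?\<alpha> = "\<lambda>m\<in>carrier M. mhat f m"
  have \<alpha>: "?\<alpha> \<in> lin_hom A M (regular A)" by (rule linmap_restrict[OF lmM A.hat_linmap[OF lmM D_linmap[OF f]]])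
  have "(THE \<alpha>. \<alpha> \<in> lin_hom A M (regular A) \<and> f = compose (carrier M) s \<alpha>) = ?\<alpha>"
  proof (rule the_equality)
    have "f \<in> extensional (carrier M)"
      using f lin_hom_ext[of f \<O> "A.RS M" "regular \<O>"] by (simp add: dual_simps)
    then have "f = compose (carrier M) s ?\<alpha>" by (rule extensionalityI)
         (use A.hat_s[OF lmM D_linmap[OF f]] in "auto simp: compose_def")
    then show "?\<alpha> \<in> lin_hom A M (regular A) \<and> f = compose (carrier M) s ?\<alpha>" using \<alpha> by blast
    fix \<alpha> assume a: "\<alpha> \<in> lin_hom A M (regular A) \<and> f = compose (carrier M) s \<alpha>"
    show "\<alpha> = ?\<alpha>"
    proof (rule lin_hom_eqI[OF conjunct1[OF a] \<alpha>])
      fix x assume x: "x \<in> carrier M"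
      have "mhat f x = \<alpha> x"
      proof (rule A.hat_eqI)
        show "\<alpha> x \<in> carrier A" using lin_hom_closed[OF conjunct1[OF a] x] by simp
        fix b assume b: "b \<in> carrier A"
        show "f (b \<odot>\<^sub>M x) = s (b \<otimes>\<^sub>A \<alpha> x)" unfolding conjunct2[OF a] using lin_hom_smult[OF conjunct1[OF a] b x] b x by simp
      qed
      then show "\<alpha> x = ?\<alpha> x" using x by simp
    qed
  qed
  then show ?thesis using m by simp
qed

abbreviation "eta \<equiv> adj_eta \<O> A M s"

lemma eta_bal: "balanced B M D A (\<lambda>(m, f). (THE \<alpha>. \<alpha> \<in> lin_hom A M (regular A) \<and> f = compose (carrier M) s \<alpha>) m)"
  by (rule balancedI) (simp_all add: eta_fun mhat_add mhat_plus mhat_l D_l)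

lemma eta_addmap: "eta \<in> addmap MD A" unfolding adj_eta_def by (rule MD_lift[OF A.agA eta_bal])

lemma eta_pure: "m \<in> carrier M \<Longrightarrow> f \<in> carrier D \<Longrightarrow> eta (pure B M D m f) = mhat f m"
  unfolding adj_eta_def using MD_lift_pure[OF A.agA eta_bal] by (simp add: eta_fun)

lemma eta_r: "p \<in> carrier MD \<Longrightarrow> a \<in> carrier A \<Longrightarrow> eta (rsmult ME p a) = eta p \<otimes>\<^sub>A a"
  by (rule MD_ext[OF addmap_comp[OF MD_r_addmap eta_addmap] addmap_comp[OF eta_addmap A.mult_addmap_l]])
     (simp_all add: MD_r_pure eta_pure mhat_r D_r)

subsection \<open>An explicit formula for the transfer\<close>

abbreviation "RB \<equiv> regular_bimodule A"

lemma RB_ag: "abelian_group RB" by (rule ag_same[OF A.agA]) simp_all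

context
  fixes U :: "('a, 'u) module" assumes U: "left_module A U"
begin

lemma RU_data: "tensor_data A RB U" by (intro tensor_data.intro RB_ag lm_ag[OF U]) (auto simp: lm_smult[OF U])

lemma EU_data: "tensor_data A ME U" by (intro tensor_data.intro ME_ag lm_ag[OF U])
     (use addmap_closed[OF MD_r_addmap] in "auto simp: lm_smult[OF U]")

lemma MDU_data: "tensor_data B M (DT U)" by (intro tensor_data.intro agM DT_ag[OF U]) (auto simp: lm_smult[OF DT_lm[OF U]])

lemmas MDU_ag = tensor_data.T_ag[OF MDU_data]
lemmas MDU_pure_closed = tensor_data.pure_closed[OF MDU_data, folded tensor_simps(1)]

text \<open>Compatibility of \<epsilon> with the right action of A is \<open>eps1_comm\<close>; it
  is what makes \<epsilon> \<otimes> Id well defined.\<close>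

lemma eps_map: "tensor_maps A RB U ME U (adj_eps \<O> A B M t) (\<lambda>u. u)"
proof (intro tensor_maps.intro tensor_maps_axioms.intro RU_data EU_data)
  show "adj_eps \<O> A B M t \<in> addmap RB ME" unfolding adj_eps_def[abs_def]
    using lm_addmap_l[OF MD_lm eps1_closed] by (simp add: addmap_def)
  show "(\<lambda>u. u) \<in> addmap U U" by (simp add: addmap_def)
  fix x r assume x: "x \<in> carrier RB" and r: "r \<in> carrier A"
  show "adj_eps \<O> A B M t (rsmult RB x r) = rsmult ME (adj_eps \<O> A B M t x) r" unfolding adj_eps_def
    using x r eps1_comm[OF r] MD_lr[of x r eps1] left_module.lm_assoc[OF MD_lm, of x r eps1] eps1_closed by simp
qed simp

lemma assoc_right_inner:
  assumes z: "z \<in> carrier U"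
  shows "balanced B M D (tensor B M (DT U)) (\<lambda>(x, y). pure B M (DT U) x (pure A D U y z))"
  by (rule balancedI)
     (use z tensor_data.pure_add_l[OF MDU_data] tensor_data.pure_add_r[OF MDU_data] tensor_data.pure_bal[OF MDU_data]
        tensor_data.pure_add_l[OF DT_data[OF U]] in
      \<open>simp_all add: MDU_pure_closed DT_pure_closed[OF U] DT_smult_pure[OF U, symmetric]\<close>)

lemma assoc_right_bal: "balanced A ME U (tensor B M (DT U)) (\<lambda>(p, z).
       tensor_lift (tensor B M (DT U)) (\<lambda>(x, y). pure B M (DT U) x (pure A D U y z)) p)"
proof -
  let ?T = "tensor B M (DT U)"
  let ?I = "\<lambda>z. tensor_lift ?T (\<lambda>(x, y). pure B M (DT U) x (pure A D U y z))"
  have Ia: "?I z \<in> addmap MD ?T" if "z \<in> carrier U" for z by (rule MD_lift[OF MDU_ag assoc_right_inner[OF that]])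
  have Ip: "?I z (pure B M D x y) = pure B M (DT U) x (pure A D U y z)"
    if "z \<in> carrier U" "x \<in> carrier M" "y \<in> carrier D" for x y z
    using MD_lift_pure[OF MDU_ag assoc_right_inner[OF that(1)] that(2,3)] by simp
  show ?thesis
  proof (rule balancedI)
    fix p z z' assume p: "p \<in> carrier ME" and z: "z \<in> carrier U" "z' \<in> carrier U"
    have zz: "z \<oplus>\<^sub>U z' \<in> carrier U" using z lm_ag[OF U] by simp
    have "?I (z \<oplus>\<^sub>U z') p = ?I z p \<oplus>\<^bsub>?T\<^esub> ?I z' p" by (rule MD_ext[OF Ia[OF zz] addmap_sum2[OF MDU_ag Ia[OF z(1)] Ia[OF z(2)]]])
         (use p z zz tensor_data.pure_add_r[OF MDU_data] tensor_data.pure_add_r[OF DT_data[OF U]] in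
           \<open>simp_all add: Ip DT_pure_closed[OF U]\<close>)
    then show "(case (p, z \<oplus>\<^sub>U z') of (p, z) \<Rightarrow> ?I z p) = (case (p, z) of (p, z) \<Rightarrow> ?I z p) \<oplus>\<^bsub>?T\<^esub> (case (p, z') of (p, z) \<Rightarrow> ?I z p)"
      by simp
  next
    fix p r z assume p: "p \<in> carrier ME" and r: "r \<in> carrier A" and z: "z \<in> carrier U"
    have rz: "r \<odot>\<^sub>U z \<in> carrier U" by (rule lm_smult[OF U r z])
    have "?I z (rsmult ME p r) = ?I (r \<odot>\<^sub>U z) p" by (rule MD_ext[OF addmap_comp[OF MD_r_addmap[OF r] Ia[OF z]] Ia[OF rz]])
         (use p r z rz in "simp_all add: MD_r_pure Ip D_r DT_bal[OF U]")
    then show "(case (rsmult ME p r, z) of (p, z) \<Rightarrow> ?I z p) = (case (p, r \<odot>\<^sub>U z) of (p, z) \<Rightarrow> ?I z p)" by simp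
  qed (use addmap_closed[OF Ia] addmap_add[OF Ia] in auto)
qed

lemma assoc_right_eps:
  assumes d: "rdual k m \<beta>" and u: "u \<in> carrier U"
  shows "assoc_right B A M D U (pure A ME U eps1 u) =
    (\<Oplus>\<^bsub>tensor B M (DT U)\<^esub>j\<in>{..<k}. pure B M (DT U) (m j) (pure A D U (tB (\<beta> j)) u))"
proof -
  let ?T = "tensor B M (DT U)"
  let ?I = "\<lambda>z. tensor_lift ?T (\<lambda>(x, y). pure B M (DT U) x (pure A D U y z))"
  note d1 = rdualD[OF d]
  have e: "eps1 \<in> carrier ME" using eps1_closed by simp
  have "assoc_right B A M D U (pure A ME U eps1 u) = ?I u eps1" unfolding assoc_right_def Let_def
    using tensor_data.lift_pure[OF EU_data MDU_ag assoc_right_bal e u] by simp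
  also have "\<dots> = (\<Oplus>\<^bsub>?T\<^esub>j\<in>{..<k}. ?I u (pure B M D (m j) (tB (\<beta> j))))" unfolding eps1_eq[OF d]
    by (rule addmap_fs[OF MD_ag MDU_ag MD_lift[OF MDU_ag assoc_right_inner[OF u]]]) (use d1 in "simp add: MD_pure_closed")
  also have "\<dots> = (\<Oplus>\<^bsub>?T\<^esub>j\<in>{..<k}. pure B M (DT U) (m j) (pure A D U (tB (\<beta> j)) u))" by (rule fs_cong[OF MDU_ag])
       (use d1 u MD_lift_pure[OF MDU_ag assoc_right_inner[OF u]] in "auto simp: MDU_pure_closed DT_pure_closed[OF U]")
  finally show ?thesis .
qed

lemma assoc_left_inner:
  assumes x: "x \<in> carrier M"
  shows "balanced A D U (tensor A ME U) (\<lambda>(y, z). pure A ME U (pure B M D x y) z)"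
proof -
  note ed = EU_data
  have pc: "pure B M D x y \<in> carrier ME" if "y \<in> carrier D" for y using MD_pure_closed[OF x that] by simp
  have r: "pure B M D x (rsmult D y r) = rsmult ME (pure B M D x y) r" if "y \<in> carrier D" "r \<in> carrier A" for y r
    using MD_r_pure[OF that(2) x that(1)] by simp
  have a: "pure B M D x (y \<oplus>\<^sub>D y') = pure B M D x y \<oplus>\<^sub>ME pure B M D x y'" if "y \<in> carrier D" "y' \<in> carrier D" for y y'
    using tensor_data.pure_add_r[OF MD_data x that] by simp
  show ?thesis by (rule balancedI)
       (use pc r a tensor_data.pure_closed[OF ed, folded tensor_simps(1)] tensor_data.pure_add_l[OF ed] tensor_data.pure_add_r[OF ed]
         tensor_data.pure_bal[OF ed] in simp_all)
qed

lemma assoc_left_bal: "balanced B M (DT U) (tensor A ME U) (\<lambda>(x, q).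
       tensor_lift (tensor A ME U) (\<lambda>(y, z). pure A ME U (pure B M D x y) z) q)"
proof -
  let ?T = "tensor A ME U"
  note ag = tensor_data.T_ag[OF EU_data]
  let ?I = "\<lambda>x. tensor_lift ?T (\<lambda>(y, z). pure A ME U (pure B M D x y) z)"
  have Ia: "?I x \<in> addmap (DT U) ?T" if "x \<in> carrier M" for x
    by (rule tensor_data.lift_addmap[OF DT_data[OF U] ag assoc_left_inner[OF that]])
  have Ip: "?I x (pure A D U y z) = pure A ME U (pure B M D x y) z"
    if "x \<in> carrier M" "y \<in> carrier D" "z \<in> carrier U" for x y z
    using tensor_data.lift_pure[OF DT_data[OF U] ag assoc_left_inner[OF that(1)] that(2,3)] by simp
  show ?thesis
  proof (rule balancedI)
    fix x x' q assume x: "x \<in> carrier M" "x' \<in> carrier M" and q: "q \<in> carrier (DT U)"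
    have xx: "x \<oplus>\<^sub>M x' \<in> carrier M" using x by simp
    have "?I (x \<oplus>\<^sub>M x') q = ?I x q \<oplus>\<^bsub>?T\<^esub> ?I x' q"
    proof (rule DT_ext[OF U Ia[OF xx] addmap_sum2[OF ag Ia[OF x(1)] Ia[OF x(2)]] _ q])
      fix y z assume y: "y \<in> carrier D" and z: "z \<in> carrier U"
      show "?I (x \<oplus>\<^sub>M x') (pure A D U y z) = ?I x (pure A D U y z) \<oplus>\<^bsub>?T\<^esub> ?I x' (pure A D U y z)"
        unfolding Ip[OF xx y z] Ip[OF x(1) y z] Ip[OF x(2) y z] tensor_data.pure_add_l[OF MD_data x y]
        using tensor_data.pure_add_l[OF EU_data, of "pure B M D x y" "pure B M D x' y" z] MD_pure_closed x y z by simp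
    qed
    then show "(case (x \<oplus>\<^sub>M x', q) of (x, q) \<Rightarrow> ?I x q) = (case (x, q) of (x, q) \<Rightarrow> ?I x q) \<oplus>\<^bsub>?T\<^esub> (case (x', q) of (x, q) \<Rightarrow> ?I x q)"
      by simp
  next
    fix x r q assume x: "x \<in> carrier M" and r: "r \<in> carrier B" and q: "q \<in> carrier (DT U)"
    have xr: "rsmult M x r \<in> carrier M" using x r by simp
    have "?I (rsmult M x r) q = ?I x (r \<odot>\<^bsub>DT U\<^esub> q)"
      by (rule DT_ext[OF U Ia[OF xr] addmap_comp[OF ev_smult_addmap[OF U r] Ia[OF x]] _ q])
         (use x r xr in "simp_all add: DT_smult_pure[OF U] Ip D_l tensor_data.pure_bal[OF MD_data]")
    then show "(case (rsmult M x r, q) of (x, q) \<Rightarrow> ?I x q) = (case (x, r \<odot>\<^bsub>DT U\<^esub> q) of (x, q) \<Rightarrow> ?I x q)" by simp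
  qed (use addmap_closed[OF Ia] addmap_add[OF Ia] in auto)
qed

lemma eta_map: "tensor_maps A ME U RB U eta (\<lambda>u. u)"
proof (intro tensor_maps.intro tensor_maps_axioms.intro RU_data EU_data)
  show "eta \<in> addmap ME RB" using eta_addmap by (simp add: addmap_def)
  show "(\<lambda>u. u) \<in> addmap U U" by (simp add: addmap_def)
qed (simp_all add: eta_r)

lemma action_bal: "balanced A RB U U (\<lambda>(a, w). a \<odot>\<^sub>U w)" by (rule balancedI)
     (simp_all add: lm_smult[OF U] left_module.lm_r_distr[OF U] left_module.lm_l_distr[OF U] left_module.lm_assoc[OF U])

text \<open>The part of \<open>transfer_hom\<close> that follows \<beta>: reassociation, \<eta> and
  the action of A. On pure tensors it is just \<open>ev\<close>.\<close>

definition "contract x = tensor_lift U (\<lambda>(a, w). a \<odot>\<^sub>U w) (tensor_map A ME U RB U eta (\<lambda>w. w) (assoc_left B A M D U x))"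

lemma contract_addmap: "contract \<in> addmap (tensor B M (DT U)) U"
proof -
  note ag = tensor_data.T_ag[OF EU_data]
  have 1: "assoc_left B A M D U \<in> addmap (tensor B M (DT U)) (tensor A ME U)"
    unfolding assoc_left_def Let_def by (rule tensor_data.lift_addmap[OF MDU_data ag assoc_left_bal])
  have 2: "tensor_lift U (\<lambda>(a, w). a \<odot>\<^sub>U w) \<in> addmap (tensor A RB U) U"
    by (rule tensor_data.lift_addmap[OF RU_data lm_ag[OF U] action_bal])
  show ?thesis unfolding contract_def[abs_def]
    by (rule addmap_comp[OF addmap_comp[OF 1 tensor_maps.tmap_addmap[OF eta_map]] 2])
qed

lemma contract_pure:
  assumes x: "x \<in> carrier M" and q: "q \<in> carrier (DT U)"
  shows "contract (pure B M (DT U) x q) = ev U x q"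
proof -
  note ag = tensor_data.T_ag[OF EU_data]
  have am: "(\<lambda>q. contract (pure B M (DT U) x q)) \<in> addmap (DT U) U"
    by (rule addmap_comp[OF tensor_data.pure_addmap_r[OF MDU_data x] contract_addmap])
  show ?thesis
  proof (rule DT_ext[OF U am ev_addmap[OF U x] _ q])
    fix y z assume y: "y \<in> carrier D" and z: "z \<in> carrier U"
    have "assoc_left B A M D U (pure B M (DT U) x (pure A D U y z)) = pure A ME U (pure B M D x y) z"
      unfolding assoc_left_def Let_def using tensor_data.lift_pure[OF MDU_data ag assoc_left_bal x DT_pure_closed[OF U y z]]
        tensor_data.lift_pure[OF DT_data[OF U] ag assoc_left_inner[OF x] y z] by simp
    moreover have "tensor_map A ME U RB U eta (\<lambda>w. w) (pure A ME U (pure B M D x y) z) = pure A RB U (mhat y x) z"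
      using tensor_maps.tmap_pure[OF eta_map, of "pure B M D x y" z] MD_pure_closed[OF x y] z eta_pure[OF x y] by simp
    moreover have "tensor_lift U (\<lambda>(a, w). a \<odot>\<^sub>U w) (pure A RB U (mhat y x) z) = mhat y x \<odot>\<^sub>U z"
      using tensor_data.lift_pure[OF RU_data lm_ag[OF U] action_bal, of "mhat y x" z] x y z by simp
    ultimately show "contract (pure B M (DT U) x (pure A D U y z)) = ev U x (pure A D U y z)"
      by (simp add: contract_def ev_pure[OF U x y z])
  qed
qed

end

text \<open>The structural isomorphisms disappear: the unit produces the sum of the m_j \<otimes>
  ((t \<circ> \<delta>_j) \<otimes> u), \<beta> acts on the second factor, and
  \<open>contract\<close> evaluates. The formula is valid for every frame of M, and the properties
  of the transfer are derived from it.\<close>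

lemma transfer_hom_eq:
  assumes U: "A.is_mod U" and W: "A.is_mod W" and \<beta>: "\<beta> \<in> linmap B (DT U) (DT W)"
    and d: "rdual k m \<delta>" and u: "u \<in> carrier U"
  shows "transfer_hom \<O> A B M s t U W \<beta> u = (\<Oplus>\<^sub>W j\<in>{..<k}. ev W (m j) (\<beta> (pure A D U (tB (\<delta> j)) u)))"
proof -
  note d1 = rdualD[OF d]
  have pU: "pure A D U (tB (\<delta> j)) u \<in> carrier (DT U)" if "j \<in> {..<k}" for j by (rule DT_pure_closed[OF U d1(4)[OF that] u])
  note bc = linmap_closed[OF \<beta> pU]
  interpret BM: tensor_maps B M "DT U" M "DT W" "\<lambda>x. x" \<beta>
    by (intro tensor_maps.intro tensor_maps_axioms.intro MDU_data[OF U] MDU_data[OF W] linmap_addmap[OF \<beta>])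
       (use linmap_smult[OF \<beta>] in "auto simp: addmap_def")
  have "tensor_map A RB U ME U (adj_eps \<O> A B M t) (\<lambda>u. u) (pure A RB U \<one>\<^sub>A u) = pure A ME U eps1 u"
    using tensor_maps.tmap_pure[OF eps_map[OF U], of "\<one>\<^sub>A" u] u left_module.lm_one[OF MD_lm eps1_closed]
    by (simp add: adj_eps_def)
  then have "transfer_hom \<O> A B M s t U W \<beta> u = contract W (id_tensor B M (DT U) (DT W) \<beta>
      (\<Oplus>\<^bsub>tensor B M (DT U)\<^esub>j\<in>{..<k}. pure B M (DT U) (m j) (pure A D U (tB (\<delta> j)) u)))"
    using u by (simp add: transfer_hom_def Let_def contract_def[OF W] assoc_right_eps[OF U d u])
  also have "\<dots> = contract W (\<Oplus>\<^bsub>tensor B M (DT W)\<^esub>j\<in>{..<k}. id_tensor B M (DT U) (DT W) \<beta> (pure B M (DT U) (m j) (pure A D U (tB (\<delta> j)) u)))"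
    using addmap_fs[OF MDU_ag[OF U] MDU_ag[OF W] BM.tmap_addmap, of "{..<k}" "\<lambda>j. pure B M (DT U) (m j) (pure A D U (tB (\<delta> j)) u)"]
      MDU_pure_closed[OF U d1(1) pU] by simp
  also have "\<dots> = contract W (\<Oplus>\<^bsub>tensor B M (DT W)\<^esub>j\<in>{..<k}. pure B M (DT W) (m j) (\<beta> (pure A D U (tB (\<delta> j)) u)))"
    using BM.tmap_pure[OF d1(1) pU] MDU_pure_closed[OF W d1(1) bc]
    by (intro arg_cong[of _ _ "contract W"] fs_cong[OF MDU_ag[OF W]]) auto
  also have "\<dots> = (\<Oplus>\<^sub>W j\<in>{..<k}. contract W (pure B M (DT W) (m j) (\<beta> (pure A D U (tB (\<delta> j)) u))))"
    by (rule addmap_fs[OF MDU_ag[OF W] lm_ag[OF W] contract_addmap[OF W]]) (use MDU_pure_closed[OF W d1(1) bc] in auto)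
  also have "\<dots> = (\<Oplus>\<^sub>W j\<in>{..<k}. ev W (m j) (\<beta> (pure A D U (tB (\<delta> j)) u)))"
    by (rule fs_cong[OF lm_ag[OF W]]) (use contract_pure[OF W d1(1) bc] ev_closed[OF W d1(1) bc] in auto)
  finally show ?thesis .
qed

end

section \<open>Linearity, naturality and finite rank of the transfer\<close>

context sym_bimodule begin

abbreviation "TH U W \<beta> \<equiv> transfer_hom \<O> A B M s t U W \<beta>"

lemma TH_ext: "TH U W \<beta> \<in> extensional (carrier U)" by (simp add: transfer_hom_def Let_def)

text \<open>Additivity holds term by term. For the action of a in A only the whole sum is linear: a
  passes from u to the functional, and \<open>M_casimir\<close> carries it to the m_j, in which
  \<open>ev\<close> is A-linear.\<close>

lemma TH_lin_hom:
  assumes U: "A.is_mod U" and W: "A.is_mod W" and \<beta>: "\<beta> \<in> linmap B (DT U) (DT W)"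
  shows "TH U W \<beta> \<in> lin_hom A U W"
proof -
  obtain k m \<delta> where d: "rdual k m \<delta>" using rdual_exists by blast
  note d1 = rdualD[OF d]
  have bc: "\<beta> (pure A D U f u) \<in> carrier (DT W)" if "f \<in> carrier D" "u \<in> carrier U" for f u
    by (rule linmap_closed[OF \<beta> DT_pure_closed[OF U that]])
  have uU: "abelian_group U" by (rule lm_ag[OF U])
  have bal: "balanced B M D W (\<lambda>(m, f). ev W m (\<beta> (pure A D U f u)))" if u: "u \<in> carrier U" for u
  proof (rule balancedI)
    fix x f f' assume x: "x \<in> carrier M" and f: "f \<in> carrier D" "f' \<in> carrier D"
    have "(\<lambda>f. ev W x (\<beta> (pure A D U f u))) \<in> addmap D W"
      by (rule addmap_comp[OF addmap_comp[OF DT_pure_l[OF U u] linmap_addmap[OF \<beta>]] ev_addmap[OF W x]])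
    from addmap_add[OF this f] show "(case (x, f \<oplus>\<^sub>D f') of (m, f) \<Rightarrow> ev W m (\<beta> (pure A D U f u))) =
      (case (x, f) of (m, f) \<Rightarrow> ev W m (\<beta> (pure A D U f u))) \<oplus>\<^sub>W (case (x, f') of (m, f) \<Rightarrow> ev W m (\<beta> (pure A D U f u)))" by simp
  next
    fix x r f assume x: "x \<in> carrier M" and r: "r \<in> carrier B" and f: "f \<in> carrier D"
    show "(case (rsmult M x r, f) of (m, f) \<Rightarrow> ev W m (\<beta> (pure A D U f u))) = (case (x, r \<odot>\<^sub>D f) of (m, f) \<Rightarrow> ev W m (\<beta> (pure A D U f u)))"
      using x r f u linmap_smult[OF \<beta> r DT_pure_closed[OF U f u]] by (simp add: ev_r[OF W x r bc] DT_smult_pure[OF U])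
  qed (use u bc in "simp_all add: ev_closed[OF W] ev_add[OF W]")
  show ?thesis
  proof (rule lin_homI[OF TH_ext])
    fix x assume x: "x \<in> carrier U"
    show "TH U W \<beta> x \<in> carrier W" unfolding transfer_hom_eq[OF U W \<beta> d x]
      by (rule fs_closed[OF lm_ag[OF W]]) (rule ev_closed[OF W d1(1) bc[OF d1(4) x]])
    fix y assume y: "y \<in> carrier U"
    have xy: "x \<oplus>\<^sub>U y \<in> carrier U" using x y uU by simp
    show "TH U W \<beta> (x \<oplus>\<^sub>U y) = TH U W \<beta> x \<oplus>\<^sub>W TH U W \<beta> y"
      unfolding transfer_hom_eq[OF U W \<beta> d x] transfer_hom_eq[OF U W \<beta> d y] transfer_hom_eq[OF U W \<beta> d xy]
    proof (subst fs_add[OF lm_ag[OF W], symmetric])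
      show "(\<Oplus>\<^sub>W j\<in>{..<k}. ev W (m j) (\<beta> (pure A D U (tB (\<delta> j)) (x \<oplus>\<^sub>U y)))) =
       (\<Oplus>\<^sub>W j\<in>{..<k}. ev W (m j) (\<beta> (pure A D U (tB (\<delta> j)) x)) \<oplus>\<^sub>W ev W (m j) (\<beta> (pure A D U (tB (\<delta> j)) y)))"
      proof (rule fs_cong[OF lm_ag[OF W]])
        fix j assume j: "j \<in> {..<k}"
        have "(\<lambda>u. ev W (m j) (\<beta> (pure A D U (tB (\<delta> j)) u))) \<in> addmap U W"
          by (rule addmap_comp[OF addmap_comp[OF DT_pure_r[OF U d1(4)[OF j]] linmap_addmap[OF \<beta>]] ev_addmap[OF W d1(1)[OF j]]])
        from addmap_add[OF this x y]
        show "ev W (m j) (\<beta> (pure A D U (tB (\<delta> j)) (x \<oplus>\<^sub>U y))) =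
          ev W (m j) (\<beta> (pure A D U (tB (\<delta> j)) x)) \<oplus>\<^sub>W ev W (m j) (\<beta> (pure A D U (tB (\<delta> j)) y))" .
        show "ev W (m j) (\<beta> (pure A D U (tB (\<delta> j)) x)) \<oplus>\<^sub>W ev W (m j) (\<beta> (pure A D U (tB (\<delta> j)) y)) \<in> carrier W"
          using ev_closed[OF W d1(1)[OF j] bc[OF d1(4)[OF j]]] x y lm_ag[OF W] by simp
      qed
    qed (use ev_closed[OF W d1(1) bc[OF d1(4)]] x y in auto)
  next
    fix a x assume a: "a \<in> carrier A" and x: "x \<in> carrier U"
    have ax: "a \<odot>\<^sub>U x \<in> carrier U" by (rule lm_smult[OF U a x])
    have "TH U W \<beta> (a \<odot>\<^sub>U x) = (\<Oplus>\<^sub>W j\<in>{..<k}. ev W (m j) (\<beta> (pure A D U (rsmult D (tB (\<delta> j)) a) x)))"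
      unfolding transfer_hom_eq[OF U W \<beta> d ax] by (rule fs_cong[OF lm_ag[OF W]])
         (use d1 a x ev_closed[OF W d1(1) bc[OF D_r[OF a d1(4)] x]] in "simp_all add: DT_bal[OF U]")
    also have "\<dots> = (\<Oplus>\<^sub>W j\<in>{..<k}. ev W (a \<odot>\<^sub>M m j) (\<beta> (pure A D U (tB (\<delta> j)) x)))"
      using M_casimir[OF d d a lm_ag[OF W] bal[OF x]] by simp
    also have "\<dots> = (\<Oplus>\<^sub>W j\<in>{..<k}. a \<odot>\<^sub>W ev W (m j) (\<beta> (pure A D U (tB (\<delta> j)) x)))" by (rule fs_cong[OF lm_ag[OF W]])
         (use d1 a x ev_closed[OF W d1(1) bc[OF d1(4) x]] lm_smult[OF W] bc in "simp_all add: ev_smult[OF W]")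
    also have "\<dots> = a \<odot>\<^sub>W TH U W \<beta> x" unfolding transfer_hom_eq[OF U W \<beta> d x]
      by (rule lm_fs_r[OF W a, symmetric]) (rule ev_closed[OF W d1(1) bc[OF d1(4) x]])
    finally show "TH U W \<beta> (a \<odot>\<^sub>U x) = a \<odot>\<^sub>W TH U W \<beta> x" .
  qed
qed

text \<open>One statement for naturality on both sides: with an identity for f or g it gives
  compatibility with composition, with the maps of shift sequences it gives compatibility with
  shifts.\<close>

lemma TH_square:
  assumes U: "A.is_mod U" and V: "A.is_mod V" and W: "A.is_mod W" and Z: "A.is_mod Z"
    and f: "f \<in> linmap A U V" and g: "g \<in> linmap A W Z"
    and \<beta>: "\<beta> \<in> linmap B (DT U) (DT W)" and \<beta>': "\<beta>' \<in> linmap B (DT V) (DT Z)"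
    and sq: "\<And>q. q \<in> carrier (DT U) \<Longrightarrow> \<beta>' (idt U V f q) = idt W Z g (\<beta> q)" and u: "u \<in> carrier U"
  shows "TH V Z \<beta>' (f u) = g (TH U W \<beta> u)"
proof -
  obtain k m \<delta> where d: "rdual k m \<delta>" using rdual_exists by blast
  note d1 = rdualD[OF d]
  have pc: "pure A D U (tB (\<delta> j)) u \<in> carrier (DT U)" if "j \<in> {..<k}" for j by (rule DT_pure_closed[OF U d1(4)[OF that] u])
  have fu: "f u \<in> carrier V" by (rule linmap_closed[OF f u])
  have "TH V Z \<beta>' (f u) = (\<Oplus>\<^sub>Z j\<in>{..<k}. g (ev W (m j) (\<beta> (pure A D U (tB (\<delta> j)) u))))"
    unfolding transfer_hom_eq[OF V Z \<beta>' d fu]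
  proof (rule fs_cong[OF lm_ag[OF Z]])
    fix j assume j: "j \<in> {..<k}"
    have "\<beta>' (pure A D V (tB (\<delta> j)) (f u)) = idt W Z g (\<beta> (pure A D U (tB (\<delta> j)) u))"
      using sq[OF pc[OF j]] idt_pure[OF U V f d1(4)[OF j] u] by simp
    then show "ev Z (m j) (\<beta>' (pure A D V (tB (\<delta> j)) (f u))) = g (ev W (m j) (\<beta> (pure A D U (tB (\<delta> j)) u)))"
      using ev_idt[OF W Z g d1(1)[OF j] linmap_closed[OF \<beta> pc[OF j]]] by simp
    show "g (ev W (m j) (\<beta> (pure A D U (tB (\<delta> j)) u))) \<in> carrier Z"
      by (rule linmap_closed[OF g ev_closed[OF W d1(1)[OF j] linmap_closed[OF \<beta> pc[OF j]]]])
  qed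
  also have "\<dots> = g (\<Oplus>\<^sub>W j\<in>{..<k}. ev W (m j) (\<beta> (pure A D U (tB (\<delta> j)) u)))"
    by (rule addmap_fs[OF lm_ag[OF W] lm_ag[OF Z] linmap_addmap[OF g], symmetric])
       (rule ev_closed[OF W d1(1) linmap_closed[OF \<beta> pc]])
  finally show ?thesis unfolding transfer_hom_eq[OF U W \<beta> d u] .
qed

text \<open>The functionals of a frame of M over A separate points, and s separates the points of
  A.\<close>

lemma M_eqI:
  assumes "x \<in> carrier M" "y \<in> carrier M" "\<And>f. f \<in> carrier D \<Longrightarrow> f x = f y"
  shows "x = y"
proof -
  obtain n :: nat and p \<phi> where fr: "frame A M {..<n} p \<phi>" by (rule M_frame)
  have "\<phi> i x = \<phi> i y" if i: "i \<in> {..<n}" for i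
  proof (rule A.s_inj)
    note c = frame_coeff[OF fr i assms(1)] frame_coeff[OF fr i assms(2)]
    show "\<phi> i x \<in> carrier A" "\<phi> i y \<in> carrier A" by (rule c)+
    fix a assume a: "a \<in> carrier A"
    have "rsmult D (sD (\<phi> i)) a x = rsmult D (sD (\<phi> i)) a y"
      by (rule assms(3)[OF D_r[OF a sD_closed[OF frame_fun[OF fr i]]]])
    then show "s (a \<otimes>\<^sub>A \<phi> i x) = s (a \<otimes>\<^sub>A \<phi> i y)"
      using assms(1,2) a linmap_smult[OF frame_fun[OF fr i] a] by (simp add: D_app sD_def)
  qed
  then have "(\<Oplus>\<^sub>M i\<in>{..<n}. \<phi> i x \<odot>\<^sub>M p i) = (\<Oplus>\<^sub>M i\<in>{..<n}. \<phi> i y \<odot>\<^sub>M p i)"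
    by (intro fs_cong[OF agM]) (use frame_coeff[OF fr _ assms(2)] frame_elt[OF fr] in auto)
  then show ?thesis using frame_sum[OF fr assms(1)] frame_sum[OF fr assms(2)] by simp
qed

text \<open>Under the adjunction, the functional g on D \<otimes> U corresponds to an A-linear map
  \<kappa> from U to M. It is determined by f(\<kappa> u) = t(g(f \<otimes> u)) because D separates
  points, and its linearity is checked in the same way. The transfer of q \<mapsto> g(q) r then
  passes through M.\<close>

lemma TH_rank_one:
  fixes U :: "('a, 'u) module" and W :: "('a, 'w) module"
  assumes U: "left_module A U" and W: "left_module A W" and g: "g \<in> linmap B (DT U) (regular B)"
  obtains \<kappa> where "\<kappa> \<in> linmap A U M" "\<And>f u. f \<in> carrier D \<Longrightarrow> u \<in> carrier U \<Longrightarrow> f (\<kappa> u) = t (g (pure A D U f u))"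
    "\<And>r u. r \<in> carrier (DT W) \<Longrightarrow> u \<in> carrier U \<Longrightarrow> TH U W (\<lambda>q. g q \<odot>\<^bsub>DT W\<^esub> r) u = ev W (\<kappa> u) r"
proof -
  obtain k m \<delta> where d: "rdual k m \<delta>" using rdual_exists by blast
  note d1 = rdualD[OF d]
  have gc: "g (pure A D U f u) \<in> carrier B" if "f \<in> carrier D" "u \<in> carrier U" for f u
    using linmap_closed[OF g DT_pure_closed[OF U that]] by simp
  \<comment> \<open>What \<open>transfer_hom_eq\<close> leaves in front of r when
    \<open>ev_r\<close> moves the scalars from r to the m_j.\<close>
  define \<kappa> where "\<kappa> u = (\<Oplus>\<^sub>M j\<in>{..<k}. rsmult M (m j) (g (pure A D U (tB (\<delta> j)) u)))" for u
  have mc: "rsmult M (m j) (g (pure A D U (tB (\<delta> j)) u)) \<in> carrier M" if "j \<in> {..<k}" "u \<in> carrier U" for j u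
    using d1(1)[OF that(1)] gc[OF d1(4)[OF that(1)] that(2)] by simp
  have \<kappa>c: "\<kappa> u \<in> carrier M" if "u \<in> carrier U" for u unfolding \<kappa>_def by (rule fs_closed[OF agM mc[OF _ that]])
  have gl: "(\<lambda>f. g (pure A D U f u)) \<in> addmap D B" if u: "u \<in> carrier U" for u
    using addmap_comp[OF DT_pure_l[OF U u] linmap_addmap[OF g]] by (simp add: addmap_def)
  have \<kappa>f: "f (\<kappa> u) = t (g (pure A D U f u))" if f: "f \<in> carrier D" and u: "u \<in> carrier U" for f u
  proof -
    note c = chk_spec[OF f d1(1)]
    have "f (\<kappa> u) = (\<Oplus>\<^sub>\<O> j\<in>{..<k}. f (rsmult M (m j) (g (pure A D U (tB (\<delta> j)) u))))"
      unfolding \<kappa>_def by (rule addmap_fs[OF agM A.agO D_addmap[OF f] mc[OF _ u]])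
    also have "\<dots> = (\<Oplus>\<^sub>\<O> j\<in>{..<k}. t (g (pure A D U (chk f (m j) \<odot>\<^sub>D tB (\<delta> j)) u)))"
    proof (rule fs_cong[OF A.agO])
      fix j assume j: "j \<in> {..<k}"
      note tj = d1(4)[OF j]
      show "f (rsmult M (m j) (g (pure A D U (tB (\<delta> j)) u))) = t (g (pure A D U (chk f (m j) \<odot>\<^sub>D tB (\<delta> j)) u))"
        using c[OF j] gc[OF tj u] linmap_smult[OF g c(1)[OF j] DT_pure_closed[OF U tj u]]
          DT_smult_pure[OF U c(1)[OF j] tj u] B.s_sym[OF c(1)[OF j] gc[OF tj u]] by simp
      show "t (g (pure A D U (chk f (m j) \<odot>\<^sub>D tB (\<delta> j)) u)) \<in> carrier \<O>"
        by (rule B.s_closed[OF gc[OF D_l[OF c(1)[OF j] tj] u]])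
    qed
    also have "\<dots> = t (g (pure A D U (\<Oplus>\<^sub>D j\<in>{..<k}. chk f (m j) \<odot>\<^sub>D tB (\<delta> j)) u))"
      by (rule addmap_fs[OF D_ag A.agO addmap_comp[OF gl[OF u] B.s_addmap] D_l[OF c(1) d1(4)], symmetric])
    finally show ?thesis using D_rdual_expand[OF d f] by simp
  qed
  have "\<kappa> \<in> linmap A U M"
  proof (rule linmapI[OF \<kappa>c])
    fix x y assume x: "x \<in> carrier U" and y: "y \<in> carrier U"
    show "\<kappa> (x \<oplus>\<^sub>U y) = \<kappa> x \<oplus>\<^sub>M \<kappa> y"
    proof (rule M_eqI)
      show "f (\<kappa> (x \<oplus>\<^sub>U y)) = f (\<kappa> x \<oplus>\<^sub>M \<kappa> y)" if f: "f \<in> carrier D" for f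
        using addmap_add[OF DT_pure_r[OF U f] x y] linmap_add[OF g DT_pure_closed[OF U f x] DT_pure_closed[OF U f y]]
          gc[OF f] \<kappa>f[OF f] D_add[OF f \<kappa>c[OF x] \<kappa>c[OF y]] x y lm_ag[OF U] by (simp add: B.s_add)
    qed (use \<kappa>c x y lm_ag[OF U] in simp_all)
  next
    fix a x assume a: "a \<in> carrier A" and x: "x \<in> carrier U"
    show "\<kappa> (a \<odot>\<^sub>U x) = a \<odot>\<^sub>M \<kappa> x"
    proof (rule M_eqI)
      show "f (\<kappa> (a \<odot>\<^sub>U x)) = f (a \<odot>\<^sub>M \<kappa> x)" if f: "f \<in> carrier D" for f
        using \<kappa>f[OF f lm_smult[OF U a x]] \<kappa>f[OF D_r[OF a f] x] DT_bal[OF U f a x] D_app(3)[OF \<kappa>c[OF x], of f a] by simp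
    qed (use \<kappa>c x a lm_smult[OF U a x] in simp_all)
  qed
  moreover have "TH U W (\<lambda>q. g q \<odot>\<^bsub>DT W\<^esub> r) u = ev W (\<kappa> u) r" if r: "r \<in> carrier (DT W)" and u: "u \<in> carrier U" for r u
  proof -
    have "TH U W (\<lambda>q. g q \<odot>\<^bsub>DT W\<^esub> r) u = (\<Oplus>\<^sub>W j\<in>{..<k}. ev W (rsmult M (m j) (g (pure A D U (tB (\<delta> j)) u))) r)"
      unfolding transfer_hom_eq[OF U W linmap_smult_elt[OF DT_lm[OF U] DT_lm[OF W] g r] d u]
      by (rule fs_cong[OF lm_ag[OF W]]) (use ev_r[OF W d1(1) gc[OF d1(4) u] r] ev_closed[OF W mc[OF _ u] r] in auto)
    also have "\<dots> = ev W (\<kappa> u) r"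
      unfolding \<kappa>_def by (rule addmap_fs[OF agM lm_ag[OF W] ev_addmap_m[OF W r] mc[OF _ u], symmetric])
    finally show ?thesis .
  qed
  ultimately show ?thesis using that \<kappa>f by blast
qed

lemma TH_plus:
  assumes U: "A.is_mod U" and W: "A.is_mod W" and \<beta>: "\<beta> \<in> linmap B (DT U) (DT W)" and \<beta>': "\<beta>' \<in> linmap B (DT U) (DT W)"
    and \<beta>'': "\<beta>'' \<in> linmap B (DT U) (DT W)" and e: "\<And>q. q \<in> carrier (DT U) \<Longrightarrow> \<beta>'' q = \<beta> q \<oplus>\<^bsub>DT W\<^esub> \<beta>' q" and u: "u \<in> carrier U"
  shows "TH U W \<beta>'' u = TH U W \<beta> u \<oplus>\<^sub>W TH U W \<beta>' u"
proof -
  obtain k m \<delta> where d: "rdual k m \<delta>" using rdual_exists by blast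
  note d1 = rdualD[OF d]
  have pc: "pure A D U (tB (\<delta> j)) u \<in> carrier (DT U)" if "j \<in> {..<k}" for j by (rule DT_pure_closed[OF U d1(4)[OF that] u])
  have c: "ev W (m j) (h (pure A D U (tB (\<delta> j)) u)) \<in> carrier W" if "h \<in> linmap B (DT U) (DT W)" "j \<in> {..<k}" for j h
    by (rule ev_closed[OF W d1(1)[OF that(2)] linmap_closed[OF that(1) pc[OF that(2)]]])
  show ?thesis unfolding transfer_hom_eq[OF U W \<beta> d u] transfer_hom_eq[OF U W \<beta>' d u] transfer_hom_eq[OF U W \<beta>'' d u]
  proof (subst fs_add[OF lm_ag[OF W], symmetric])
    show "(\<Oplus>\<^sub>W j\<in>{..<k}. ev W (m j) (\<beta>'' (pure A D U (tB (\<delta> j)) u))) =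
      (\<Oplus>\<^sub>W i\<in>{..<k}. ev W (m i) (\<beta> (pure A D U (tB (\<delta> i)) u)) \<oplus>\<^sub>W ev W (m i) (\<beta>' (pure A D U (tB (\<delta> i)) u)))"
      by (rule fs_cong[OF lm_ag[OF W]])
         (use e[OF pc] addmap_add[OF ev_addmap[OF W d1(1)] linmap_closed[OF \<beta> pc] linmap_closed[OF \<beta>' pc]]
            c[OF \<beta>] c[OF \<beta>'] lm_ag[OF W] in auto)
  qed (use c[OF \<beta>] c[OF \<beta>'] in auto)
qed

lemma TH_zero:
  assumes U: "A.is_mod U" and W: "A.is_mod W"
  shows "TH U W (\<lambda>q\<in>carrier (DT U). \<zero>\<^bsub>DT W\<^esub>) = (\<lambda>u\<in>carrier U. \<zero>\<^sub>W)"
proof (rule extensionalityI[OF TH_ext])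
  let ?z = "\<lambda>q\<in>carrier (DT U). \<zero>\<^bsub>DT W\<^esub>"
  have z: "?z \<in> linmap B (DT U) (DT W)" by (rule lin_hom_linmap[OF lin_hom_zero[OF DT_lm[OF U] DT_lm[OF W]]])
  fix u assume u: "u \<in> carrier U"
  \<comment> \<open>The zero map is the sum of two copies of itself.\<close>
  have "TH U W ?z u = TH U W ?z u \<oplus>\<^sub>W TH U W ?z u" by (rule TH_plus[OF U W z z z _ u]) (use DT_ag[OF W] in simp)
  then have "TH U W ?z u = \<zero>\<^sub>W"
    using lin_hom_closed[OF TH_lin_hom[OF U W z] u] lm_ag[OF W] ag_add_diff_cancel[of W "TH U W ?z u" "TH U W ?z u"] by simp
  then show "TH U W ?z u = (\<lambda>u\<in>carrier U. \<zero>\<^sub>W) u" using u by simp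
qed simp

lemma TH_step:
  assumes U: "A.is_mod U" and W: "A.is_mod W" and \<beta>: "fin_rank B (DT U) (DT W) \<beta>"
    and g: "g \<in> linmap B (DT U) (regular B)" and r: "r \<in> carrier (DT W)"
  shows "TH U W (\<lambda>q\<in>carrier (DT U). \<beta> q \<oplus>\<^bsub>DT W\<^esub> g q \<odot>\<^bsub>DT W\<^esub> r) =
    (\<lambda>u\<in>carrier U. TH U W \<beta> u \<oplus>\<^sub>W TH U W (\<lambda>q. g q \<odot>\<^bsub>DT W\<^esub> r) u)"
proof (rule extensionalityI[OF TH_ext])
  note T = DT_lm[OF U] DT_lm[OF W]
  note b = lin_hom_linmap[OF fin_rank_lin_hom[OF T \<beta>]] and n = lin_hom_linmap[OF fin_rank_lin_hom[OF T fin_rank.step[OF \<beta> g r]]]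
  fix u assume "u \<in> carrier U"
  then show "TH U W (\<lambda>q\<in>carrier (DT U). \<beta> q \<oplus>\<^bsub>DT W\<^esub> g q \<odot>\<^bsub>DT W\<^esub> r) u =
    (\<lambda>u\<in>carrier U. TH U W \<beta> u \<oplus>\<^sub>W TH U W (\<lambda>q. g q \<odot>\<^bsub>DT W\<^esub> r) u) u" using TH_plus[OF U W b linmap_smult_elt[OF T g r] n] by simp
qed simp

text \<open>By \<open>TH_rank_one\<close> a single term is transferred to u \<mapsto>
  \<open>ev W (\<kappa> u) r\<close>. For r = f \<otimes> w this is u \<mapsto> mhat f (\<kappa> u)
  w, a map of the required form, and a general r is a sum of such tensors.\<close>

lemma TH_fin_rank:
  assumes U: "A.is_mod U" and W: "A.is_mod W" and fr: "fin_rank B (DT U) (DT W) \<beta>"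
  shows "fin_rank A U W (TH U W \<beta>)"
  using fr
proof induction
  case zero
  show ?case unfolding TH_zero[OF U W] by (rule fin_rank.zero)
next
  case (step \<beta> g r)
  obtain \<kappa> where \<kappa>: "\<kappa> \<in> linmap A U M"
    "\<And>r u. r \<in> carrier (DT W) \<Longrightarrow> u \<in> carrier U \<Longrightarrow> TH U W (\<lambda>q. g q \<odot>\<^bsub>DT W\<^esub> r) u = ev W (\<kappa> u) r"
    by (rule TH_rank_one[OF U W step.hyps(2)]) blast
  note \<kappa>c = linmap_closed[OF \<kappa>(1)]
  have "fin_rank A U W (\<lambda>u\<in>carrier U. ev W (\<kappa> u) r)" using step.hyps(3)[unfolded tensor_simps(1)]
  proof (induction r rule: tensor_data.tensor_induct[OF DT_data[OF W], consumes 1])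
    case (1 f w)
    have h: "(\<lambda>u. mhat f (\<kappa> u)) \<in> linmap A U (regular A)"
      by (rule linmap_comp[OF \<kappa>(1) A.hat_linmap[OF lmM D_linmap[OF 1(1)]]])
    have eq: "(\<lambda>u\<in>carrier U. ev W (\<kappa> u) (pure A D W f w)) = (\<lambda>u\<in>carrier U. (\<lambda>u\<in>carrier U. \<zero>\<^sub>W) u \<oplus>\<^sub>W mhat f (\<kappa> u) \<odot>\<^sub>W w)"
      by (rule restrict_ext) (use \<kappa>c 1 lm_ag[OF W] lm_smult[OF W] in "simp add: ev_pure[OF W]")
    show ?case unfolding eq by (rule fin_rank.step[OF fin_rank.zero h 1(2)])
  next
    case (2 a b)
    have eq: "(\<lambda>u\<in>carrier U. ev W (\<kappa> u) (a \<oplus>\<^bsub>tensor_ab A D W\<^esub> b)) =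
      (\<lambda>u\<in>carrier U. (\<lambda>u\<in>carrier U. ev W (\<kappa> u) a) u \<oplus>\<^sub>W (\<lambda>u\<in>carrier U. ev W (\<kappa> u) b) u)" by (rule restrict_ext)
         (use addmap_add[OF ev_addmap[OF W \<kappa>c]] 2(1,2) in "simp add: tensor_simps")
    show ?case unfolding eq by (rule fin_rank_add[OF U W 2(3,4)])
  qed
  from fin_rank_add[OF U W step.IH this]
  have "fin_rank A U W (\<lambda>u\<in>carrier U. TH U W \<beta> u \<oplus>\<^sub>W (\<lambda>u\<in>carrier U. ev W (\<kappa> u) r) u)" .
  moreover have "TH U W (\<lambda>q\<in>carrier (DT U). \<beta> q \<oplus>\<^bsub>DT W\<^esub> g q \<odot>\<^bsub>DT W\<^esub> r) =
    (\<lambda>u\<in>carrier U. TH U W \<beta> u \<oplus>\<^sub>W (\<lambda>u\<in>carrier U. ev W (\<kappa> u) r) u)"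
    unfolding TH_step[OF U W step.hyps] by (rule restrict_ext) (simp add: \<kappa>(2)[OF step.hyps(3)])
  ultimately show ?case by metis
qed

text \<open>The transfer is additive and keeps finite rank, so it descends to stable
  classes.\<close>

lemma TH_stable:
  assumes U: "A.is_mod U" and W: "A.is_mod W" and st: "(\<beta>, \<beta>') \<in> stable_rel B (DT U) (DT W)"
  shows "(TH U W \<beta>, TH U W \<beta>') \<in> stable_rel A U W"
proof -
  note b = stable_hom(1)[OF st] and b' = stable_hom(2)[OF st]
  let ?d = "\<lambda>q\<in>carrier (DT U). \<beta> q \<ominus>\<^bsub>DT W\<^esub> \<beta>' q"
  have dl: "?d \<in> lin_hom B (DT U) (DT W)" by (rule lin_hom_minus[OF b b' DT_lm[OF U] DT_lm[OF W]])
  have fr: "fin_rank B (DT U) (DT W) ?d" using st unfolding stable_rel_iff[OF DT_lm[OF U] DT_lm[OF W]] by blast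
  note th = TH_lin_hom[OF U W lin_hom_linmap[OF b]] TH_lin_hom[OF U W lin_hom_linmap[OF b']] TH_lin_hom[OF U W lin_hom_linmap[OF dl]]
  have "TH U W ?d = (\<lambda>u\<in>carrier U. TH U W \<beta> u \<ominus>\<^sub>W TH U W \<beta>' u)"
  proof (rule extensionalityI[OF TH_ext])
    fix u assume u: "u \<in> carrier U"
    have "TH U W \<beta> u = TH U W ?d u \<oplus>\<^sub>W TH U W \<beta>' u"
      by (rule TH_plus[OF U W lin_hom_linmap[OF dl] lin_hom_linmap[OF b'] lin_hom_linmap[OF b] _ u])
         (use lin_hom_closed[OF b] lin_hom_closed[OF b'] DT_ag[OF W] in simp)
    then show "TH U W ?d u = (\<lambda>u\<in>carrier U. TH U W \<beta> u \<ominus>\<^sub>W TH U W \<beta>' u) u"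
      using lin_hom_closed[OF th(3) u] lin_hom_closed[OF th(2) u] lm_ag[OF W] u by simp
  qed simp
  then show ?thesis using TH_fin_rank[OF U W fr] th unfolding stable_rel_iff[OF U W] by simp
qed

lemma DT_scalar:
  assumes W: "A.is_mod W" and c: "c \<in> carrier \<O>" and f: "f \<in> carrier D" and w: "w \<in> carrier W"
  shows "(c \<odot>\<^sub>B \<one>\<^sub>B) \<odot>\<^bsub>DT W\<^esub> pure A D W f w = pure A D W f ((c \<odot>\<^sub>A \<one>\<^sub>A) \<odot>\<^sub>W w)"
proof -
  have "(c \<odot>\<^sub>B \<one>\<^sub>B) \<odot>\<^sub>D f = rsmult D f (c \<odot>\<^sub>A \<one>\<^sub>A)" by (rule D_eqI) (use c f in "simp_all add: D_l D_r D_app M_scalar")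
  then show ?thesis using c f w by (simp add: DT_smult_pure[OF W] DT_bal[OF W])
qed

end

section \<open>Tensoring sequences of shifts\<close>

context sym_bimodule begin

text \<open>The functional on D \<otimes> P built from a functional \<phi> on P and an element m of
  M: absorb x into D by \<phi>, then take the coefficient at m. These are the coordinate functionals
  of the frame in \<open>DT_proj\<close>.\<close>

lemma chk_linmap:
  assumes P: "A.is_mod P" and \<phi>: "\<phi> \<in> linmap A P (regular A)" and m: "m \<in> carrier M"
  shows "tensor_lift B (\<lambda>(f, x). chk (rsmult D f (\<phi> x)) m) \<in> linmap B (DT P) (regular B)"
    and "\<And>f x. f \<in> carrier D \<Longrightarrow> x \<in> carrier P \<Longrightarrow>
      tensor_lift B (\<lambda>(f, x). chk (rsmult D f (\<phi> x)) m) (pure A D P f x) = chk (rsmult D f (\<phi> x)) m"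
proof -
  have \<phi>c: "\<phi> x \<in> carrier A" if "x \<in> carrier P" for x using linmap_closed[OF \<phi> that] by simp
  have radd: "rsmult D f (a \<oplus>\<^sub>A b) = rsmult D f a \<oplus>\<^sub>D rsmult D f b" if "f \<in> carrier D" "a \<in> carrier A" "b \<in> carrier A" for f a b
    by (rule D_eqI) (use that in "simp_all add: D_r D_plus D_app left_module.lm_l_distr[OF lmM] D_add")
  have rmult: "rsmult D f (a \<otimes>\<^sub>A b) = rsmult D (rsmult D f a) b" if "f \<in> carrier D" "a \<in> carrier A" "b \<in> carrier A" for f a b
    by (rule D_eqI) (use that in "simp_all add: D_r D_app left_module.lm_assoc[OF lmM]")
  have bal: "balanced A D P B (\<lambda>(f, x). chk (rsmult D f (\<phi> x)) m)" by (rule balancedI)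
       (use m \<phi>c linmap_add[OF \<phi>] linmap_smult[OF \<phi>] addmap_add[OF D_r_addmap] in
         \<open>simp_all add: chk_spec(1) D_r radd rmult chk_plus\<close>)
  note am = tensor_data.lift_addmap[OF DT_data[OF P] B.agA bal] and lp = tensor_data.lift_pure[OF DT_data[OF P] B.agA bal]
  show pu: "tensor_lift B (\<lambda>(f, x). chk (rsmult D f (\<phi> x)) m) (pure A D P f x) = chk (rsmult D f (\<phi> x)) m"
    if "f \<in> carrier D" "x \<in> carrier P" for f x using lp[OF that] by simp
  show "tensor_lift B (\<lambda>(f, x). chk (rsmult D f (\<phi> x)) m) \<in> linmap B (DT P) (regular B)"
  proof (rule linmapI)
    fix b q assume b: "b \<in> carrier B" and q: "q \<in> carrier (DT P)"
    have "tensor_lift B (\<lambda>(f, x). chk (rsmult D f (\<phi> x)) m) (b \<odot>\<^bsub>DT P\<^esub> q) =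
      b \<otimes>\<^sub>B tensor_lift B (\<lambda>(f, x). chk (rsmult D f (\<phi> x)) m) q"
    proof (rule DT_ext[OF P addmap_comp[OF ev_smult_addmap[OF P b] am] addmap_comp[OF am B.mult_addmap_r[OF b]] _ q])
      fix f x assume f: "f \<in> carrier D" and x: "x \<in> carrier P"
      show "tensor_lift B (\<lambda>(f, x). chk (rsmult D f (\<phi> x)) m) (b \<odot>\<^bsub>DT P\<^esub> pure A D P f x) =
        b \<otimes>\<^sub>B tensor_lift B (\<lambda>(f, x). chk (rsmult D f (\<phi> x)) m) (pure A D P f x)"
        using f x b m \<phi>c[OF x] by (simp add: DT_smult_pure[OF P] pu D_l D_lr chk_smult D_r)
    qed
    then show "tensor_lift B (\<lambda>(f, x). chk (rsmult D f (\<phi> x)) m) (b \<odot>\<^bsub>DT P\<^esub> q) =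
      b \<odot>\<^bsub>regular B\<^esub> tensor_lift B (\<lambda>(f, x). chk (rsmult D f (\<phi> x)) m) q" by simp
  qed (use addmap_closed[OF am] addmap_add[OF am] in simp_all)
qed

text \<open>A frame of D over B and one of P over A multiply to a frame of the tensor product,
  indexed by pairs.\<close>

lemma DT_proj:
  assumes P: "A.is_mod P" and pr: "fg_projective A P"
  shows "fg_projective B (DT P)"
proof -
  obtain n :: nat and p \<phi> where fr: "frame A P {..<n} p \<phi>" by (rule fg_projective_frame[OF P pr])
  obtain k m \<delta> where d: "rdual k m \<delta>" using rdual_exists by blast
  note d1 = rdualD[OF d] and pc = frame_elt[OF fr] and \<phi>c = frame_coeff[OF fr]
  let ?\<psi> = "\<lambda>(i, j). tensor_lift B (\<lambda>(f, x). chk (rsmult D f (\<phi> i x)) (m j))"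
  let ?p = "\<lambda>(i, j). pure A D P (tB (\<delta> j)) (p i)"
  note cl = chk_linmap[OF P frame_fun[OF fr] d1(1)]
  note agT = DT_ag[OF P]
  have cc: "chk (rsmult D f (\<phi> i x)) (m j) \<in> carrier B" if "f \<in> carrier D" "x \<in> carrier P" "i \<in> {..<n}" "j \<in> {..<k}" for f x i j
    by (rule chk_spec(1)[OF D_r[OF \<phi>c[OF that(3,2)] that(1)] d1(1)[OF that(4)]])
  have "frame B (DT P) ({..<n} \<times> {..<k}) ?p ?\<psi>" unfolding frame_def
  proof (intro conjI ballI)
    fix q assume q: "q \<in> carrier (DT P)"
    have am: "(\<lambda>q. \<Oplus>\<^bsub>DT P\<^esub>x\<in>{..<n} \<times> {..<k}. ?\<psi> x q \<odot>\<^bsub>DT P\<^esub> ?p x) \<in> addmap (DT P) (DT P)"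
    proof (rule addmap_sum[OF agT agT])
      fix x assume "x \<in> {..<n} \<times> {..<k}"
      then show "(\<lambda>q. ?\<psi> x q \<odot>\<^bsub>DT P\<^esub> ?p x) \<in> addmap (DT P) (DT P)"
        using linmap_addmap[OF linmap_smult_elt[OF DT_lm[OF P] DT_lm[OF P] cl(1)]] DT_pure_closed[OF P d1(4) pc] by auto
    qed
    show "(\<Oplus>\<^bsub>DT P\<^esub>x\<in>{..<n} \<times> {..<k}. ?\<psi> x q \<odot>\<^bsub>DT P\<^esub> ?p x) = q"
    proof (rule DT_ext[OF P am _ _ q, of "\<lambda>q. q"])
      show "(\<lambda>q. q) \<in> addmap (DT P) (DT P)" by (rule addmapI) simp_all
      fix f x assume f: "f \<in> carrier D" and x: "x \<in> carrier P"
      have s: "chk (rsmult D f (\<phi> i x)) (m j) \<odot>\<^sub>D tB (\<delta> j) \<in> carrier D" if "i \<in> {..<n}" "j \<in> {..<k}" for i j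
        by (rule D_l[OF cc[OF f x that] d1(4)[OF that(2)]])
      have "(\<Oplus>\<^bsub>DT P\<^esub>y\<in>{..<n} \<times> {..<k}. ?\<psi> y (pure A D P f x) \<odot>\<^bsub>DT P\<^esub> ?p y) =
        (\<Oplus>\<^bsub>DT P\<^esub>i\<in>{..<n}. \<Oplus>\<^bsub>DT P\<^esub>j\<in>{..<k}. pure A D P (chk (rsmult D f (\<phi> i x)) (m j) \<odot>\<^sub>D tB (\<delta> j)) (p i))"
        by (subst fs_Times[OF agT]) (use cl(2)[OF _ _ f x] cc[OF f x] d1(4) pc s in
             \<open>auto intro!: fs_cong[OF agT] fs_closed[OF agT] DT_pure_closed[OF P] lm_smult[OF DT_lm[OF P]] simp: DT_smult_pure[OF P]\<close>)
      also have "\<dots> = (\<Oplus>\<^bsub>DT P\<^esub>i\<in>{..<n}. pure A D P f (\<phi> i x \<odot>\<^sub>P p i))"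
      proof (rule fs_cong[OF agT])
        fix i assume i: "i \<in> {..<n}"
        have "(\<Oplus>\<^bsub>DT P\<^esub>j\<in>{..<k}. pure A D P (chk (rsmult D f (\<phi> i x)) (m j) \<odot>\<^sub>D tB (\<delta> j)) (p i)) =
           pure A D P (\<Oplus>\<^sub>D j\<in>{..<k}. chk (rsmult D f (\<phi> i x)) (m j) \<odot>\<^sub>D tB (\<delta> j)) (p i)"
          by (rule addmap_fs[OF D_ag agT DT_pure_l[OF P pc[OF i]] s[OF i], symmetric])
        also have "\<dots> = pure A D P (rsmult D f (\<phi> i x)) (p i)" using D_rdual_expand[OF d D_r[OF \<phi>c[OF i x] f]] by simp
        also have "\<dots> = pure A D P f (\<phi> i x \<odot>\<^sub>P p i)" by (rule DT_bal[OF P f \<phi>c[OF i x] pc[OF i]])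
        finally show "(\<Oplus>\<^bsub>DT P\<^esub>j\<in>{..<k}. pure A D P (chk (rsmult D f (\<phi> i x)) (m j) \<odot>\<^sub>D tB (\<delta> j)) (p i)) =
          pure A D P f (\<phi> i x \<odot>\<^sub>P p i)" .
        show "pure A D P f (\<phi> i x \<odot>\<^sub>P p i) \<in> carrier (DT P)"
          by (rule DT_pure_closed[OF P f lm_smult[OF P \<phi>c[OF i x] pc[OF i]]])
      qed
      also have "\<dots> = pure A D P f (\<Oplus>\<^sub>P i\<in>{..<n}. \<phi> i x \<odot>\<^sub>P p i)"
        by (rule addmap_fs[OF lm_ag[OF P] agT DT_pure_r[OF P f] lm_smult[OF P \<phi>c[OF _ x] pc], symmetric])
      also have "\<dots> = pure A D P f x" using frame_sum[OF fr x] by simp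
      finally show "(\<Oplus>\<^bsub>DT P\<^esub>y\<in>{..<n} \<times> {..<k}. ?\<psi> y (pure A D P f x) \<odot>\<^bsub>DT P\<^esub> ?p y) = pure A D P f x" .
    qed
  qed (use cl(1) DT_pure_closed[OF P d1(4) pc] in auto)
  then show ?thesis by (rule frame_fg_projective[OF DT_lm[OF P]])
qed

text \<open>An \<O>-linear h cannot be tensored with D over A. Through the frame of M an element is
  described by its values under \<open>ev\<close>; h is applied to these before reassembling. In
  this way a retraction over \<O> yields a retraction after tensoring.\<close>

lemma DT_scalar_map:
  assumes fr: "frame A M I p \<phi>" and W: "A.is_mod W" and V: "A.is_mod V"
    and h: "h \<in> linmap \<O> (A.RS W) (A.RS V)"
  shows "(\<lambda>q. \<Oplus>\<^bsub>DT V\<^esub>i\<in>I. pure A D V (sD (\<phi> i)) (h (ev W (p i) q)))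
    \<in> linmap \<O> (B.RS (DT W)) (B.RS (DT V))"
proof -
  note pc = frame_elt[OF fr] and sc = sD_closed[OF frame_fun[OF fr]]
  note hc = linmap_closed[OF linmap_comp[OF ev_linmap[OF W pc] h], simplified]
  have l: "(\<lambda>q. pure A D V (sD (\<phi> i)) (h (ev W (p i) q))) \<in> linmap \<O> (B.RS (DT W)) (B.RS (DT V))"
    if i: "i \<in> I" for i
  proof (rule linmap_comp[OF linmap_comp[OF ev_linmap[OF W pc[OF i]] h], of "\<lambda>v. pure A D V (sD (\<phi> i)) v"])
    show "pure A D V (sD (\<phi> i)) \<in> linmap \<O> (A.RS V) (B.RS (DT V))" by (rule linmapI)
         (use addmap_closed[OF DT_pure_r[OF V sc[OF i]]] addmap_add[OF DT_pure_r[OF V sc[OF i]]] DT_scalar[OF V _ sc[OF i]] in simp_all)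
  qed
  have e: "(\<Oplus>\<^bsub>DT V\<^esub>i\<in>I. pure A D V (sD (\<phi> i)) (h (ev W (p i) q))) =
      (\<Oplus>\<^bsub>B.RS (DT V)\<^esub>i\<in>I. pure A D V (sD (\<phi> i)) (h (ev W (p i) q)))" if "q \<in> carrier (DT W)" for q
    by (rule fs_same[OF DT_ag[OF V] B.agU_rs[OF DT_lm[OF V]]]) (use DT_pure_closed[OF V sc hc[OF _ that]] in auto)
  have "(\<lambda>q. \<Oplus>\<^bsub>B.RS (DT V)\<^esub>i\<in>I. pure A D V (sD (\<phi> i)) (h (ev W (p i) q)))
    \<in> linmap \<O> (B.RS (DT W)) (B.RS (DT V))"
    by (rule linmap_sum[OF B.lm_rs[OF DT_lm[OF V]] frame_finite[OF fr] l])
  then show ?thesis unfolding linmap_def addmap_def using e DT_ag[OF W] lm_smult[OF DT_lm[OF W]] by auto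
qed

text \<open>Preimages are chosen for the finitely many values of q at a frame of M and reassembled
  as in \<open>DT_expand\<close>. This serves both exactness in the middle and surjectivity.\<close>

lemma idt_image:
  assumes V: "A.is_mod V" and W: "A.is_mod W" and h: "h \<in> linmap A V W" and q: "q \<in> carrier (DT W)"
    and im: "\<And>m. m \<in> carrier M \<Longrightarrow> ev W m q \<in> h ` carrier V"
  shows "q \<in> idt V W h ` carrier (DT V)"
proof -
  obtain n :: nat and p \<phi> where fr: "frame A M {..<n} p \<phi>" by (rule M_frame)
  note pc = frame_elt[OF fr] and sc = sD_closed[OF frame_fun[OF fr]]
  have "\<forall>j\<in>{..<n}. \<exists>x. x \<in> carrier V \<and> ev W (p j) q = h x" using im[OF pc] by blast
  from bchoice[OF this] obtain x where x: "\<And>j. j \<in> {..<n} \<Longrightarrow> x j \<in> carrier V" "\<And>j. j \<in> {..<n} \<Longrightarrow> ev W (p j) q = h (x j)" by blast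
  note xc = DT_pure_closed[OF V sc x(1)]
  have "idt V W h (\<Oplus>\<^bsub>DT V\<^esub>j\<in>{..<n}. pure A D V (sD (\<phi> j)) (x j)) = (\<Oplus>\<^bsub>DT W\<^esub>j\<in>{..<n}. idt V W h (pure A D V (sD (\<phi> j)) (x j)))"
    by (rule addmap_fs[OF DT_ag[OF V] DT_ag[OF W] idt_addmap[OF V W h] xc])
  also have "\<dots> = (\<Oplus>\<^bsub>DT W\<^esub>j\<in>{..<n}. pure A D W (sD (\<phi> j)) (ev W (p j) q))" by (rule fs_cong[OF DT_ag[OF W]])
       (use idt_pure[OF V W h sc x(1)] x(2) DT_pure_closed[OF W sc ev_closed[OF W pc q]] in auto)
  also have "\<dots> = q" by (rule DT_expand[OF fr W q])
  finally show ?thesis by (rule image_eqI[OF sym fs_closed[OF DT_ag[OF V] xc]])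
qed

lemma tensor_shifts_simps [simp]:
  "obj (tensor_shifts A D X) = (\<lambda>i. DT (obj X i))" "prj (tensor_shifts A D X) = (\<lambda>i. DT (prj X i))"
  "inc (tensor_shifts A D X) = (\<lambda>i. idt (obj X i) (prj X i) (inc X i))"
  "pro (tensor_shifts A D X) = (\<lambda>i. idt (prj X i) (obj X (i + 1)) (pro X i))" by (simp_all add: tensor_shifts_def)

text \<open>Exactness is checked on values under \<open>ev\<close>, where \<open>ev_idt\<close>
  reduces it to exactness of the given sequences; projectivity comes from \<open>DT_proj\<close>,
  the splitting from \<open>DT_scalar_map\<close>.\<close>

lemma tensor_shift_seq:
  fixes X :: "('a, 'u, 'p) shifts"
  assumes X: "A.shift_seq X"
  shows "B.shift_seq (tensor_shifts A D X)"
  unfolding B.shift_seq_def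
proof (intro conjI allI)
  fix i
  let ?U = "obj X i" and ?P = "prj X i" and ?V = "obj X (i + 1)"
  note U = A.sq_obj[OF X, of i] and P = A.sq_prj[OF X, of i] and V = A.sq_obj[OF X, of "i + 1"]
  note inc = A.sq_inc[OF X, of i] and pro = A.sq_pro[OF X, of i]
  note inc' = lin_hom_linmap[OF inc] and pro' = lin_hom_linmap[OF pro]
  obtain n :: nat and p \<phi> where fr: "frame A M {..<n} p \<phi>" by (rule M_frame)
  note pc = frame_elt[OF fr] and sc = sD_closed[OF frame_fun[OF fr]]
  note ii = idt_lin_hom[OF U P inc'] and ip = idt_lin_hom[OF P V pro']
  show "left_module B (obj (tensor_shifts A D X) i)" "left_module B (prj (tensor_shifts A D X) i)"
    "inc (tensor_shifts A D X) i \<in> lin_hom B (obj (tensor_shifts A D X) i) (prj (tensor_shifts A D X) i)"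
    "pro (tensor_shifts A D X) i \<in> lin_hom B (prj (tensor_shifts A D X) i) (obj (tensor_shifts A D X) (i + 1))"
    "fg_projective B (prj (tensor_shifts A D X) i)"
    using DT_lm[OF U] DT_lm[OF P] ii ip DT_proj[OF P A.sq_proj[OF X]] by simp_all
  have "inj_on (idt ?U ?P (inc X i)) (carrier (DT ?U))"
  proof (rule inj_onI)
    fix q r assume q: "q \<in> carrier (DT ?U)" and r: "r \<in> carrier (DT ?U)"
      and e: "idt ?U ?P (inc X i) q = idt ?U ?P (inc X i) r"
    show "q = r"
    proof (rule ev_joint_inj[OF fr U q r])
      fix m assume m: "m \<in> carrier M"
      have "inc X i (ev ?U m q) = inc X i (ev ?U m r)" using e ev_idt[OF U P inc' m q] ev_idt[OF U P inc' m r] by simp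
      then show "ev ?U m q = ev ?U m r" using inj_onD[OF A.sq_inj[OF X]] ev_closed[OF U m q] ev_closed[OF U m r] by blast
    qed
  qed
  then show "inj_on (inc (tensor_shifts A D X) i) (carrier (obj (tensor_shifts A D X) i))" by simp
  have "idt ?U ?P (inc X i) ` carrier (DT ?U) = {q \<in> carrier (DT ?P). idt ?P ?V (pro X i) q = \<zero>\<^bsub>DT ?V\<^esub>}"
  proof (intro equalityI subsetI)
    fix y assume "y \<in> idt ?U ?P (inc X i) ` carrier (DT ?U)"
    then obtain q where q: "q \<in> carrier (DT ?U)" and y: "y = idt ?U ?P (inc X i) q" by blast
    have yc: "y \<in> carrier (DT ?P)" unfolding y by (rule lin_hom_closed[OF ii q])
    have "idt ?P ?V (pro X i) y = \<zero>\<^bsub>DT ?V\<^esub>"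
    proof (rule ev_joint_inj[OF fr V lin_hom_closed[OF ip yc]])
      fix m assume m: "m \<in> carrier M"
      have "ev ?V m (idt ?P ?V (pro X i) y) = pro X i (inc X i (ev ?U m q))"
        unfolding ev_idt[OF P V pro' m yc] unfolding y ev_idt[OF U P inc' m q] ..
      also have "\<dots> = ev ?V m \<zero>\<^bsub>DT ?V\<^esub>"
        using A.sq_pro_inc[OF X ev_closed[OF U m q]] addmap_zero[OF DT_ag[OF V] lm_ag[OF V] ev_addmap[OF V m]] by simp
      finally show "ev ?V m (idt ?P ?V (pro X i) y) = ev ?V m \<zero>\<^bsub>DT ?V\<^esub>" .
    qed (use DT_ag[OF V] in simp)
    then show "y \<in> {q \<in> carrier (DT ?P). idt ?P ?V (pro X i) q = \<zero>\<^bsub>DT ?V\<^esub>}" using yc by simp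
  next
    fix q assume "q \<in> {q \<in> carrier (DT ?P). idt ?P ?V (pro X i) q = \<zero>\<^bsub>DT ?V\<^esub>}"
    then have q: "q \<in> carrier (DT ?P)" and z: "idt ?P ?V (pro X i) q = \<zero>\<^bsub>DT ?V\<^esub>" by auto
    show "q \<in> idt ?U ?P (inc X i) ` carrier (DT ?U)"
    proof (rule idt_image[OF U P inc' q])
      fix m assume m: "m \<in> carrier M"
      have "pro X i (ev ?P m q) = \<zero>\<^bsub>?V\<^esub>"
        using ev_idt[OF P V pro' m q] z addmap_zero[OF DT_ag[OF V] lm_ag[OF V] ev_addmap[OF V m]] by simp
      then show "ev ?P m q \<in> inc X i ` carrier ?U" by (rule A.sq_imI[OF X ev_closed[OF P m q]])
    qed
  qed
  then show "inc (tensor_shifts A D X) i ` carrier (obj (tensor_shifts A D X) i) =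
      {p \<in> carrier (prj (tensor_shifts A D X) i). pro (tensor_shifts A D X) i p = \<zero>\<^bsub>obj (tensor_shifts A D X) (i + 1)\<^esub>}" by simp
  have "idt ?P ?V (pro X i) ` carrier (DT ?P) = carrier (DT ?V)"
  proof (intro equalityI subsetI)
    show "y \<in> carrier (DT ?V)" if "y \<in> idt ?P ?V (pro X i) ` carrier (DT ?P)" for y
      using that lin_hom_closed[OF ip] by blast
    fix q assume q: "q \<in> carrier (DT ?V)"
    show "q \<in> idt ?P ?V (pro X i) ` carrier (DT ?P)"
      by (rule idt_image[OF P V pro' q]) (unfold A.sq_sur[OF X], rule ev_closed[OF V _ q])
  qed
  then show "pro (tensor_shifts A D X) i ` carrier (prj (tensor_shifts A D X) i) = carrier (obj (tensor_shifts A D X) (i + 1))"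
    by simp
  obtain \<rho> where \<rho>: "\<rho> \<in> linmap \<O> (A.RS ?P) (A.RS ?U)"
    "\<And>x. x \<in> carrier ?U \<Longrightarrow> \<rho> (inc X i x) = x" using A.sq_split[OF X, of i] by blast
  let ?\<sigma> = "\<lambda>q. \<Oplus>\<^bsub>DT ?U\<^esub>j\<in>{..<n}. pure A D ?U (sD (\<phi> j)) (\<rho> (ev ?P (p j) q))"
  have \<sigma>: "?\<sigma> \<in> linmap \<O> (B.RS (DT ?P)) (B.RS (DT ?U))" by (rule DT_scalar_map[OF fr P U \<rho>(1)])
  have \<sigma>i: "?\<sigma> (idt ?U ?P (inc X i) q) = q" if q: "q \<in> carrier (DT ?U)" for q
  proof -
    have "?\<sigma> (idt ?U ?P (inc X i) q) = (\<Oplus>\<^bsub>DT ?U\<^esub>j\<in>{..<n}. pure A D ?U (sD (\<phi> j)) (ev ?U (p j) q))"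
      by (rule fs_cong[OF DT_ag[OF U]])
         (use ev_idt[OF U P inc' pc q] \<rho>(2) ev_closed[OF U pc q] DT_pure_closed[OF U sc ev_closed[OF U pc q]] in auto)
    then show ?thesis using DT_expand[OF fr U q] by simp
  qed
  show "\<exists>\<rho>\<in>linmap \<O> (B.RS (prj (tensor_shifts A D X) i)) (B.RS (obj (tensor_shifts A D X) i)).
      \<forall>x\<in>carrier (obj (tensor_shifts A D X) i). \<rho> (inc (tensor_shifts A D X) i x) = x"
    unfolding tensor_shifts_simps by (intro bexI[of _ ?\<sigma>] ballI \<sigma>i \<sigma>)
qed

end

section \<open>Functoriality of tensoring and transfer on the stable category\<close>

context sym_bimodule begin

text \<open>A factorisation through P becomes one through D \<otimes> P, which is projective by
  \<open>DT_proj\<close>.\<close>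

lemma idt_stable:
  assumes U: "A.is_mod U" and W: "A.is_mod W" and st: "(f, g) \<in> stable_rel A U W"
  shows "(idt U W f, idt U W g) \<in> stable_rel B (DT U) (DT W)"
proof -
  note f = lin_hom_linmap[OF stable_hom(1)[OF st]] and g = lin_hom_linmap[OF stable_hom(2)[OF st]]
  let ?d = "\<lambda>x\<in>carrier U. f x \<ominus>\<^sub>W g x"
  have d: "?d \<in> linmap A U W" by (rule lin_hom_linmap[OF lin_hom_minus[OF stable_hom(1)[OF st] stable_hom(2)[OF st] U W]])
  have "?d \<in> proj_hom A U W" using st by (simp add: stable_rel_def)
  then obtain P :: "('a, nat \<Rightarrow> 'a) module" and k h where P: "left_module A P" "fg_projective A P"
    and k: "k \<in> lin_hom A U P" and h: "h \<in> lin_hom A P W" and e: "?d = compose (carrier U) h k"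
    unfolding proj_hom_def by blast
  note k' = lin_hom_linmap[OF k] and h' = lin_hom_linmap[OF h]
  note am = idt_addmap[OF U W f] idt_addmap[OF U W g] idt_addmap[OF U W d]
  have "idt U W f q \<ominus>\<^bsub>DT W\<^esub> idt U W g q = idt P W h (idt U P k q)" if q: "q \<in> carrier (DT U)" for q
  proof -
    have "idt U W f q = idt U W ?d q \<oplus>\<^bsub>DT W\<^esub> idt U W g q"
    proof (rule DT_ext[OF U am(1) addmap_sum2[OF DT_ag[OF W] am(3,2)] _ q])
      fix x u assume x: "x \<in> carrier D" and u: "u \<in> carrier U"
      have "f u = ?d u \<oplus>\<^sub>W g u" using u linmap_closed[OF f u] linmap_closed[OF g u] lm_ag[OF W] by simp
      then have "pure A D W x (f u) = pure A D W x (?d u) \<oplus>\<^bsub>DT W\<^esub> pure A D W x (g u)"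
        using addmap_add[OF DT_pure_r[OF W x] linmap_closed[OF d u] linmap_closed[OF g u]] by simp
      then show "idt U W f (pure A D U x u) = idt U W ?d (pure A D U x u) \<oplus>\<^bsub>DT W\<^esub> idt U W g (pure A D U x u)"
        unfolding idt_pure[OF U W f x u] idt_pure[OF U W g x u] idt_pure[OF U W d x u] .
    qed
    then have "idt U W f q \<ominus>\<^bsub>DT W\<^esub> idt U W g q = idt U W ?d q"
      using addmap_closed[OF am(2) q] addmap_closed[OF am(3) q] DT_ag[OF W] by simp
    also have "\<dots> = idt P W h (idt U P k q)" by (rule idt_comp[OF U P(1) W k' h' d _ q]) (simp add: e)
    finally show ?thesis .
  qed
  then have "(\<lambda>q\<in>carrier (DT U). idt U W f q \<ominus>\<^bsub>DT W\<^esub> idt U W g q) = (\<lambda>q\<in>carrier (DT U). idt P W h (idt U P k q))"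
    by (intro restrict_ext) blast
  moreover have "fin_rank B (DT U) (DT W) (\<lambda>q\<in>carrier (DT U). idt P W h (idt U P k q))"
    by (rule fin_rank_factor[OF DT_lm[OF U] DT_lm[OF W] DT_lm[OF P(1)] DT_proj[OF P]])
       (rule lin_hom_linmap[OF idt_lin_hom[OF U P(1) k']] lin_hom_linmap[OF idt_lin_hom[OF P(1) W h']])+
  ultimately show ?thesis unfolding stable_rel_iff[OF DT_lm[OF U] DT_lm[OF W]]
    using idt_lin_hom[OF U W f] idt_lin_hom[OF U W g] by simp
qed

lemma idt_shift_family:
  fixes X :: "('a, 'u, 'p) shifts" and Y :: "('a, 'v, 'q) shifts"
  assumes X: "A.shift_seq X" and Y: "A.shift_seq Y" and F: "shift_family A X Y d F"
  shows "shift_family B (tensor_shifts A D X) (tensor_shifts A D Y) d (\<lambda>i. idt (obj X i) (obj Y (i + d)) (F i))"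
  unfolding shift_family_def tensor_shifts_simps
proof (intro allI conjI)
  fix i
  have e: "i + 1 + d = i + d + 1" by simp
  note Fi = lin_hom_linmap[OF shift_familyD(1)[OF F]]
  note XU = A.sq_obj[OF X] and XP = A.sq_prj[OF X] and YU = A.sq_obj[OF Y] and YP = A.sq_prj[OF Y]
  note Xi = lin_hom_linmap[OF A.sq_inc[OF X]] and Xp = lin_hom_linmap[OF A.sq_pro[OF X]]
  note Yi = lin_hom_linmap[OF A.sq_inc[OF Y]] and Yp = lin_hom_linmap[OF A.sq_pro[OF Y]]
  show "idt (obj X i) (obj Y (i + d)) (F i) \<in> lin_hom B (DT (obj X i)) (DT (obj Y (i + d)))"
    by (rule idt_lin_hom[OF XU YU Fi])
  obtain g where g: "g \<in> lin_hom A (prj X i) (prj Y (i + d))"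
    "\<And>x. x \<in> carrier (obj X i) \<Longrightarrow> g (inc X i x) = inc Y (i + d) (F i x)"
    "\<And>p. p \<in> carrier (prj X i) \<Longrightarrow> pro Y (i + d) (g p) = F (i + 1) (pro X i p)" using shift_familyD(2)[OF F, of i] by blast
  note g' = lin_hom_linmap[OF g(1)]
  note Fi1 = Fi[of "i + 1", unfolded e]
  show "\<exists>g\<in>lin_hom B (DT (prj X i)) (DT (prj Y (i + d))).
      (\<forall>x\<in>carrier (DT (obj X i)). g (idt (obj X i) (prj X i) (inc X i) x) =
         idt (obj Y (i + d)) (prj Y (i + d)) (inc Y (i + d)) (idt (obj X i) (obj Y (i + d)) (F i) x)) \<and>
      (\<forall>p\<in>carrier (DT (prj X i)). idt (prj Y (i + d)) (obj Y (i + d + 1)) (pro Y (i + d)) (g p) =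
         idt (obj X (i + 1)) (obj Y (i + 1 + d)) (F (i + 1)) (idt (prj X i) (obj X (i + 1)) (pro X i) p))"
  proof (intro bexI conjI ballI)
    show "idt (prj X i) (prj Y (i + d)) g \<in> lin_hom B (DT (prj X i)) (DT (prj Y (i + d)))"
      by (rule idt_lin_hom[OF XP YP g'])
    fix q assume q: "q \<in> carrier (DT (obj X i))"
    show "idt (prj X i) (prj Y (i + d)) g (idt (obj X i) (prj X i) (inc X i) q) =
         idt (obj Y (i + d)) (prj Y (i + d)) (inc Y (i + d)) (idt (obj X i) (obj Y (i + d)) (F i) q)"
      unfolding idt_comp[OF XU XP YP Xi g' linmap_comp[OF Xi g'] refl q, symmetric]
      by (rule idt_comp[OF XU YU YP Fi Yi linmap_comp[OF Xi g'] _ q]) (rule g(2))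
  next
    fix q assume q: "q \<in> carrier (DT (prj X i))"
    show "idt (prj Y (i + d)) (obj Y (i + d + 1)) (pro Y (i + d)) (idt (prj X i) (prj Y (i + d)) g q) =
         idt (obj X (i + 1)) (obj Y (i + 1 + d)) (F (i + 1)) (idt (prj X i) (obj X (i + 1)) (pro X i) q)"
      unfolding e idt_comp[OF XP YP YU g' Yp linmap_comp[OF g' Yp] refl q, symmetric]
      by (rule idt_comp[OF XP XU YU Xp Fi1 linmap_comp[OF g' Yp] _ q]) (rule g(3))
  qed
qed

text \<open>The transfer of the map of middle terms completes the transferred maps to a morphism of
  sequences, both squares by \<open>TH_square\<close>. Transfer and shift thus commute on
  representatives, not merely on classes.\<close>

lemma TH_shift_family:
  fixes X :: "('a, 'u, 'p) shifts" and Y :: "('a, 'v, 'q) shifts"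
  assumes X: "A.shift_seq X" and Y: "A.shift_seq Y" and G: "shift_family B (tensor_shifts A D X) (tensor_shifts A D Y) d G"
  shows "shift_family A X Y d (\<lambda>i. TH (obj X i) (obj Y (i + d)) (G i))"
  unfolding shift_family_def
proof (intro allI conjI)
  fix i
  have e: "i + 1 + d = i + d + 1" by simp
  note Gi = lin_hom_linmap[OF shift_familyD(1)[OF G, unfolded tensor_shifts_simps]]
  note XU = A.sq_obj[OF X] and XP = A.sq_prj[OF X] and YU = A.sq_obj[OF Y] and YP = A.sq_prj[OF Y]
  note Xi = lin_hom_linmap[OF A.sq_inc[OF X]] and Xp = lin_hom_linmap[OF A.sq_pro[OF X]]
  note Yi = lin_hom_linmap[OF A.sq_inc[OF Y]] and Yp = lin_hom_linmap[OF A.sq_pro[OF Y]]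
  show "TH (obj X i) (obj Y (i + d)) (G i) \<in> lin_hom A (obj X i) (obj Y (i + d))" by (rule TH_lin_hom[OF XU YU Gi])
  obtain g where g: "g \<in> lin_hom B (DT (prj X i)) (DT (prj Y (i + d)))"
    "\<And>x. x \<in> carrier (DT (obj X i)) \<Longrightarrow> g (idt (obj X i) (prj X i) (inc X i) x) =
       idt (obj Y (i + d)) (prj Y (i + d)) (inc Y (i + d)) (G i x)"
    "\<And>p. p \<in> carrier (DT (prj X i)) \<Longrightarrow> idt (prj Y (i + d)) (obj Y (i + d + 1)) (pro Y (i + d)) (g p) =
       G (i + 1) (idt (prj X i) (obj X (i + 1)) (pro X i) p)"
    using shift_familyD(2)[OF G, of i, unfolded tensor_shifts_simps] by blast
  note g' = lin_hom_linmap[OF g(1)]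
  show "\<exists>g\<in>lin_hom A (prj X i) (prj Y (i + d)).
      (\<forall>x\<in>carrier (obj X i). g (inc X i x) = inc Y (i + d) (TH (obj X i) (obj Y (i + d)) (G i) x)) \<and>
      (\<forall>p\<in>carrier (prj X i). pro Y (i + d) (g p) = TH (obj X (i + 1)) (obj Y (i + 1 + d)) (G (i + 1)) (pro X i p))"
  proof (intro bexI conjI ballI)
    show "TH (prj X i) (prj Y (i + d)) g \<in> lin_hom A (prj X i) (prj Y (i + d))" by (rule TH_lin_hom[OF XP YP g'])
    show "TH (prj X i) (prj Y (i + d)) g (inc X i x) = inc Y (i + d) (TH (obj X i) (obj Y (i + d)) (G i) x)"
      if "x \<in> carrier (obj X i)" for x by (rule TH_square[OF XU XP YU YP Xi Yi Gi g' g(2) that])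
    show "pro Y (i + d) (TH (prj X i) (prj Y (i + d)) g p) = TH (obj X (i + 1)) (obj Y (i + 1 + d)) (G (i + 1)) (pro X i p)"
      if "p \<in> carrier (prj X i)" for p
      unfolding e by (rule TH_square[OF XP XU YP YU Xp Yp g' Gi[of "i + 1", unfolded e] g(3)[symmetric] that, symmetric])
  qed
qed

end

section \<open>The canonical identifications\<close>

context sym_alg begin

text \<open>The identity of the common term in degree 0 is shifted both ways. The two composites are
  shift families that are the identity in degree 0, hence stably the identity in every
  degree.\<close>

lemma shift_iso:
  fixes X :: "('a, 'u, 'p) shifts" and Y :: "('a, 'u, 'q) shifts"
  assumes X: "shift_seq X" and Y: "shift_seq Y" and XY: "obj Y 0 = obj X 0"
  obtains S S' where "shift_family A X Y 0 S" "S 0 = (\<lambda>x\<in>carrier (obj X 0). x)" "shift_family A Y X 0 S'"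
    "\<And>k. (compose (carrier (obj X k)) (S' k) (S k), \<lambda>x\<in>carrier (obj X k). x) \<in> stable_rel A (obj X k) (obj X k)"
    "\<And>k. (compose (carrier (obj Y k)) (S k) (S' k), \<lambda>x\<in>carrier (obj Y k). x) \<in> stable_rel A (obj Y k) (obj Y k)"
proof -
  let ?id = "\<lambda>x\<in>carrier (obj X 0). x"
  have i: "?id \<in> lin_hom A (obj X 0) (obj X 0)" by (rule lin_hom_id[OF sq_obj[OF X]])
  obtain S where S: "shift_family A X Y 0 S" "S 0 = ?id" using shift_family_exists[OF X Y, of ?id 0] i XY by auto
  obtain S' where S': "shift_family A Y X 0 S'" "S' 0 = ?id" using shift_family_exists[OF Y X, of ?id 0] i XY by auto
  have c: "compose (carrier (obj X 0)) ?id ?id = ?id" by (auto simp: compose_def)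
  have "(compose (carrier (obj X k)) (S' k) (S k), \<lambda>x\<in>carrier (obj X k). x) \<in> stable_rel A (obj X k) (obj X k)" for k
    using shift_family_stable[OF X X shift_family_compose[OF X Y X S(1) S'(1), simplified] shift_family_id[OF X], of 0 k]
      stable_refl[OF sq_obj[OF X] sq_obj[OF X] i] S(2) S'(2) c by simp
  moreover have "(compose (carrier (obj Y k)) (S k) (S' k), \<lambda>x\<in>carrier (obj Y k). x) \<in> stable_rel A (obj Y k) (obj Y k)" for k
    using shift_family_stable[OF Y Y shift_family_compose[OF Y X Y S'(1) S(1), simplified] shift_family_id[OF Y], of 0 k]
      stable_refl[OF sq_obj[OF X] sq_obj[OF X] i] S(2) S'(2) c XY by simp
  ultimately show ?thesis using that S S' by blast
qed

end

section \<open>Composition laws and cancellation of stable isomorphisms\<close>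

lemma compose_id_l: "f \<in> lin_hom R U V \<Longrightarrow> compose (carrier U) (\<lambda>x\<in>carrier V. x) f = f"
  by (rule extensionalityI[of _ "carrier U"]) (auto simp: lin_hom_ext lin_hom_closed)

lemma compose_id_r: "f \<in> lin_hom R U V \<Longrightarrow> compose (carrier U) f (\<lambda>x\<in>carrier U. x) = f"
  by (rule extensionalityI[of _ "carrier U"]) (auto simp: lin_hom_ext)

lemma compose_lin_hom_assoc:
  "f \<in> lin_hom R U V \<Longrightarrow> compose (carrier U) h (compose (carrier U) g f) = compose (carrier U) (compose (carrier V) h g) f"
  by (rule extensionalityI[of _ "carrier U"]) (auto simp: lin_hom_closed)

lemma stable_cancel_left:
  assumes U: "left_module A U" and V: "left_module A V" and W: "left_module A W"
    and f: "f \<in> lin_hom A U V" and g: "g \<in> lin_hom A U V" and h: "h \<in> lin_hom A V W" and h': "h' \<in> lin_hom A W V"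
    and i: "(compose (carrier V) h' h, \<lambda>x\<in>carrier V. x) \<in> stable_rel A V V"
    and st: "(compose (carrier U) h f, compose (carrier U) h g) \<in> stable_rel A U W"
  shows "(f, g) \<in> stable_rel A U V"
proof -
  have s: "(compose (carrier U) (compose (carrier V) h' h) k, k) \<in> stable_rel A U V" if k: "k \<in> lin_hom A U V" for k
    using stable_comp_right[OF U V V i k] compose_id_l[OF k] by simp
  have "(compose (carrier U) (compose (carrier V) h' h) f, compose (carrier U) (compose (carrier V) h' h) g) \<in> stable_rel A U V"
    unfolding compose_lin_hom_assoc[OF f, symmetric] compose_lin_hom_assoc[OF g, symmetric]
    by (rule stable_comp_left[OF U W V st h'])
  then show ?thesis by (rule stable_trans[OF U V stable_sym[OF U V s[OF f]] stable_trans[OF U V _ s[OF g]]])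
qed

section \<open>Tensored and transferred classes on representatives\<close>

context sym_bimodule begin

context
  fixes Y :: "('a, 'v, 'q) shifts" and Y' :: "('b, (('m \<Rightarrow> 'k) \<times> 'v \<Rightarrow>\<^sub>0 int) set, 'q2) shifts" and S
  assumes Y: "A.shift_seq Y" and Y': "B.shift_seq Y'" and Y0: "obj Y' 0 = DT (obj Y 0)"
    and S: "shift_family B (tensor_shifts A D Y) Y' 0 S" "S 0 = (\<lambda>x\<in>carrier (DT (obj Y 0)). x)"
begin

text \<open>Any family contributing to \<open>canonical_shift_iso\<close> agrees stably with S in
  degree 0, hence in degree n; so the identification is the stable class of the single map
  \<open>S n\<close>.\<close>

lemma canonical_mem: "\<theta> \<in> canonical_shift_iso A B D Y Y' n \<longleftrightarrow> (S n, \<theta>) \<in> stable_rel B (DT (obj Y n)) (obj Y' n)"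
proof
  note TY = tensor_shift_seq[OF Y]
  note V = DT_lm[OF A.sq_obj[OF Y]] and V' = B.sq_obj[OF Y']
  assume "\<theta> \<in> canonical_shift_iso A B D Y Y' n"
  then obtain F where F: "shift_family B (tensor_shifts A D Y) Y' 0 F" "(S 0, F 0) \<in> stable_rel B (DT (obj Y 0)) (DT (obj Y 0))"
    "(F n, \<theta>) \<in> stable_rel B (DT (obj Y n)) (obj Y' n)"
    by (auto simp: canonical_shift_iso_def shift_class_def stable_class_mem Let_def S(2))
  have "(S n, F n) \<in> stable_rel B (DT (obj Y n)) (obj Y' n)"
    using B.shift_family_stable[OF TY Y' S(1) F(1), of 0 n] F(2) Y0 by simp
  then show "(S n, \<theta>) \<in> stable_rel B (DT (obj Y n)) (obj Y' n)" by (rule stable_trans[OF V V' _ F(3)])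
next
  assume st: "(S n, \<theta>) \<in> stable_rel B (DT (obj Y n)) (obj Y' n)"
  have "(S 0, S 0) \<in> stable_rel B (DT (obj Y 0)) (DT (obj Y 0))"
    unfolding S(2) by (rule stable_refl[OF DT_lm[OF A.sq_obj[OF Y]] DT_lm[OF A.sq_obj[OF Y]] lin_hom_id[OF DT_lm[OF A.sq_obj[OF Y]]]])
  then show "\<theta> \<in> canonical_shift_iso A B D Y Y' n"
    using S(1) st by (auto simp: canonical_shift_iso_def shift_class_def stable_class_mem Let_def S(2)[symmetric])
qed

lemma S_lin_hom: "S n \<in> lin_hom B (DT (obj Y n)) (obj Y' n)" using shift_familyD(1)[OF S(1), of n] by simp

text \<open>Both ingredients vary within stable classes, and tensoring with D and composition
  respect these.\<close>

lemma tensor_class_eq: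
  assumes U: "A.is_mod U" and f: "f \<in> lin_hom A U (obj Y n)"
  shows "tensor_class A B D U Y Y' n (stable_class A U (obj Y n) f) =
    stable_class B (DT U) (obj Y' n) (compose (carrier (DT U)) (S n) (idt U (obj Y n) f))" unfolding tensor_class_def
proof (rule the_elem_eqI)
  note V = A.sq_obj[OF Y, of n] and V' = B.sq_obj[OF Y', of n]
  show "stable_class B (DT U) (obj Y' n) (compose (carrier (DT U)) (S n) (idt U (obj Y n) f)) \<in>
    {stable_class B (DT U) (obj Y' n) (compose (carrier (DT U)) \<theta> (idt U (obj Y n) f')) | f' \<theta>.
        f' \<in> stable_class A U (obj Y n) f \<and> \<theta> \<in> canonical_shift_iso A B D Y Y' n}"
    using stable_refl[OF U V f] stable_refl[OF DT_lm[OF V] V' S_lin_hom] by (auto simp: canonical_mem stable_class_mem)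
  fix a assume "a \<in> {stable_class B (DT U) (obj Y' n) (compose (carrier (DT U)) \<theta> (idt U (obj Y n) f')) | f' \<theta>.
        f' \<in> stable_class A U (obj Y n) f \<and> \<theta> \<in> canonical_shift_iso A B D Y Y' n}"
  then obtain f' \<theta> where a: "a = stable_class B (DT U) (obj Y' n) (compose (carrier (DT U)) \<theta> (idt U (obj Y n) f'))"
    and f': "(f, f') \<in> stable_rel A U (obj Y n)" and \<theta>: "(S n, \<theta>) \<in> stable_rel B (DT (obj Y n)) (obj Y' n)"
    by (auto simp: canonical_mem stable_class_mem)
  show "a = stable_class B (DT U) (obj Y' n) (compose (carrier (DT U)) (S n) (idt U (obj Y n) f))" unfolding a
    by (rule stable_class_eq[OF DT_lm[OF U] V' stable_comp[OF DT_lm[OF U] DT_lm[OF V] V' idt_stable[OF U V f'] \<theta>], symmetric])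
qed

text \<open>\<open>S n\<close> has the stable left inverse S', so maps with stably equal composites
  with \<open>S n\<close> are stably equal, and by \<open>TH_stable\<close> their transfers share a
  class.\<close>

lemma transfer_map_eq:
  assumes U: "A.is_mod U" and S': "S' \<in> lin_hom B (obj Y' n) (DT (obj Y n))"
    "(compose (carrier (DT (obj Y n))) S' (S n), \<lambda>x\<in>carrier (DT (obj Y n)). x) \<in> stable_rel B (DT (obj Y n)) (DT (obj Y n))"
    and \<beta>: "\<beta> \<in> lin_hom B (DT U) (DT (obj Y n))"
    and b: "(b, compose (carrier (DT U)) (S n) \<beta>) \<in> stable_rel B (DT U) (obj Y' n)"
  shows "transfer_map \<O> A B M s t U Y Y' n (stable_class B (DT U) (obj Y' n) b) =
    stable_class A U (obj Y n) (TH U (obj Y n) \<beta>)" unfolding transfer_map_def Let_def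
proof (rule the_elem_eqI)
  note V = A.sq_obj[OF Y, of n] and V' = B.sq_obj[OF Y', of n]
  show "stable_class A U (obj Y n) (TH U (obj Y n) \<beta>) \<in> {stable_class A U (obj Y n) (TH U (obj Y n) \<beta>) | \<beta>.
        \<beta> \<in> lin_hom B (DT U) (DT (obj Y n)) \<and>
        (\<exists>\<theta>\<in>canonical_shift_iso A B D Y Y' n. compose (carrier (DT U)) \<theta> \<beta> \<in> stable_class B (DT U) (obj Y' n) b)}"
  proof -
    have "S n \<in> canonical_shift_iso A B D Y Y' n"
      using stable_refl[OF DT_lm[OF V] V' S_lin_hom] by (simp add: canonical_mem)
    moreover have "compose (carrier (DT U)) (S n) \<beta> \<in> stable_class B (DT U) (obj Y' n) b"
      using b by (simp add: stable_class_mem)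
    ultimately show ?thesis using \<beta> by blast
  qed
  fix a assume "a \<in> {stable_class A U (obj Y n) (TH U (obj Y n) \<beta>) | \<beta>. \<beta> \<in> lin_hom B (DT U) (DT (obj Y n)) \<and>
        (\<exists>\<theta>\<in>canonical_shift_iso A B D Y Y' n. compose (carrier (DT U)) \<theta> \<beta> \<in> stable_class B (DT U) (obj Y' n) b)}"
  then obtain \<beta>' \<theta> where a: "a = stable_class A U (obj Y n) (TH U (obj Y n) \<beta>')"
    and \<beta>': "\<beta>' \<in> lin_hom B (DT U) (DT (obj Y n))" and \<theta>: "(S n, \<theta>) \<in> stable_rel B (DT (obj Y n)) (obj Y' n)"
    and b': "(b, compose (carrier (DT U)) \<theta> \<beta>') \<in> stable_rel B (DT U) (obj Y' n)"
    by (auto simp: canonical_mem stable_class_mem)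
  note UV' = DT_lm[OF U] V'
  have "(compose (carrier (DT U)) (S n) \<beta>, compose (carrier (DT U)) (S n) \<beta>') \<in> stable_rel B (DT U) (obj Y' n)"
    by (rule stable_trans[OF UV' stable_sym[OF UV' b] stable_trans[OF UV' b'
         stable_sym[OF UV' stable_comp_right[OF DT_lm[OF U] DT_lm[OF V] V' \<theta> \<beta>']]]])
  then have "(\<beta>, \<beta>') \<in> stable_rel B (DT U) (DT (obj Y n))"
    by (rule stable_cancel_left[OF DT_lm[OF U] DT_lm[OF V] V' \<beta> \<beta>' S_lin_hom S'])
  then show "a = stable_class A U (obj Y n) (TH U (obj Y n) \<beta>)"
    unfolding a using stable_class_eq[OF U V TH_stable[OF U V]] by metis
qed

end

end

section \<open>The Tate duality pairing on representatives\<close>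

context ext_sym_alg begin

abbreviation "tt \<equiv> twisted_trace \<O> K A s"

lemma coset_shift:
  assumes x: "x \<in> carrier K" and r: "r \<in> carrier \<O>"
  shows "carrier \<O> +>\<^bsub>K\<^esub> (x \<oplus>\<^sub>K r) = carrier \<O> +>\<^bsub>K\<^esub> x"
proof -
  have sr: "subring (carrier \<O>) K" using fof by (simp add: field_of_fractions_def)
  note cl = subringE(7)[OF sr] subringE(5)[OF sr]
  have e1: "h \<oplus>\<^sub>K (x \<oplus>\<^sub>K r) = (h \<oplus>\<^sub>K r) \<oplus>\<^sub>K x" if "h \<in> carrier \<O>" for h using that x r by (simp add: K.add.m_ac)
  have e2: "h \<oplus>\<^sub>K x = (h \<oplus>\<^sub>K (\<ominus>\<^sub>K r)) \<oplus>\<^sub>K (x \<oplus>\<^sub>K r)" if "h \<in> carrier \<O>" for h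
  proof -
    have "(h \<oplus>\<^sub>K \<ominus>\<^sub>K r) \<oplus>\<^sub>K (x \<oplus>\<^sub>K r) = (h \<oplus>\<^sub>K x) \<oplus>\<^sub>K (\<ominus>\<^sub>K r \<oplus>\<^sub>K r)" by (rule ag_add4[OF agK]) (use that x r in simp_all)
    then show ?thesis using that x r by (simp add: K.l_neg)
  qed
  show ?thesis
  proof (intro equalityI subsetI)
    fix y assume "y \<in> carrier \<O> +>\<^bsub>K\<^esub> (x \<oplus>\<^sub>K r)"
    then obtain h where "h \<in> carrier \<O>" "y = h \<oplus>\<^sub>K (x \<oplus>\<^sub>K r)" by (auto simp: a_r_coset_def')
    then show "y \<in> carrier \<O> +>\<^bsub>K\<^esub> x" using e1 cl(1)[OF _ r] by (auto simp: a_r_coset_def')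
  next
    fix y assume "y \<in> carrier \<O> +>\<^bsub>K\<^esub> x"
    then obtain h where "h \<in> carrier \<O>" "y = h \<oplus>\<^sub>K x" by (auto simp: a_r_coset_def')
    then show "y \<in> carrier \<O> +>\<^bsub>K\<^esub> (x \<oplus>\<^sub>K r)" using e2 cl(1)[OF _ cl(2)[OF r]] by (auto simp: a_r_coset_def')
  qed
qed

context
  fixes U :: "('a, 'u) module"
  assumes U: "left_module A U" and free: "fg_free \<O> (RS U)"
begin

text \<open>Packages the twisted trace as a fixed scalar times a sum of values of additive
  functions, so that additivity, scaling and the value s(g v) follow without returning to K
  \<otimes> U. The scalar is the inverse of the c with z' z_A = c, and \<open>h i\<close> is the
  i-th coordinate after the action of z'.\<close>

lemma tt_expand:
  obtains c and I :: "'u set" and h where "c \<in> carrier K" "\<And>i. i \<in> I \<Longrightarrow> i \<in> carrier U" "\<And>i. i \<in> I \<Longrightarrow> h i \<in> addmap U K"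
    "\<And>i a u. i \<in> I \<Longrightarrow> a \<in> carrier \<O> \<Longrightarrow> u \<in> carrier U \<Longrightarrow> h i ((a \<odot>\<^sub>A \<one>\<^sub>A) \<odot>\<^sub>U u) = a \<otimes>\<^sub>K h i u"
    "\<And>f. f \<in> lin_hom A U U \<Longrightarrow> tt U f = c \<otimes>\<^sub>K (\<Oplus>\<^sub>K i\<in>I. h i (f i))"
    "\<And>g v. g \<in> linmap A U (regular A) \<Longrightarrow> v \<in> carrier U \<Longrightarrow> c \<otimes>\<^sub>K (\<Oplus>\<^sub>K i\<in>I. h i (g i \<odot>\<^sub>U v)) = s (g v)"
proof -
  obtain c z' where z: "c \<in> carrier \<O>" "c \<noteq> \<zero>\<^sub>K" "z' \<in> carrier A" "z' \<otimes>\<^sub>A zA = c \<odot>\<^sub>A \<one>\<^sub>A" by (rule scaled_inverse_exists)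
  have c0: "c \<noteq> \<zero>\<^sub>\<O>" using z(2) by simp
  note ic = inv_K[OF O_sub[OF z(1)] z(2)]
  obtain I where I: "finite_basis \<O> (RS U) I" using free by (auto simp: fg_free_def)
  obtain \<upsilon> where fr: "frame \<O> (RS U) I (\<lambda>x. x) \<upsilon>" by (rule basis_frame[OF lm_rs[OF U] I])
  have uc: "i \<in> carrier U" if "i \<in> I" for i using frame_elt[OF fr that] by simp
  have h: "(\<lambda>x. \<upsilon> i (z' \<odot>\<^sub>U x)) \<in> linmap \<O> (RS U) (regular \<O>)" if i: "i \<in> I" for i
    by (rule linmap_comp[OF lm_rs_smult_linmap[OF U z(3)] frame_fun[OF fr i]])
  have OK: "(\<Oplus>\<^sub>\<O> i\<in>I. k i) = (\<Oplus>\<^sub>K i\<in>I. k i)" if "\<And>i. i \<in> I \<Longrightarrow> k i \<in> carrier \<O>" for k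
  proof -
    have "finite I" using I by (simp add: finite_basis_def)
    then show ?thesis using that
    proof (induction I rule: finite_induct)
      case (insert j J)
      then show ?case by (subst (1 2) fs_insert) auto
    qed simp
  qed
  show ?thesis
  proof (rule that[of "inv\<^bsub>K\<^esub> c" I "\<lambda>i x. \<upsilon> i (z' \<odot>\<^sub>U x)"])
    fix i assume i: "i \<in> I"
    show "(\<lambda>x. \<upsilon> i (z' \<odot>\<^sub>U x)) \<in> addmap U K" by (rule addmapI)
         (use addmap_closed[OF linmap_addmap[OF h[OF i]]] addmap_add[OF linmap_addmap[OF h[OF i]]] in simp_all)
    show "\<upsilon> i (z' \<odot>\<^sub>U ((a \<odot>\<^sub>A \<one>\<^sub>A) \<odot>\<^sub>U u)) = a \<otimes>\<^sub>K \<upsilon> i (z' \<odot>\<^sub>U u)" if "a \<in> carrier \<O>" "u \<in> carrier U" for a u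
      using linmap_smult[OF h[OF i], of a u] that by simp
  next
    fix f assume f: "f \<in> lin_hom A U U"
    show "tt U f = inv\<^bsub>K\<^esub> c \<otimes>\<^sub>K (\<Oplus>\<^sub>K i\<in>I. \<upsilon> i (z' \<odot>\<^sub>U f i))"
      using twisted_trace_eq[OF z U free fr f] OK[of "\<lambda>i. \<upsilon> i (z' \<odot>\<^sub>U f i)"]
        linmap_closed[OF h] lin_hom_closed[OF f uc] by simp
  next
    fix g v assume g: "g \<in> linmap A U (regular A)" and v: "v \<in> carrier U"
    have gc: "g u \<in> carrier A" if "u \<in> carrier U" for u using linmap_closed[OF g that] by simp
    have "(\<Oplus>\<^sub>\<O> i\<in>I. \<upsilon> i (z' \<odot>\<^sub>U (g i \<odot>\<^sub>U v))) = c \<otimes>\<^sub>\<O> s (g v)"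
      by (rule trace_rank_one[OF U fr g v z(3) inverse_central[OF z(3,1) c0 z(4)] z(1,4)])
    moreover have "(\<Oplus>\<^sub>\<O> i\<in>I. \<upsilon> i (z' \<odot>\<^sub>U (g i \<odot>\<^sub>U v))) = (\<Oplus>\<^sub>K i\<in>I. \<upsilon> i (z' \<odot>\<^sub>U (g i \<odot>\<^sub>U v)))"
      by (rule OK) (use linmap_closed[OF h] lm_smult[OF U gc[OF uc] v] in simp)
    ultimately show "inv\<^bsub>K\<^esub> c \<otimes>\<^sub>K (\<Oplus>\<^sub>K i\<in>I. \<upsilon> i (z' \<odot>\<^sub>U (g i \<odot>\<^sub>U v))) = s (g v)"
      using K.m_assoc[of "inv\<^bsub>K\<^esub> c" c "s (g v)"] ic z(1) O_sub[OF s_closed[OF gc[OF v]]] by simp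
  qed (use ic uc in auto)
qed

lemma tt_closed:
  assumes f: "f \<in> lin_hom A U U"
  shows "tt U f \<in> carrier K"
proof (rule tt_expand)
  fix c and I :: "'u set" and h
  assume "c \<in> carrier K" and I: "\<And>i. i \<in> I \<Longrightarrow> i \<in> carrier U" and h: "\<And>i. i \<in> I \<Longrightarrow> h i \<in> addmap U K"
    and e: "\<And>f. f \<in> lin_hom A U U \<Longrightarrow> tt U f = c \<otimes>\<^sub>K (\<Oplus>\<^sub>K i\<in>I. h i (f i))"
  then show ?thesis unfolding e[OF f] by (intro K.m_closed fs_closed addmap_closed[OF h lin_hom_closed[OF f I]]) simp_all
qed

lemma tt_plus:
  assumes f: "f \<in> lin_hom A U U" and g: "g \<in> lin_hom A U U"
  shows "tt U (\<lambda>x\<in>carrier U. f x \<oplus>\<^sub>U g x) = tt U f \<oplus>\<^sub>K tt U g"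
proof (rule tt_expand)
  fix c and I :: "'u set" and h
  assume c: "c \<in> carrier K" and I: "\<And>i. i \<in> I \<Longrightarrow> i \<in> carrier U" and h: "\<And>i. i \<in> I \<Longrightarrow> h i \<in> addmap U K"
    and e: "\<And>f. f \<in> lin_hom A U U \<Longrightarrow> tt U f = c \<otimes>\<^sub>K (\<Oplus>\<^sub>K i\<in>I. h i (f i))"
  have hc: "h i (k i) \<in> carrier K" if "i \<in> I" "k \<in> lin_hom A U U" for i k
    by (rule addmap_closed[OF h[OF that(1)] lin_hom_closed[OF that(2) I[OF that(1)]]])
  have "(\<Oplus>\<^sub>K i\<in>I. h i ((\<lambda>x\<in>carrier U. f x \<oplus>\<^sub>U g x) i)) = (\<Oplus>\<^sub>K i\<in>I. h i (f i) \<oplus>\<^sub>K h i (g i))"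
    by (rule fs_cong) (use I addmap_add[OF h lin_hom_closed[OF f I] lin_hom_closed[OF g I]] hc f g in auto)
  also have "\<dots> = (\<Oplus>\<^sub>K i\<in>I. h i (f i)) \<oplus>\<^sub>K (\<Oplus>\<^sub>K i\<in>I. h i (g i))" by (rule fs_add) (use hc f g in auto)
  finally show ?thesis using e[OF lin_hom_plus[OF f g U U]] e[OF f] e[OF g] c hc f g by (simp add: K.r_distr)
qed

lemma tt_scale:
  assumes a: "a \<in> carrier \<O>" and f: "f \<in> lin_hom A U U" and g: "g \<in> lin_hom A U U"
    and fg: "\<And>x. x \<in> carrier U \<Longrightarrow> g x = (a \<odot>\<^sub>A \<one>\<^sub>A) \<odot>\<^sub>U f x"
  shows "tt U g = a \<otimes>\<^sub>K tt U f"
proof (rule tt_expand)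
  fix c and I :: "'u set" and h
  assume c: "c \<in> carrier K" and I: "\<And>i. i \<in> I \<Longrightarrow> i \<in> carrier U" and h: "\<And>i. i \<in> I \<Longrightarrow> h i \<in> addmap U K"
    and hs: "\<And>i a u. i \<in> I \<Longrightarrow> a \<in> carrier \<O> \<Longrightarrow> u \<in> carrier U \<Longrightarrow> h i ((a \<odot>\<^sub>A \<one>\<^sub>A) \<odot>\<^sub>U u) = a \<otimes>\<^sub>K h i u"
    and e: "\<And>f. f \<in> lin_hom A U U \<Longrightarrow> tt U f = c \<otimes>\<^sub>K (\<Oplus>\<^sub>K i\<in>I. h i (f i))"
  have hc: "h i (f i) \<in> carrier K" if "i \<in> I" for i by (rule addmap_closed[OF h[OF that] lin_hom_closed[OF f I[OF that]]])
  have "(\<Oplus>\<^sub>K i\<in>I. h i (g i)) = (\<Oplus>\<^sub>K i\<in>I. a \<otimes>\<^sub>K h i (f i))"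
    by (rule fs_cong) (use fg[OF I] hs[OF _ a lin_hom_closed[OF f I]] hc a in auto)
  also have "\<dots> = a \<otimes>\<^sub>K (\<Oplus>\<^sub>K i\<in>I. h i (f i))"
    by (rule addmap_fs[OF agK agK _ hc, of "\<lambda>x. a \<otimes>\<^sub>K x", symmetric]) (rule addmapI, use a in "simp_all add: K.r_distr")
  finally show ?thesis unfolding e[OF f] e[OF g] using a c hc by (simp add: K.m_lcomm)
qed

lemma tt_rank_one:
  assumes g: "g \<in> linmap A U (regular A)" and v: "v \<in> carrier U"
  shows "tt U (\<lambda>x\<in>carrier U. g x \<odot>\<^sub>U v) = s (g v)"
proof (rule tt_expand)
  fix c and I :: "'u set" and h
  assume I: "\<And>i. i \<in> I \<Longrightarrow> i \<in> carrier U" and h: "\<And>i. i \<in> I \<Longrightarrow> h i \<in> addmap U K"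
    and e: "\<And>f. f \<in> lin_hom A U U \<Longrightarrow> tt U f = c \<otimes>\<^sub>K (\<Oplus>\<^sub>K i\<in>I. h i (f i))"
    and r: "\<And>g v. g \<in> linmap A U (regular A) \<Longrightarrow> v \<in> carrier U \<Longrightarrow> c \<otimes>\<^sub>K (\<Oplus>\<^sub>K i\<in>I. h i (g i \<odot>\<^sub>U v)) = s (g v)"
  note l = linmap_smult_elt[OF U U g v]
  have "(\<Oplus>\<^sub>K i\<in>I. h i ((\<lambda>x\<in>carrier U. g x \<odot>\<^sub>U v) i)) = (\<Oplus>\<^sub>K i\<in>I. h i (g i \<odot>\<^sub>U v))"
    by (rule fs_cong) (use I addmap_closed[OF h linmap_closed[OF l I]] in auto)
  then show ?thesis unfolding e[OF linmap_restrict[OF U l]] using r[OF g v] by simp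
qed

lemma tt_zero: "tt U (\<lambda>x\<in>carrier U. \<zero>\<^sub>U) = \<zero>\<^sub>K"
  using tt_scale[OF R.zero_closed lin_hom_zero[OF U U] lin_hom_zero[OF U U]] tt_closed[OF lin_hom_zero[OF U U]]
    lm_zero_l[OF lmA, of "\<one>\<^sub>A"] U by simp

lemma tt_step:
  assumes f: "fin_rank A U U f" and g: "g \<in> linmap A U (regular A)" and v: "v \<in> carrier U"
  shows "tt U (\<lambda>x\<in>carrier U. f x \<oplus>\<^sub>U g x \<odot>\<^sub>U v) = tt U f \<oplus>\<^sub>K s (g v)"
proof -
  have "(\<lambda>x\<in>carrier U. f x \<oplus>\<^sub>U g x \<odot>\<^sub>U v) = (\<lambda>x\<in>carrier U. f x \<oplus>\<^sub>U (\<lambda>x\<in>carrier U. g x \<odot>\<^sub>U v) x)" by (rule restrict_ext) simp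
  then show ?thesis
    using tt_plus[OF fin_rank_lin_hom[OF U U f] linmap_restrict[OF U linmap_smult_elt[OF U U g v]]] tt_rank_one[OF g v] by simp
qed

text \<open>Each term contributes some s(g v) in \<O>. By this integrality the trace modulo \<O>
  depends only on the stable class.\<close>

lemma tt_fin_rank: "fin_rank A U U f \<Longrightarrow> tt U f \<in> carrier \<O>"
proof (induction rule: fin_rank.induct)
  case zero
  show ?case unfolding tt_zero using R.zero_closed by simp
next
  case (step f g v)
  have "tt U f \<oplus>\<^sub>\<O> s (g v) \<in> carrier \<O>"
    by (rule ag_add[OF agO step.IH s_closed]) (use linmap_closed[OF step.hyps(2,3)] in simp)
  then show ?case unfolding tt_step[OF step.hyps] by simp
qed

lemma tt_stable:
  assumes st: "(f, g) \<in> stable_rel A U U"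
  shows "carrier \<O> +>\<^bsub>K\<^esub> tt U f = carrier \<O> +>\<^bsub>K\<^esub> tt U g"
proof -
  note f = stable_hom(1)[OF st] and g = stable_hom(2)[OF st]
  let ?d = "\<lambda>x\<in>carrier U. f x \<ominus>\<^sub>U g x"
  have d: "?d \<in> lin_hom A U U" by (rule lin_hom_minus[OF f g U U])
  have r: "tt U ?d \<in> carrier \<O>" using st unfolding stable_rel_iff[OF U U] by (blast intro: tt_fin_rank)
  have "f = (\<lambda>x\<in>carrier U. ?d x \<oplus>\<^sub>U g x)" by (rule lin_hom_eqI[OF f lin_hom_plus[OF d g U U]])
       (use lin_hom_closed[OF f] lin_hom_closed[OF g] lm_ag[OF U] in simp)
  then have "tt U f = tt U g \<oplus>\<^sub>K tt U ?d" using tt_plus[OF d g] K.a_comm[OF O_sub[OF r] tt_closed[OF g]] by metis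
  then show ?thesis using coset_shift[OF tt_closed[OF g] r] by simp
qed

end

text \<open>Families that agree stably in degree 0 still do so in degree n, and stably equal
  endomorphisms have equal traces modulo \<O>. One representative f and one family H through the
  second class therefore compute the pairing.\<close>

lemma tate_pairing_eq:
  fixes X :: "('a, 'u, 'p) shifts" and Y :: "('a, 'v, 'q) shifts"
  assumes X: "shift_seq X" and Y: "shift_seq Y" and free: "fg_free \<O> (RS (obj X 0))"
    and f: "f \<in> lin_hom A (obj X 0) (obj Y n)" and H: "shift_family A Y X (- n) H"
  shows "tate_pairing \<O> K A s X Y n (stable_class A (obj X 0) (obj Y n) f) (stable_class A (obj Y 0) (obj X (- n)) (H 0)) =
    carrier \<O> +>\<^bsub>K\<^esub> tt (obj X 0) (compose (carrier (obj X 0)) (H n) f)" unfolding tate_pairing_def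
proof (rule the_elem_eqI)
  let ?U = "obj X 0" and ?V = "obj Y n" and ?a = "stable_class A (obj X 0) (obj Y n) f"
    and ?c = "stable_class A (obj Y 0) (obj X (- n)) (H 0)"
  note U = sq_obj[OF X, of 0] and V = sq_obj[OF Y, of n]
  have H0: "H 0 \<in> lin_hom A (obj Y 0) (obj X (- n))" and Hn: "H n \<in> lin_hom A ?V ?U"
    using shift_familyD(1)[OF H, of 0] shift_familyD(1)[OF H, of n] by simp_all
  show "carrier \<O> +>\<^bsub>K\<^esub> tt ?U (compose (carrier ?U) (H n) f) \<in>
    {carrier \<O> +>\<^bsub>K\<^esub> tt ?U (compose (carrier ?U) h f) |f h. f \<in> ?a \<and> h \<in> shift_class A Y X (- n) n ?c}"
    using stable_refl[OF U V f] stable_refl[OF V U Hn] stable_refl[OF sq_obj[OF Y] sq_obj[OF X] H0] H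
    by (auto simp: shift_class_def stable_class_mem)
  fix v assume "v \<in> {carrier \<O> +>\<^bsub>K\<^esub> tt ?U (compose (carrier ?U) h f) |f h. f \<in> ?a \<and> h \<in> shift_class A Y X (- n) n ?c}"
  then obtain f' h F where v: "v = carrier \<O> +>\<^bsub>K\<^esub> tt ?U (compose (carrier ?U) h f')"
    and f': "(f, f') \<in> stable_rel A ?U ?V" and F: "shift_family A Y X (- n) F"
      "(H 0, F 0) \<in> stable_rel A (obj Y 0) (obj X (- n))" "(F n, h) \<in> stable_rel A ?V ?U"
    by (auto simp: shift_class_def stable_class_mem)
  have "(H n, F n) \<in> stable_rel A ?V ?U" using shift_family_stable[OF Y X H F(1), of 0 n] F(2) by simp
  then have "(H n, h) \<in> stable_rel A ?V ?U" by (rule stable_trans[OF V U _ F(3)])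
  from tt_stable[OF U free stable_comp[OF U V U f' this]]
  show "v = carrier \<O> +>\<^bsub>K\<^esub> tt ?U (compose (carrier ?U) (H n) f)" unfolding v by simp
qed

end

section \<open>Comparison of twisted traces over A and over B\<close>

locale tate_bimodule = sym_bimodule \<O> A s B t M + KA: ext_sym_alg \<O> K A s + KB: ext_sym_alg \<O> K B t
  for \<O> K :: "'k ring" and A :: "('k, 'a) module" and s and B :: "('k, 'b) module" and t and M :: "('a, 'b, 'm) bimodule"
begin

text \<open>By \<open>TH_rank_one\<close> and additivity in r it is enough to take r = f \<otimes>
  w. Then the transfer is u \<mapsto> mhat f (\<kappa> u) w, with twisted trace s(mhat f (\<kappa>
  w)) = f(\<kappa> w) = t(g(f \<otimes> w)).\<close>

lemma twisted_trace_rank_one: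
  assumes U: "A.is_mod U" and free: "fg_free \<O> (A.RS U)"
    and g: "g \<in> linmap B (DT U) (regular B)" and r: "r \<in> carrier (DT U)"
  shows "KA.tt U (TH U U (\<lambda>q. g q \<odot>\<^bsub>DT U\<^esub> r)) = t (g r)"
proof -
  obtain \<kappa> where \<kappa>: "\<kappa> \<in> linmap A U M" "\<And>f u. f \<in> carrier D \<Longrightarrow> u \<in> carrier U \<Longrightarrow> f (\<kappa> u) = t (g (pure A D U f u))"
    "\<And>r u. r \<in> carrier (DT U) \<Longrightarrow> u \<in> carrier U \<Longrightarrow> TH U U (\<lambda>q. g q \<odot>\<^bsub>DT U\<^esub> r) u = ev U (\<kappa> u) r"
    by (rule TH_rank_one[OF U U g]) (rule that, assumption+)
  note \<kappa>c = linmap_closed[OF \<kappa>(1)]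
  have l: "(\<lambda>u\<in>carrier U. ev U (\<kappa> u) r) \<in> lin_hom A U U" if "r \<in> carrier (DT U)" for r
    by (rule linmap_restrict[OF U], rule linmapI)
       (use \<kappa>c linmap_add[OF \<kappa>(1)] linmap_smult[OF \<kappa>(1)] that in "simp_all add: ev_closed[OF U] ev_add[OF U] ev_smult[OF U]")
  have "KA.tt U (\<lambda>u\<in>carrier U. ev U (\<kappa> u) r) = t (g r)" using r[unfolded tensor_simps(1)]
  proof (induction r rule: tensor_data.tensor_induct[OF DT_data[OF U], consumes 1])
    case (1 f w)
    have h: "(\<lambda>u. mhat f (\<kappa> u)) \<in> linmap A U (regular A)"
      by (rule linmap_comp[OF \<kappa>(1) A.hat_linmap[OF lmM D_linmap[OF 1(1)]]])
    have eq: "(\<lambda>u\<in>carrier U. ev U (\<kappa> u) (pure A D U f w)) = (\<lambda>u\<in>carrier U. mhat f (\<kappa> u) \<odot>\<^sub>U w)"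
      by (rule restrict_ext) (use \<kappa>c 1 in "simp add: ev_pure[OF U]")
    show ?case
      unfolding eq KA.tt_rank_one[OF U free h 1(2)] A.hat_s[OF lmM D_linmap[OF 1(1)] \<kappa>c[OF 1(2)]] by (rule \<kappa>(2)[OF 1])
  next
    case (2 a b)
    note ab = 2(1,2)[folded tensor_simps(1)[of A D U]]
    have eq: "(\<lambda>u\<in>carrier U. ev U (\<kappa> u) (a \<oplus>\<^bsub>tensor_ab A D U\<^esub> b)) =
      (\<lambda>u\<in>carrier U. (\<lambda>u\<in>carrier U. ev U (\<kappa> u) a) u \<oplus>\<^sub>U (\<lambda>u\<in>carrier U. ev U (\<kappa> u) b) u)"
      by (rule restrict_ext) (use addmap_add[OF ev_addmap[OF U \<kappa>c] ab] in "simp add: tensor_simps")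
    have "t (g (a \<oplus>\<^bsub>tensor_ab A D U\<^esub> b)) = t (g a) \<oplus>\<^sub>K t (g b)"
      using linmap_add[OF g ab] linmap_closed[OF g ab(1)] linmap_closed[OF g ab(2)] by (simp add: B.s_add tensor_simps)
    then show ?case unfolding eq KA.tt_plus[OF U free l[OF ab(1)] l[OF ab(2)]] 2(3,4) by simp
  qed
  moreover have "TH U U (\<lambda>q. g q \<odot>\<^bsub>DT U\<^esub> r) = (\<lambda>u\<in>carrier U. ev U (\<kappa> u) r)"
    by (rule extensionalityI[OF TH_ext]) (auto simp: \<kappa>(3)[OF r])
  ultimately show ?thesis by simp
qed

text \<open>A new term q \<mapsto> g(q) r adds t(g r) on both sides.\<close>

lemma twisted_trace_transfer_fin_rank:
  assumes U: "A.is_mod U" and free: "fg_free \<O> (A.RS U)" and Tfree: "fg_free \<O> (B.RS (DT U))"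
    and fr: "fin_rank B (DT U) (DT U) \<beta>"
  shows "KA.tt U (TH U U \<beta>) = KB.tt (DT U) \<beta>"
  using fr
proof induction
  case zero
  show ?case unfolding TH_zero[OF U U] KA.tt_zero[OF U free] KB.tt_zero[OF DT_lm[OF U] Tfree] ..
next
  case (step \<beta> g r)
  note T = DT_lm[OF U]
  show ?case unfolding KB.tt_step[OF T Tfree step.hyps] TH_step[OF U U step.hyps] step.IH[symmetric]
      twisted_trace_rank_one[OF U free step.hyps(2,3), symmetric]
    by (rule KA.tt_plus[OF U free TH_lin_hom[OF U U lin_hom_linmap[OF fin_rank_lin_hom[OF T T step.hyps(1)]]]
          TH_lin_hom[OF U U linmap_smult_elt[OF T T step.hyps(2,3)]]])
qed

text \<open>A nonzero multiple c \<beta> has finite rank over B, with c taken from a scaled inverse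
  of z_B. Traces and transfer are \<O>-linear, so the finite rank case gives the claim multiplied by
  c, and c cancels in K.\<close>

lemma twisted_trace_transfer:
  assumes U: "A.is_mod U" and free: "fg_free \<O> (A.RS U)" and Tfree: "fg_free \<O> (B.RS (DT U))"
    and \<beta>: "\<beta> \<in> lin_hom B (DT U) (DT U)"
  shows "KA.tt U (TH U U \<beta>) = KB.tt (DT U) \<beta>"
proof -
  note T = DT_lm[OF U] and bl = lin_hom_linmap[OF \<beta>]
  obtain c z' where z: "c \<in> carrier \<O>" "c \<noteq> \<zero>\<^sub>K" "z' \<in> carrier B" "z' \<otimes>\<^sub>B B.zA = c \<odot>\<^sub>B \<one>\<^sub>B" by (rule KB.scaled_inverse_exists)
  obtain J where J: "finite_basis \<O> (B.RS (DT U)) J" using Tfree by (auto simp: fg_free_def)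
  obtain \<omega> where w: "frame \<O> (B.RS (DT U)) J (\<lambda>x. x) \<omega>" by (rule basis_frame[OF B.lm_rs[OF T] J])
  let ?c = "\<lambda>q\<in>carrier (DT U). (c \<odot>\<^sub>B \<one>\<^sub>B) \<odot>\<^bsub>DT U\<^esub> \<beta> q"
  have fr: "fin_rank B (DT U) (DT U) ?c"
    by (rule B.scaled_fin_rank[OF T T w z(3) B.inverse_central[OF z(3,1) _ z(4)] z(1,4) bl]) (use z(2) in simp_all)
  note cl = fin_rank_lin_hom[OF T T fr]
  \<comment> \<open>\<open>ev\<close> is \<O>-linear because the two actions of \<O> on M coincide;
    this carries c from the side of B to that of A.\<close>
  have sc: "TH U U ?c u = (c \<odot>\<^sub>A \<one>\<^sub>A) \<odot>\<^sub>U TH U U \<beta> u" if u: "u \<in> carrier U" for u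
  proof -
    obtain k m \<delta> where d: "rdual k m \<delta>" using rdual_exists by blast
    note d1 = rdualD[OF d]
    have q: "\<beta> (pure A D U (tB (\<delta> j)) u) \<in> carrier (DT U)" if "j \<in> {..<k}" for j
      by (rule linmap_closed[OF bl DT_pure_closed[OF U d1(4)[OF that] u]])
    show ?thesis unfolding transfer_hom_eq[OF U U lin_hom_linmap[OF cl] d u] transfer_hom_eq[OF U U bl d u]
    proof (subst lm_fs_r[OF U])
      show "(\<Oplus>\<^sub>U j\<in>{..<k}. ev U (m j) (?c (pure A D U (tB (\<delta> j)) u))) =
        (\<Oplus>\<^sub>U j\<in>{..<k}. (c \<odot>\<^sub>A \<one>\<^sub>A) \<odot>\<^sub>U ev U (m j) (\<beta> (pure A D U (tB (\<delta> j)) u)))" by (rule fs_cong[OF lm_ag[OF U]])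
           (use linmap_smult[OF ev_linmap[OF U d1(1)] z(1)] q DT_pure_closed[OF U d1(4) u]
              ev_closed[OF U d1(1) q] lm_smult[OF U] z(1) in auto)
    qed (use ev_closed[OF U d1(1) q] z(1) in simp_all)
  qed
  have "c \<otimes>\<^sub>K KA.tt U (TH U U \<beta>) = c \<otimes>\<^sub>K KB.tt (DT U) \<beta>" using twisted_trace_transfer_fin_rank[OF U free Tfree fr]
      KA.tt_scale[OF U free z(1) TH_lin_hom[OF U U bl] TH_lin_hom[OF U U lin_hom_linmap[OF cl]] sc]
      KB.tt_scale[OF T Tfree z(1) \<beta> cl] by simp
  then show ?thesis
    using KA.K.m_lcancel[of c] z(1,2) KA.tt_closed[OF U free TH_lin_hom[OF U U bl]] KB.tt_closed[OF T Tfree \<beta>] by simp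
qed

text \<open>With an identity on the target, \<open>TH_square\<close> turns the composite into the
  transfer of g after Id \<otimes> f, to which \<open>twisted_trace_transfer\<close>
  applies.\<close>

lemma transfer_adjoint_l:
  assumes U: "A.is_mod U" and W: "A.is_mod W" and free: "fg_free \<O> (A.RS U)" "fg_free \<O> (B.RS (DT U))"
    and f: "f \<in> lin_hom A U W" and g: "g \<in> lin_hom B (DT W) (DT U)"
  shows "KA.tt U (compose (carrier U) (TH W U g) f) = KB.tt (DT U) (compose (carrier (DT U)) g (idt U W f))"
proof -
  note fl = lin_hom_linmap[OF f] and gl = lin_hom_linmap[OF g]
  have c: "compose (carrier (DT U)) g (idt U W f) \<in> lin_hom B (DT U) (DT U)"
    by (rule lin_hom_compose[OF idt_lin_hom[OF U W fl] g DT_lm[OF U]])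
  have "compose (carrier U) (TH W U g) f = TH U U (compose (carrier (DT U)) g (idt U W f))"
  proof (rule lin_hom_eqI[OF lin_hom_compose[OF f TH_lin_hom[OF W U gl] U] TH_lin_hom[OF U U lin_hom_linmap[OF c]]])
    fix u assume u: "u \<in> carrier U"
    have i: "(\<lambda>x\<in>carrier U. x) \<in> linmap A U U" by (rule lin_hom_linmap[OF lin_hom_id[OF U]])
    have "TH W U g (f u) = (\<lambda>x\<in>carrier U. x) (TH U U (compose (carrier (DT U)) g (idt U W f)) u)"
    proof (rule TH_square[OF U W U U fl i lin_hom_linmap[OF c] gl _ u])
      fix q assume q: "q \<in> carrier (DT U)"
      show "g (idt U W f q) = idt U U (\<lambda>x\<in>carrier U. x) (compose (carrier (DT U)) g (idt U W f) q)"
        using q lin_hom_closed[OF c q] by (simp add: idt_id[OF U])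
    qed
    then show "compose (carrier U) (TH W U g) f u = TH U U (compose (carrier (DT U)) g (idt U W f)) u"
      using u lin_hom_closed[OF TH_lin_hom[OF U U lin_hom_linmap[OF c]] u] by simp
  qed
  then show ?thesis using twisted_trace_transfer[OF U free c] by simp
qed

text \<open>The mirror image, with the identity of \<open>TH_square\<close> on the source.\<close>

lemma transfer_adjoint_r:
  assumes V: "A.is_mod V" and W: "A.is_mod W" and free: "fg_free \<O> (A.RS V)" "fg_free \<O> (B.RS (DT V))"
    and f: "f \<in> lin_hom A W V" and g: "g \<in> lin_hom B (DT V) (DT W)"
  shows "KA.tt V (compose (carrier V) f (TH V W g)) = KB.tt (DT V) (compose (carrier (DT V)) (idt W V f) g)"
proof -
  note fl = lin_hom_linmap[OF f] and gl = lin_hom_linmap[OF g]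
  have c: "compose (carrier (DT V)) (idt W V f) g \<in> lin_hom B (DT V) (DT V)"
    by (rule lin_hom_compose[OF g idt_lin_hom[OF W V fl] DT_lm[OF V]])
  have "compose (carrier V) f (TH V W g) = TH V V (compose (carrier (DT V)) (idt W V f) g)"
  proof (rule lin_hom_eqI[OF lin_hom_compose[OF TH_lin_hom[OF V W gl] f V] TH_lin_hom[OF V V lin_hom_linmap[OF c]]])
    fix v assume v: "v \<in> carrier V"
    have i: "(\<lambda>x\<in>carrier V. x) \<in> linmap A V V" by (rule lin_hom_linmap[OF lin_hom_id[OF V]])
    have "TH V V (compose (carrier (DT V)) (idt W V f) g) ((\<lambda>x\<in>carrier V. x) v) = f (TH V W g v)"
    proof (rule TH_square[OF V V W V i fl gl lin_hom_linmap[OF c] _ v])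
      fix q assume q: "q \<in> carrier (DT V)"
      show "compose (carrier (DT V)) (idt W V f) g (idt V V (\<lambda>x\<in>carrier V. x) q) = idt W V f (g q)"
        using q by (simp add: idt_id[OF V])
    qed
    then show "compose (carrier V) f (TH V W g) v = TH V V (compose (carrier (DT V)) (idt W V f) g) v" using v by simp
  qed
  then show ?thesis using twisted_trace_transfer[OF V free c] by simp
qed

text \<open>Freeness over \<O> enters in degree 0, where the traces are taken. The endomorphisms to
  be compared come from shift families over B, and these are matched in degree 0, where they start
  from the same representatives.\<close>

theorem tate_duality_transfer:
  fixes X :: "('a, 'u, 'p) shifts" and Y :: "('a, 'v, 'q) shifts" and X' :: "('b, (('m \<Rightarrow> 'k) \<times> 'u \<Rightarrow>\<^sub>0 int) set, 'p2) shifts"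
    and Y' :: "('b, (('m \<Rightarrow> 'k) \<times> 'v \<Rightarrow>\<^sub>0 int) set, 'q2) shifts"
  assumes X: "A.shift_seq X" and Y: "A.shift_seq Y" and X': "B.shift_seq X'" and Y': "B.shift_seq Y'"
    and X0: "obj X' 0 = DT (obj X 0)" and Y0: "obj Y' 0 = DT (obj Y 0)" and \<alpha>: "\<alpha> \<in> stable_hom A (obj X 0) (obj Y n)"
    and \<beta>: "\<beta> \<in> stable_hom B (DT (obj Y 0)) (obj X' (- n))"
    and fX: "fg_free \<O> (A.RS (obj X 0))" "fg_free \<O> (B.RS (DT (obj X 0)))"
    and fY: "fg_free \<O> (A.RS (obj Y 0))" "fg_free \<O> (B.RS (DT (obj Y 0)))"
  shows "tate_pairing \<O> K A s X Y n \<alpha> (transfer_map \<O> A B M s t (obj Y 0) X X' (- n) \<beta>)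
         = tate_pairing \<O> K B t X' Y' n (tensor_class A B D (obj X 0) Y Y' n \<alpha>) \<beta>" (is ?left)
    and "tate_pairing \<O> K A s Y X (- n) (transfer_map \<O> A B M s t (obj Y 0) X X' (- n) \<beta>) \<alpha>
         = tate_pairing \<O> K B t Y' X' (- n) \<beta> (tensor_class A B D (obj X 0) Y Y' n \<alpha>)" (is ?right)
proof -
  let ?U = "obj X 0" and ?V = "obj Y 0" and ?TX = "tensor_shifts A D X" and ?TY = "tensor_shifts A D Y"
  note Xl = A.sq_obj[OF X] and Yl = A.sq_obj[OF Y] and Xl' = B.sq_obj[OF X'] and Yl' = B.sq_obj[OF Y']
  note DX = DT_lm[OF Xl] and DY = DT_lm[OF Yl]
  note TX = tensor_shift_seq[OF X] and TY = tensor_shift_seq[OF Y]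
  obtain f where f: "f \<in> lin_hom A ?U (obj Y n)" "\<alpha> = stable_class A ?U (obj Y n) f" by (rule stable_hom_obtain[OF Xl Yl \<alpha>])
  obtain b where b: "b \<in> lin_hom B (DT ?V) (obj X' (- n))" "\<beta> = stable_class B (DT ?V) (obj X' (- n)) b"
    by (rule stable_hom_obtain[OF DY Xl' \<beta>])
  \<comment> \<open>The identification of D \<otimes> \<Sigma>^k(U) with the k-th shift of D
    \<otimes> U chosen in X', together with a stable inverse.\<close>
  obtain S S' where S: "shift_family B ?TX X' 0 S" "S 0 = (\<lambda>x\<in>carrier (obj ?TX 0). x)" "shift_family B X' ?TX 0 S'"
    "\<And>k. (compose (carrier (obj ?TX k)) (S' k) (S k), \<lambda>x\<in>carrier (obj ?TX k). x) \<in> stable_rel B (obj ?TX k) (obj ?TX k)"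
    "\<And>k. (compose (carrier (obj X' k)) (S k) (S' k), \<lambda>x\<in>carrier (obj X' k). x) \<in> stable_rel B (obj X' k) (obj X' k)"
    by (rule B.shift_iso[OF TX X']) (use X0 in simp, blast intro: that)
  obtain T T' where T: "shift_family B ?TY Y' 0 T" "T 0 = (\<lambda>x\<in>carrier (obj ?TY 0). x)" "shift_family B Y' ?TY 0 T'"
    by (rule B.shift_iso[OF TY Y']) (use Y0 in simp, blast intro: that)
  note S = S[unfolded tensor_shifts_simps] and T = T[unfolded tensor_shifts_simps]
  have Sl: "S k \<in> lin_hom B (DT (obj X k)) (obj X' k)" and Sl': "S' k \<in> lin_hom B (obj X' k) (DT (obj X k))"
    and Tl: "T k \<in> lin_hom B (DT (obj Y k)) (obj Y' k)" for k
    using shift_familyD(1)[OF S(1), of k] shift_familyD(1)[OF S(3), of k] shift_familyD(1)[OF T(1), of k] by simp_all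
  \<comment> \<open>The representative ending in D \<otimes> \<Sigma>^(-n)(U), to which the transfer
    applies; b itself ends in the shift chosen in X'.\<close>
  let ?b = "compose (carrier (DT ?V)) (S' (- n)) b"
  have bl: "?b \<in> lin_hom B (DT ?V) (DT (obj X (- n)))" by (rule lin_hom_compose[OF b(1) Sl' DY])
  have Sb: "(compose (carrier (DT ?V)) (S (- n)) ?b, b) \<in> stable_rel B (DT ?V) (obj X' (- n))"
    using stable_comp_right[OF DY Xl' Xl' S(5) b(1)]
    unfolding compose_id_l[OF b(1)] compose_lin_hom_assoc[OF b(1), symmetric] .
  have tr: "transfer_map \<O> A B M s t ?V X X' (- n) \<beta> = stable_class A ?V (obj X (- n)) (TH ?V (obj X (- n)) ?b)"
    unfolding b(2) by (rule transfer_map_eq[OF X X' X0 S(1,2) Yl Sl' S(4) bl stable_sym[OF DY Xl' Sb]])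
  let ?f = "idt ?U (obj Y n) f" and ?Tf = "compose (carrier (DT ?U)) (T n) (idt ?U (obj Y n) f)"
  have fl: "?f \<in> lin_hom B (DT ?U) (DT (obj Y n))" by (rule idt_lin_hom[OF Xl Yl lin_hom_linmap[OF f(1)]])
  have Tfl: "?Tf \<in> lin_hom B (DT ?U) (obj Y' n)" by (rule lin_hom_compose[OF fl Tl DX])
  have tc: "tensor_class A B D ?U Y Y' n \<alpha> = stable_class B (DT ?U) (obj Y' n) ?Tf"
    unfolding f(2) by (rule tensor_class_eq[OF Y Y' Y0 T(1,2) Xl f(1)])

  show ?left
  proof -
    \<comment> \<open>Shifts \<open>?b\<close> along the tensored sequences, so that the transferred
      family computes the pairing over A.\<close>
    obtain G where G: "shift_family B ?TY ?TX (- n) G" "G 0 = ?b"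
      by (rule B.shift_family_exists[OF TY TX, of ?b "- n"]) (use bl in simp, blast intro: that)
    let ?H = "\<lambda>i. TH (obj Y i) (obj X (i + - n)) (G i)"
    have H: "shift_family A Y X (- n) ?H" by (rule TH_shift_family[OF Y X G(1)])
    have Gn: "G n \<in> lin_hom B (DT (obj Y n)) (DT ?U)" using shift_familyD(1)[OF G(1), of n] by simp
    \<comment> \<open>Shifts b along the sequences chosen over B, for the pairing over B.\<close>
    obtain E where E: "shift_family B Y' X' (- n) E" "E 0 = b"
      by (rule B.shift_family_exists[OF Y' X', of b "- n"]) (use b(1) Y0 in simp, blast intro: that)
    have En: "E n \<in> lin_hom B (obj Y' n) (DT ?U)" using shift_familyD(1)[OF E(1), of n] X0 by simp
    note ET = B.shift_family_compose[OF TY Y' X' T(1) E(1), simplified]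
    note SG = B.shift_family_compose[OF TY TX X' G(1) S(1), simplified]
    have e0: "compose (carrier (DT ?V)) (E 0) (T 0) = b" unfolding E(2) T(2) by (rule compose_id_r[OF b(1)])
    have en: "compose (carrier (DT (obj Y n))) (S 0) (G n) = G n" unfolding S(2) by (rule compose_id_l[OF Gn])
    \<comment> \<open>In degree 0 both composites represent b; \<open>shift_family_stable\<close>
      moves the agreement to degree n.\<close>
    have "(compose (carrier (DT ?V)) (E 0) (T 0), compose (carrier (DT ?V)) (S (- n)) (G 0)) \<in> stable_rel B (DT ?V) (obj X' (- n))"
      unfolding e0 G(2) by (rule stable_sym[OF DY Xl' Sb])
    then have "(compose (carrier (DT (obj Y n))) (E n) (T n), compose (carrier (DT (obj Y n))) (S 0) (G n))
        \<in> stable_rel B (DT (obj Y n)) (DT ?U)" using B.shift_family_stable[OF TY X' ET SG, of 0 n] X0 by simp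
    then have st: "(compose (carrier (DT ?U)) (compose (carrier (DT (obj Y n))) (E n) (T n)) ?f, compose (carrier (DT ?U)) (G n) ?f)
        \<in> stable_rel B (DT ?U) (DT ?U)" unfolding en by (rule stable_comp_right[OF DX DY DX _ fl])
    have "tate_pairing \<O> K A s X Y n \<alpha> (transfer_map \<O> A B M s t ?V X X' (- n) \<beta>) =
      carrier \<O> +>\<^bsub>K\<^esub> KA.tt ?U (compose (carrier ?U) (TH (obj Y n) ?U (G n)) f)"
      using KA.tate_pairing_eq[OF X Y fX(1) f(1) H] G(2) unfolding tr f(2) by simp
    also have "\<dots> = carrier \<O> +>\<^bsub>K\<^esub> KB.tt (DT ?U) (compose (carrier (DT ?U)) (G n) ?f)"
      unfolding transfer_adjoint_l[OF Xl Yl fX f(1) Gn] ..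
    also have "\<dots> = carrier \<O> +>\<^bsub>K\<^esub> KB.tt (DT ?U) (compose (carrier (DT ?U)) (E n) ?Tf)"
      unfolding compose_lin_hom_assoc[OF fl] by (rule KB.tt_stable[OF DX fX(2) st, symmetric])
    also have "\<dots> = tate_pairing \<O> K B t X' Y' n (tensor_class A B D ?U Y Y' n \<alpha>) \<beta>"
      using KB.tate_pairing_eq[OF X' Y' _ _ E(1), of ?Tf] fX(2) Tfl unfolding tc b(2) X0 Y0 E(2) by simp
    finally show ?thesis .
  qed

  show ?right
  proof -
    \<comment> \<open>In this pairing \<alpha> is the second argument, so it is f that gets shifted,
      by -n, to a map ending in V.\<close>
    obtain F where F: "shift_family A X Y n F" "F 0 = f" by (rule A.shift_family_exists[OF X Y f(1)]) (blast intro: that)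
    have F': "shift_family A X Y (- (- n)) F" using F(1) by simp
    have Fn: "F (- n) \<in> lin_hom A (obj X (- n)) ?V" using shift_familyD(1)[OF F(1), of "- n"] by simp
    let ?F = "\<lambda>i. idt (obj X i) (obj Y (i + n)) (F i)"
    have idF: "shift_family B ?TX ?TY n ?F" by (rule idt_shift_family[OF X Y F(1)])
    have Fn': "idt (obj X (- n)) ?V (F (- n)) \<in> lin_hom B (DT (obj X (- n))) (DT ?V)"
      by (rule idt_lin_hom[OF Xl Yl lin_hom_linmap[OF Fn]])
    obtain E where E: "shift_family B X' Y' n E" "E 0 = ?Tf"
      by (rule B.shift_family_exists[OF X' Y', of ?Tf n]) (use Tfl X0 in simp, blast intro: that)
    have E': "shift_family B X' Y' (- (- n)) E" using E(1) by simp
    have En: "E (- n) \<in> lin_hom B (obj X' (- n)) (DT ?V)" using shift_familyD(1)[OF E(1), of "- n"] Y0 by simp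
    note ES = B.shift_family_compose[OF TX X' Y' S(1) E(1), simplified]
    note TF = B.shift_family_compose[OF TX TY Y' idF T(1), simplified]
    have e0: "compose (carrier (DT ?U)) (E 0) (S 0) = ?Tf" unfolding E(2) S(2) by (rule compose_id_r[OF Tfl])
    have en: "compose (carrier (DT (obj X (- n)))) (T 0) (idt (obj X (- n)) ?V (F (- n))) = idt (obj X (- n)) ?V (F (- n))"
      unfolding T(2) by (rule compose_id_l[OF Fn'])
    \<comment> \<open>Both composites are \<open>?Tf\<close> in degree 0; in degree -n they compare
      the shifted \<open>?Tf\<close> over B with Id \<otimes> F.\<close>
    have "(compose (carrier (DT ?U)) (E 0) (S 0), compose (carrier (DT ?U)) (T n) (idt ?U (obj Y n) (F 0))) \<in> stable_rel B (DT ?U) (obj Y' n)"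
      unfolding e0 F(2) by (rule stable_refl[OF DX Yl' Tfl])
    then have "(compose (carrier (DT (obj X (- n)))) (E (- n)) (S (- n)), compose (carrier (DT (obj X (- n)))) (T 0) (idt (obj X (- n)) ?V (F (- n))))
        \<in> stable_rel B (DT (obj X (- n))) (DT ?V)" using B.shift_family_stable[OF TX Y' ES TF, of 0 "- n"] Y0 by simp
    then have "(compose (carrier (DT ?V)) (compose (carrier (DT (obj X (- n)))) (E (- n)) (S (- n))) ?b,
        compose (carrier (DT ?V)) (idt (obj X (- n)) ?V (F (- n))) ?b) \<in> stable_rel B (DT ?V) (DT ?V)"
      unfolding en by (rule stable_comp_right[OF DY DX DY _ bl])
    then have st: "(compose (carrier (DT ?V)) (E (- n)) (compose (carrier (DT ?V)) (S (- n)) ?b),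
        compose (carrier (DT ?V)) (idt (obj X (- n)) ?V (F (- n))) ?b) \<in> stable_rel B (DT ?V) (DT ?V)"
      unfolding compose_lin_hom_assoc[OF bl] .
    \<comment> \<open>\<open>Sb\<close> removes the detour through D \<otimes>
      \<Sigma>^(-n)(U).\<close>
    have st': "(compose (carrier (DT ?V)) (idt (obj X (- n)) ?V (F (- n))) ?b, compose (carrier (DT ?V)) (E (- n)) b)
        \<in> stable_rel B (DT ?V) (DT ?V)"
      by (rule stable_trans[OF DY DY stable_sym[OF DY DY st] stable_comp_left[OF DY Xl' DY Sb En]])
    have "tate_pairing \<O> K A s Y X (- n) (transfer_map \<O> A B M s t ?V X X' (- n) \<beta>) \<alpha> =
      carrier \<O> +>\<^bsub>K\<^esub> KA.tt ?V (compose (carrier ?V) (F (- n)) (TH ?V (obj X (- n)) ?b))"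
      using KA.tate_pairing_eq[OF Y X fY(1) TH_lin_hom[OF Yl Xl lin_hom_linmap[OF bl]] F'] F(2) unfolding tr f(2) by simp
    also have "\<dots> = carrier \<O> +>\<^bsub>K\<^esub> KB.tt (DT ?V) (compose (carrier (DT ?V)) (idt (obj X (- n)) ?V (F (- n))) ?b)"
      unfolding transfer_adjoint_r[OF Yl Xl fY Fn bl] ..
    also have "\<dots> = carrier \<O> +>\<^bsub>K\<^esub> KB.tt (DT ?V) (compose (carrier (DT ?V)) (E (- n)) b)"
      by (rule KB.tt_stable[OF DY fY(2) st'])
    also have "\<dots> = tate_pairing \<O> K B t Y' X' (- n) \<beta> (tensor_class A B D ?U Y Y' n \<alpha>)"
      using KB.tate_pairing_eq[OF Y' X' _ _ E', of b] fY(2) b(1) unfolding tc b(2) X0 Y0 E(2) by simp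
    finally show ?thesis .
  qed
qed

end

theorem theorem1p1:
  fixes \<O> K :: "'k ring"
    and A :: "('k, 'a) module" and B :: "('k, 'b) module"
    and s :: "'a \<Rightarrow> 'k" and t :: "'b \<Rightarrow> 'k"
    and M :: "('a, 'b, 'm) bimodule"
    and U :: "('a, 'u) module" and V :: "('a, 'v) module"
    and X :: "('a, 'u, 'p) shifts" and Y :: "('a, 'v, 'q) shifts"
    and X' :: "('b, (('m \<Rightarrow> 'k) \<times> 'u \<Rightarrow>\<^sub>0 int) set, 'p2) shifts"
    and Y' :: "('b, (('m \<Rightarrow> 'k) \<times> 'v \<Rightarrow>\<^sub>0 int) set, 'q2) shifts"
    and n :: int
  assumes "complete_dvr \<O>" and "field_of_fractions \<O> K" and "char_zero K"
    and "symmetric_algebra \<O> A" and "semisimple_ring (extended_algebra \<O> K A)"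
    and "symmetric_algebra \<O> B" and "semisimple_ring (extended_algebra \<O> K B)"
    and "symmetrising_form \<O> A s" and "symmetrising_form \<O> B t"
    and "is_bimodule \<O> A B M"
    and "fg_projective A M" and "fg_projective (opp B) (right_part M)"
    and "left_module A U" and "fg_free \<O> (restrict_scalars A U)"
    and "left_module A V" and "fg_free \<O> (restrict_scalars A V)"
    and "shifts_of \<O> A U X" and "shifts_of \<O> A V Y"
    and "shifts_of \<O> B (tensor A (dual \<O> A M) U) X'" and "shifts_of \<O> B (tensor A (dual \<O> A M) V) Y'"
    and "\<alpha> \<in> tate_ext A U Y n"
    and "\<beta> \<in> tate_ext B (tensor A (dual \<O> A M) V) X' (-n)"
  shows "tate_pairing \<O> K A s X Y n \<alpha> (transfer_map \<O> A B M s t V X X' (-n) \<beta>)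
         = tate_pairing \<O> K B t X' Y' n (tensor_class A B (dual \<O> A M) U Y Y' n \<alpha>) \<beta>
       \<and> tate_pairing \<O> K A s Y X (-n) (transfer_map \<O> A B M s t V X X' (-n) \<beta>) \<alpha>
         = tate_pairing \<O> K B t Y' X' (-n) \<beta> (tensor_class A B (dual \<O> A M) U Y Y' n \<alpha>)"
proof -
  have pid: "principal_domain \<O>"
    using assms(1) by (simp add: complete_dvr_def discrete_valuation_ring_def)
  have A: "sym_alg \<O> A s" and B: "sym_alg \<O> B t"
    using assms(4,6,8,9) pid
    by (auto simp: symmetric_algebra_def intro!: sym_alg.intro algebra_over.intro sym_alg_axioms.intro)
  have fr: "fractions \<O> K" by (rule fractions.intro[OF assms(2)])
  have eA: "ext_sym_alg \<O> K A s" and eB: "ext_sym_alg \<O> K B t"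
    by (intro ext_sym_alg.intro ext_sym_alg_axioms.intro A B fr assms(3,5,7))+
  interpret tate_bimodule \<O> K A s B t M
    by (intro tate_bimodule.intro sym_bimodule.intro sym_bimodule_axioms.intro A B eA eB assms(10-12))
  have U: "obj X 0 = U" and V: "obj Y 0 = V" and U': "obj X' 0 = DT U" and V': "obj Y' 0 = DT V"
    using assms(17-20) by (simp_all add: shifts_of_def)
  have sq: "A.shift_seq X" "A.shift_seq Y" "B.shift_seq X'" "B.shift_seq Y'"
    using assms(17-20) by (blast intro: A.shifts_of_seq B.shifts_of_seq)+
  \<comment> \<open>The degree 0 terms of X' and Y' are D \<otimes> U and D \<otimes> V, and
    \<open>shifts_of\<close> makes every term free over \<O>.\<close>
  have fD: "fg_free \<O> (restrict_scalars B (DT U))" "fg_free \<O> (restrict_scalars B (DT V))"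
    using assms(19,20) U' V' by (metis shifts_of_def)+
  show ?thesis
    using tate_duality_transfer[OF sq, of \<alpha> n \<beta>] assms(14,16,21,22) fD by (simp add: U V U' V' tate_ext_def)
qed

end
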